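(* Let $G=(V,E)$ be an undirected graph with edge weights $w:E\to\mathbb{R}_{\geqslant0}$, $T\subseteq V$ a set of $k$ terminals, $\widehat{X}\subseteq E$ a prediction, and $\epsilon>0$ a constant. For $\alpha\geqslant1$ let $\mathcal{A}_\alpha$ denote the algorithm: set $w_\alpha(e)=w(e)/\alpha$ for $e\in\widehat{X}$ and $w_\alpha(e)=w(e)$ otherwise; compute a minimum spanning tree $\mathrm{MST}_\alpha$ of the complete graph on $T$ whose edge $\{t_1,t_2\}$ has cost equal to the $w_\alpha$-shortest-path distance in $G$; output the union over edges $\{t_1,t_2\}$ of $\mathrm{MST}_\alpha$ of a $w_\alpha$-cheapest $t_1$–$t_2$ path in $G$. Consider the algorithm that runs $\mathcal{A}_\alpha$ for $\alpha=(1+\epsilon)^i$, $i=0,1,\dots,\lceil\log_{1+\epsilon}\epsilon^{-1}\rceil$, and outputs the found solution of smallest weight $w$. This algorithm runs in time near-linear in the size of $G$ and outputs a Steiner tree $X$ such that, for any Steiner tree $X'\subseteq E$ for $T$, \[ w(X)\leqslant (1+\epsilon)\min_{\alpha\geqslant1}\Big\{\Big(1+\frac1\alpha\Big)w(X') + \Big(1-\frac1\alpha\Big)\eta^- + \min\Big\{\eta^+,\ (\alpha-1)\sum_{e\in S}\mathbf{c}(e)\Big\}\Big\}, \] where $(\eta^+,\eta^-)=(w(\widehat{X}\setminus X'), w(X'\setminus\widehat{X}))$, $\mathbf{c}(\{t_1,t_2\})$ is the $w$-shortest-path distance between terminals $t_1,t_2$ in $G$, $\mathrm{MST}$ is a minimum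 spanning tree of the complete graph on $T$ with costs $\mathbf{c}$, and $S$ is a set of $\min\{k-1,|\widehat{X}\setminus X'|\}$ edges of $\mathrm{MST}$ of highest cost $\mathbf{c}$.
   Context: A Steiner tree for terminal set $T$ in $G$ is an edge set $X\subseteq E$ such that all terminals lie in the same connected component of $(V,X)$; $w(X)=\sum_{e\in X}w(e)$. Near-linear time means $O(|E|+|V|\log|V|)$ up to the constant factor depending on $\epsilon$. *)

theory Defs
  imports Complex_Main
begin

subsection \<open>Graphs, paths and Steiner trees\<close>

definition simple_graph :: "'v set \<Rightarrow> 'v set set \<Rightarrow> bool" where
  "simple_graph V E \<longleftrightarrow> finite V \<and> E \<subseteq> {{u, v} | u v. u \<in> V \<and> v \<in> V \<and> u \<noteq> v}"

text \<open>A path is given by its list of vertices; \<open>path_edges\<close> is the set of edges it traverses.\<close>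

fun path_edges :: "'v list \<Rightarrow> 'v set set" where
  "path_edges (u # v # p) = insert {u, v} (path_edges (v # p))"
| "path_edges _ = {}"

definition is_path :: "'v set \<Rightarrow> 'v set set \<Rightarrow> 'v list \<Rightarrow> bool" where
  "is_path V E p \<longleftrightarrow> p \<noteq> [] \<and> set p \<subseteq> V \<and> distinct p \<and> path_edges p \<subseteq> E"

definition same_component :: "'v set \<Rightarrow> 'v set set \<Rightarrow> 'v \<Rightarrow> 'v \<Rightarrow> bool" where
  "same_component V E u v \<longleftrightarrow> (\<exists>p. is_path V E p \<and> hd p = u \<and> last p = v)"

definition is_cycle :: "'v set set \<Rightarrow> 'v list \<Rightarrow> bool" where
  "is_cycle E p \<longleftrightarrow> length p \<ge> 3 \<and> distinct p \<and> path_edges p \<subseteq> E \<and> {last p, hd p} \<in> E"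

definition steiner_tree :: "'v set \<Rightarrow> 'v set set \<Rightarrow> 'v set \<Rightarrow> 'v set set \<Rightarrow> bool" where
  "steiner_tree V E T X \<longleftrightarrow> X \<subseteq> E \<and> (\<forall>s\<in>T. \<forall>t\<in>T. same_component V X s t)"

definition spanning_tree :: "'v set \<Rightarrow> 'v set set \<Rightarrow> 'v set set \<Rightarrow> bool" where
  "spanning_tree V E F \<longleftrightarrow>
     F \<subseteq> E \<and> (\<forall>u\<in>V. \<forall>v\<in>V. same_component V F u v) \<and> (\<nexists>p. is_cycle F p)"

definition minimum_spanning_tree ::
  "'v set \<Rightarrow> 'v set set \<Rightarrow> ('v set \<Rightarrow> real) \<Rightarrow> 'v set set \<Rightarrow> bool" where
  "minimum_spanning_tree V E c F \<longleftrightarrow>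
     spanning_tree V E F \<and> (\<forall>F'. spanning_tree V E F' \<longrightarrow> sum c F \<le> sum c F')"

definition complete_edges :: "'v set \<Rightarrow> 'v set set" where
  "complete_edges T = {{s, t} | s t. s \<in> T \<and> t \<in> T \<and> s \<noteq> t}"

definition joins :: "'v set \<Rightarrow> 'v set set \<Rightarrow> 'v set \<Rightarrow> 'v list \<Rightarrow> bool" where
  "joins V E e p \<longleftrightarrow> is_path V E p \<and> {hd p, last p} = e"

text \<open>The distance is a function of the unordered pair of end points, so that it can
  serve directly as an edge cost of the complete graph.  It is the usual distance whenever
  the two end points lie in the same component.\<close>

definition path_dist :: "'v set \<Rightarrow> 'v set set \<Rightarrow> ('v set \<Rightarrow> real) \<Rightarrow> 'v set \<Rightarrow> real" where
  "path_dist V E w e = (INF p\<in>{p. joins V E e p}. sum w (path_edges p))"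

definition cheapest_path ::
  "'v set \<Rightarrow> 'v set set \<Rightarrow> ('v set \<Rightarrow> real) \<Rightarrow> 'v set \<Rightarrow> 'v list \<Rightarrow> bool" where
  "cheapest_path V E w e p \<longleftrightarrow>
     joins V E e p \<and> (\<forall>q. joins V E e q \<longrightarrow> sum w (path_edges p) \<le> sum w (path_edges q))"


subsection \<open>The algorithm\<close>

definition steiner_instance ::
  "'v set \<Rightarrow> 'v set set \<Rightarrow> ('v set \<Rightarrow> real) \<Rightarrow> 'v set \<Rightarrow> 'v set set \<Rightarrow> bool" where
  "steiner_instance V E w T Xhat \<longleftrightarrow>
     simple_graph V E \<and> (\<forall>e\<in>E. w e \<ge> 0) \<and> T \<subseteq> V \<and> Xhat \<subseteq> E"

definition scaled_weight ::
  "('v set \<Rightarrow> real) \<Rightarrow> 'v set set \<Rightarrow> real \<Rightarrow> 'v set \<Rightarrow> real" where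
  "scaled_weight w Xhat \<alpha> e = (if e \<in> Xhat then w e / \<alpha> else w e)"

text \<open>The choice of the minimum spanning tree, of the cheapest paths and, in
  \<open>algorithm_output\<close>, among solutions of equal weight is left open in the description of
  the algorithm.  Hence both stages are relations that hold for every output
  that can arise from some resolution of these choices.\<close>

definition scaled_algorithm_output ::
  "'v set \<Rightarrow> 'v set set \<Rightarrow> ('v set \<Rightarrow> real) \<Rightarrow> 'v set \<Rightarrow> 'v set set \<Rightarrow> real \<Rightarrow> 'v set set \<Rightarrow> bool" where
  "scaled_algorithm_output V E w T Xhat \<alpha> X \<longleftrightarrow>
     (\<exists>F P. minimum_spanning_tree T (complete_edges T)
               (path_dist V E (scaled_weight w Xhat \<alpha>)) F \<and>
            (\<forall>e\<in>F. cheapest_path V E (scaled_weight w Xhat \<alpha>) e (P e)) \<and>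
            X = (\<Union>e\<in>F. path_edges (P e)))"

definition max_exponent :: "real \<Rightarrow> nat" where
  "max_exponent \<epsilon> = nat \<lceil>log (1 + \<epsilon>) (inverse \<epsilon>)\<rceil>"

text \<open>The conversion to \<open>nat\<close> never truncates, not even for \<open>\<epsilon> > 1\<close>.\<close>

lemma max_exponent_ceiling:
  assumes "\<epsilon> > 0"
  shows "int (max_exponent \<epsilon>) = \<lceil>log (1 + \<epsilon>) (inverse \<epsilon>)\<rceil>"
proof -
  have "log (1 + \<epsilon>) \<epsilon> < log (1 + \<epsilon>) (1 + \<epsilon>)"
    using assms by (subst log_less_cancel_iff) auto
  then have "log (1 + \<epsilon>) (inverse \<epsilon>) > -1"
    using assms by (simp add: log_inverse)
  then show ?thesis
    unfolding max_exponent_def by linarith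
qed

definition algorithm_output ::
  "real \<Rightarrow> 'v set \<Rightarrow> 'v set set \<Rightarrow> ('v set \<Rightarrow> real) \<Rightarrow> 'v set \<Rightarrow> 'v set set \<Rightarrow> 'v set set \<Rightarrow> bool" where
  "algorithm_output \<epsilon> V E w T Xhat X \<longleftrightarrow>
     (\<exists>Y. (\<forall>i\<le>max_exponent \<epsilon>. scaled_algorithm_output V E w T Xhat ((1 + \<epsilon>) ^ i) (Y i)) \<and>
          (\<exists>i\<le>max_exponent \<epsilon>. X = Y i) \<and>
          (\<forall>i\<le>max_exponent \<epsilon>. sum w X \<le> sum w (Y i)))"

definition highest_cost_edges ::
  "('v set \<Rightarrow> real) \<Rightarrow> 'v set set \<Rightarrow> nat \<Rightarrow> 'v set set \<Rightarrow> bool" where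
  "highest_cost_edges c F j S \<longleftrightarrow>
     S \<subseteq> F \<and> card S = j \<and> (\<forall>e\<in>S. \<forall>f\<in>F - S. c f \<le> c e)"


subsection \<open>Machine model for the running time\<close>

text \<open>A unit-cost random access machine with integer and real memory: finitely many named
  arrays of each kind (a scalar is cell 0 of an array), all cells initially 0 apart from the
  input.  Natural numbers support addition, truncated subtraction and comparison only; reals
  support the field operations and comparison, and there is no conversion from reals
  to natural numbers.  A program is fixed for all inputs, so its expressions have constant size and
  charging 1 for each assignment and each test counts elementary operations up to a constant
  factor.\<close>

type_synonym name = string
type_synonym state = "(name \<Rightarrow> nat \<Rightarrow> nat) \<times> (name \<Rightarrow> nat \<Rightarrow> real)"

datatype nexp =
  NConst nat
| NRead name nexp
| NAdd nexp nexp
| NSub nexp nexp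

datatype rexp =
  RConst nat
| RRead name nexp
| RAdd rexp rexp
| RSub rexp rexp
| RMul rexp rexp
| RDiv rexp rexp

datatype bexp =
  NLess nexp nexp
| RLess rexp rexp
| BNot bexp
| BAnd bexp bexp

datatype com =
  Skip
| NWrite name nexp nexp
| RWrite name nexp rexp
| Seq com com
| Cond bexp com com
| While bexp com

fun nval :: "nexp \<Rightarrow> state \<Rightarrow> nat" where
  "nval (NConst k) s = k"
| "nval (NRead x a) s = fst s x (nval a s)"
| "nval (NAdd a b) s = nval a s + nval b s"
| "nval (NSub a b) s = nval a s - nval b s"

fun rval :: "rexp \<Rightarrow> state \<Rightarrow> real" where
  "rval (RConst k) s = real k"
| "rval (RRead x a) s = snd s x (nval a s)"
| "rval (RAdd a b) s = rval a s + rval b s"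
| "rval (RSub a b) s = rval a s - rval b s"
| "rval (RMul a b) s = rval a s * rval b s"
| "rval (RDiv a b) s = rval a s / rval b s"

fun bval :: "bexp \<Rightarrow> state \<Rightarrow> bool" where
  "bval (NLess a b) s \<longleftrightarrow> nval a s < nval b s"
| "bval (RLess a b) s \<longleftrightarrow> rval a s < rval b s"
| "bval (BNot b) s \<longleftrightarrow> \<not> bval b s"
| "bval (BAnd a b) s \<longleftrightarrow> bval a s \<and> bval b s"

definition nwrite :: "name \<Rightarrow> nat \<Rightarrow> nat \<Rightarrow> state \<Rightarrow> state" where
  "nwrite x i k s = ((fst s)(x := (fst s x)(i := k)), snd s)"

definition rwrite :: "name \<Rightarrow> nat \<Rightarrow> real \<Rightarrow> state \<Rightarrow> state" where
  "rwrite x i r s = (fst s, (snd s)(x := (snd s x)(i := r)))"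

text \<open>\<open>exec c s t s'\<close>: started in \<open>s\<close>, program \<open>c\<close> halts in \<open>s'\<close> after \<open>t\<close> steps.\<close>

inductive exec :: "com \<Rightarrow> state \<Rightarrow> nat \<Rightarrow> state \<Rightarrow> bool" where
  Skip: "exec Skip s 1 s"
| NWrite: "exec (NWrite x a b) s 1 (nwrite x (nval a s) (nval b s) s)"
| RWrite: "exec (RWrite x a r) s 1 (rwrite x (nval a s) (rval r s) s)"
| Seq: "exec c s t s' \<Longrightarrow> exec d s' t' s'' \<Longrightarrow> exec (Seq c d) s (t + t') s''"
| CondTrue: "bval b s \<Longrightarrow> exec c s t s' \<Longrightarrow> exec (Cond b c d) s (Suc t) s'"
| CondFalse: "\<not> bval b s \<Longrightarrow> exec d s t s' \<Longrightarrow> exec (Cond b c d) s (Suc t) s'"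
| WhileFalse: "\<not> bval b s \<Longrightarrow> exec (While b c) s 1 s"
| WhileTrue: "bval b s \<Longrightarrow> exec c s t s' \<Longrightarrow> exec (While b c) s' t' s'' \<Longrightarrow>
    exec (While b c) s (Suc (t + t')) s''"

text \<open>Input format: \<open>vtx\<close> numbers the vertices by \<open>0, \<dots>, |V| - 1\<close> and edge number
  \<open>j < |E|\<close> joins the vertices with numbers \<open>src j\<close> and \<open>dst j\<close>, in either order.\<close>

definition edge_of :: "(nat \<Rightarrow> 'v) \<Rightarrow> (nat \<Rightarrow> nat) \<Rightarrow> (nat \<Rightarrow> nat) \<Rightarrow> nat \<Rightarrow> 'v set" where
  "edge_of vtx src dst j = {vtx (src j), vtx (dst j)}"

definition edge_list_representation ::
  "'v set \<Rightarrow> 'v set set \<Rightarrow> (nat \<Rightarrow> 'v) \<Rightarrow> (nat \<Rightarrow> nat) \<Rightarrow> (nat \<Rightarrow> nat) \<Rightarrow> bool" where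
  "edge_list_representation V E vtx src dst \<longleftrightarrow>
     bij_betw vtx {..<card V} V \<and>
     (\<forall>j<card E. src j < card V \<and> dst j < card V) \<and>
     bij_betw (edge_of vtx src dst) {..<card E} E"

definition input_state ::
  "real \<Rightarrow> 'v set \<Rightarrow> 'v set set \<Rightarrow> ('v set \<Rightarrow> real) \<Rightarrow> 'v set \<Rightarrow> 'v set set \<Rightarrow>
   (nat \<Rightarrow> 'v) \<Rightarrow> (nat \<Rightarrow> nat) \<Rightarrow> (nat \<Rightarrow> nat) \<Rightarrow> state" where
  "input_state \<epsilon> V E w T Xhat vtx src dst =
    ((\<lambda>_ _. 0)
       (''n'' := (\<lambda>_. 0)(0 := card V),
        ''m'' := (\<lambda>_. 0)(0 := card E),
        ''src'' := (\<lambda>j. if j < card E then src j else 0),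
        ''dst'' := (\<lambda>j. if j < card E then dst j else 0),
        ''terminal'' := (\<lambda>i. if i < card V \<and> vtx i \<in> T then 1 else 0),
        ''predicted'' := (\<lambda>j. if j < card E \<and> edge_of vtx src dst j \<in> Xhat then 1 else 0)),
     (\<lambda>_ _. 0)
       (''epsilon'' := (\<lambda>_. 0)(0 := \<epsilon>),
        ''weight'' := (\<lambda>j. if j < card E then w (edge_of vtx src dst j) else 0)))"

definition output_edges ::
  "'v set set \<Rightarrow> (nat \<Rightarrow> 'v) \<Rightarrow> (nat \<Rightarrow> nat) \<Rightarrow> (nat \<Rightarrow> nat) \<Rightarrow> state \<Rightarrow> 'v set set" where
  "output_edges E vtx src dst s =
     edge_of vtx src dst ` {j. j < card E \<and> fst s ''output'' j = 1}"

end

theory Submission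
  imports Defs
begin

text \<open>Guarantee: for fixed \<open>\<alpha>\<close> the output costs at most \<open>2 w\<^sub>\<alpha>(X')\<close> in the scaled weights, because a
  closed walk that uses every edge of \<open>X'\<close> at most twice connects the terminals.  Returning to the original
  weights adds \<open>1 - 1/\<alpha>\<close> times the weight of the predicted edges that are used.  Those outside \<open>X'\<close> weigh at
  most \<open>\<eta>\<^sup>+\<close>; alternatively, they lie on the paths of at most \<open>min (k - 1) |Xhat - X'|\<close> edges of the minimum
  spanning tree for \<open>\<alpha>\<close>, and by exchanging tree edges these cost no more than the most expensive edges of the
  minimum spanning tree for the original distances.  The grid of values of \<open>\<alpha>\<close> loses the factor \<open>1 + \<epsilon>\<close>.

  Running time (Mehlhorn's algorithm): a search from all terminals simultaneously assigns every
  vertex \<open>v\<close> to a nearest terminal at distance \<open>d v\<close>.  An edge \<open>uv\<close> between two regions joins their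
  terminals at cost \<open>d u + w\<^sub>\<alpha> uv + d v\<close>, and every path that leaves a union of regions contains such an edge of
  at most its own cost.  Hence the algorithm of Prim on these edges builds a minimum spanning tree of the
  terminal distances together with cheapest paths.  Both searches are the same program on a Fibonacci heap.\<close>

section \<open>Connectivity and trees\<close>

text \<open>The output relation leaves the tree and the paths open. The guarantee therefore has to
  hold for every resolution of these choices, whereas the program has to realise only one. Binary
  heaps would pay a logarithm per edge, so key decreases must be cheap, and their cost can be
  bounded only in the long run; this is why the program logic carries credits. The rest of the
  program is shaped by the machine. Natural numbers cannot be multiplied, so row addresses come from
  repeated addition, and one stride \<open>n + 2 * m\<close> serves the children of heap elements as
  well as the adjacency lists. There is no logarithm: the end of the grid is recognised by comparing
  \<alpha> * \<epsilon> with 1, and the number \<open>L\<close> with \<open>n < 2 ^ L\<close> exists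
  only in the analysis. Runs for different \<alpha> share dirty memory, so besides the input a run
  may rely only on cells that it has written itself or can validate. Finally, the program never
  lists paths: it marks edges, and the marked set has to be identified as a union of cheapest paths
  for some minimum spanning tree.\<close>

definition linked :: "'v set set \<Rightarrow> 'v \<Rightarrow> 'v \<Rightarrow> bool" where
  "linked F = (\<lambda>u v. {u, v} \<in> F)\<^sup>*\<^sup>*"

definition connects :: "'v set \<Rightarrow> 'v set set \<Rightarrow> bool" where
  "connects T F \<longleftrightarrow> (\<forall>u\<in>T. \<forall>v\<in>T. linked F u v)"

text \<open>Every edge is a bridge. In this form acyclicity passes to subsets and survives an edge
  between two components without any surgery on closed vertex lists. The condition
  \<open>u \<noteq> v\<close> exempts loops.\<close>

definition forest :: "'v set set \<Rightarrow> bool" where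
  "forest F \<longleftrightarrow> (\<forall>u v. {u, v} \<in> F \<and> u \<noteq> v \<longrightarrow> \<not> linked (F - {{u, v}}) u v)"

lemma linked_refl [simp]: "linked F u u"
  by (simp add: linked_def)

lemma linked_edge: "{u, v} \<in> F \<Longrightarrow> linked F u v"
  by (auto simp: linked_def)

lemma linked_trans: "linked F u v \<Longrightarrow> linked F v w \<Longrightarrow> linked F u w"
  unfolding linked_def by (rule rtranclp_trans)

lemma linked_subst: "linked F u v \<Longrightarrow> (\<And>x y. {x, y} \<in> F \<Longrightarrow> linked G x y) \<Longrightarrow> linked G u v"
  unfolding linked_def by (induction rule: rtranclp_induct) (auto intro: rtranclp_trans)

lemma linked_mono: "linked F u v \<Longrightarrow> F \<subseteq> G \<Longrightarrow> linked G u v"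
  by (erule linked_subst) (auto intro: linked_edge)

lemma linked_sym: "linked F u v \<Longrightarrow> linked F v u"
  unfolding linked_def
proof (induction rule: rtranclp_induct)
  case (step y z)
  then have "{z, y} \<in> F" by (simp add: insert_commute)
  then show ?case using step by (meson converse_rtranclp_into_rtranclp)
qed simp

lemma linked_insert:
  assumes "linked (insert {a, b} F) u v"
  shows "linked F u v \<or> linked F u a \<and> linked F b v \<or> linked F u b \<and> linked F a v"
  using assms unfolding linked_def
proof (induction rule: rtranclp_induct)
  case base
  then show ?case by simp
next
  case (step y z)
  let ?L = "(\<lambda>u v. {u, v} \<in> F)\<^sup>*\<^sup>*"
  have L: "?L = linked F" by (simp add: linked_def)
  show ?case
  proof (cases "{y, z} \<in> F")
    case True
    then have "linked F y z" by (rule linked_edge)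
    then show ?thesis using step.IH linked_trans unfolding L by metis
  next
    case False
    then have "y = a \<and> z = b \<or> y = b \<and> z = a" using step.hyps by (auto simp: doubleton_eq_iff)
    then show ?thesis using step.IH linked_trans linked_sym linked_refl unfolding L by metis
  qed
qed

section \<open>Simple paths as witnesses of connectivity\<close>

lemma path_edges_subset_Pow: "e \<in> path_edges p \<Longrightarrow> e \<subseteq> set p"
  by (induction p rule: path_edges.induct) auto

lemma finite_path_edges [simp]: "finite (path_edges p)"
  by (induction p rule: path_edges.induct) auto

lemma path_edges_append: "path_edges (p @ x # q) = path_edges (p @ [x]) \<union> path_edges (x # q)"
proof (induction p)
  case (Cons y p)
  then show ?case by (cases p) auto
qed simp

lemma path_edges_snoc: "p \<noteq> [] \<Longrightarrow> path_edges (p @ [x]) = insert {last p, x} (path_edges p)"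
proof (induction p)
  case (Cons y p)
  then show ?case by (cases p) auto
qed simp

lemma path_edges_rev: "path_edges (rev p) = path_edges p"
proof (induction p rule: path_edges.induct)
  case (1 u v p)
  have "path_edges (rev (u # v # p)) = path_edges (rev p @ v # [u])" by simp
  also have "\<dots> = path_edges (rev p @ [v]) \<union> path_edges [v, u]" by (rule path_edges_append)
  also have "\<dots> = path_edges (u # v # p)" using 1 by (auto simp: insert_commute)
  finally show ?case .
qed auto

lemma linked_path: "p \<noteq> [] \<Longrightarrow> path_edges p \<subseteq> F \<Longrightarrow> linked F (hd p) (last p)"
proof (induction p rule: path_edges.induct)
  case (1 u v p)
  have "linked F v (last (v # p))" using 1 by auto
  moreover have "linked F u v" using 1 by (auto intro: linked_edge)
  ultimately show ?case using linked_trans by fastforce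
qed auto

text \<open>Loop erasure: a step back to a visited vertex truncates the path there, so it stays
  simple. The bound on \<open>set p\<close> later supplies the vertex condition of
  \<open>is_path\<close>.\<close>

lemma linked_imp_path:
  assumes "linked F u v"
  shows "\<exists>p. p \<noteq> [] \<and> hd p = u \<and> last p = v \<and> distinct p \<and> path_edges p \<subseteq> F \<and> set p \<subseteq> insert u (\<Union>F)"
  using assms unfolding linked_def
proof (induction rule: rtranclp_induct)
  case base
  show ?case by (rule exI[of _ "[u]"]) simp
next
  case (step y z)
  then obtain p where p: "p \<noteq> []" "hd p = u" "last p = y" "distinct p" "path_edges p \<subseteq> F"
    "set p \<subseteq> insert u (\<Union>F)" by blast
  show ?case
  proof (cases "z \<in> set p")
    case True
    then obtain q r where qr: "p = q @ z # r" by (meson split_list)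
    have "path_edges (q @ [z]) \<subseteq> F" using p(5) unfolding qr path_edges_append[of q z r] by blast
    moreover have "hd (q @ [z]) = u" using p(2) qr by (cases q) auto
    ultimately show ?thesis using p qr by (intro exI[of _ "q @ [z]"]) auto
  next
    case False
    have "path_edges (p @ [z]) \<subseteq> F" using p step by (simp add: path_edges_snoc)
    then show ?thesis using p False step by (intro exI[of _ "p @ [z]"]) auto
  qed
qed

section \<open>Edge exchange and the graphic matroid\<close>

lemma list_crossing:
  assumes "p \<noteq> []" "hd p \<in> D" "last p \<notin> D"
  shows "\<exists>q x y r. p = q @ x # y # r \<and> x \<in> D \<and> y \<notin> D"
  using assms
proof (induction p)
  case (Cons a p)
  show ?case
  proof (cases p)
    case Nil
    then show ?thesis using Cons by auto
  next
    case (Cons b p')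
    show ?thesis
    proof (cases "b \<in> D")
      case True
      then obtain q x y r where "p = q @ x # y # r" "x \<in> D" "y \<notin> D"
        using Cons.IH Cons.prems Cons by auto
      then show ?thesis by (metis append_Cons)
    next
      case False
      then show ?thesis using Cons.prems Cons by (metis append_Nil list.sel(1))
    qed
  qed
qed simp

text \<open>A simple path in \<open>B\<close> from \<open>u\<close> to \<open>v\<close> leaves
  \<open>D\<close> through some edge and uses that edge only once. Its two remaining pieces together
  with the new edge therefore still link the ends of the removed one. Working with an arbitrary
  vertex set \<open>D\<close> instead of a fundamental cycle makes the same exchange serve the
  cardinality bound and the algorithm of Prim.\<close>

lemma connects_exchange:
  assumes B: "connects T B" and uv: "u \<in> T" "v \<in> T" "u \<in> D" "v \<notin> D"
  shows "\<exists>x y. {x, y} \<in> B \<and> x \<in> D \<and> y \<notin> D \<and> connects T (insert {u, v} (B - {{x, y}}))"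
proof -
  obtain p where p: "p \<noteq> []" "hd p = u" "last p = v" "distinct p" "path_edges p \<subseteq> B"
    using linked_imp_path[of B u v] B uv by (auto simp: connects_def)
  obtain q x y r where qr: "p = q @ x # y # r" "x \<in> D" "y \<notin> D"
    using list_crossing[of p D] p uv by auto
  have e: "path_edges p = path_edges (q @ [x]) \<union> insert {x, y} (path_edges (y # r))"
    using path_edges_append[of q x "y # r"] qr(1) by simp
  have "{x, y} \<notin> path_edges (q @ [x])" "{x, y} \<notin> path_edges (y # r)"
    using path_edges_subset_Pow[of "{x, y}" "q @ [x]"] path_edges_subset_Pow[of "{x, y}" "y # r"] p(4) qr by auto
  then have sub: "path_edges (q @ [x]) \<subseteq> B - {{x, y}}" "path_edges (y # r) \<subseteq> B - {{x, y}}" "{x, y} \<in> B"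
    using e p(5) by auto
  have "hd (q @ [x]) = u" using qr p(2) by (cases q) auto
  then have ux: "linked (B - {{x, y}}) u x" using linked_path[OF _ sub(1)] by auto
  have yv: "linked (B - {{x, y}}) y v" using linked_path[OF _ sub(2)] qr p(3) by auto
  let ?B = "insert {u, v} (B - {{x, y}})"
  have "linked ?B x u" "linked ?B u v" "linked ?B v y"
    using linked_mono[OF ux, of ?B] linked_mono[OF yv, of ?B] linked_sym[of ?B] linked_edge[of u v ?B] by auto
  then have xy: "linked ?B x y" using linked_trans by metis
  have "linked ?B s t" if "linked B s t" for s t
    using that
  proof (rule linked_subst)
    fix a b assume ab: "{a, b} \<in> B"
    show "linked ?B a b"
    proof (cases "{a, b} = {x, y}")
      case True
      then show ?thesis using xy linked_sym[OF xy] by (auto simp: doubleton_eq_iff)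
    next
      case False
      then show ?thesis using ab by (intro linked_edge) auto
    qed
  qed
  then have "connects T ?B" using B by (auto simp: connects_def)
  then show ?thesis using qr(2,3) sub(3) by (intro exI[of _ x] exI[of _ y]) blast
qed

lemma forest_subset: "forest F \<Longrightarrow> G \<subseteq> F \<Longrightarrow> forest G"
  unfolding forest_def by (meson Diff_mono linked_mono order_refl subsetD)

text \<open>If an old edge \<open>{x, y}\<close> ceased to be a bridge, the detour would have to use
  \<open>{u, v}\<close>; closing it with \<open>{x, y}\<close> would link \<open>u\<close> and
  \<open>v\<close> inside \<open>F\<close>.\<close>

lemma forest_insert:
  assumes F: "forest F" and uv: "\<not> linked F u v"
  shows "forest (insert {u, v} F)"
  unfolding forest_def
proof (intro allI impI notI, elim conjE)
  fix x y assume xy: "{x, y} \<in> insert {u, v} F" "x \<noteq> y" and l: "linked (insert {u, v} F - {{x, y}}) x y"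
  show False
  proof (cases "{x, y} = {u, v}")
    case True
    then have "linked F x y" using linked_mono[OF l, of F] by auto
    then show False using True uv linked_sym[of F x y] by (auto simp: doubleton_eq_iff)
  next
    case False
    let ?G = "F - {{x, y}}"
    have e: "insert {u, v} F - {{x, y}} = insert {u, v} ?G" using False by auto
    have xyF: "{x, y} \<in> F" using xy False by auto
    have sub: "linked F s t" if "linked ?G s t" for s t using linked_mono[OF that] by auto
    have "\<not> linked ?G x y" using F xyF xy(2) by (auto simp: forest_def)
    then have "linked ?G x u \<and> linked ?G v y \<or> linked ?G x v \<and> linked ?G u y"
      using linked_insert[OF l[unfolded e]] by auto
    then have "linked F u v"
      using sub linked_edge[OF xyF] linked_trans linked_sym by metis
    then show False using uv by simp
  qed
qed

lemma forest_empty: "forest {}"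
  by (auto simp: forest_def)

lemma complete_edgesE:
  assumes "e \<in> complete_edges T"
  obtains u v where "e = {u, v}" "u \<in> T" "v \<in> T" "u \<noteq> v"
  using assms by (auto simp: complete_edges_def)

lemma complete_edgesI: "u \<in> T \<Longrightarrow> v \<in> T \<Longrightarrow> u \<noteq> v \<Longrightarrow> {u, v} \<in> complete_edges T"
  by (auto simp: complete_edges_def)

lemma finite_complete_edges: "finite T \<Longrightarrow> finite (complete_edges T)"
  by (rule finite_subset[of _ "Pow T"]) (auto simp: complete_edges_def)

text \<open>Each edge of \<open>A\<close> missing in \<open>B\<close> is traded for an edge of
  \<open>B\<close> outside \<open>A\<close>. This keeps the size and the connectivity of
  \<open>B\<close> and shrinks \<open>A - B\<close> until \<open>A \<subseteq> B\<close>.\<close>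

lemma card_forest_le_connects:
  assumes "forest A" "A \<subseteq> complete_edges T" "connects T B" "finite B" "finite T"
  shows "card A \<le> card B"
  using assms(3,4)
proof (induction "card (A - B)" arbitrary: B rule: less_induct)
  case less
  have finA: "finite A" using assms finite_complete_edges finite_subset by metis
  show ?case
  proof (cases "A \<subseteq> B")
    case True
    then show ?thesis using less.prems card_mono by blast
  next
    case False
    then obtain e where e: "e \<in> A" "e \<notin> B" by blast
    then obtain u v where uv: "e = {u, v}" "u \<in> T" "v \<in> T" "u \<noteq> v"
      using assms(2) by (meson complete_edgesE subsetD)
    \<comment> \<open>The component of \<open>u\<close> after the deletion of \<open>e\<close> from
      the forest \<open>A\<close>. No edge of \<open>A - {e}\<close> leaves it, so the edge of
      \<open>B\<close> that the exchange removes cannot belong to \<open>A\<close>.\<close>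
    let ?D = "{x. linked (A - {e}) u x}"
    have v: "v \<notin> ?D" using assms(1) e uv by (auto simp: forest_def)
    obtain x y where xy: "{x, y} \<in> B" "x \<in> ?D" "y \<notin> ?D" "connects T (insert {u, v} (B - {{x, y}}))"
      using connects_exchange[OF less.prems(1) uv(2,3), of ?D] v by auto
    have nA: "{x, y} \<notin> A"
    proof
      assume "{x, y} \<in> A"
      then have "linked (A - {e}) x y" using xy(1) e by (intro linked_edge) auto
      then show False using xy linked_trans by fastforce
    qed
    let ?B = "insert e (B - {{x, y}})"
    have "A - ?B = A - B - {e}" using nA by auto
    then have "card (A - ?B) < card (A - B)" using e finA
      by (metis Diff_iff card_Diff1_less finite_Diff)
    then have "card A \<le> card ?B" using less.hyps[of ?B] xy(4) uv(1) less.prems by auto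
    also have "card ?B = card B" using e xy(1) less.prems(2)
      by (metis DiffD1 card_Suc_Diff1 card_insert_disjoint finite_Diff)
    finally show ?thesis .
  qed
qed

text \<open>The comparison is with a star, which connects \<open>T\<close> by at most
  \<open>card T - 1\<close> edges.\<close>

lemma card_forest_le:
  assumes "forest A" "A \<subseteq> complete_edges T" "finite T"
  shows "card A \<le> card T - 1"
proof (cases "T = {}")
  case True
  then show ?thesis using assms by (simp add: complete_edges_def)
next
  case False
  then obtain r where r: "r \<in> T" by blast
  let ?B = "(\<lambda>t. {r, t}) ` (T - {r})"
  have star: "linked ?B r t" if "t \<in> T" for t
    using that by (cases "t = r") (auto intro: linked_edge)
  have "linked ?B u v" if "u \<in> T" "v \<in> T" for u v
    using linked_trans[OF linked_sym[OF star[OF that(1)]] star[OF that(2)]] .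
  then have "connects T ?B" by (simp add: connects_def)
  then have "card A \<le> card ?B" using assms by (intro card_forest_le_connects) auto
  also have "\<dots> \<le> card (T - {r})" using assms by (intro card_image_le) auto
  finally show ?thesis using r assms by simp
qed

text \<open>An inclusion-maximal choice of edges of \<open>B\<close> that keeps the forest acyclic
  already links both ends of every edge of \<open>B\<close>, since an edge between different
  components could still be added. Subtracting \<open>A\<close> at the end makes the choice disjoint
  from it.\<close>

lemma forest_augment:
  assumes A: "forest A" and B: "connects T B" "finite B"
  shows "\<exists>C\<subseteq>B. A \<inter> C = {} \<and> forest (A \<union> C) \<and> connects T (A \<union> C)"
proof -
  let ?P = "\<lambda>C. C \<subseteq> B \<and> forest (A \<union> C)"
  have "finite {C. ?P C}" using B(2) by simp
  moreover have "{C. ?P C} \<noteq> {}" using A by auto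
  ultimately have "\<exists>C\<in>{C. ?P C}. \<forall>D\<in>{C. ?P C}. C \<subseteq> D \<longrightarrow> C = D"
    by (rule finite_has_maximal)
  then obtain C where C: "?P C" "\<And>D. ?P D \<Longrightarrow> C \<subseteq> D \<Longrightarrow> C = D"
    unfolding mem_Collect_eq by (elim bexE, unfold mem_Collect_eq) simp
  have "connects T (A \<union> C)"
    unfolding connects_def
  proof (intro ballI)
    fix u v assume "u \<in> T" "v \<in> T"
    then have "linked B u v" using B(1) by (auto simp: connects_def)
    then show "linked (A \<union> C) u v"
    proof (rule linked_subst)
      fix x y assume xy: "{x, y} \<in> B"
      show "linked (A \<union> C) x y"
      proof (rule ccontr)
        assume n: "\<not> linked (A \<union> C) x y"
        then have "forest (A \<union> insert {x, y} C)" using forest_insert[of "A \<union> C" x y] C by simp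
        then have "C = insert {x, y} C" using C xy by blast
        then have "{x, y} \<in> C" by blast
        then show False using n by (auto intro: linked_edge)
      qed
    qed
  qed
  moreover have "A \<union> (C - A) = A \<union> C" by blast
  ultimately show ?thesis using C by (intro exI[of _ "C - A"]) auto
qed

section \<open>Translation between bridges, cycles and simple paths\<close>

lemma hd_last_notin_path_edges: "distinct p \<Longrightarrow> length p \<ge> 3 \<Longrightarrow> {hd p, last p} \<notin> path_edges p"
proof -
  assume d: "distinct p" and l: "length p \<ge> 3"
  then obtain x y z r where p: "p = x # y # z # r"
    by (metis One_nat_def Suc_le_length_iff numeral_3_eq_3)
  have "last p \<in> set (z # r)" using p by auto
  then have "last p \<noteq> y" "last p \<noteq> x" using d p by auto
  moreover have "{x, last p} \<notin> path_edges (y # z # r)"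
    using path_edges_subset_Pow[of "{x, last p}" "y # z # r"] d p by auto
  ultimately show ?thesis using p by (auto simp: doubleton_eq_iff)
qed

lemma forest_iff_no_cycle:
  assumes "\<And>u. {u} \<notin> F"
  shows "forest F \<longleftrightarrow> (\<nexists>p. is_cycle F p)"
proof
  assume F: "forest F"
  show "\<nexists>p. is_cycle F p"
  proof
    assume "\<exists>p. is_cycle F p"
    then obtain p where p: "length p \<ge> 3" "distinct p" "path_edges p \<subseteq> F" "{last p, hd p} \<in> F"
      by (auto simp: is_cycle_def)
    then have ne: "p \<noteq> []" by auto
    have "hd p \<noteq> last p" using p(4) assms[of "hd p"] by (intro notI) simp
    moreover have "path_edges p \<subseteq> F - {{hd p, last p}}" using p hd_last_notin_path_edges by auto
    then have "linked (F - {{hd p, last p}}) (hd p) (last p)" by (rule linked_path[OF ne])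
    moreover have "{hd p, last p} \<in> F" using p(4) by (simp add: insert_commute)
    ultimately show False using F unfolding forest_def by blast
  qed
next
  assume F: "\<nexists>p. is_cycle F p"
  show "forest F"
    unfolding forest_def
  proof (intro allI impI notI, elim conjE)
    fix u v assume uv: "{u, v} \<in> F" "u \<noteq> v" "linked (F - {{u, v}}) u v"
    then obtain p where p: "p \<noteq> []" "hd p = u" "last p = v" "distinct p" "path_edges p \<subseteq> F - {{u, v}}"
      using linked_imp_path[OF uv(3)] by blast
    have "length p \<ge> 3"
    proof (rule ccontr)
      assume "\<not> length p \<ge> 3"
      then consider x where "p = [x]" | x y where "p = [x, y]"
        using p(1) by (cases p; cases "tl p"; cases "tl (tl p)") auto
      then show False using p uv by cases auto
    qed
    then have "is_cycle F p" using p uv by (auto simp: is_cycle_def insert_commute)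
    then show False using F by blast
  qed
qed

lemma same_component_iff:
  assumes "u \<in> V" "\<Union>F \<subseteq> V"
  shows "same_component V F u v \<longleftrightarrow> linked F u v"
proof
  assume "same_component V F u v"
  then obtain p where "p \<noteq> []" "path_edges p \<subseteq> F" "hd p = u" "last p = v"
    by (auto simp: same_component_def is_path_def)
  then show "linked F u v" using linked_path[of p F] by simp
next
  assume "linked F u v"
  from linked_imp_path[OF this] obtain p where p: "p \<noteq> []" "hd p = u" "last p = v" "distinct p"
    "path_edges p \<subseteq> F" "set p \<subseteq> insert u (\<Union>F)" by blast
  have "set p \<subseteq> V" using p(6) assms by blast
  then show "same_component V F u v"
    unfolding same_component_def is_path_def using p by blast
qed

lemma complete_edges_Union: "F \<subseteq> complete_edges T \<Longrightarrow> \<Union>F \<subseteq> T"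
  by (auto simp: complete_edges_def dest!: subsetD)

lemma spanning_tree_iff:
  "spanning_tree T (complete_edges T) F \<longleftrightarrow> F \<subseteq> complete_edges T \<and> connects T F \<and> forest F"
proof (cases "F \<subseteq> complete_edges T")
  case True
  then have "{u} \<notin> F" for u by (auto simp: complete_edges_def doubleton_eq_iff)
  then have "forest F \<longleftrightarrow> (\<nexists>p. is_cycle F p)" by (rule forest_iff_no_cycle)
  moreover have "(\<forall>u\<in>T. \<forall>v\<in>T. same_component T F u v) \<longleftrightarrow> connects T F"
    unfolding connects_def using same_component_iff complete_edges_Union[OF True] by metis
  ultimately show ?thesis using True by (simp add: spanning_tree_def)
qed (simp add: spanning_tree_def)

text \<open>Costs are nonnegative, so thinning a connecting set to a spanning tree cannot make it
  dearer. Comparison sets obtained from walks thus need not be acyclic.\<close>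

lemma minimum_spanning_tree_le_connects:
  assumes F: "minimum_spanning_tree T (complete_edges T) c F" and T: "finite T"
    and B: "connects T B" "B \<subseteq> complete_edges T" and c: "\<And>e. e \<in> complete_edges T \<Longrightarrow> 0 \<le> c e"
  shows "sum c F \<le> sum c B"
proof -
  have fin: "finite B" using B T finite_complete_edges finite_subset by metis
  obtain C where C: "C \<subseteq> B" "forest C" "connects T C"
    using forest_augment[OF forest_empty B(1) fin] by auto
  then have "spanning_tree T (complete_edges T) C" using B by (auto simp: spanning_tree_iff)
  then have "sum c F \<le> sum c C" using F by (auto simp: minimum_spanning_tree_def)
  also have "\<dots> \<le> sum c B" using C B c fin by (intro sum_mono2) auto
  finally show ?thesis .
qed

lemma sum_highest_cost_edges:
  assumes S: "highest_cost_edges c F j S" and C: "C \<subseteq> F" "card C \<le> card S" and F: "finite F"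
    and c: "\<And>e. e \<in> F \<Longrightarrow> 0 \<le> c e"
  shows "sum c C \<le> sum c S"
proof -
  have SF: "S \<subseteq> F" and top: "\<And>e f. e \<in> S \<Longrightarrow> f \<in> F - S \<Longrightarrow> c f \<le> c e"
    using S by (auto simp: highest_cost_edges_def)
  have fin: "finite S" "finite C" using SF C F finite_subset by auto
  have "sum c (C - S) \<le> sum c (S - C)"
  proof (cases "C - S = {}")
    case True
    have "0 \<le> sum c (S - C)" using SF c by (intro sum_nonneg) auto
    then show ?thesis unfolding True by simp
  next
    case False
    \<comment> \<open>\<open>?M\<close> separates the two differences: every edge of
      \<open>C - S\<close> costs at most \<open>?M\<close>, every edge of \<open>S - C\<close> at
      least \<open>?M\<close>, and the latter are no fewer.\<close>
    let ?M = "Max (c ` (C - S))"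
    have M: "?M \<in> c ` (C - S)" using False fin by (intro Max_in) auto
    then obtain f0 where f0: "f0 \<in> C - S" "?M = c f0" by auto
    have "card C = card (C \<inter> S) + card (C - S)" "card S = card (C \<inter> S) + card (S - C)"
      using sum.Int_Diff[OF fin(2), of "\<lambda>_. 1::nat" S] sum.Int_Diff[OF fin(1), of "\<lambda>_. 1::nat" C]
      by (simp_all add: Int_commute)
    then have cd: "card (C - S) \<le> card (S - C)" using C by linarith
    have "sum c (C - S) \<le> real (card (C - S)) * ?M"
      using fin by (intro sum_bounded_above) (auto intro!: Max_ge)
    also have "\<dots> \<le> real (card (S - C)) * ?M"
      using cd c[of f0] f0 C by (intro mult_right_mono) auto
    also have "\<dots> \<le> sum c (S - C)"
      unfolding f0(2) using top f0(1) C by (intro sum_bounded_below) auto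
    finally show ?thesis .
  qed
  moreover have "sum c C = sum c (C \<inter> S) + sum c (C - S)"
    by (rule sum.Int_Diff[OF fin(2)])
  moreover have "sum c S = sum c (C \<inter> S) + sum c (S - C)"
    using sum.Int_Diff[OF fin(1), of c C] by (simp add: Int_commute)
  ultimately show ?thesis by linarith
qed

text \<open>Removing \<open>F'\<close> from the minimum spanning tree \<open>F\<close> and completing the remaining forest with
  edges of the tree \<open>G\<close> cannot be cheaper than \<open>F\<close>, so \<open>F'\<close> costs at most the new edges.\<close>

lemma sum_tree_edges_le_highest:
  assumes F: "minimum_spanning_tree T (complete_edges T) c' F" and G: "spanning_tree T (complete_edges T) G"
    and S: "highest_cost_edges c G j S" and F': "F' \<subseteq> F" "card F' \<le> card S" and T: "finite T"
    and le: "\<And>e. e \<in> complete_edges T \<Longrightarrow> c' e \<le> c e" and c: "\<And>e. e \<in> complete_edges T \<Longrightarrow> 0 \<le> c e"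
  shows "sum c' F' \<le> sum c S"
proof -
  have F1: "F \<subseteq> complete_edges T" "connects T F" "forest F"
    using F by (auto simp: minimum_spanning_tree_def spanning_tree_iff)
  have G1: "G \<subseteq> complete_edges T" "connects T G" "forest G" using G by (auto simp: spanning_tree_iff)
  have fin: "finite F" "finite G" using F1 G1 T finite_complete_edges finite_subset by metis+
  obtain C where C: "C \<subseteq> G" "(F - F') \<inter> C = {}" "forest ((F - F') \<union> C)" "connects T ((F - F') \<union> C)"
    using forest_augment[OF forest_subset[OF F1(3), of "F - F'"] G1(2) fin(2)] by auto
  have finC: "finite C" using C fin finite_subset by metis
  have finF': "finite F'" using F' fin finite_subset by metis
  have "spanning_tree T (complete_edges T) ((F - F') \<union> C)"
    using C F1 G1 by (auto simp: spanning_tree_iff)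
  then have "sum c' F \<le> sum c' ((F - F') \<union> C)" using F by (auto simp: minimum_spanning_tree_def)
  also have "\<dots> = sum c' (F - F') + sum c' C" using C fin finC by (intro sum.union_disjoint) auto
  finally have "sum c' F' \<le> sum c' C" using sum_diff[OF fin(1) F'(1), of c'] by simp
  also have "\<dots> \<le> sum c C" using C G1 le by (intro sum_mono) auto
  also have "\<dots> \<le> sum c S"
  proof (rule sum_highest_cost_edges[OF S C(1) _ fin(2)])
    \<comment> \<open>A forest has no more edges than a connecting set, so at most as many edges
      come in as were taken out.\<close>
    have "card ((F - F') \<union> C) \<le> card F"
      using C F1 G1 fin T by (intro card_forest_le_connects[of _ T]) auto
    moreover have "card ((F - F') \<union> C) = card (F - F') + card C"
      using C fin finC by (intro card_Un_disjoint) auto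
    moreover have "card (F - F') = card F - card F'" "card F' \<le> card F"
      using F' fin finF' by (auto intro: card_Diff_subset card_mono)
    ultimately show "card C \<le> card S" using F'(2) by linarith
  qed (use G1 c in auto)
  finally show ?thesis .
qed

section \<open>Distances and the approximation guarantee\<close>

lemma simple_graph_edges:
  assumes "simple_graph V E"
  shows "finite E" "\<Union>E \<subseteq> V" "finite V"
proof -
  have "E \<subseteq> Pow V" using assms by (auto simp: simple_graph_def)
  then show "finite E" "\<Union>E \<subseteq> V" "finite V" using assms by (auto simp: simple_graph_def intro: finite_subset)
qed

lemma path_dist_le:
  assumes w: "\<And>e. e \<in> E \<Longrightarrow> 0 \<le> w e" and p: "joins V E e p"
  shows "path_dist V E w e \<le> sum w (path_edges p)"
  unfolding path_dist_def
proof (rule cINF_lower)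
  show "bdd_below ((\<lambda>p. sum w (path_edges p)) ` {p. joins V E e p})"
    by (rule bdd_belowI2[of _ 0]) (use w in \<open>auto simp: joins_def is_path_def intro!: sum_nonneg\<close>)
qed (use p in simp)

text \<open>The path \<open>p\<close> witnesses that the infimum ranges over a nonempty set; over
  the empty set its value would be unspecified.\<close>

lemma path_dist_ge:
  assumes "joins V E e p" "\<And>q. joins V E e q \<Longrightarrow> r \<le> sum w (path_edges q)"
  shows "r \<le> path_dist V E w e"
  unfolding path_dist_def by (rule cINF_greatest) (use assms in auto)

lemma path_dist_nonneg:
  assumes "\<And>e. e \<in> E \<Longrightarrow> 0 \<le> w e" "joins V E e p"
  shows "0 \<le> path_dist V E w e"
  by (rule path_dist_ge[OF assms(2)]) (use assms in \<open>auto simp: joins_def is_path_def intro!: sum_nonneg\<close>)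

lemma path_dist_cheapest:
  assumes "\<And>e. e \<in> E \<Longrightarrow> 0 \<le> w e" "cheapest_path V E w e p"
  shows "path_dist V E w e = sum w (path_edges p)"
proof (rule antisym)
  show "path_dist V E w e \<le> sum w (path_edges p)"
    using assms by (intro path_dist_le) (auto simp: cheapest_path_def)
  show "sum w (path_edges p) \<le> path_dist V E w e"
    using assms by (intro path_dist_ge) (auto simp: cheapest_path_def)
qed

lemma path_dist_mono:
  assumes "\<And>e. e \<in> E \<Longrightarrow> 0 \<le> w' e" "\<And>e. e \<in> E \<Longrightarrow> w' e \<le> w e" "joins V E e p"
  shows "path_dist V E w' e \<le> path_dist V E w e"
proof (rule path_dist_ge[OF assms(3)])
  fix q assume q: "joins V E e q"
  have "path_dist V E w' e \<le> sum w' (path_edges q)" using q assms(1) by (intro path_dist_le)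
  also have "\<dots> \<le> sum w (path_edges q)" using q assms(2) by (intro sum_mono) (auto simp: joins_def is_path_def)
  finally show "path_dist V E w' e \<le> sum w (path_edges q)" .
qed

text \<open>Counts an edge once per traversal, whereas \<open>sum w (path_edges p)\<close> counts it
  once. The walk around a Steiner tree repeats edges, so the factor 2 is visible only in this
  measure.\<close>

fun walk_weight :: "('v set \<Rightarrow> real) \<Rightarrow> 'v list \<Rightarrow> real" where
  "walk_weight w (u # v # p) = w {u, v} + walk_weight w (v # p)"
| "walk_weight w _ = 0"

lemma walk_weight_append: "walk_weight w (p @ x # q) = walk_weight w (p @ [x]) + walk_weight w (x # q)"
proof (induction p)
  case (Cons y p)
  then show ?case by (cases p) auto
qed simp

lemma sum_path_edges_le_walk_weight:
  assumes "\<And>e. e \<in> path_edges p \<Longrightarrow> 0 \<le> w e"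
  shows "sum w (path_edges p) \<le> walk_weight w p"
  using assms
proof (induction p rule: path_edges.induct)
  case (1 u v p)
  have "sum w (path_edges (u # v # p)) \<le> w {u, v} + sum w (path_edges (v # p))"
    using 1(2) by (cases "{u, v} \<in> path_edges (v # p)") (auto simp: insert_absorb)
  then show ?case using 1 by auto
qed auto

lemma walk_weight_distinct:
  "distinct p \<Longrightarrow> walk_weight w p = sum w (path_edges p)"
proof (induction p rule: path_edges.induct)
  case (1 u v p)
  have "{u, v} \<notin> path_edges (v # p)" using path_edges_subset_Pow[of "{u, v}" "v # p"] 1(2) by auto
  then show ?case using 1 by simp
qed auto

lemma path_dist_le_walk_weight:
  assumes G: "\<Union>E \<subseteq> V" and w: "\<And>e. e \<in> E \<Longrightarrow> 0 \<le> w e"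
    and p: "p \<noteq> []" "path_edges p \<subseteq> E" "hd p \<in> V"
  shows "path_dist V E w {hd p, last p} \<le> walk_weight w p"
proof -
  have "linked (path_edges p) (hd p) (last p)" using p(1) by (rule linked_path) simp
  from linked_imp_path[OF this] obtain q where q: "q \<noteq> []" "hd q = hd p" "last q = last p" "distinct q"
    "path_edges q \<subseteq> path_edges p" "set q \<subseteq> insert (hd p) (\<Union>(path_edges p))" by blast
  have "set q \<subseteq> V" using q(6) p G by blast
  then have "joins V E {hd p, last p} q" using q p by (auto simp: joins_def is_path_def)
  then have "path_dist V E w {hd p, last p} \<le> sum w (path_edges q)" by (intro path_dist_le w)
  also have "\<dots> \<le> sum w (path_edges p)" using q p w by (intro sum_mono2) auto
  also have "\<dots> \<le> walk_weight w p" using p w by (intro sum_path_edges_le_walk_weight) auto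
  finally show ?thesis .
qed

text \<open>A walk that uses every edge of \<open>X\<close> at most twice: extend it by a detour along an edge
  that leaves the visited vertices as long as there is one.\<close>

lemma closed_walk:
  assumes X: "finite X" and w: "\<And>e. e \<in> X \<Longrightarrow> 0 \<le> w e"
  shows "\<exists>q. q \<noteq> [] \<and> hd q = r \<and> path_edges q \<subseteq> X \<and> walk_weight w q \<le> 2 * sum w X \<and>
    (\<forall>v. linked X r v \<longrightarrow> v \<in> set q)"
proof -
  \<comment> \<open>\<open>Y\<close> collects the edges already traversed by detours; choosing it as
    large as possible replaces a recursion on the walk. The condition
    \<open>Y \<subseteq> Pow (set q)\<close> ensures that an edge to an unvisited vertex is not yet
    in \<open>Y\<close>, so that its two traversals are still covered by the budget.\<close>
  let ?P = "\<lambda>(q, Y). q \<noteq> [] \<and> hd q = r \<and> path_edges q \<subseteq> X \<and> Y \<subseteq> X \<and> Y \<subseteq> Pow (set q) \<and>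
    walk_weight w q \<le> 2 * sum w Y"
  have "?P ([r], {})" by simp
  moreover have "\<forall>z. ?P z \<longrightarrow> card (snd z) < Suc (card X)"
    using X by (auto intro!: le_imp_less_Suc card_mono)
  ultimately have "\<exists>z. ?P z \<and> (\<forall>z'. ?P z' \<longrightarrow> card (snd z') \<le> card (snd z))"
    by (rule ex_has_greatest_nat)
  then obtain z where z: "?P z" "\<forall>z'. ?P z' \<longrightarrow> card (snd z') \<le> card (snd z)" by (elim exE conjE)
  obtain q Y where qY: "z = (q, Y)" by (cases z)
  have q: "q \<noteq> []" "hd q = r" "path_edges q \<subseteq> X" "Y \<subseteq> X" "Y \<subseteq> Pow (set q)"
    "walk_weight w q \<le> 2 * sum w Y" using z(1) qY by auto
  have finY: "finite Y" using q X finite_subset by blast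
  have closed: "v \<in> set q" if uv: "u \<in> set q" "{u, v} \<in> X" for u v
  proof (rule ccontr)
    assume v: "v \<notin> set q"
    obtain q1 q2 where q12: "q = q1 @ u # q2" using uv by (meson split_list)
    let ?q = "q1 @ u # v # u # q2"
    have nY: "{u, v} \<notin> Y" using q(5) v by auto
    have pe: "path_edges ?q = path_edges q \<union> {{u, v}}"
      using path_edges_append[of q1 u "v # u # q2"] path_edges_append[of q1 u q2] q12
      by (auto simp: insert_commute)
    have ww: "walk_weight w ?q = walk_weight w q + 2 * w {u, v}"
      using walk_weight_append[of w q1 u "v # u # q2"] walk_weight_append[of w q1 u q2] q12
      by (simp add: insert_commute)
    have "?P (?q, insert {u, v} Y)"
      unfolding prod.case
    proof (intro conjI)
      show "hd ?q = r" using q(2) q12 by (cases q1) auto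
      show "path_edges ?q \<subseteq> X" unfolding pe using q(3) uv(2) by simp
      show "insert {u, v} Y \<subseteq> X" using q(4) uv(2) by simp
      have "set ?q = insert v (set q)" using q12 by auto
      then show "insert {u, v} Y \<subseteq> Pow (set ?q)" using q(5) uv(1) by auto
      show "walk_weight w ?q \<le> 2 * sum w (insert {u, v} Y)" unfolding ww using q(6) nY finY by simp
    qed simp
    then have "card (snd (?q, insert {u, v} Y)) \<le> card (snd z)" by (rule z(2)[rule_format])
    then have "card (insert {u, v} Y) \<le> card Y" unfolding qY snd_conv .
    then show False using nY finY by simp
  qed
  have "v \<in> set q" if "linked X r v" for v
    using that unfolding linked_def
  proof (induction rule: rtranclp_induct)
    case base
    then show ?case using q by auto
  next
    case (step y z)
    then show ?case using closed by blast
  qed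
  moreover have "walk_weight w q \<le> 2 * sum w X"
    using q(6) sum_mono2[OF X q(4), of w] w by auto
  ultimately show ?thesis using q by blast
qed

text \<open>\<open>p\<close> is the stretch of the walk from its latest terminal \<open>hd p\<close>
  to the head of \<open>q\<close>. On arrival at another terminal the weight of the stretch pays for
  the edge between the two terminals and a new stretch starts; at a nonterminal the stretch just
  grows. Every traversal is thus spent at most once.\<close>

lemma walk_connects_terminals:
  assumes G: "\<Union>E \<subseteq> V" and w: "\<And>e. e \<in> E \<Longrightarrow> 0 \<le> w e" and T: "T \<subseteq> V"
    and c: "\<And>e. e \<in> complete_edges T \<Longrightarrow> 0 \<le> path_dist V E w e"
    and q: "q \<noteq> []" "path_edges q \<subseteq> E"
    and p: "p \<noteq> []" "hd p \<in> T" "last p = hd q" "path_edges p \<subseteq> E"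
  shows "\<exists>F. F \<subseteq> complete_edges T \<and> finite F \<and> (\<forall>t\<in>T \<inter> set q. linked F (hd p) t) \<and>
    sum (path_dist V E w) F \<le> walk_weight w p + walk_weight w q"
  using q p
proof (induction q arbitrary: p rule: path_edges.induct)
  case (1 u v q)
  have e: "{u, v} \<in> E" "path_edges (v # q) \<subseteq> E" using 1(3) by auto
  have wp: "walk_weight w (p @ [v]) = walk_weight w p + w {u, v}"
  proof -
    have p: "p = butlast p @ [u]" using 1(4,6) by (metis append_butlast_last_id list.sel(1))
    have "walk_weight w (p @ [v]) = walk_weight w (butlast p @ u # [v])" using p by (metis append.assoc append_Cons append_Nil)
    then show ?thesis using walk_weight_append[of w "butlast p" u "[v]"] p by simp
  qed
  show ?case
  proof (cases "u \<in> T")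
    case True
    obtain F where F: "F \<subseteq> complete_edges T" "finite F" "\<forall>t\<in>T \<inter> set (v # q). linked F u t"
      "sum (path_dist V E w) F \<le> walk_weight w [u, v] + walk_weight w (v # q)"
      using 1(1)[of "[u, v]"] e True by auto
    show ?thesis
    proof (cases "hd p = u")
      case True
      have pn: "0 \<le> walk_weight w p"
        using sum_path_edges_le_walk_weight[of p w] sum_nonneg[of "path_edges p" w] 1(7) w
        by (metis order_trans subsetD)
      show ?thesis using F True pn by (intro exI[of _ F]) auto
    next
      case False
      have ce: "{hd p, u} \<in> complete_edges T" using False True 1(5) by (intro complete_edgesI) auto
      have "path_dist V E w {hd p, last p} \<le> walk_weight w p"
        using 1(4,5,7) T by (intro path_dist_le_walk_weight G w) auto
      then have d: "path_dist V E w {hd p, u} \<le> walk_weight w p" using 1(6) by simp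
      let ?F = "insert {hd p, u} F"
      have l: "linked ?F (hd p) u" by (intro linked_edge) simp
      have "linked ?F (hd p) t" if "t \<in> T \<inter> set (u # v # q)" for t
      proof (cases "t = u")
        case False
        then have "linked F u t" using F(3) that by auto
        then show ?thesis using linked_trans[OF l] linked_mono[of F u t ?F] by blast
      qed (use l in simp)
      moreover have "sum (path_dist V E w) ?F \<le> path_dist V E w {hd p, u} + sum (path_dist V E w) F"
        using F c[OF ce] by (cases "{hd p, u} \<in> F") (auto simp: insert_absorb)
      ultimately show ?thesis using F ce d by (intro exI[of _ ?F]) auto
    qed
  next
    case False
    obtain F where F: "F \<subseteq> complete_edges T" "finite F" "\<forall>t\<in>T \<inter> set (v # q). linked F (hd p) t"
      "sum (path_dist V E w) F \<le> walk_weight w (p @ [v]) + walk_weight w (v # q)"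
      using 1(1)[of "p @ [v]"] e 1(4-7) by (auto simp: path_edges_snoc)
    then show ?thesis using False wp by (intro exI[of _ F]) auto
  qed
next
  case ("2_2" u)
  show ?case
  proof (cases "u \<in> T \<and> hd p \<noteq> u")
    case True
    have "path_dist V E w {hd p, last p} \<le> walk_weight w p"
      using "2_2" T by (intro path_dist_le_walk_weight G w) auto
    moreover have "{hd p, u} \<in> complete_edges T" using True "2_2" by (intro complete_edgesI) auto
    ultimately show ?thesis using "2_2"
      by (intro exI[of _ "{{hd p, u}}"]) (auto intro: linked_edge)
  next
    case False
    have "0 \<le> walk_weight w p"
      using sum_path_edges_le_walk_weight[of p w] sum_nonneg[of "path_edges p" w] "2_2"(6) w
      by (metis order_trans subsetD)
    then show ?thesis using False by (intro exI[of _ "{}"]) auto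
  qed
qed auto

lemma steiner_tree_joins:
  assumes "steiner_tree V E T X" "e \<in> complete_edges T"
  shows "\<exists>p. joins V E e p"
proof -
  obtain s t where st: "e = {s, t}" "s \<in> T" "t \<in> T" using assms(2) by (auto simp: complete_edges_def)
  then obtain p where "is_path V X p" "hd p = s" "last p = t"
    using assms(1) unfolding steiner_tree_def same_component_def by blast
  then have "joins V E e p" using st assms(1) by (auto simp: joins_def is_path_def steiner_tree_def)
  then show ?thesis ..
qed

lemma mst_le_twice_steiner_tree:
  assumes G: "simple_graph V E" and w: "\<And>e. e \<in> E \<Longrightarrow> 0 \<le> w e" and T: "T \<subseteq> V"
    and X: "steiner_tree V E T X" and F: "minimum_spanning_tree T (complete_edges T) (path_dist V E w) F"
  shows "sum (path_dist V E w) F \<le> 2 * sum w X"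
proof (cases "T = {}")
  case True
  have XE: "X \<subseteq> E" using X by (simp add: steiner_tree_def)
  have "F = {}" using F True by (auto simp: minimum_spanning_tree_def spanning_tree_def complete_edges_def)
  moreover have "0 \<le> sum w X" using w XE by (intro sum_nonneg) auto
  ultimately show ?thesis by simp
next
  case False
  then obtain r where r: "r \<in> T" by blast
  have XE: "X \<subseteq> E" using X by (simp add: steiner_tree_def)
  note g = simple_graph_edges[OF G]
  have finX: "finite X" using XE g finite_subset by blast
  have lX: "linked X r t" if "t \<in> T" for t
  proof -
    have "same_component V X r t" using X r that by (auto simp: steiner_tree_def)
    moreover have "\<Union>X \<subseteq> V" using XE g(2) by blast
    ultimately show ?thesis using same_component_iff[of r V X t] r T by blast
  qed
  obtain q where q: "q \<noteq> []" "hd q = r" "path_edges q \<subseteq> X" "walk_weight w q \<le> 2 * sum w X"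
    "\<forall>v. linked X r v \<longrightarrow> v \<in> set q"
    using closed_walk[OF finX, of w r] w XE by auto
  have c: "0 \<le> path_dist V E w e" if e: "e \<in> complete_edges T" for e
  proof -
    obtain p where "joins V E e p" using steiner_tree_joins[OF X e] by (elim exE)
    then show ?thesis by (intro path_dist_nonneg[OF w])
  qed
  have "\<exists>H. H \<subseteq> complete_edges T \<and> finite H \<and> (\<forall>t\<in>T \<inter> set q. linked H (hd [r]) t) \<and>
    sum (path_dist V E w) H \<le> walk_weight w [r] + walk_weight w q"
    using q XE r by (intro walk_connects_terminals[OF g(2) w T c]) auto
  then obtain H where H: "H \<subseteq> complete_edges T" "\<forall>t\<in>T \<inter> set q. linked H r t"
    "sum (path_dist V E w) H \<le> walk_weight w q" by auto
  have lH: "linked H r t" if "t \<in> T" for t using H(2) q(5) lX that by auto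
  have "linked H u v" if "u \<in> T" "v \<in> T" for u v
    using linked_trans[OF linked_sym[OF lH[OF that(1)]] lH[OF that(2)]] .
  then have "connects T H" by (simp add: connects_def)
  moreover have "finite T" using T g(3) finite_subset by blast
  ultimately have "sum (path_dist V E w) F \<le> sum (path_dist V E w) H"
    using minimum_spanning_tree_le_connects[OF F _ _ H(1) c] by blast
  then show ?thesis using H(3) q(4) by linarith
qed

section \<open>The output for one value of \<alpha>\<close>

locale scaled_run =
  fixes V :: "'v set" and E w T Xhat \<alpha> X F P
  assumes inst: "steiner_instance V E w T Xhat" and alpha: "1 \<le> \<alpha>"
    and F: "minimum_spanning_tree T (complete_edges T) (path_dist V E (scaled_weight w Xhat \<alpha>)) F"
    and P: "\<And>e. e \<in> F \<Longrightarrow> cheapest_path V E (scaled_weight w Xhat \<alpha>) e (P e)"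
    and X: "X = (\<Union>e\<in>F. path_edges (P e))"
begin

abbreviation "wa \<equiv> scaled_weight w Xhat \<alpha>"

lemma inst': "simple_graph V E" "\<And>e. e \<in> E \<Longrightarrow> 0 \<le> w e" "T \<subseteq> V" "Xhat \<subseteq> E"
  using inst by (auto simp: steiner_instance_def)

lemmas fin = simple_graph_edges[OF inst'(1)]

lemma wa_nonneg: "e \<in> E \<Longrightarrow> 0 \<le> wa e" and wa_le: "e \<in> E \<Longrightarrow> wa e \<le> w e"
  using inst'(2)[of e] alpha mult_left_mono[of 1 \<alpha> "w e"] by (auto simp: scaled_weight_def divide_le_eq)

lemma F_facts: "F \<subseteq> complete_edges T" "connects T F" "forest F" "finite F" "finite T" "finite Xhat"
proof -
  show "F \<subseteq> complete_edges T" "connects T F" "forest F"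
    using F by (auto simp: minimum_spanning_tree_def spanning_tree_iff)
  show "finite T" "finite Xhat" using inst' fin finite_subset by metis+
  then show "finite F" using \<open>F \<subseteq> complete_edges T\<close> finite_complete_edges finite_subset by metis
qed

lemma P_edges: "e \<in> F \<Longrightarrow> path_edges (P e) \<subseteq> E"
  using P by (auto simp: cheapest_path_def joins_def is_path_def)

lemma X_sub: "X \<subseteq> E" "finite X"
  using P_edges fin(1) X by (auto intro: finite_subset)

lemma steiner: "steiner_tree V E T X"
proof -
  have "linked X u v" if "u \<in> T" "v \<in> T" for u v
  proof -
    have "linked F u v" using F_facts(2) that by (auto simp: connects_def)
    then show ?thesis
    proof (rule linked_subst)
      fix x y assume xy: "{x, y} \<in> F"
      then have p: "P {x, y} \<noteq> []" "{hd (P {x, y}), last (P {x, y})} = {x, y}"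
        using P by (auto simp: cheapest_path_def joins_def is_path_def)
      have "linked X (hd (P {x, y})) (last (P {x, y}))"
        using p(1) xy X by (intro linked_path) auto
      then show "linked X x y" using p(2) linked_sym[of X y x] by (auto simp: doubleton_eq_iff)
    qed
  qed
  moreover have "\<Union>X \<subseteq> V" using X_sub(1) fin(2) by blast
  ultimately have "same_component V X u v" if "u \<in> T" "v \<in> T" for u v
    using same_component_iff[of u V X v] that inst'(3) by blast
  then show ?thesis using X_sub by (simp add: steiner_tree_def)
qed

lemma sum_wa_le: "G \<subseteq> F \<Longrightarrow> Z \<subseteq> (\<Union>e\<in>G. path_edges (P e)) \<Longrightarrow> sum wa Z \<le> sum (path_dist V E wa) G"
proof -
  assume G: "G \<subseteq> F" and Z: "Z \<subseteq> (\<Union>e\<in>G. path_edges (P e))"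
  have finG: "finite G" using G F_facts(4) finite_subset by blast
  have nn: "0 \<le> wa e" if "e \<in> (\<Union>f\<in>G. path_edges (P f))" for e
    using that G P_edges wa_nonneg by blast
  have "sum wa Z \<le> sum wa (\<Union>e\<in>G. path_edges (P e))"
    using Z nn finG by (intro sum_mono2) auto
  also have "\<dots> \<le> (\<Sum>e\<in>G. sum wa (path_edges (P e)))"
    using finG nn
  proof (induction G rule: finite_induct)
    case (insert e G)
    let ?A = "path_edges (P e)" and ?B = "\<Union>e\<in>G. path_edges (P e)"
    have "sum wa (?A \<union> ?B) = sum wa ?A + sum wa ?B - sum wa (?A \<inter> ?B)"
      using insert by (intro sum_Un) auto
    moreover have "0 \<le> sum wa (?A \<inter> ?B)" using insert.prems by (intro sum_nonneg) auto
    ultimately show ?case using insert by auto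
  qed simp
  also have "\<dots> = sum (path_dist V E wa) G"
    using G by (intro sum.cong refl path_dist_cheapest[OF wa_nonneg, symmetric] P) auto
  finally show ?thesis .
qed

text \<open>With \<open>?b = 1 - 1 / \<alpha>\<close>, returning to the original weights adds
  \<open>?b\<close> times the predicted part of \<open>X\<close>. Doubling \<open>X'\<close> in the
  scaled weights brings twice the discount \<open>?b * sum w (X' \<inter> Xhat)\<close>, one half of
  which cancels against the predicted edges that \<open>X\<close> may share with \<open>X'\<close>.
  What remains are the first two terms of the bound plus \<open>?b\<close> times the weight of
  \<open>?Z\<close>, the predicted edges of \<open>X\<close> outside \<open>X'\<close>.\<close>

lemma weight_bound:
  assumes X': "steiner_tree V E T X'"
    and M: "minimum_spanning_tree T (complete_edges T) (path_dist V E w) M"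
    and S: "highest_cost_edges (path_dist V E w) M (min (card T - 1) (card (Xhat - X'))) S"
  shows "sum w X \<le> (1 + 1 / \<alpha>) * sum w X' + (1 - 1 / \<alpha>) * sum w (X' - Xhat) +
    min (sum w (Xhat - X')) ((\<alpha> - 1) * (\<Sum>e\<in>S. path_dist V E w e))"
proof -
  let ?b = "1 - 1 / \<alpha>"
  have b: "0 \<le> ?b" "?b \<le> 1" using alpha by auto
  have X'E: "X' \<subseteq> E" "finite X'" using X' fin(1) by (auto simp: steiner_tree_def intro: finite_subset)
  have split: "sum w Y = sum wa Y + ?b * sum w (Y \<inter> Xhat)" if "Y \<subseteq> E" for Y
  proof -
    have fY: "finite Y" using that fin(1) finite_subset by blast
    have "sum w Y = sum (\<lambda>e. wa e + (if e \<in> Xhat then ?b * w e else 0)) Y"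
      by (intro sum.cong) (auto simp: scaled_weight_def algebra_simps)
    also have "\<dots> = sum wa Y + ?b * sum w (Y \<inter> Xhat)"
      using fY by (auto simp: sum.distrib sum.inter_restrict sum_distrib_left intro!: sum.cong)
    finally show ?thesis .
  qed
  have two: "sum wa X \<le> 2 * sum wa X'"
    using sum_wa_le[of F X] X mst_le_twice_steiner_tree[OF inst'(1) wa_nonneg inst'(3) X' F] by auto
  have X'1: "sum w X' = sum w (X' \<inter> Xhat) + sum w (X' - Xhat)" by (rule sum.Int_Diff[OF X'E(2)])
  let ?Z = "X \<inter> (Xhat - X')"
  have XX: "sum w (X \<inter> Xhat) \<le> sum w (X' \<inter> Xhat) + sum w ?Z"
  proof -
    have "sum w (X \<inter> Xhat) \<le> sum w ((X' \<inter> Xhat) \<union> ?Z)"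
      using X_sub X'E inst'(2) by (intro sum_mono2) auto
    also have "\<dots> = sum w (X' \<inter> Xhat) + sum w ?Z"
      using X_sub X'E by (intro sum.union_disjoint) auto
    finally show ?thesis .
  qed
  have main: "sum w X \<le> (1 + 1 / \<alpha>) * sum w X' + ?b * sum w (X' - Xhat) + ?b * sum w ?Z"
  proof -
    have "sum w X = sum wa X + ?b * sum w (X \<inter> Xhat)" using split[OF X_sub(1)] .
    also have "\<dots> \<le> 2 * sum wa X' + ?b * (sum w (X' \<inter> Xhat) + sum w ?Z)"
      using two XX b by (intro add_mono mult_left_mono) auto
    also have "sum wa X' = sum w X' - ?b * sum w (X' \<inter> Xhat)" using split[OF X'E(1)] by simp
    also have "sum w (X' \<inter> Xhat) = sum w X' - sum w (X' - Xhat)" using X'1 by simp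
    finally show ?thesis by (simp add: algebra_simps)
  qed
  have Z1: "?b * sum w ?Z \<le> sum w (Xhat - X')"
  proof -
    have "sum w ?Z \<le> sum w (Xhat - X')"
      using F_facts(6) inst' by (intro sum_mono2) auto
    moreover have "0 \<le> sum w ?Z" using X_sub inst'(2) by (intro sum_nonneg) auto
    ultimately show ?thesis using b by (meson mult_left_le_one_le order_trans)
  qed
  \<comment> \<open>Each edge of \<open>?Z\<close> selects one tree edge whose path contains it, so
    only few tree edges are charged. All of \<open>?Z\<close> is predicted, hence
    \<open>?b * w = (\<alpha> - 1) * wa\<close> on it, which turns original weight into scaled cost
    of tree edges.\<close>
  have Z2: "?b * sum w ?Z \<le> (\<alpha> - 1) * (\<Sum>e\<in>S. path_dist V E w e)"
  proof -
    have "\<forall>e\<in>?Z. \<exists>f\<in>F. e \<in> path_edges (P f)" using X by auto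
    then obtain f where f: "\<And>e. e \<in> ?Z \<Longrightarrow> f e \<in> F \<and> e \<in> path_edges (P (f e))" by metis
    have c1: "card (f ` ?Z) \<le> card (Xhat - X')"
    proof -
      have "card (f ` ?Z) \<le> card ?Z" using X_sub by (intro card_image_le) auto
      also have "\<dots> \<le> card (Xhat - X')" using F_facts(6) by (intro card_mono) auto
      finally show ?thesis .
    qed
    have c2: "card (f ` ?Z) \<le> card T - 1"
    proof -
      have "card (f ` ?Z) \<le> card F" using f F_facts(4) by (intro card_mono) auto
      also have "\<dots> \<le> card T - 1" using F_facts by (intro card_forest_le)
      finally show ?thesis .
    qed
    have c: "0 \<le> path_dist V E w e" "path_dist V E wa e \<le> path_dist V E w e" if e: "e \<in> complete_edges T" for e
    proof -
      obtain p where "joins V E e p" using steiner_tree_joins[OF X' e] by (elim exE)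
      then show "path_dist V E wa e \<le> path_dist V E w e" by (intro path_dist_mono[OF wa_nonneg wa_le])
      show "0 \<le> path_dist V E w e" using \<open>joins V E e p\<close> by (intro path_dist_nonneg[OF inst'(2)])
    qed
    have "sum wa ?Z \<le> sum (path_dist V E wa) (f ` ?Z)"
      using f by (intro sum_wa_le) auto
    also have "\<dots> \<le> (\<Sum>e\<in>S. path_dist V E w e)"
    proof (rule sum_tree_edges_le_highest[OF F _ S _ _ F_facts(5)])
      show "spanning_tree T (complete_edges T) M" using M by (simp add: minimum_spanning_tree_def)
      show "f ` ?Z \<subseteq> F" using f by auto
      show "card (f ` ?Z) \<le> card S" using c1 c2 S by (simp add: highest_cost_edges_def)
    qed (use c in auto)
    finally have "sum wa ?Z \<le> (\<Sum>e\<in>S. path_dist V E w e)" .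
    moreover have "sum w ?Z = \<alpha> * sum wa ?Z"
      unfolding sum_distrib_left using alpha by (intro sum.cong) (auto simp: scaled_weight_def)
    then have "?b * sum w ?Z = (\<alpha> - 1) * sum wa ?Z" using alpha by (simp add: field_simps)
    ultimately show ?thesis using alpha by (simp add: mult_left_mono)
  qed
  show ?thesis using main Z1 Z2 by linarith
qed

end

text \<open>Frees the grid from logarithms: the rounding of \<alpha> and the stopping test of the
  program both compare \<open>(1 + \<epsilon>) ^ i * \<epsilon>\<close> with 1.\<close>

lemma le_max_exponent_iff:
  assumes "\<epsilon> > 0"
  shows "max_exponent \<epsilon> \<le> i \<longleftrightarrow> 1 \<le> (1 + \<epsilon>) ^ i * \<epsilon>"
proof -
  have "max_exponent \<epsilon> \<le> i \<longleftrightarrow> \<lceil>log (1 + \<epsilon>) (inverse \<epsilon>)\<rceil> \<le> int i"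
    using max_exponent_ceiling[OF assms] by linarith
  also have "\<dots> \<longleftrightarrow> log (1 + \<epsilon>) (inverse \<epsilon>) \<le> real i" by (simp add: ceiling_le_iff)
  also have "\<dots> \<longleftrightarrow> inverse \<epsilon> \<le> (1 + \<epsilon>) powr real i" using assms by (subst log_le_iff) auto
  also have "\<dots> \<longleftrightarrow> 1 \<le> (1 + \<epsilon>) ^ i * \<epsilon>" using assms by (simp add: powr_realpow field_simps)
  finally show ?thesis .
qed

text \<open>\<alpha> is rounded down, because among the terms of the bound only the coefficient
  \<open>1 + 1 / \<alpha>\<close> decreases with \<alpha>. Inside the grid, rounding enlarges
  \<open>1 / \<alpha>\<close> by a factor of at most \<open>1 + \<epsilon>\<close>; beyond its end,
  the last grid point \<open>g\<close> already satisfies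
  \<open>1 / g \<le> \<epsilon>\<close>.\<close>

lemma grid_below:
  assumes eps: "\<epsilon> > 0" and \<alpha>: "1 \<le> \<alpha>"
  shows "\<exists>i\<le>max_exponent \<epsilon>. (1 + \<epsilon>) ^ i \<le> \<alpha> \<and> 1 + 1 / (1 + \<epsilon>) ^ i \<le> (1 + \<epsilon>) * (1 + 1 / \<alpha>)"
proof (cases "(1 + \<epsilon>) ^ max_exponent \<epsilon> \<le> \<alpha>")
  case True
  let ?g = "(1 + \<epsilon>) ^ max_exponent \<epsilon>"
  have "1 \<le> ?g * \<epsilon>" using le_max_exponent_iff[OF eps] by blast
  moreover have "0 < ?g" using eps by simp
  ultimately have "1 / ?g \<le> \<epsilon>" by (simp add: field_simps)
  moreover have "1 + \<epsilon> \<le> (1 + \<epsilon>) * (1 + 1 / \<alpha>)" using eps \<alpha> by (simp add: algebra_simps)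
  ultimately show ?thesis using True by force
next
  case False
  define j where "j = (LEAST j. \<alpha> < (1 + \<epsilon>) ^ j)"
  have ex: "\<alpha> < (1 + \<epsilon>) ^ max_exponent \<epsilon>" using False by simp
  have j: "\<alpha> < (1 + \<epsilon>) ^ j" unfolding j_def by (rule LeastI[of _ "max_exponent \<epsilon>"]) (rule ex)
  have jle: "j \<le> max_exponent \<epsilon>" unfolding j_def by (rule Least_le) (rule ex)
  have j0: "j \<noteq> 0" using j \<alpha> by (intro notI) simp
  then obtain i where i: "j = Suc i" using not0_implies_Suc by blast
  have "\<not> \<alpha> < (1 + \<epsilon>) ^ i" using not_less_Least[of i "\<lambda>j. \<alpha> < (1 + \<epsilon>) ^ j"] i unfolding j_def by simp
  then have le: "(1 + \<epsilon>) ^ i \<le> \<alpha>" by simp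
  have g: "0 < (1 + \<epsilon>) ^ i" using eps by simp
  have "1 / (1 + \<epsilon>) ^ i \<le> (1 + \<epsilon>) * (1 / \<alpha>)"
    using j g \<alpha> unfolding i by (simp add: field_simps)
  then have "1 + 1 / (1 + \<epsilon>) ^ i \<le> (1 + \<epsilon>) * (1 + 1 / \<alpha>)"
    using eps by (simp add: algebra_simps)
  then show ?thesis using le jle i by (intro exI[of _ i]) auto
qed

lemma algorithm_guarantee:
  assumes eps: "\<epsilon> > 0" and inst: "steiner_instance V E w T Xhat" and out: "algorithm_output \<epsilon> V E w T Xhat X"
  shows "steiner_tree V E T X"
    "steiner_tree V E T X' \<Longrightarrow> minimum_spanning_tree T (complete_edges T) (path_dist V E w) M \<Longrightarrow>
      highest_cost_edges (path_dist V E w) M (min (card T - 1) (card (Xhat - X'))) S \<Longrightarrow>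
      sum w X \<le> (1 + \<epsilon>) * (INF \<alpha>\<in>{1..}. (1 + 1 / \<alpha>) * sum w X' + (1 - 1 / \<alpha>) * sum w (X' - Xhat) +
        min (sum w (Xhat - X')) ((\<alpha> - 1) * (\<Sum>e\<in>S. path_dist V E w e)))"
proof -
  obtain Y where Y: "\<And>i. i \<le> max_exponent \<epsilon> \<Longrightarrow> scaled_algorithm_output V E w T Xhat ((1 + \<epsilon>) ^ i) (Y i)"
    and XY: "\<exists>i\<le>max_exponent \<epsilon>. X = Y i" and min: "\<And>i. i \<le> max_exponent \<epsilon> \<Longrightarrow> sum w X \<le> sum w (Y i)"
    using out by (auto simp: algorithm_output_def)
  have run: "\<exists>F P. scaled_run V E w T Xhat ((1 + \<epsilon>) ^ i) (Y i) F P" if i: "i \<le> max_exponent \<epsilon>" for i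
  proof -
    obtain F P where "minimum_spanning_tree T (complete_edges T)
        (path_dist V E (scaled_weight w Xhat ((1 + \<epsilon>) ^ i))) F"
      "\<forall>e\<in>F. cheapest_path V E (scaled_weight w Xhat ((1 + \<epsilon>) ^ i)) e (P e)"
      "Y i = (\<Union>e\<in>F. path_edges (P e))"
      using Y[OF i] unfolding scaled_algorithm_output_def by blast
    then have "scaled_run V E w T Xhat ((1 + \<epsilon>) ^ i) (Y i) F P"
      using inst eps by unfold_locales auto
    then show ?thesis by blast
  qed
  show "steiner_tree V E T X" using XY run scaled_run.steiner by metis
  assume X': "steiner_tree V E T X'" and M: "minimum_spanning_tree T (complete_edges T) (path_dist V E w) M"
    and S: "highest_cost_edges (path_dist V E w) M (min (card T - 1) (card (Xhat - X'))) S"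
  let ?f = "\<lambda>\<alpha>. (1 + 1 / \<alpha>) * sum w X' + (1 - 1 / \<alpha>) * sum w (X' - Xhat) +
        min (sum w (Xhat - X')) ((\<alpha> - 1) * (\<Sum>e\<in>S. path_dist V E w e))"
  have w: "\<And>e. e \<in> E \<Longrightarrow> 0 \<le> w e" "Xhat \<subseteq> E" "X' \<subseteq> E" using inst X' by (auto simp: steiner_instance_def steiner_tree_def)
  have nn: "0 \<le> sum w X'" "0 \<le> sum w (X' - Xhat)" "0 \<le> sum w (Xhat - X')"
    using w by (auto intro!: sum_nonneg)
  have Sn: "0 \<le> (\<Sum>e\<in>S. path_dist V E w e)"
  proof (rule sum_nonneg)
    fix e assume "e \<in> S"
    then have "e \<in> complete_edges T"
      using S M by (auto simp: highest_cost_edges_def minimum_spanning_tree_def spanning_tree_def)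
    then obtain p where "joins V E e p" using steiner_tree_joins[OF X'] by blast
    then show "0 \<le> path_dist V E w e" by (intro path_dist_nonneg[OF w(1)])
  qed
  have "sum w X / (1 + \<epsilon>) \<le> (INF \<alpha>\<in>{1..}. ?f \<alpha>)"
  proof (rule cINF_greatest)
    fix \<alpha> :: real assume "\<alpha> \<in> {1..}"
    then have \<alpha>: "1 \<le> \<alpha>" by simp
    obtain i where i: "i \<le> max_exponent \<epsilon>" "(1 + \<epsilon>) ^ i \<le> \<alpha>"
      "1 + 1 / (1 + \<epsilon>) ^ i \<le> (1 + \<epsilon>) * (1 + 1 / \<alpha>)" using grid_below[OF eps \<alpha>] by blast
    define \<beta> where "\<beta> = (1 + \<epsilon>) ^ i"
    have \<beta>: "1 \<le> \<beta>" "\<beta> \<le> \<alpha>" "1 + 1 / \<beta> \<le> (1 + \<epsilon>) * (1 + 1 / \<alpha>)" using eps i by (auto simp: \<beta>_def)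
    have "sum w X \<le> sum w (Y i)" using min i by blast
    also have "\<dots> \<le> ?f \<beta>" using run[OF i(1)] scaled_run.weight_bound[OF _ X' M S] unfolding \<beta>_def by blast
    also have "\<dots> \<le> (1 + \<epsilon>) * ?f \<alpha>"
    proof -
      have 1: "(1 + 1 / \<beta>) * sum w X' \<le> (1 + \<epsilon>) * ((1 + 1 / \<alpha>) * sum w X')"
        using mult_right_mono[OF \<beta>(3) nn(1)] by (simp add: mult.assoc)
      have grow: "x \<le> (1 + \<epsilon>) * y" if "x \<le> y" "0 \<le> y" for x y
      proof -
        have "0 \<le> \<epsilon> * y" using that eps by simp
        then show ?thesis unfolding distrib_right using that by linarith
      qed
      have ia: "1 / \<alpha> \<le> 1" "1 / \<alpha> \<le> 1 / \<beta>" using \<alpha> \<beta> by (auto simp: frac_le)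
      have 2: "(1 - 1 / \<beta>) * sum w (X' - Xhat) \<le> (1 + \<epsilon>) * ((1 - 1 / \<alpha>) * sum w (X' - Xhat))"
        using ia nn by (intro grow mult_right_mono mult_nonneg_nonneg) auto
      have "(\<beta> - 1) * (\<Sum>e\<in>S. path_dist V E w e) \<le> (\<alpha> - 1) * (\<Sum>e\<in>S. path_dist V E w e)"
        using \<beta> Sn by (intro mult_right_mono) auto
      moreover have "0 \<le> (\<alpha> - 1) * (\<Sum>e\<in>S. path_dist V E w e)" using \<alpha> Sn by simp
      ultimately have 3: "min (sum w (Xhat - X')) ((\<beta> - 1) * (\<Sum>e\<in>S. path_dist V E w e)) \<le>
          (1 + \<epsilon>) * min (sum w (Xhat - X')) ((\<alpha> - 1) * (\<Sum>e\<in>S. path_dist V E w e))"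
        using nn by (intro grow) auto
      show ?thesis using 1 2 3 by (simp only: distrib_left)
    qed
    finally show "sum w X / (1 + \<epsilon>) \<le> ?f \<alpha>" using eps by (simp add: pos_divide_le_eq mult.commute)
  qed simp
  then show "sum w X \<le> (1 + \<epsilon>) * (INF \<alpha>\<in>{1..}. ?f \<alpha>)" using eps by (simp add: pos_divide_le_eq mult.commute)
qed

declare split_paired_All [simp del] split_paired_Ex [simp del]

section \<open>Credit-based program logic\<close>

text \<open>A run starts with \<open>n\<close> credits, pays one per step and hands the rest to \<open>Q\<close>.  An amortised
  bound is an invariant that bounds the remaining credits from below by a potential of the state.\<close>

definition wp :: "com \<Rightarrow> (state \<Rightarrow> nat \<Rightarrow> bool) \<Rightarrow> state \<Rightarrow> nat \<Rightarrow> bool" where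
  "wp c Q s n \<longleftrightarrow> (\<exists>t s'. exec c s t s' \<and> t \<le> n \<and> Q s' (n - t))"

notation Seq (infixr ";;" 60)

fun nwrites :: "com \<Rightarrow> name set" where
  "nwrites Skip = {}"
| "nwrites (NWrite x a b) = {x}"
| "nwrites (RWrite x a b) = {}"
| "nwrites (c ;; d) = nwrites c \<union> nwrites d"
| "nwrites (Cond b c d) = nwrites c \<union> nwrites d"
| "nwrites (While b c) = nwrites c"

fun rwrites :: "com \<Rightarrow> name set" where
  "rwrites Skip = {}"
| "rwrites (NWrite x a b) = {}"
| "rwrites (RWrite x a b) = {x}"
| "rwrites (c ;; d) = rwrites c \<union> rwrites d"
| "rwrites (Cond b c d) = rwrites c \<union> rwrites d"
| "rwrites (While b c) = rwrites c"

text \<open>The arrays that a program may change are read off from its syntax. Specifications then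
  mention only the arrays that matter, and all others are recovered from
  \<open>frame\<close>.\<close>

definition frame :: "com \<Rightarrow> state \<Rightarrow> state \<Rightarrow> bool" where
  "frame c s s' \<longleftrightarrow> (\<forall>x. x \<notin> nwrites c \<longrightarrow> fst s' x = fst s x) \<and>
    (\<forall>x. x \<notin> rwrites c \<longrightarrow> snd s' x = snd s x)"

lemma frameD1: "frame c s s' \<Longrightarrow> x \<notin> nwrites c \<Longrightarrow> fst s' x = fst s x"
  and frameD2: "frame c s s' \<Longrightarrow> x \<notin> rwrites c \<Longrightarrow> snd s' x = snd s x"
  by (auto simp: frame_def)

lemma fst_nwrite [simp]:
  "fst (nwrite x i k s) y = (if y = x then (fst s x)(i := k) else fst s y)"
  "snd (nwrite x i k s) = snd s"
  by (auto simp: nwrite_def)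

lemma snd_rwrite [simp]:
  "snd (rwrite x i r s) y = (if y = x then (snd s x)(i := r) else snd s y)"
  "fst (rwrite x i r s) = fst s"
  by (auto simp: rwrite_def)

lemma exec_frame: "exec c s t s' \<Longrightarrow> frame c s s'"
  by (induction rule: exec.induct) (auto simp: frame_def)

inductive_cases SkipE: "exec Skip s t s'"
inductive_cases NWriteE: "exec (NWrite x a b) s t s'"
inductive_cases RWriteE: "exec (RWrite x a b) s t s'"
inductive_cases SeqE: "exec (c ;; d) s t s'"
inductive_cases CondE: "exec (Cond b c d) s t s'"

lemma wp_Skip: "wp Skip Q s n \<longleftrightarrow> 1 \<le> n \<and> Q s (n - 1)"
  by (auto simp: wp_def elim!: SkipE intro!: exI exec.Skip[simplified])

lemma wp_NWrite:
  "wp (NWrite x a b) Q s n \<longleftrightarrow> 1 \<le> n \<and> Q (nwrite x (nval a s) (nval b s) s) (n - 1)"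
  by (auto simp: wp_def elim!: NWriteE intro!: exI exec.NWrite[simplified])

lemma wp_RWrite:
  "wp (RWrite x a b) Q s n \<longleftrightarrow> 1 \<le> n \<and> Q (rwrite x (nval a s) (rval b s) s) (n - 1)"
  by (auto simp: wp_def elim!: RWriteE intro!: exI exec.RWrite[simplified])

lemma wp_Seq: "wp (c ;; d) Q s n \<longleftrightarrow> wp c (wp d Q) s n"
proof
  assume "wp (c ;; d) Q s n"
  then obtain t s' where e: "exec (c ;; d) s t s'" "t \<le> n" "Q s' (n - t)"
    by (auto simp: wp_def)
  from e(1) obtain t1 t2 s1 where *: "exec c s t1 s1" "exec d s1 t2 s'" "t = t1 + t2"
    by (auto elim: SeqE)
  then have "wp d Q s1 (n - t1)"
    unfolding wp_def using e by (intro exI[of _ t2] exI[of _ s']) auto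
  then show "wp c (wp d Q) s n"
    unfolding wp_def[of c] using e * by (intro exI[of _ t1] exI[of _ s1]) auto
next
  assume "wp c (wp d Q) s n"
  then obtain t1 s1 t2 s2 where *: "exec c s t1 s1" "t1 \<le> n"
    "exec d s1 t2 s2" "t2 \<le> n - t1" "Q s2 (n - t1 - t2)"
    by (auto simp: wp_def)
  then show "wp (c ;; d) Q s n"
    unfolding wp_def by (intro exI[of _ "t1 + t2"] exI[of _ s2]) (auto intro: exec.Seq)
qed

lemma wp_Cond:
  "wp (Cond b c d) Q s n \<longleftrightarrow> 1 \<le> n \<and> (if bval b s then wp c Q s (n - 1) else wp d Q s (n - 1))"
proof -
  have "wp (Cond b c d) Q s n" if "1 \<le> n" "exec (if bval b s then c else d) s t s'" "t \<le> n - 1"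
    "Q s' (n - 1 - t)" for t s'
    unfolding wp_def using that
    by (intro exI[of _ "Suc t"] exI[of _ s'])
      (auto intro: exec.CondTrue exec.CondFalse split: if_splits)
  moreover have "1 \<le> n \<and> (if bval b s then wp c Q s (n - 1) else wp d Q s (n - 1))"
    if wp: "wp (Cond b c d) Q s n"
  proof -
    obtain t s' where e: "exec (Cond b c d) s t s'" "t \<le> n" "Q s' (n - t)"
      using wp by (auto simp: wp_def)
    from e(1) obtain t' where "t = Suc t'" "exec (if bval b s then c else d) s t' s'"
      by (auto elim: CondE)
    then show ?thesis using e unfolding wp_def
      by (auto intro!: exI[of _ t'] exI[of _ s'] split: if_splits)
  qed
  ultimately show ?thesis
    by (smt (verit, ccfv_threshold) wp_def)
qed

lemmas wp_simps = wp_Skip wp_NWrite wp_RWrite wp_Seq wp_Cond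

lemma wp_mono: "wp c Q s n \<Longrightarrow> (\<And>s' n'. Q s' n' \<Longrightarrow> frame c s s' \<Longrightarrow> R s' n') \<Longrightarrow> wp c R s n"
  unfolding wp_def using exec_frame by blast

text \<open>For a callee with worst-case bound \<open>k\<close>: its unspent credits return to the
  caller, and only the lower bound \<open>n - k\<close> on them is remembered.\<close>

lemma wp_use:
  assumes "wp c (\<lambda>s' _. Q s') s k" "k \<le> n"
    "\<And>s' n'. Q s' \<Longrightarrow> frame c s s' \<Longrightarrow> n \<le> n' + k \<Longrightarrow> R s' n'"
  shows "wp c R s n"
proof -
  obtain t s' where e: "exec c s t s'" "t \<le> k" "Q s'"
    using assms(1) by (auto simp: wp_def)
  have "R s' (n - t)"
    using e assms(2) exec_frame by (intro assms(3)) auto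
  then show ?thesis unfolding wp_def using e assms(2)
    by (intro exI[of _ t] exI[of _ s']) auto
qed

lemma wp_credits_mono: "wp c (\<lambda>s' _. Q s') s k \<Longrightarrow> k \<le> n \<Longrightarrow> wp c (\<lambda>s' _. Q s') s n"
  by (rule wp_use) auto

text \<open>Every iteration consumes a credit, so the credits are also the termination measure.\<close>

lemma wp_While:
  assumes "I s n"
    and "\<And>s n. I s n \<Longrightarrow> bval b s \<Longrightarrow> 1 \<le> n \<and> wp c I s (n - 1)"
    and "\<And>s n. I s n \<Longrightarrow> \<not> bval b s \<Longrightarrow> 1 \<le> n \<and> Q s (n - 1)"
  shows "wp (While b c) Q s n"
  using assms(1)
proof (induction n arbitrary: s rule: less_induct)
  case (less n)
  show ?case
  proof (cases "bval b s")
    case True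
    then obtain t s' where e: "1 \<le> n" "exec c s t s'" "t \<le> n - 1" "I s' (n - 1 - t)"
      using assms(2)[OF less.prems] by (auto simp: wp_def)
    then have "wp (While b c) Q s' (n - 1 - t)"
      by (intro less.IH) auto
    then obtain t' s'' where "exec (While b c) s' t' s''" "t' \<le> n - 1 - t" "Q s'' (n - 1 - t - t')"
      by (auto simp: wp_def)
    with e True show ?thesis unfolding wp_def
      by (intro exI[of _ "Suc (t + t')"] exI[of _ s'']) (auto intro: exec.WhileTrue)
  next
    case False
    then show ?thesis unfolding wp_def using assms(3)[OF less.prems]
      by (intro exI[of _ 1] exI[of _ s]) (auto intro: exec.WhileFalse[simplified])
  qed
qed

abbreviation rd :: "name \<Rightarrow> nexp" where
  "rd x \<equiv> NRead x (NConst 0)"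

abbreviation upd :: "name \<Rightarrow> nexp \<Rightarrow> com" where
  "upd x a \<equiv> NWrite x (NConst 0) a"

definition For :: "name \<Rightarrow> nexp \<Rightarrow> com \<Rightarrow> com" where
  "For i e c = upd i (NConst 0) ;; While (NLess (rd i) e) (c ;; upd i (NAdd (rd i) (NConst 1)))"

lemma nwrites_For [simp]: "nwrites (For i e c) = insert i (nwrites c)"
  and rwrites_For [simp]: "rwrites (For i e c) = rwrites c"
  by (auto simp: For_def)

text \<open>The iterations draw on one common stock of credits, so their costs may differ. The two
  credits demanded in \<open>step\<close> pay for the test and for advancing the counter. The limit
  is evaluated anew at every test, whence \<open>bound\<close>.\<close>

lemma wp_For_amortised:
  assumes init: "1 \<le> n" "I 0 (nwrite i 0 0 s) (n - 1)"
    and step: "\<And>k s' n. k < N \<Longrightarrow> I k s' n \<Longrightarrow> fst s' i 0 = k \<Longrightarrow> frame (For i e c) s s' \<Longrightarrow>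
      1 \<le> n \<and> wp c (\<lambda>s'' n'. fst s'' i 0 = k \<and> 1 \<le> n' \<and>
        I (Suc k) (nwrite i 0 (Suc k) s'') (n' - 1)) s' (n - 1)"
    and bound: "\<And>k s' n. I k s' n \<Longrightarrow> fst s' i 0 = k \<Longrightarrow> frame (For i e c) s s' \<Longrightarrow> nval e s' = N"
    and exit: "\<And>s' n. I N s' n \<Longrightarrow> fst s' i 0 = N \<Longrightarrow> frame (For i e c) s s' \<Longrightarrow>
      1 \<le> n \<and> Q s' (n - 1)"
  shows "wp (For i e c) Q s n"
proof -
  let ?J = "\<lambda>s' n. fst s' i 0 \<le> N \<and> I (fst s' i 0) s' n \<and> frame (For i e c) s s'"
  show ?thesis
    unfolding For_def wp_Seq wp_NWrite
  proof (intro conjI init(1), rule wp_While[where I = ?J])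
    show "?J (nwrite i (nval (NConst 0) s) (nval (NConst 0) s) s) (n - 1)"
      using init by (auto simp: frame_def)
  next
    fix s' n assume J: "?J s' n" and b: "bval (NLess (rd i) e) s'"
    then have lt: "fst s' i 0 < N" using bound[of "fst s' i 0" s' n] by auto
    have *: "1 \<le> n \<and> wp c (\<lambda>s'' n'. fst s'' i 0 = fst s' i 0 \<and> 1 \<le> n' \<and>
        I (Suc (fst s' i 0)) (nwrite i 0 (Suc (fst s' i 0)) s'') (n' - 1)) s' (n - 1)"
      using J by (intro step lt) auto
    have "wp (c ;; upd i (NAdd (rd i) (NConst 1))) ?J s' (n - 1)"
      unfolding wp_Seq by (rule wp_mono[OF *[THEN conjunct2]]) (use J lt in \<open>auto simp: wp_simps frame_def\<close>)
    with * show "1 \<le> n \<and> wp (c ;; upd i (NAdd (rd i) (NConst 1))) ?J s' (n - 1)" by simp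
  next
    fix s' n assume J: "?J s' n" and b: "\<not> bval (NLess (rd i) e) s'"
    then have "fst s' i 0 = N" using bound[of "fst s' i 0" s' n] by auto
    then show "1 \<le> n \<and> Q s' (n - 1)" using J exit[of s' n] by auto
  qed
qed

text \<open>\<open>K\<close> is the cost of the body, 2 per iteration pay for test and counter, and
  the final 2 for the initial assignment and the failing test.\<close>

lemma wp_For:
  assumes init: "I 0 (nwrite i 0 0 s)"
    and step: "\<And>k s'. k < N \<Longrightarrow> I k s' \<Longrightarrow> fst s' i 0 = k \<Longrightarrow> frame (For i e c) s s' \<Longrightarrow>
      wp c (\<lambda>s'' _. fst s'' i 0 = k \<and> I (Suc k) (nwrite i 0 (Suc k) s'')) s' K"
    and bound: "\<And>k s'. I k s' \<Longrightarrow> fst s' i 0 = k \<Longrightarrow> frame (For i e c) s s' \<Longrightarrow> nval e s' = N"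
    and exit: "\<And>s'. I N s' \<Longrightarrow> fst s' i 0 = N \<Longrightarrow> frame (For i e c) s s' \<Longrightarrow> Q s'"
    and n: "(K + 2) * N + 2 \<le> n"
  shows "wp (For i e c) (\<lambda>s' _. Q s') s n"
proof (rule wp_For_amortised[where I = "\<lambda>k s' n. k \<le> N \<and> I k s' \<and> (K + 2) * (N - k) + 1 \<le> n" and N = N])
  fix k s' n' assume k: "k < N" and I: "k \<le> N \<and> I k s' \<and> (K + 2) * (N - k) + 1 \<le> n'"
    and i: "fst s' i 0 = k" and fr: "frame (For i e c) s s'"
  have "(K + 2) * (N - k) = (K + 2) * (N - Suc k) + (K + 2)"
    using k by (metis Suc_diff_Suc mult_Suc_right add.commute)
  then have n': "K + 2 + (K + 2) * (N - Suc k) + 1 \<le> n'" using I by simp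
  have "wp c (\<lambda>s'' n'. fst s'' i 0 = k \<and> 1 \<le> n' \<and>
      (Suc k \<le> N \<and> I (Suc k) (nwrite i 0 (Suc k) s'') \<and> (K + 2) * (N - Suc k) + 1 \<le> n' - 1)) s' (n' - 1)"
    by (rule wp_use[OF step[OF k _ i fr]]) (use I k n' in auto)
  then show "1 \<le> n' \<and> wp c (\<lambda>s'' n'. fst s'' i 0 = k \<and> 1 \<le> n' \<and>
      (Suc k \<le> N \<and> I (Suc k) (nwrite i 0 (Suc k) s'') \<and> (K + 2) * (N - Suc k) + 1 \<le> n' - 1)) s' (n' - 1)"
    using n' by simp
qed (use assms in auto)

section \<open>Fibonacci heaps with child arrays\<close>

text \<open>The elements of \<open>A\<close> form a forest: \<open>par y\<close> is 0 for a root and the parent plus one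
  otherwise, and the \<open>deg p\<close> children of \<open>p\<close> are stored at the addresses \<open>p * K + i\<close>.
  A child in slot \<open>i\<close> has degree at least \<open>i\<close>, or \<open>i - 1\<close> if it is marked; this bound survives
  moving a child to a lower slot, so a removed child can be replaced by the last one.  For
  the elements of \<open>X\<close> the heap order with the parent and the degree bound may be violated.\<close>

definition heap :: "nat \<Rightarrow> nat set \<Rightarrow> nat set \<Rightarrow> (nat \<Rightarrow> real) \<Rightarrow> (nat \<Rightarrow> nat) \<Rightarrow> (nat \<Rightarrow> nat) \<Rightarrow>
    (nat \<Rightarrow> nat) \<Rightarrow> (nat \<Rightarrow> nat) \<Rightarrow> (nat \<Rightarrow> nat) \<Rightarrow> bool" where
  "heap K A X key par deg ch idx mark \<longleftrightarrow>
     A \<subseteq> {..<K} \<and>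
     (\<forall>y\<in>A. par y \<noteq> 0 \<longrightarrow> par y - 1 \<in> A \<and> idx y < deg (par y - 1) \<and>
        ch ((par y - 1) * K + idx y) = y) \<and>
     (\<forall>p\<in>A. \<forall>i<deg p. ch (p * K + i) \<in> A \<and> par (ch (p * K + i)) = Suc p \<and>
        idx (ch (p * K + i)) = i) \<and>
     (\<forall>y\<in>A. y \<notin> X \<and> par y \<noteq> 0 \<longrightarrow> idx y \<le> deg y + mark y \<and> key (par y - 1) \<le> key y) \<and>
     (\<forall>y\<in>A. mark y \<le> 1) \<and>
     (\<exists>L::nat \<Rightarrow> nat. \<forall>y\<in>A. par y \<noteq> 0 \<longrightarrow> L y < L (par y - 1))"

lemma stride_eq_iff:
  assumes "i < K" "i' < (K::nat)"
  shows "p * K + i = p' * K + i' \<longleftrightarrow> p = p' \<and> i = i'"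
proof
  assume eq: "p * K + i = p' * K + i'"
  have "(p * K + i) div K = p" "(p * K + i) mod K = i" "(p' * K + i') div K = p'"
    "(p' * K + i') mod K = i'" using assms by auto
  then show "p = p' \<and> i = i'" using eq by metis
qed simp

lemma heapD:
  assumes "heap K A X key par deg ch idx mark"
  shows "A \<subseteq> {..<K}" "finite A"
    "\<And>y. y \<in> A \<Longrightarrow> par y \<noteq> 0 \<Longrightarrow> par y - 1 \<in> A"
    "\<And>y. y \<in> A \<Longrightarrow> par y \<noteq> 0 \<Longrightarrow> idx y < deg (par y - 1)"
    "\<And>y. y \<in> A \<Longrightarrow> par y \<noteq> 0 \<Longrightarrow> ch ((par y - 1) * K + idx y) = y"
    "\<And>p i. p \<in> A \<Longrightarrow> i < deg p \<Longrightarrow> ch (p * K + i) \<in> A"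
    "\<And>p i. p \<in> A \<Longrightarrow> i < deg p \<Longrightarrow> par (ch (p * K + i)) = Suc p"
    "\<And>p i. p \<in> A \<Longrightarrow> i < deg p \<Longrightarrow> idx (ch (p * K + i)) = i"
    "\<And>y. y \<in> A \<Longrightarrow> y \<notin> X \<Longrightarrow> par y \<noteq> 0 \<Longrightarrow> idx y \<le> deg y + mark y"
    "\<And>y. y \<in> A \<Longrightarrow> y \<notin> X \<Longrightarrow> par y \<noteq> 0 \<Longrightarrow> key (par y - 1) \<le> key y"
    "\<And>y. y \<in> A \<Longrightarrow> mark y \<le> 1"
    "\<exists>L::nat \<Rightarrow> nat. \<forall>y\<in>A. par y \<noteq> 0 \<longrightarrow> L y < L (par y - 1)"
  using assms unfolding heap_def by (auto intro: finite_subset[of _ "{..<K}"])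

lemma heap_children_inj:
  assumes h: "heap K A X key par deg ch idx mark" and p: "p \<in> A"
  shows "inj_on (\<lambda>i. ch (p * K + i)) {..<deg p}"
proof (rule inj_on_inverseI)
  fix i assume "i \<in> {..<deg p}"
  then show "idx (ch (p * K + i)) = i" using heapD(8)[OF h p, of i] by simp
qed

text \<open>Children are distinct elements of \<open>A\<close>. This crude bound, valid even while
  elements are exempt, keeps the children of different parents in disjoint rows of length
  \<open>K\<close>.\<close>

lemma heap_deg_le:
  assumes h: "heap K A X key par deg ch idx mark" and p: "p \<in> A"
  shows "deg p \<le> K"
proof -
  have "inj_on (\<lambda>i. ch (p * K + i)) {..<deg p}"
    using heap_children_inj[OF h p] .
  moreover have "(\<lambda>i. ch (p * K + i)) ` {..<deg p} \<subseteq> {..<K}"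
    using heapD(6)[OF h p] heapD(1)[OF h] by auto
  ultimately have "card {..<deg p} \<le> card {..<K}"
    using card_inj_on_le by blast
  then show ?thesis by simp
qed

text \<open>An element of degree at least \<open>k + 3\<close> has two children of degree at least \<open>k\<close>, in the
  slots \<open>k + 1\<close> and \<open>k + 2\<close>.\<close>

lemma heap_card_deg_ge:
  assumes h: "heap K A {} key par deg ch idx mark"
  shows "2 * card {x \<in> A. k + 3 \<le> deg x} \<le> card {x \<in> A. k \<le> deg x}"
proof -
  let ?B = "{x \<in> A. k + 3 \<le> deg x}"
  let ?f = "\<lambda>(x, b). ch (x * K + (k + 1 + b))"
  have inj: "inj_on ?f (?B \<times> {0, 1})"
  proof (rule inj_onI, clarify, goal_cases)
    case (1 x b y c)
    have "k + 1 + b < deg x" "k + 1 + c < deg y" using 1 by auto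
    then have "Suc x = Suc y" "k + 1 + b = k + 1 + c"
      using 1 heapD(7,8)[OF h] by (metis)+
    then show ?case by simp
  qed
  have sub: "?f ` (?B \<times> {0, 1}) \<subseteq> {x \<in> A. k \<le> deg x}"
  proof (clarify, goal_cases)
    case (1 z x b)
    have lt: "k + 1 + b < deg x" using 1 by auto
    let ?y = "ch (x * K + (k + 1 + b))"
    have y: "?y \<in> A" "par ?y = Suc x" "idx ?y = k + 1 + b"
      using heapD(6,7,8)[OF h _ lt] 1 by blast+
    then have "k + 1 + b \<le> deg ?y + mark ?y" using heapD(9)[OF h, of ?y] by auto
    moreover have "mark ?y \<le> 1" using heapD(11)[OF h y(1)] .
    ultimately show ?case using y by auto
  qed
  have fin: "finite {x \<in> A. k \<le> deg x}" using heapD(2)[OF h] by simp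
  have "card (?B \<times> {0, 1::nat}) \<le> card {x \<in> A. k \<le> deg x}"
    using card_inj_on_le[OF inj sub fin] .
  then show ?thesis by (simp add: card_cartesian_product)
qed

text \<open>Raising the required degree by three at least halves the number of elements, so after
  \<open>L\<close> halvings none is left. Counting elements by degree replaces the usual lower bound
  on subtree sizes by Fibonacci numbers.\<close>

lemma heap_deg_less:
  assumes h: "heap K A {} key par deg ch idx mark" and A: "card A < 2 ^ L" and x: "x \<in> A"
  shows "deg x < 3 * L"
proof (rule ccontr)
  assume "\<not> deg x < 3 * L"
  have "2 ^ j * card {x \<in> A. 3 * j \<le> deg x} \<le> card A" for j
  proof (induction j)
    case (Suc j)
    have "2 * card {x \<in> A. 3 * Suc j \<le> deg x} \<le> card {x \<in> A. 3 * j \<le> deg x}"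
      using heap_card_deg_ge[OF h, of "3 * j"] by (simp add: add.commute)
    then have "2 ^ j * (2 * card {x \<in> A. 3 * Suc j \<le> deg x}) \<le>
        2 ^ j * card {x \<in> A. 3 * j \<le> deg x}"
      by (rule mult_left_mono) simp
    also note Suc.IH
    finally show ?case by (simp only: power_Suc mult_ac)
  qed simp
  from this[of L] have "2 ^ L * card {x \<in> A. 3 * L \<le> deg x} < 2 ^ L * 1" using A by linarith
  then have "card {x \<in> A. 3 * L \<le> deg x} = 0" by simp
  then show False using x \<open>\<not> deg x < 3 * L\<close> heapD(2)[OF h] by auto
qed

text \<open>The levels in \<open>heap\<close> rise strictly along parent pointers and take finitely
  many values on \<open>A\<close>. Climbing therefore ends at a root, and keys do not grow on the
  way.\<close>

lemma heap_root_above: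
  assumes h: "heap K A {} key par deg ch idx mark" and x: "x \<in> A"
  shows "\<exists>r\<in>A. par r = 0 \<and> key r \<le> key x"
proof -
  obtain L :: "nat \<Rightarrow> nat" where L: "\<forall>y\<in>A. par y \<noteq> 0 \<longrightarrow> L y < L (par y - 1)"
    using heapD(12)[OF h] by blast
  have fin: "finite (L ` A)" using heapD(2)[OF h] by simp
  show ?thesis using x
  proof (induction "Max (L ` A) - L x" arbitrary: x rule: less_induct)
    case less
    show ?case
    proof (cases "par x = 0")
      case False
      have p: "par x - 1 \<in> A" "key (par x - 1) \<le> key x" "L x < L (par x - 1)"
        using heapD(3,10)[OF h less.prems] False L less.prems by auto
      have "L (par x - 1) \<le> Max (L ` A)" using p fin by simp
      then obtain r where "r \<in> A" "par r = 0" "key r \<le> key (par x - 1)"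
        using less.hyps[of "par x - 1"] p by (meson diff_less_mono2 less_le_trans)
      then show ?thesis using p by (auto intro: order_trans)
    qed (use less.prems in auto)
  qed
qed

text \<open>The exemption moves from \<open>y\<close>, now a root, to \<open>p\<close>: the cut
  lowers the degree of \<open>p\<close>, and the degree bound of \<open>p\<close> within its own
  parent is all that may fail. If \<open>y\<close> is itself the last child, then
  \<open>z = y\<close> and the slot written lies beyond the new degree.\<close>

lemma heap_cut:
  assumes h: "heap K A {y} key par deg ch idx mark" and y: "y \<in> A" and np: "par y \<noteq> 0"
    and p: "p = par y - 1" and z: "z = ch (p * K + (deg p - 1))"
  shows "heap K A {p} key (par(y := 0)) (deg(p := deg p - 1)) (ch(p * K + idx y := z))
    (idx(z := idx y)) (mark(y := 0))"
    and "p \<in> A" "p \<noteq> y" "z \<noteq> p"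
proof -
  have pA: "p \<in> A" and iy: "idx y < deg p" and cy: "ch (p * K + idx y) = y"
    using heapD(3,4,5)[OF h y np] p by auto
  have py: "par y = Suc p" using np p by simp
  have dK: "deg q \<le> K" if "q \<in> A" for q using heap_deg_le[OF h that] .
  have zA: "z \<in> A" and pz: "par z = Suc p" and iz: "idx z = deg p - 1"
    using heapD(6,7,8)[OF h pA, of "deg p - 1"] iy z by auto
  obtain L :: "nat \<Rightarrow> nat" where L: "\<forall>y\<in>A. par y \<noteq> 0 \<longrightarrow> L y < L (par y - 1)"
    using heapD(12)[OF h] by blast
  have yp: "y \<noteq> p" using L y np p by auto
  have zp: "z \<noteq> p" using L zA pz by fastforce
  show "p \<in> A" "p \<noteq> y" "z \<noteq> p" using pA yp zp by auto
  have addr: "q * K + i = p * K + idx y \<longleftrightarrow> q = p \<and> i = idx y" if "q \<in> A" "i < deg q" for q i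
    using stride_eq_iff[of i K "idx y" q p] that dK[of q] dK[of p] iy pA by auto
  show "heap K A {p} key (par(y := 0)) (deg(p := deg p - 1)) (ch(p * K + idx y := z))
    (idx(z := idx y)) (mark(y := 0))"
    unfolding heap_def
  proof (intro conjI)
    show "A \<subseteq> {..<K}" using heapD(1)[OF h] .
    show "\<forall>ya\<in>A. (par(y := 0)) ya \<noteq> 0 \<longrightarrow> (par(y := 0)) ya - 1 \<in> A \<and>
       (idx(z := idx y)) ya < (deg(p := deg p - 1)) ((par(y := 0)) ya - 1) \<and>
       (ch(p * K + idx y := z)) (((par(y := 0)) ya - 1) * K + (idx(z := idx y)) ya) = ya"
    proof (intro ballI impI)
      fix x assume x: "x \<in> A" and "(par(y := 0)) x \<noteq> 0"
      then have xy: "x \<noteq> y" and px: "par x \<noteq> 0" by (auto split: if_splits)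
      note hx = heapD(3,4,5)[OF h x px]
      show "(par(y := 0)) x - 1 \<in> A \<and>
       (idx(z := idx y)) x < (deg(p := deg p - 1)) ((par(y := 0)) x - 1) \<and>
       (ch(p * K + idx y := z)) (((par(y := 0)) x - 1) * K + (idx(z := idx y)) x) = x"
      proof (cases "x = z")
        case True
        \<comment> \<open>Otherwise the last child \<open>z\<close> would be \<open>y\<close>. Hence
          the slot that \<open>z\<close> moves to is below the reduced degree.\<close>
        then have "idx y \<noteq> deg p - 1" using xy cy z by auto
        then show ?thesis using True xy pz iy pA by auto
      next
        case False
        have lt: "idx x < deg p - 1" if "par x - 1 = p"
        proof -
          have "idx x \<noteq> deg p - 1" using False hx(3) z that by auto
          then show ?thesis using hx(2) that by auto
        qed
        have "\<not> (par x - 1 = p \<and> idx x = idx y)" using hx(3) cy xy by auto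
        then have "(par x - 1) * K + idx x \<noteq> p * K + idx y" using addr[of "par x - 1" "idx x"] hx by auto
        then show ?thesis using False xy hx lt by auto
      qed
    qed
    show "\<forall>pa\<in>A. \<forall>i<(deg(p := deg p - 1)) pa. (ch(p * K + idx y := z)) (pa * K + i) \<in> A \<and>
       (par(y := 0)) ((ch(p * K + idx y := z)) (pa * K + i)) = Suc pa \<and>
       (idx(z := idx y)) ((ch(p * K + idx y := z)) (pa * K + i)) = i"
    proof (intro ballI allI impI)
      fix q i assume q: "q \<in> A" and i: "i < (deg(p := deg p - 1)) q"
      then have i': "i < deg q" by (auto split: if_splits)
      note hq = heapD(6,7,8)[OF h q i']
      show "(ch(p * K + idx y := z)) (q * K + i) \<in> A \<and>
       (par(y := 0)) ((ch(p * K + idx y := z)) (q * K + i)) = Suc q \<and>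
       (idx(z := idx y)) ((ch(p * K + idx y := z)) (q * K + i)) = i"
      proof (cases "q = p \<and> i = idx y")
        case True
        then have "y \<noteq> z" using i iz by auto
        then show ?thesis using True zA pz by auto
      next
        case False
        then have *: "q * K + i \<noteq> p * K + idx y" using addr[OF q i'] by auto
        have "ch (q * K + i) \<noteq> y" using hq py False by auto
        moreover have "ch (q * K + i) \<noteq> z"
        proof
          assume "ch (q * K + i) = z"
          then have "q = p" "i = deg p - 1" using hq pz iz by auto
          then show False using i by simp
        qed
        ultimately show ?thesis using * hq by auto
      qed
    qed
    show "\<forall>ya\<in>A. ya \<notin> {p} \<and> (par(y := 0)) ya \<noteq> 0 \<longrightarrow>
       (idx(z := idx y)) ya \<le> (deg(p := deg p - 1)) ya + (mark(y := 0)) ya \<and>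
       key ((par(y := 0)) ya - 1) \<le> key ya"
    proof (intro ballI impI)
      fix x assume x: "x \<in> A" and "x \<notin> {p} \<and> (par(y := 0)) x \<noteq> 0"
      then have xy: "x \<noteq> y" and px: "par x \<noteq> 0" and xA: "x \<in> A" and xp: "x \<noteq> p"
        by (auto split: if_splits)
      have *: "idx x \<le> deg x + mark x" "key (par x - 1) \<le> key x"
        using heapD(9,10)[OF h xA _ px] xy by auto
      moreover have "idx y \<le> idx z" using iy iz by simp
      ultimately show "(idx(z := idx y)) x \<le> (deg(p := deg p - 1)) x + (mark(y := 0)) x \<and>
       key ((par(y := 0)) x - 1) \<le> key x"
        using xy xp by auto
    qed
    show "\<forall>ya\<in>A. (mark(y := 0)) ya \<le> 1" using heapD(11)[OF h] by auto
    show "\<exists>L::nat \<Rightarrow> nat. \<forall>ya\<in>A. (par(y := 0)) ya \<noteq> 0 \<longrightarrow> L ya < L ((par(y := 0)) ya - 1)"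
      using L by auto
  qed
qed

lemma heap_weaken: "heap K A {} key par deg ch idx mark \<Longrightarrow> heap K A X key par deg ch idx mark"
  by (auto simp: heap_def)

lemma heap_exempt_root:
  "heap K A {p} key par deg ch idx mark \<Longrightarrow> par p = 0 \<Longrightarrow> heap K A {} key par deg ch idx mark"
  unfolding heap_def by (elim conjE, intro conjI; assumption?) auto

text \<open>The mark is the single unit of slack in the degree bound: it absorbs the loss of one
  child. An element that is already marked has no slack left and must be cut in turn.\<close>

lemma heap_exempt_mark:
  assumes h: "heap K A {p} key par deg ch idx mark"
    and "idx p \<le> Suc (deg p)" "key (par p - 1) \<le> key p"
  shows "heap K A {} key par deg ch idx (mark(p := 1))"
  using assms unfolding heap_def
  by (elim conjE, intro conjI; assumption?) auto

lemma heap_decrease: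
  assumes h: "heap K A {} key par deg ch idx mark" and k: "k \<le> key v"
  shows "heap K A {v} (key(v := k)) par deg ch idx mark"
proof -
  have "(key(v := k)) (par y - 1) \<le> (key(v := k)) y" if "y \<in> A - {v}" "par y \<noteq> 0" for y
    using heapD(10)[OF h, of y] that k by auto
  then show ?thesis
    using h unfolding heap_def by (elim conjE, intro conjI; assumption?) auto
qed

lemma heap_insert:
  assumes h: "heap K A {} key par deg ch idx mark" and v: "v \<notin> A" "v < K"
  shows "heap K (insert v A) {} (key(v := k)) (par(v := 0)) (deg(v := 0)) ch idx (mark(v := 0))"
proof -
  obtain L :: "nat \<Rightarrow> nat" where L: "\<forall>y\<in>A. par y \<noteq> 0 \<longrightarrow> L y < L (par y - 1)"
    using heapD(12)[OF h] by blast
  have v': "y \<noteq> v" if "y \<in> A" for y using v that by blast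
  note old = heapD[OF h]
  show ?thesis
    unfolding heap_def
  proof (intro conjI ballI allI impI)
    show "insert v A \<subseteq> {..<K}" using old(1) v by simp
  next
    fix y assume "y \<in> insert v A" "(par(v := 0)) y \<noteq> 0"
    then have y: "y \<in> A" "par y \<noteq> 0" "y \<noteq> v" by (auto split: if_splits)
    then show "(par(v := 0)) y - 1 \<in> insert v A" "idx y < (deg(v := 0)) ((par(v := 0)) y - 1)"
      "ch (((par(v := 0)) y - 1) * K + idx y) = y"
      using old(3,4,5)[OF y(1,2)] v'[of "par y - 1"] by auto
  next
    fix p i assume "p \<in> insert v A" "i < (deg(v := 0)) p"
    then have p: "p \<in> A" "i < deg p" by (auto split: if_splits)
    then show "ch (p * K + i) \<in> insert v A" "(par(v := 0)) (ch (p * K + i)) = Suc p"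
      "idx (ch (p * K + i)) = i" using old(6,7,8)[OF p] v' by auto
  next
    fix y assume "y \<in> insert v A" "y \<notin> {} \<and> (par(v := 0)) y \<noteq> 0"
    then have y: "y \<in> A" "par y \<noteq> 0" "y \<noteq> v" by (auto split: if_splits)
    then show "idx y \<le> (deg(v := 0)) y + (mark(v := 0)) y"
      "(key(v := k)) ((par(v := 0)) y - 1) \<le> (key(v := k)) y"
      using old(9,10)[OF y(1) _ y(2)] v'[OF old(3)[OF y(1,2)]] by auto
  next
    fix y assume "y \<in> insert v A"
    then show "(mark(v := 0)) y \<le> 1" using old(11) by auto
  next
    show "\<exists>L::nat \<Rightarrow> nat. \<forall>y\<in>insert v A. (par(v := 0)) y \<noteq> 0 \<longrightarrow> L y < L ((par(v := 0)) y - 1)"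
      using L by (intro exI[of _ L]) auto
  qed
qed

text \<open>Equal degrees put \<open>y\<close> into slot \<open>deg x = deg y\<close>, which is just
  what the degree bound permits. Since \<open>x\<close> is not its own child, its degree is below
  \<open>K\<close> and the new slot still lies in its row.\<close>

lemma heap_link:
  assumes h: "heap K A {} key par deg ch idx mark" and x: "x \<in> A" "par x = 0" and y: "y \<in> A" "par y = 0"
    and xy: "x \<noteq> y" "key x \<le> key y" "deg y = deg x"
  shows "heap K A {} key (par(y := Suc x)) (deg(x := Suc (deg x))) (ch(x * K + deg x := y))
    (idx(y := deg x)) mark"
    and "deg x < K"
proof -
  have dx: "deg x < K"
  proof -
    have "inj_on (\<lambda>i. ch (x * K + i)) {..<deg x}"
      using heap_children_inj[OF h x(1)] .
    moreover have "(\<lambda>i. ch (x * K + i)) ` {..<deg x} \<subseteq> {..<K} - {x}"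
      using heapD(6,7)[OF h x(1)] heapD(1)[OF h] x(2) by fastforce
    ultimately have "card {..<deg x} \<le> card ({..<K} - {x})"
      using card_inj_on_le finite_Diff finite_lessThan by metis
    moreover have "x < K" using heapD(1)[OF h] x by auto
    ultimately show ?thesis by simp
  qed
  then show "deg x < K" .
  have addr: "q * K + i = x * K + deg x \<longleftrightarrow> q = x \<and> i = deg x" if "q \<in> A" "i < deg q" for q i
    using stride_eq_iff[of i K "deg x" q x] that heap_deg_le[OF h, of q] dx by auto
  obtain L :: "nat \<Rightarrow> nat" where L: "\<forall>y\<in>A. par y \<noteq> 0 \<longrightarrow> L y < L (par y - 1)"
    using heapD(12)[OF h] by blast
  show "heap K A {} key (par(y := Suc x)) (deg(x := Suc (deg x))) (ch(x * K + deg x := y))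
    (idx(y := deg x)) mark"
    unfolding heap_def
  proof (intro conjI)
    show "A \<subseteq> {..<K}" using heapD(1)[OF h] .
    show "\<forall>ya\<in>A. (par(y := Suc x)) ya \<noteq> 0 \<longrightarrow> (par(y := Suc x)) ya - 1 \<in> A \<and>
       (idx(y := deg x)) ya < (deg(x := Suc (deg x))) ((par(y := Suc x)) ya - 1) \<and>
       (ch(x * K + deg x := y)) (((par(y := Suc x)) ya - 1) * K + (idx(y := deg x)) ya) = ya"
    proof (intro ballI impI)
      fix z assume z: "z \<in> A" and "(par(y := Suc x)) z \<noteq> 0"
      show "(par(y := Suc x)) z - 1 \<in> A \<and>
       (idx(y := deg x)) z < (deg(x := Suc (deg x))) ((par(y := Suc x)) z - 1) \<and>
       (ch(x * K + deg x := y)) (((par(y := Suc x)) z - 1) * K + (idx(y := deg x)) z) = z"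
      proof (cases "z = y")
        case False
        then have pz: "par z \<noteq> 0" using \<open>(par(y := Suc x)) z \<noteq> 0\<close> by simp
        note hz = heapD(3,4,5)[OF h z pz]
        have "(par z - 1) * K + idx z \<noteq> x * K + deg x"
          using addr[of "par z - 1" "idx z"] hz by auto
        then show ?thesis using False hz by auto
      qed (use x in auto)
    qed
    show "\<forall>p\<in>A. \<forall>i<(deg(x := Suc (deg x))) p. (ch(x * K + deg x := y)) (p * K + i) \<in> A \<and>
       (par(y := Suc x)) ((ch(x * K + deg x := y)) (p * K + i)) = Suc p \<and>
       (idx(y := deg x)) ((ch(x * K + deg x := y)) (p * K + i)) = i"
    proof (intro ballI allI impI)
      fix p i assume p: "p \<in> A" and i: "i < (deg(x := Suc (deg x))) p"
      show "(ch(x * K + deg x := y)) (p * K + i) \<in> A \<and>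
       (par(y := Suc x)) ((ch(x * K + deg x := y)) (p * K + i)) = Suc p \<and>
       (idx(y := deg x)) ((ch(x * K + deg x := y)) (p * K + i)) = i"
      proof (cases "p = x \<and> i = deg x")
        case False
        then have i': "i < deg p" using i by (auto split: if_splits)
        note hp = heapD(6,7,8)[OF h p i']
        have "ch (p * K + i) \<noteq> y" using hp y by auto
        then show ?thesis using hp addr[OF p i'] False by auto
      qed (use y in auto)
    qed
    show "\<forall>ya\<in>A. ya \<notin> {} \<and> (par(y := Suc x)) ya \<noteq> 0 \<longrightarrow>
       (idx(y := deg x)) ya \<le> (deg(x := Suc (deg x))) ya + mark ya \<and>
       key ((par(y := Suc x)) ya - 1) \<le> key ya"
      using heapD(9,10)[OF h] x y xy by auto
    show "\<forall>y\<in>A. mark y \<le> 1" using heapD(11)[OF h] by auto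
    \<comment> \<open>\<open>x\<close> is a root, so its level may be raised at will: above that of
      \<open>y\<close> for the new child, and not below its old value for the others.\<close>
    show "\<exists>L::nat \<Rightarrow> nat. \<forall>ya\<in>A. (par(y := Suc x)) ya \<noteq> 0 \<longrightarrow> L ya < L ((par(y := Suc x)) ya - 1)"
    proof (intro exI[of _ "L(x := Suc (L x + L y))"] ballI impI)
      fix z assume z: "z \<in> A" and "(par(y := Suc x)) z \<noteq> 0"
      then show "(L(x := Suc (L x + L y))) z < (L(x := Suc (L x + L y))) ((par(y := Suc x)) z - 1)"
        using L x y xy by (cases "z = y") (auto intro: less_SucI trans_less_add1)
    qed
  qed
qed

text \<open>Roots are subject neither to the heap order nor to the degree bound, so the children can
  be released all at once and need no repair.\<close>

lemma heap_remove_root: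
  assumes h: "heap K A {} key par deg ch idx mark" and u: "u \<in> A" "par u = 0"
    and C: "C = (\<lambda>i. ch (u * K + i)) ` {..<deg u}"
  shows "heap K (A - {u}) {} key (\<lambda>y. if y \<in> C then 0 else par y) deg ch idx mark"
    and "{x \<in> A - {u}. (if x \<in> C then 0 else par x) = 0} = ({x \<in> A. par x = 0} - {u}) \<union> C"
    and "{x \<in> A. par x = 0} \<inter> C = {}"
proof -
  have C_iff: "y \<in> C \<longleftrightarrow> par y = Suc u" if y: "y \<in> A" for y
  proof
    assume "y \<in> C"
    then obtain i where "i < deg u" "y = ch (u * K + i)" unfolding C by blast
    then show "par y = Suc u" using heapD(7)[OF h u(1)] by simp
  next
    assume "par y = Suc u"
    then show "y \<in> C" unfolding C using heapD(4,5)[OF h y]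
      by (intro image_eqI[of _ _ "idx y"]) simp_all
  qed
  have CA: "C \<subseteq> A" unfolding C using heapD(6)[OF h u(1)] by blast
  have uC: "u \<notin> C" using C_iff[OF u(1)] u by simp
  obtain L :: "nat \<Rightarrow> nat" where L: "\<forall>y\<in>A. par y \<noteq> 0 \<longrightarrow> L y < L (par y - 1)"
    using heapD(12)[OF h] by blast
  let ?par = "\<lambda>y. if y \<in> C then 0 else par y"
  have *: "par y \<noteq> 0 \<and> ?par y = par y \<and> par y - 1 \<noteq> u \<and> y \<in> A" if "y \<in> A - {u}" "?par y \<noteq> 0" for y
    using that C_iff[of y] by (auto split: if_splits)
  show "heap K (A - {u}) {} key ?par deg ch idx mark"
    unfolding heap_def
  proof (intro conjI)
    show "A - {u} \<subseteq> {..<K}" using heapD(1)[OF h] by blast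
    show "\<forall>y\<in>A - {u}. ?par y \<noteq> 0 \<longrightarrow> ?par y - 1 \<in> A - {u} \<and> idx y < deg (?par y - 1) \<and>
        ch ((?par y - 1) * K + idx y) = y"
      using * heapD(3,4,5)[OF h] by simp
    show "\<forall>p\<in>A - {u}. \<forall>i<deg p. ch (p * K + i) \<in> A - {u} \<and> ?par (ch (p * K + i)) = Suc p \<and>
        idx (ch (p * K + i)) = i"
    proof (intro ballI allI impI)
      fix p i assume p: "p \<in> A - {u}" and i: "i < deg p"
      have hp: "ch (p * K + i) \<in> A" "par (ch (p * K + i)) = Suc p" "idx (ch (p * K + i)) = i"
        using heapD(6,7,8)[OF h _ i] p by blast+
      then have "ch (p * K + i) \<notin> C" using C_iff[OF hp(1)] p by simp
      moreover have "ch (p * K + i) \<noteq> u" using hp(2) u(2) by (intro notI) simp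
      ultimately show "ch (p * K + i) \<in> A - {u} \<and> ?par (ch (p * K + i)) = Suc p \<and> idx (ch (p * K + i)) = i"
        using hp by simp
    qed
    show "\<forall>y\<in>A - {u}. y \<notin> {} \<and> ?par y \<noteq> 0 \<longrightarrow> idx y \<le> deg y + mark y \<and> key (?par y - 1) \<le> key y"
      using * heapD(9,10)[OF h] by simp
    show "\<forall>y\<in>A - {u}. mark y \<le> 1" using heapD(11)[OF h] by blast
    show "\<exists>L::nat \<Rightarrow> nat. \<forall>y\<in>A - {u}. ?par y \<noteq> 0 \<longrightarrow> L y < L (?par y - 1)"
    proof (intro exI[of _ L] ballI impI)
      fix y assume y: "y \<in> A - {u}" "?par y \<noteq> 0"
      from *[OF this] show "L y < L (?par y - 1)" using L by simp
    qed
  qed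
  show "{x \<in> A - {u}. ?par x = 0} = ({x \<in> A. par x = 0} - {u}) \<union> C"
    using CA uC by auto
  show "{x \<in> A. par x = 0} \<inter> C = {}" using C_iff by force
qed

text \<open>The index set is arbitrary because during a consolidation the valid entries are the
  compacted front and the unprocessed rest, possibly with a gap between them.\<close>

definition roots :: "nat set \<Rightarrow> (nat \<Rightarrow> nat) \<Rightarrow> (nat \<Rightarrow> nat) \<Rightarrow> nat set \<Rightarrow> bool" where
  "roots A par rt I \<longleftrightarrow> inj_on rt I \<and> rt ` I = {x \<in> A. par x = 0}"

abbreviation heap_of :: "nat \<Rightarrow> nat set \<Rightarrow> nat set \<Rightarrow> state \<Rightarrow> bool" where
  "heap_of K A X s \<equiv> heap K A X (snd s ''key'') (fst s ''par'') (fst s ''deg'') (fst s ''ch'')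
     (fst s ''idx'') (fst s ''mark'')"

abbreviation roots_of :: "nat set \<Rightarrow> state \<Rightarrow> bool" where
  "roots_of A s \<equiv> roots A (fst s ''par'') (fst s ''rt'') {..<fst s ''rn'' 0}"

text \<open>The row address \<open>v * K\<close> has to be tabulated, as the machine offers no
  multiplication.\<close>

definition strided :: "nat \<Rightarrow> nat \<Rightarrow> state \<Rightarrow> bool" where
  "strided n K s \<longleftrightarrow> (\<forall>v<n. fst s ''base'' v = v * K)"

section \<open>Programs for the heap operations\<close>

definition find_min :: com where
  "find_min = upd ''bi'' (NConst 0) ;;
     For ''i'' (rd ''rn'')
       (Cond (RLess (RRead ''key'' (NRead ''rt'' (rd ''i''))) (RRead ''key'' (NRead ''rt'' (rd ''bi''))))
         (upd ''bi'' (rd ''i'')) Skip)"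

definition remove_min :: com where
  "remove_min = upd ''u'' (NRead ''rt'' (rd ''bi'')) ;;
     upd ''rn'' (NSub (rd ''rn'') (NConst 1)) ;;
     NWrite ''rt'' (rd ''bi'') (NRead ''rt'' (rd ''rn'')) ;;
     NWrite ''st'' (rd ''u'') (NConst 2) ;;
     NWrite ''ord'' (rd ''cnt'') (rd ''u'') ;;
     upd ''cnt'' (NAdd (rd ''cnt'') (NConst 1)) ;;
     For ''i'' (NRead ''deg'' (rd ''u''))
       (upd ''y'' (NRead ''ch'' (NAdd (NRead ''base'' (rd ''u'')) (rd ''i''))) ;;
        NWrite ''par'' (rd ''y'') (NConst 0) ;;
        NWrite ''rt'' (rd ''rn'') (rd ''y'') ;;
        upd ''rn'' (NAdd (rd ''rn'') (NConst 1)))"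

text \<open>One pass over the roots pairs roots of equal degree.  The survivors are written back to the front
  \<open>rt 0, \<dots>, rt (nl - 1)\<close> of the root list, and \<open>bp d\<close> is the position there of a root that
  had degree \<open>d\<close>.  The entries of \<open>bp\<close> are never cleared: the test validates them by comparing degrees.\<close>

definition pair_root :: com where
  "pair_root = upd ''r'' (NRead ''rt'' (rd ''i'')) ;;
     upd ''q'' (NRead ''bp'' (NRead ''deg'' (rd ''r''))) ;;
     Cond (BAnd (NLess (rd ''q'') (rd ''nl''))
        (BAnd (BNot (NLess (NRead ''deg'' (NRead ''rt'' (rd ''q''))) (NRead ''deg'' (rd ''r''))))
              (BNot (NLess (NRead ''deg'' (rd ''r'')) (NRead ''deg'' (NRead ''rt'' (rd ''q'')))))))
      (upd ''p'' (NRead ''rt'' (rd ''q'')) ;;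
       upd ''y'' (rd ''r'') ;;
       Cond (RLess (RRead ''key'' (rd ''r'')) (RRead ''key'' (rd ''p'')))
         (upd ''y'' (rd ''p'') ;; upd ''p'' (rd ''r'') ;; NWrite ''rt'' (rd ''q'') (rd ''r'')) Skip ;;
       NWrite ''ch'' (NAdd (NRead ''base'' (rd ''p'')) (NRead ''deg'' (rd ''p''))) (rd ''y'') ;;
       NWrite ''idx'' (rd ''y'') (NRead ''deg'' (rd ''p'')) ;;
       NWrite ''par'' (rd ''y'') (NAdd (rd ''p'') (NConst 1)) ;;
       NWrite ''deg'' (rd ''p'') (NAdd (NRead ''deg'' (rd ''p'')) (NConst 1)))
      (NWrite ''rt'' (rd ''nl'') (rd ''r'') ;;
       NWrite ''bp'' (NRead ''deg'' (rd ''r'')) (rd ''nl'') ;;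
       upd ''nl'' (NAdd (rd ''nl'') (NConst 1)))"

definition consolidate :: com where
  "consolidate = upd ''nl'' (NConst 0) ;; For ''i'' (rd ''rn'') pair_root ;; upd ''rn'' (rd ''nl'')"

text \<open>An element whose key drops is cut off even if the heap order is still intact. After the
  cut \<open>par y = 0\<close>, so the loop ends unless \<open>y\<close> has been replaced by a
  marked parent. Applied to a root it does nothing.\<close>

definition cut :: com where
  "cut = While (NLess (NConst 0) (NRead ''par'' (rd ''y'')))
    (upd ''p'' (NSub (NRead ''par'' (rd ''y'')) (NConst 1)) ;;
     NWrite ''deg'' (rd ''p'') (NSub (NRead ''deg'' (rd ''p'')) (NConst 1)) ;;
     upd ''z'' (NRead ''ch'' (NAdd (NRead ''base'' (rd ''p'')) (NRead ''deg'' (rd ''p'')))) ;;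
     NWrite ''ch'' (NAdd (NRead ''base'' (rd ''p'')) (NRead ''idx'' (rd ''y''))) (rd ''z'') ;;
     NWrite ''idx'' (rd ''z'') (NRead ''idx'' (rd ''y'')) ;;
     NWrite ''par'' (rd ''y'') (NConst 0) ;;
     NWrite ''mark'' (rd ''y'') (NConst 0) ;;
     NWrite ''rt'' (rd ''rn'') (rd ''y'') ;;
     upd ''rn'' (NAdd (rd ''rn'') (NConst 1)) ;;
     Cond (NLess (NConst 0) (NRead ''par'' (rd ''p'')))
       (Cond (NLess (NConst 0) (NRead ''mark'' (rd ''p'')))
          (upd ''y'' (rd ''p''))
          (NWrite ''mark'' (rd ''p'') (NConst 1)))
       Skip)"

lemma wp_find_min:
  assumes R: "0 < R" "fst s ''rn'' 0 = R"
  shows "wp find_min (\<lambda>s' _. fst s' ''bi'' 0 < R \<and>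
      (\<forall>q<R. snd s ''key'' (fst s ''rt'' (fst s' ''bi'' 0)) \<le> snd s ''key'' (fst s ''rt'' q)))
    s (4 * R + 3)"
  unfolding find_min_def wp_Seq wp_NWrite
proof (intro conjI)
  let ?s = "nwrite ''bi'' (nval (NConst 0) s) (nval (NConst 0) s) s"
  let ?c = "Cond (RLess (RRead ''key'' (NRead ''rt'' (rd ''i''))) (RRead ''key'' (NRead ''rt'' (rd ''bi''))))
         (upd ''bi'' (rd ''i'')) Skip"
  let ?I = "\<lambda>k s'. fst s' ''bi'' 0 < R \<and>
      (\<forall>q<k. snd s ''key'' (fst s ''rt'' (fst s' ''bi'' 0)) \<le> snd s ''key'' (fst s ''rt'' q))"
  show "wp (For ''i'' (rd ''rn'') ?c) (\<lambda>s' _. ?I R s') ?s (4 * R + 3 - 1)"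
  proof (rule wp_For[where I = ?I and N = R and K = 2])
    fix k s' assume k: "k < R" and I: "?I k s'" and i: "fst s' ''i'' 0 = k"
      and fr: "frame (For ''i'' (rd ''rn'') ?c) ?s s'"
    show "wp ?c (\<lambda>s'' _. fst s'' ''i'' 0 = k \<and> ?I (Suc k) (nwrite ''i'' 0 (Suc k) s'')) s' 2"
      using k I i by (auto simp: wp_simps frameD1[OF fr] frameD2[OF fr] less_Suc_eq dest: order_trans less_imp_le)
  next
    fix k s' assume fr: "frame (For ''i'' (rd ''rn'') ?c) ?s s'"
    show "nval (rd ''rn'') s' = R" using R by (simp add: frameD1[OF fr])
  qed (use R in auto)
qed simp

lemma wp_remove_min:
  assumes h: "heap_of K A {} s" and r: "roots_of A s" and R: "R = fst s ''rn'' 0"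
    and A: "A \<subseteq> {..<n}" and st: "strided n K s" and bi: "fst s ''bi'' 0 < R"
    and u: "u = fst s ''rt'' (fst s ''bi'' 0)"
  shows "u \<in> A"
    "wp remove_min (\<lambda>s' _. fst s' ''u'' 0 = u \<and> heap_of K (A - {u}) {} s' \<and> roots_of (A - {u}) s' \<and>
      fst s' ''rn'' 0 = R - 1 + fst s ''deg'' u \<and> fst s' ''st'' = (fst s ''st'')(u := 2) \<and>
      fst s' ''ord'' = (fst s ''ord'')(fst s ''cnt'' 0 := u) \<and> fst s' ''cnt'' 0 = Suc (fst s ''cnt'' 0))
     s (6 * fst s ''deg'' u + 8)"
proof -
  have inj: "inj_on (fst s ''rt'') {..<R}" and img: "fst s ''rt'' ` {..<R} = {x \<in> A. fst s ''par'' x = 0}"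
    using r R by (auto simp: roots_def)
  then show uA: "u \<in> A" using bi u by auto
  have pu: "fst s ''par'' u = 0" using img bi u by auto
  let ?D = "fst s ''deg'' u"
  let ?ch = "\<lambda>i. fst s ''ch'' (u * K + i)"
  let ?rt = "(fst s ''rt'')(fst s ''bi'' 0 := fst s ''rt'' (R - 1))"
  note rem = heap_remove_root[OF h uA pu refl]
  have chA: "?ch ` {..<?D} \<subseteq> A" using heapD(6)[OF h uA] by auto
  have base: "fst s ''base'' u = u * K" using st uA A by (auto simp: strided_def)
  have rt_inj: "inj_on ?rt {..<R - 1}"
  proof (rule inj_onI)
    fix x y assume xy: "x \<in> {..<R - 1}" "y \<in> {..<R - 1}" "?rt x = ?rt y"
    then have "x < R" "y < R" "R - 1 < R" "x \<noteq> R - 1" "y \<noteq> R - 1" by auto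
    then show "x = y" using xy inj_onD[OF inj, of x y] inj_onD[OF inj, of "R - 1" y]
        inj_onD[OF inj, of x "R - 1"] by (auto split: if_splits)
  qed
  have rt_img: "?rt ` {..<R - 1} = {x \<in> A. fst s ''par'' x = 0} - {u}"
  proof -
    have "?rt ` {..<R - 1} = fst s ''rt'' ` ({..<R} - {fst s ''bi'' 0})"
    proof (intro set_eqI iffI)
      fix x assume "x \<in> ?rt ` {..<R - 1}"
      then obtain i where i: "i < R - 1" "x = ?rt i" by blast
      show "x \<in> fst s ''rt'' ` ({..<R} - {fst s ''bi'' 0})"
      proof (cases "i = fst s ''bi'' 0")
        case True
        then show ?thesis using i by (intro image_eqI[of _ _ "R - 1"]) auto
      next
        case False
        then show ?thesis using i by (intro image_eqI[of _ _ i]) auto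
      qed
    next
      fix x assume "x \<in> fst s ''rt'' ` ({..<R} - {fst s ''bi'' 0})"
      then obtain i where i: "i < R" "i \<noteq> fst s ''bi'' 0" "x = fst s ''rt'' i" by blast
      show "x \<in> ?rt ` {..<R - 1}"
      proof (cases "i = R - 1")
        case True
        then show ?thesis using i bi by (intro image_eqI[of _ _ "fst s ''bi'' 0"]) auto
      next
        case False
        then show ?thesis using i by (intro image_eqI[of _ _ i]) auto
      qed
    qed
    also have "\<dots> = fst s ''rt'' ` {..<R} - {u}"
      using inj_on_image_set_diff[OF inj, of "{..<R}" "{fst s ''bi'' 0}"] bi u by auto
    finally show ?thesis using img by simp
  qed
  \<comment> \<open>Positions below \<open>R - 1\<close> hold the remaining old roots, with the last
    one moved into the gap; the children follow in the order of their slots.\<close>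
  let ?I = "\<lambda>k s'. fst s' ''u'' 0 = u \<and> fst s' ''rn'' 0 = R - 1 + k \<and>
      (\<forall>x. fst s' ''par'' x = (if x \<in> ?ch ` {..<k} then 0 else fst s ''par'' x)) \<and>
      (\<forall>x<R - 1. fst s' ''rt'' x = ?rt x) \<and> (\<forall>i<k. fst s' ''rt'' (R - 1 + i) = ?ch i)"
  let ?s = "nwrite ''cnt'' 0 (Suc (fst s ''cnt'' 0)) (nwrite ''ord'' (fst s ''cnt'' 0) u (nwrite ''st'' u 2
     (nwrite ''rt'' (fst s ''bi'' 0) (fst s ''rt'' (R - 1)) (nwrite ''rn'' 0 (R - 1) (nwrite ''u'' 0 u s)))))"
  let ?c = "upd ''y'' (NRead ''ch'' (NAdd (NRead ''base'' (rd ''u'')) (rd ''i''))) ;;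
        NWrite ''par'' (rd ''y'') (NConst 0) ;;
        NWrite ''rt'' (rd ''rn'') (rd ''y'') ;;
        upd ''rn'' (NAdd (rd ''rn'') (NConst 1))"
  let ?F = "For ''i'' (NRead ''deg'' (rd ''u'')) ?c"
  let ?Q = "\<lambda>s'. fst s' ''u'' 0 = u \<and> heap_of K (A - {u}) {} s' \<and> roots_of (A - {u}) s' \<and>
      fst s' ''rn'' 0 = R - 1 + fst s ''deg'' u \<and> fst s' ''st'' = (fst s ''st'')(u := 2) \<and>
      fst s' ''ord'' = (fst s ''ord'')(fst s ''cnt'' 0 := u) \<and> fst s' ''cnt'' 0 = Suc (fst s ''cnt'' 0)"
  have loop: "wp ?F (\<lambda>s' _. ?Q s') ?s (6 * ?D + 2)"
  proof (rule wp_For[where I = ?I and N = ?D and K = 4])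
    show "?I 0 (nwrite ''i'' 0 0 ?s)" by simp
  next
    fix k s' assume k: "k < ?D" and I: "?I k s'" and i: "fst s' ''i'' 0 = k" and fr: "frame ?F ?s s'"
    show "wp ?c (\<lambda>s'' _. fst s'' ''i'' 0 = k \<and> ?I (Suc k) (nwrite ''i'' 0 (Suc k) s'')) s' 4"
      using I i base by (auto simp: wp_simps frameD1[OF fr] lessThan_Suc less_Suc_eq)
  next
    fix k s' assume I: "?I k s'" and fr: "frame ?F ?s s'"
    show "nval (NRead ''deg'' (rd ''u'')) s' = ?D" using I by (simp add: frameD1[OF fr])
  next
    fix s' assume I: "?I ?D s'" and fr: "frame ?F ?s s'"
    let ?C = "?ch ` {..<?D}"
    have par: "fst s' ''par'' = (\<lambda>x. if x \<in> ?C then 0 else fst s ''par'' x)" using I by auto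
    have rts: "roots (A - {u}) (fst s' ''par'') (fst s' ''rt'') {..<R - 1 + ?D}"
      unfolding roots_def
    proof
      have split: "{..<R - 1 + ?D} = {..<R - 1} \<union> (\<lambda>i. R - 1 + i) ` {..<?D}"
      proof (intro set_eqI iffI)
        fix x assume "x \<in> {..<R - 1 + ?D}"
        then show "x \<in> {..<R - 1} \<union> (\<lambda>i. R - 1 + i) ` {..<?D}"
          by (cases "x < R - 1") (auto intro!: image_eqI[of _ _ "x - (R - 1)"])
      qed auto
      have i1: "inj_on (fst s' ''rt'') {..<R - 1}"
        using rt_inj I by (subst inj_on_cong[of _ _ ?rt]) auto
      have e1: "fst s' ''rt'' ` {..<R - 1} = {x \<in> A. fst s ''par'' x = 0} - {u}"
        using rt_img I by (metis (no_types, lifting) image_cong lessThan_iff)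
      have e2: "fst s' ''rt'' ` ((\<lambda>i. R - 1 + i) ` {..<?D}) = ?C"
        using I by (auto simp: image_image)
      have i2: "inj_on (fst s' ''rt'') ((\<lambda>i. R - 1 + i) ` {..<?D})"
      proof (rule inj_onI, clarsimp)
        fix x y assume "x < ?D" "y < ?D" "fst s' ''rt'' (R - Suc 0 + x) = fst s' ''rt'' (R - Suc 0 + y)"
        then have "?ch x = ?ch y" using I by simp
        then show "x = y" using inj_onD[OF heap_children_inj[OF h uA], of x y] \<open>x < ?D\<close> \<open>y < ?D\<close> by auto
      qed
      show "inj_on (fst s' ''rt'') {..<R - 1 + ?D}"
        unfolding split by (rule inj_on_Un[THEN iffD2], intro conjI i1 i2)
         (use e1 e2 rem(3) in blast)
      show "fst s' ''rt'' ` {..<R - 1 + ?D} = {x \<in> A - {u}. fst s' ''par'' x = 0}"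
        unfolding split image_Un e1 e2 unfolding par rem(2) ..
    qed
    have "heap_of K (A - {u}) {} s'"
      using rem(1) unfolding par by (simp add: frameD1[OF fr] frameD2[OF fr])
    then show "?Q s'" using I rts by (simp add: frameD1[OF fr])
  qed simp
  show "wp remove_min (\<lambda>s' _. ?Q s') s (6 * ?D + 8)"
    unfolding remove_min_def using loop by (simp add: wp_simps(1-4) R u)
qed

lemma roots_move:
  assumes r: "roots A par rt I" and k: "k \<in> I" and j: "j \<notin> I - {k}"
  shows "roots A par (rt(j := rt k)) (insert j (I - {k}))"
proof -
  let ?f = "\<lambda>i. if i = j then k else i"
  have f: "rt(j := rt k) = rt \<circ> ?f" by auto
  have fI: "?f ` (insert j (I - {k})) = I" using k j by auto
  have "inj_on ?f (insert j (I - {k}))" using j by (auto simp: inj_on_def)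
  then have "inj_on (rt \<circ> ?f) (insert j (I - {k}))"
    using r by (intro comp_inj_on) (simp_all only: fI roots_def)
  moreover have "(rt \<circ> ?f) ` (insert j (I - {k})) = rt ` I" unfolding image_comp[symmetric] fI ..
  ultimately show ?thesis using r unfolding f roots_def by simp
qed

text \<open>Position \<open>k\<close> leaves the list, so the surviving root \<open>p\<close> must
  stand at position \<open>q\<close>: it is there already, or it is copied over the losing
  root.\<close>

lemma roots_link:
  assumes r: "roots A par rt I" and q: "q \<in> I" and k: "k \<in> I" and qk: "q \<noteq> k"
    and py: "p = rt q \<and> y = rt k \<or> p = rt k \<and> y = rt q"
  shows "roots A (par(y := Suc p)) (rt(q := p)) (I - {k})"
proof -
  have del: "roots A (par(rt i := Suc x)) rt (I - {i})" if i: "i \<in> I" for i x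
  proof -
    have inj: "inj_on rt I" and img: "rt ` I = {x \<in> A. par x = 0}" using r by (auto simp: roots_def)
    have "rt ` (I - {i}) = rt ` I - {rt i}"
      using inj_on_image_set_diff[OF inj, of I "{i}"] i by simp
    then show ?thesis using inj img by (auto simp: roots_def intro: inj_on_subset)
  qed
  from py show ?thesis
  proof
    assume "p = rt q \<and> y = rt k"
    then show ?thesis using del[OF k, of p] by simp
  next
    assume "p = rt k \<and> y = rt q"
    moreover have "insert q (I - {q} - {k}) = I - {k}" using q qk by auto
    ultimately show ?thesis using roots_move[OF del[OF q, of p], of k q] k qk by simp
  qed
qed

lemma roots_add:
  assumes r: "roots A par rt {..<R}" and v: "v \<notin> A \<or> par v \<noteq> 0"
  shows "roots (insert v A) (par(v := 0)) (rt(R := v)) {..<Suc R}"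
proof -
  have inj: "inj_on rt {..<R}" and img: "rt ` {..<R} = {x \<in> A. par x = 0}" using r by (auto simp: roots_def)
  have vr: "v \<notin> rt ` {..<R}" using v img by auto
  have "inj_on (rt(R := v)) {..<Suc R}"
    using inj vr by (auto simp: inj_on_def lessThan_Suc)
  moreover have "(rt(R := v)) ` {..<Suc R} = insert v (rt ` {..<R})"
    by (auto simp: lessThan_Suc)
  ultimately show ?thesis using img v by (auto simp: roots_def)
qed

text \<open>\<open>?U\<close> consists of the positions still waiting for a partner: the entry of
  \<open>bp\<close> for their degree points back to them. A link advances \<open>k\<close> and uses
  up at most one such position; otherwise \<open>nl\<close> grows by one and \<open>?U\<close> by at
  least one. Either way \<open>2 * nl \<le> k + card ?U\<close> persists. Degrees are distinct on
  \<open>?U\<close>, because \<open>bp\<close> inverts them, so at most \<open>3 * L\<close> roots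
  stay single.\<close>

lemma wp_consolidate:
  assumes h: "heap_of K A {} s" and r: "roots_of A s" and R: "R = fst s ''rn'' 0"
    and A: "A \<subseteq> {..<n}" and st: "strided n K s" and L: "card A < 2 ^ L"
  shows "wp consolidate (\<lambda>s' _. heap_of K A {} s' \<and> roots_of A s' \<and> 2 * fst s' ''rn'' 0 \<le> R + 3 * L)
    s (15 * R + 4)"
proof -
  let ?U = "\<lambda>nl bp deg rt. {q. q < nl \<and> (bp::nat \<Rightarrow> nat) ((deg::nat \<Rightarrow> nat) ((rt::nat \<Rightarrow> nat) q)) = (q::nat)}"
  let ?I = "\<lambda>k s'. fst s' ''nl'' 0 \<le> k \<and> heap_of K A {} s' \<and>
    roots A (fst s' ''par'') (fst s' ''rt'') ({..<fst s' ''nl'' 0} \<union> {k..<R}) \<and>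
    2 * fst s' ''nl'' 0 \<le> k + card (?U (fst s' ''nl'' 0) (fst s' ''bp'') (fst s' ''deg'') (fst s' ''rt''))"
  let ?s = "nwrite ''nl'' 0 0 s"
  let ?F = "For ''i'' (rd ''rn'') pair_root"
  have loop: "wp ?F (\<lambda>s' _. ?I R s') ?s (15 * R + 2)"
  proof (rule wp_For[where I = ?I and N = R and K = 13])
    show "?I 0 (nwrite ''i'' 0 0 ?s)" using h r R by (simp add: atLeast0LessThan)
  next
    fix k s' assume k: "k < R" and I: "?I k s'" and i: "fst s' ''i'' 0 = k" and fr: "frame ?F ?s s'"
    define nl where "nl = fst s' ''nl'' 0"
    define r where "r = fst s' ''rt'' k"
    define q where "q = fst s' ''bp'' (fst s' ''deg'' r)"
    define x where "x = fst s' ''rt'' q"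
    define key where "key = snd s' ''key''"
    define deg where "deg = fst s' ''deg''"
    define bp where "bp = fst s' ''bp''"
    define rt where "rt = fst s' ''rt''"
    define par where "par = fst s' ''par''"
    note defs = nl_def[symmetric] key_def[symmetric] deg_def[symmetric] bp_def[symmetric] rt_def[symmetric]
      par_def[symmetric]
    have I': "nl \<le> k" "heap K A {} key par deg (fst s' ''ch'') (fst s' ''idx'') (fst s' ''mark'')"
      "roots A par rt ({..<nl} \<union> {k..<R})" "2 * nl \<le> k + card (?U nl bp deg rt)"
      using I unfolding defs by auto
    have inj: "inj_on rt ({..<nl} \<union> {k..<R})" using I'(3) by (auto simp: roots_def)
    have rx: "r = rt k" "q = bp (deg r)" "x = rt q" by (auto simp: r_def q_def x_def deg_def bp_def rt_def)
    have mem: "rt i \<in> A \<and> par (rt i) = 0" if "i \<in> {..<nl} \<union> {k..<R}" for i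
      using I'(3) that unfolding roots_def by blast
    have base: "fst s' ''base'' v = v * K" if "v \<in> A" for v
      using st A that by (auto simp: strided_def frameD1[OF fr] pair_root_def)
    show "wp pair_root (\<lambda>s'' _. fst s'' ''i'' 0 = k \<and> ?I (Suc k) (nwrite ''i'' 0 (Suc k) s'')) s' 13"
    proof (cases "q < nl \<and> deg x = deg r")
      case True
      then have rA: "r \<in> A" "par r = 0" and xA: "x \<in> A" "par x = 0"
        using mem[of k] mem[of q] k rx by auto
      have qk: "q \<noteq> k" using True I' by auto
      have ne: "r \<noteq> x" using inj_onD[OF inj, of k q] k True qk rx by auto
      have link: "heap K A {} key (par(y := Suc p)) (deg(p := Suc (deg p)))
          ((fst s' ''ch'')(p * K + deg p := y)) ((fst s' ''idx'')(y := deg p)) (fst s' ''mark'') \<and>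
          roots A (par(y := Suc p)) (rt(q := p)) ({..<nl} \<union> {Suc k..<R}) \<and>
          2 * nl \<le> Suc k + card (?U nl bp (deg(p := Suc (deg p))) (rt(q := p)))"
        if py: "p = x \<and> y = r \<or> p = r \<and> y = x" and le: "key p \<le> key y" for p y
      proof (intro conjI)
        show "heap K A {} key (par(y := Suc p)) (deg(p := Suc (deg p)))
          ((fst s' ''ch'')(p * K + deg p := y)) ((fst s' ''idx'')(y := deg p)) (fst s' ''mark'')"
          using py rA xA ne le True by (intro heap_link(1)[OF I'(2)]) auto
        have e: "({..<nl} \<union> {k..<R}) - {k} = {..<nl} \<union> {Suc k..<R}" using I'(1) by auto
        show "roots A (par(y := Suc p)) (rt(q := p)) ({..<nl} \<union> {Suc k..<R})"
          unfolding e[symmetric] using py k True qk rx by (intro roots_link[OF I'(3)]) auto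
        have "?U nl bp deg rt - {q} \<subseteq> ?U nl bp (deg(p := Suc (deg p))) (rt(q := p))"
        proof
          fix i assume i: "i \<in> ?U nl bp deg rt - {q}"
          then have "rt i \<noteq> rt q" "rt i \<noteq> rt k"
            using inj_onD[OF inj, of i q] inj_onD[OF inj, of i k] True k I'(1) by auto
          then have "rt i \<noteq> p" using py rx by auto
          then show "i \<in> ?U nl bp (deg(p := Suc (deg p))) (rt(q := p))" using i by auto
        qed
        then have "card (?U nl bp deg rt - {q}) \<le> card (?U nl bp (deg(p := Suc (deg p))) (rt(q := p)))"
          by (rule card_mono[rotated]) simp
        moreover have "card (?U nl bp deg rt) \<le> Suc (card (?U nl bp deg rt - {q}))"
          by (cases "q \<in> ?U nl bp deg rt") (simp_all only: card_Suc_Diff1 finite_Collect_conjI finite_Collect_less_nat simp_thms Diff_insert0 Diff_empty le_SucI order_refl)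
        ultimately show "2 * nl \<le> Suc k + card (?U nl bp (deg(p := Suc (deg p))) (rt(q := p)))"
          using I'(4) by linarith
      qed
      show ?thesis
      proof (cases "key r < key x")
        case less: True
        show ?thesis
          using link[of r x] less True I'(1) base[OF rA(1)] i
          by (simp add: pair_root_def wp_simps rx[symmetric] defs)
      next
        case False
        have triv: "rt(q := x) = rt" using rx by auto
        show ?thesis
          using link[of x r, unfolded triv] False True I'(1) base[OF xA(1)] i
          by (simp add: pair_root_def wp_simps rx[symmetric] defs)
      qed
    next
      case False
      have e: "insert nl (({..<nl} \<union> {k..<R}) - {k}) = {..<Suc nl} \<union> {Suc k..<R}"
        using I'(1) by auto
      have "roots A par (rt(nl := rt k)) (insert nl (({..<nl} \<union> {k..<R}) - {k}))"
        using k I'(1) by (intro roots_move[OF I'(3)]) auto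
      then have ro: "roots A par (rt(nl := r)) ({..<Suc nl} \<union> {Suc k..<R})" unfolding e rx(1) .
      \<comment> \<open>No position is lost when \<open>bp\<close> is overwritten at
        \<open>deg r\<close>: a position registered there would be \<open>q\<close>, with a root of
        the same degree as \<open>r\<close>, and would have been paired.\<close>
      have "insert nl (?U nl bp deg rt) \<subseteq> ?U (Suc nl) (bp(deg r := nl)) deg (rt(nl := r))"
        using False rx by auto
      then have "card (insert nl (?U nl bp deg rt)) \<le> card (?U (Suc nl) (bp(deg r := nl)) deg (rt(nl := r)))"
        by (rule card_mono[rotated]) simp
      moreover have "card (insert nl (?U nl bp deg rt)) = Suc (card (?U nl bp deg rt))"
        by (subst card_insert_disjoint) auto
      ultimately have "Suc (card (?U nl bp deg rt)) \<le> card (?U (Suc nl) (bp(deg r := nl)) deg (rt(nl := r)))"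
        by metis
      moreover have "2 * Suc nl \<le> Suc k + b" if "Suc a \<le> b" "2 * nl \<le> k + a" for a b
        using that by simp
      ultimately have "2 * Suc nl \<le> Suc k + card (?U (Suc nl) (bp(deg r := nl)) deg (rt(nl := r)))"
        using I'(4) by blast
      moreover have "\<not> q < nl \<or> deg x < deg r \<or> deg r < deg x" using False by auto
      ultimately show ?thesis
        using ro I'(1,2) i
        by (elim disjE; simp add: pair_root_def wp_simps rx[symmetric] defs)
    qed
  next
    fix k s' assume fr: "frame ?F ?s s'"
    show "nval (rd ''rn'') s' = R" using R by (simp add: frameD1[OF fr] pair_root_def)
  qed simp_all
  show ?thesis
    unfolding consolidate_def
  proof (simp add: wp_simps, rule wp_use[OF loop], simp, goal_cases)
    case (1 s' n')
    let ?nl = "fst s' ''nl'' 0"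
    let ?V = "?U ?nl (fst s' ''bp'') (fst s' ''deg'') (fst s' ''rt'')"
    have ro: "roots A (fst s' ''par'') (fst s' ''rt'') {..<?nl}" using 1 by simp
    have "inj_on (\<lambda>q. fst s' ''deg'' (fst s' ''rt'' q)) ?V"
      by (rule inj_on_inverseI[of _ "fst s' ''bp''"]) simp
    moreover have "(\<lambda>q. fst s' ''deg'' (fst s' ''rt'' q)) ` ?V \<subseteq> {..<3 * L}"
    proof clarify
      fix q assume "q < ?nl"
      then have "fst s' ''rt'' q \<in> A" using ro by (auto simp: roots_def)
      then show "fst s' ''deg'' (fst s' ''rt'' q) < 3 * L"
        using heap_deg_less[OF _ L] 1 by blast
    qed
    ultimately have "card ?V \<le> card {..<3 * L}" using card_inj_on_le by blast
    then show ?case using 1 ro by (auto simp: wp_simps)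
  qed
qed

lemma wp_cut:
  assumes h: "heap_of K A {y} s" and r: "roots_of A s" and A: "A \<subseteq> {..<n}" and st: "strided n K s"
    and y: "fst s ''y'' 0 = y" "y \<in> A"
    and cr: "40 * fst s ''rn'' 0 + 60 * sum (fst s ''mark'') A + 114 + c \<le> N"
  shows "wp cut (\<lambda>s' n'. heap_of K A {} s' \<and> roots_of A s' \<and>
      40 * fst s' ''rn'' 0 + 60 * sum (fst s' ''mark'') A + c \<le> n') s N"
proof -
  have fin: "finite A" using heapD(2)[OF h] .
  \<comment> \<open>113 credits pay for the cut that ends the cascade: 40 for the new root, 60 for
    the mark it may set, 13 for one round of the loop. In a cascading round the 60 credits freed
    with the mark of \<open>p\<close> cover 40 + 13. The mark of the current \<open>y\<close> is
    left out of the sum because its cut erases it. The last credit is for the failing test.\<close>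
  let ?I = "\<lambda>s' n'. (let y = fst s' ''y'' 0 in y \<in> A \<and> heap_of K A {y} s' \<and> roots_of A s' \<and> strided n K s' \<and>
      40 * fst s' ''rn'' 0 + (if fst s' ''par'' y = 0 then 60 * sum (fst s' ''mark'') A
        else 60 * sum (fst s' ''mark'') (A - {y}) + 113) + c + 1 \<le> n')"
  show ?thesis
    unfolding cut_def
  proof (rule wp_While[where I = ?I])
    have "sum (fst s ''mark'') (A - {y}) \<le> sum (fst s ''mark'') A"
      by (rule sum_mono2) (use fin in auto)
    then show "?I s N" using assms by (auto simp: Let_def)
  next
    fix s n' assume I: "?I s n'" and b: "bval (NLess (NConst 0) (NRead ''par'' (rd ''y''))) s"
    define y where "y = fst s ''y'' 0"
    define key where "key = snd s ''key''"
    define deg where "deg = fst s ''deg''"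
    define ch where "ch = fst s ''ch''"
    define idx where "idx = fst s ''idx''"
    define rt where "rt = fst s ''rt''"
    define par where "par = fst s ''par''"
    define mark where "mark = fst s ''mark''"
    define rn where "rn = fst s ''rn'' 0"
    define p where "p = par y - 1"
    define z where "z = ch (p * K + (deg p - 1))"
    note defs = key_def[symmetric] deg_def[symmetric] ch_def[symmetric] idx_def[symmetric] rt_def[symmetric]
      par_def[symmetric] mark_def[symmetric] rn_def[symmetric] y_def[symmetric]
    have I': "y \<in> A" "par y \<noteq> 0" "heap K A {y} key par deg ch idx mark" "roots A par rt {..<rn}"
      "40 * rn + 60 * sum mark (A - {y}) + 113 + c + 1 \<le> n'" "strided n K s"
      using I b unfolding Let_def bval.simps nval.simps defs by auto
    note c = heap_cut[OF I'(3,1,2) p_def z_def]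
    have base: "fst s ''base'' p = p * K" using I'(6) c(2) A by (auto simp: strided_def)
    have ro: "roots A (par(y := 0)) (rt(rn := y)) {..<Suc rn}"
      using roots_add[OF I'(4), of y] I'(1,2) by (simp add: insert_absorb)
    have yp: "par y = Suc p" using I' p_def by simp
    have m: "sum (mark(y := 0)) A = sum mark (A - {y})"
      using I'(1) fin by (simp add: sum.remove[of A y])
    have s1: "strided n K (nwrite a i k s) = strided n K s" if "a \<noteq> ''base''" for a i k s
      using that by (simp add: strided_def)
    have "wp (upd ''p'' (NSub (NRead ''par'' (rd ''y'')) (NConst 1)) ;;
     NWrite ''deg'' (rd ''p'') (NSub (NRead ''deg'' (rd ''p'')) (NConst 1)) ;;
     upd ''z'' (NRead ''ch'' (NAdd (NRead ''base'' (rd ''p'')) (NRead ''deg'' (rd ''p'')))) ;;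
     NWrite ''ch'' (NAdd (NRead ''base'' (rd ''p'')) (NRead ''idx'' (rd ''y''))) (rd ''z'') ;;
     NWrite ''idx'' (rd ''z'') (NRead ''idx'' (rd ''y'')) ;;
     NWrite ''par'' (rd ''y'') (NConst 0) ;;
     NWrite ''mark'' (rd ''y'') (NConst 0) ;;
     NWrite ''rt'' (rd ''rn'') (rd ''y'') ;;
     upd ''rn'' (NAdd (rd ''rn'') (NConst 1)) ;;
     Cond (NLess (NConst 0) (NRead ''par'' (rd ''p'')))
       (Cond (NLess (NConst 0) (NRead ''mark'' (rd ''p'')))
          (upd ''y'' (rd ''p''))
          (NWrite ''mark'' (rd ''p'') (NConst 1)))
       Skip) ?I s (n' - 1)"
    proof -
      consider (root) "par p = 0" | (marked) "par p \<noteq> 0" "mark p \<noteq> 0" | (unmarked) "par p \<noteq> 0" "mark p = 0"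
        by blast
      then show ?thesis
      proof cases
        case root
        have "heap K A {y} key (par(y := 0)) (deg(p := deg p - 1)) (ch(p * K + idx y := z))
            (idx(z := idx y)) (mark(y := 0))"
          by (rule heap_weaken, rule heap_exempt_root[OF c(1)]) (use root c in auto)
        then show ?thesis
          using root c(2-4) ro m I'(1,5,6) yp base
          by (auto simp: wp_simps Let_def defs z_def[symmetric, simplified] s1)
      next
        case marked
        have "sum (mark(y := 0)) (A - {p}) + mark p = sum mark (A - {y})"
          using m c(2,3) fin by (simp add: sum.remove[of A p])
        moreover have "mark p = 1" using marked heapD(11)[OF I'(3) c(2)] by simp
        ultimately have "sum (mark(y := 0)) (A - {p}) + 1 = sum mark (A - {y})" by simp
        then show ?thesis
          using marked c ro I'(1,5,6) yp base
          by (auto simp: wp_simps Let_def defs z_def[symmetric, simplified] s1)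
      next
        case unmarked
        have hp: "idx p \<le> deg p + mark p" "key (par p - 1) \<le> key p" "idx p < deg (par p - 1)"
          using heapD(9,10,4)[OF I'(3) c(2)] c(3) unmarked by auto
        have "heap K A {} key (par(y := 0)) (deg(p := deg p - 1)) (ch(p * K + idx y := z))
            (idx(z := idx y)) ((mark(y := 0))(p := 1))"
          by (rule heap_exempt_mark[OF c(1)]) (use hp unmarked c in auto)
        then have hh: "heap K A {y} key (par(y := 0)) (deg(p := deg p - 1)) (ch(p * K + idx y := z))
            (idx(z := idx y)) ((mark(y := 0))(p := 1))" by (rule heap_weaken)
        have "sum ((mark(y := 0))(p := 1)) A = sum (mark(y := 0)) A + 1"
          using c(2,3) fin unmarked by (simp add: sum.remove[of A p])
        then have "sum ((mark(y := 0))(p := 1)) A = sum mark (A - {y}) + 1" using m by simp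
        then show ?thesis
          using unmarked c(2-4) ro I'(1,5,6) yp base hh
          by (auto simp: wp_simps Let_def defs z_def[symmetric, simplified] s1)
      qed
    qed
    then show "1 \<le> n' \<and> wp (upd ''p'' (NSub (NRead ''par'' (rd ''y'')) (NConst 1)) ;;
     NWrite ''deg'' (rd ''p'') (NSub (NRead ''deg'' (rd ''p'')) (NConst 1)) ;;
     upd ''z'' (NRead ''ch'' (NAdd (NRead ''base'' (rd ''p'')) (NRead ''deg'' (rd ''p'')))) ;;
     NWrite ''ch'' (NAdd (NRead ''base'' (rd ''p'')) (NRead ''idx'' (rd ''y''))) (rd ''z'') ;;
     NWrite ''idx'' (rd ''z'') (NRead ''idx'' (rd ''y'')) ;;
     NWrite ''par'' (rd ''y'') (NConst 0) ;;
     NWrite ''mark'' (rd ''y'') (NConst 0) ;;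
     NWrite ''rt'' (rd ''rn'') (rd ''y'') ;;
     upd ''rn'' (NAdd (rd ''rn'') (NConst 1)) ;;
     Cond (NLess (NConst 0) (NRead ''par'' (rd ''p'')))
       (Cond (NLess (NConst 0) (NRead ''mark'' (rd ''p'')))
          (upd ''y'' (rd ''p''))
          (NWrite ''mark'' (rd ''p'') (NConst 1)))
       Skip) ?I s (n' - 1)" using I'(5) by simp
  next
    fix s n' assume I: "?I s n'" and b: "\<not> bval (NLess (NConst 0) (NRead ''par'' (rd ''y''))) s"
    then have "fst s ''par'' (fst s ''y'' 0) = 0" by simp
    then show "1 \<le> n' \<and> heap_of K A {} s \<and> roots_of A s \<and>
      40 * fst s ''rn'' 0 + 60 * sum (fst s ''mark'') A + c \<le> n' - 1"
      using I heap_exempt_root by (auto simp: Let_def)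
  qed
qed

definition extract_min :: com where
  "extract_min = find_min ;; remove_min ;; consolidate"

text \<open>The removed root has fewer than \<open>3 * L\<close> children. Hence the removal
  contributes at most \<open>18 * L\<close>, and the consolidation handles fewer than
  \<open>R + 3 * L\<close> roots at 15 credits each, on top of \<open>4 * R\<close> for finding the
  minimum.\<close>

lemma wp_extract_min:
  assumes h: "heap_of K A {} s" and r: "roots_of A s" and R: "R = fst s ''rn'' 0" "0 < R"
    and A: "A \<subseteq> {..<n}" and st: "strided n K s" and L: "card A < 2 ^ L"
  shows "wp extract_min (\<lambda>s' _. \<exists>u\<in>A. fst s' ''u'' 0 = u \<and> (\<forall>x\<in>A. snd s ''key'' u \<le> snd s ''key'' x) \<and>
      heap_of K (A - {u}) {} s' \<and> roots_of (A - {u}) s' \<and> 2 * fst s' ''rn'' 0 \<le> R + 6 * L \<and>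
      fst s' ''st'' = (fst s ''st'')(u := 2) \<and>
      fst s' ''ord'' = (fst s ''ord'')(fst s ''cnt'' 0 := u) \<and> fst s' ''cnt'' 0 = Suc (fst s ''cnt'' 0))
    s (19 * R + 63 * L + 15)"
  unfolding extract_min_def wp_Seq
proof (rule wp_use[OF wp_find_min[OF R(2) R(1)[symmetric]]])
  show "4 * R + 3 \<le> 19 * R + 63 * L + 15" by simp
  fix s1 n1
  assume bi: "fst s1 ''bi'' 0 < R \<and>
      (\<forall>q<R. snd s ''key'' (fst s ''rt'' (fst s1 ''bi'' 0)) \<le> snd s ''key'' (fst s ''rt'' q))"
    and fr1: "frame find_min s s1" and n1: "19 * R + 63 * L + 15 \<le> n1 + (4 * R + 3)"
  note f1 = frameD1[OF fr1, unfolded find_min_def, simplified] frameD2[OF fr1, unfolded find_min_def, simplified]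
  define u where "u = fst s1 ''rt'' (fst s1 ''bi'' 0)"
  have h1: "heap_of K A {} s1" "roots_of A s1" "R = fst s1 ''rn'' 0" "strided n K s1"
    using h r R st by (simp_all add: f1 strided_def)
  note rm = wp_remove_min[OF h1(1-3) A h1(4) conjunct1[OF bi] u_def]
  have D: "fst s1 ''deg'' u < 3 * L" using heap_deg_less[OF h1(1) L rm(1)] .
  have min: "\<forall>x\<in>A. snd s ''key'' u \<le> snd s ''key'' x"
  proof
    fix x assume "x \<in> A"
    then obtain y where y: "y \<in> A" "fst s ''par'' y = 0" "snd s ''key'' y \<le> snd s ''key'' x"
      using heap_root_above[OF h] by blast
    then have "y \<in> fst s ''rt'' ` {..<R}" using r R by (auto simp: roots_def)
    then have "snd s ''key'' u \<le> snd s ''key'' y" using bi by (auto simp: u_def f1)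
    then show "snd s ''key'' u \<le> snd s ''key'' x" using y by simp
  qed
  show "wp remove_min (wp consolidate (\<lambda>s' _. \<exists>u\<in>A. fst s' ''u'' 0 = u \<and>
      (\<forall>x\<in>A. snd s ''key'' u \<le> snd s ''key'' x) \<and>
      heap_of K (A - {u}) {} s' \<and> roots_of (A - {u}) s' \<and> 2 * fst s' ''rn'' 0 \<le> R + 6 * L \<and>
      fst s' ''st'' = (fst s ''st'')(u := 2) \<and>
      fst s' ''ord'' = (fst s ''ord'')(fst s ''cnt'' 0 := u) \<and> fst s' ''cnt'' 0 = Suc (fst s ''cnt'' 0)))
    s1 n1"
  proof (rule wp_use[OF rm(2)])
    show "6 * fst s1 ''deg'' u + 8 \<le> n1" using n1 D by linarith
    fix s2 n2
    assume p2: "fst s2 ''u'' 0 = u \<and> heap_of K (A - {u}) {} s2 \<and> roots_of (A - {u}) s2 \<and>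
      fst s2 ''rn'' 0 = R - 1 + fst s1 ''deg'' u \<and> fst s2 ''st'' = (fst s1 ''st'')(u := 2) \<and>
      fst s2 ''ord'' = (fst s1 ''ord'')(fst s1 ''cnt'' 0 := u) \<and> fst s2 ''cnt'' 0 = Suc (fst s1 ''cnt'' 0)"
      and fr2: "frame remove_min s1 s2" and n2: "n1 \<le> n2 + (6 * fst s1 ''deg'' u + 8)"
    have A2: "A - {u} \<subseteq> {..<n}" using A by blast
    have L2: "card (A - {u}) < 2 ^ L" using L by (meson card_Diff1_le le_less_trans)
    have st2: "strided n K s2" using h1(4) by (simp add: strided_def frameD1[OF fr2] remove_min_def)
    show "wp consolidate (\<lambda>s' _. \<exists>u\<in>A. fst s' ''u'' 0 = u \<and>
      (\<forall>x\<in>A. snd s ''key'' u \<le> snd s ''key'' x) \<and>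
      heap_of K (A - {u}) {} s' \<and> roots_of (A - {u}) s' \<and> 2 * fst s' ''rn'' 0 \<le> R + 6 * L \<and>
      fst s' ''st'' = (fst s ''st'')(u := 2) \<and>
      fst s' ''ord'' = (fst s ''ord'')(fst s ''cnt'' 0 := u) \<and> fst s' ''cnt'' 0 = Suc (fst s ''cnt'' 0)) s2 n2"
    proof (rule wp_use[OF wp_consolidate[OF conjunct1[OF conjunct2[OF p2]] _ refl A2 st2 L2]])
      show "roots_of (A - {u}) s2" using p2 by blast
      show "15 * fst s2 ''rn'' 0 + 4 \<le> n2" using p2 n1 n2 D by linarith
      fix s3 n3
      assume p3: "heap_of K (A - {u}) {} s3 \<and> roots_of (A - {u}) s3 \<and>
          2 * fst s3 ''rn'' 0 \<le> fst s2 ''rn'' 0 + 3 * L" and fr3: "frame consolidate s2 s3"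
      have "2 * fst s3 ''rn'' 0 \<le> R + 6 * L" using p2 p3 D by linarith
      moreover have "fst s3 ''u'' 0 = u" "fst s3 ''st'' = (fst s ''st'')(u := 2)"
        "fst s3 ''ord'' = (fst s ''ord'')(fst s ''cnt'' 0 := u)" "fst s3 ''cnt'' 0 = Suc (fst s ''cnt'' 0)"
        using p2 by (simp_all add: frameD1[OF fr3] consolidate_def pair_root_def f1)
      ultimately show "\<exists>u\<in>A. fst s3 ''u'' 0 = u \<and>
      (\<forall>x\<in>A. snd s ''key'' u \<le> snd s ''key'' x) \<and>
      heap_of K (A - {u}) {} s3 \<and> roots_of (A - {u}) s3 \<and> 2 * fst s3 ''rn'' 0 \<le> R + 6 * L \<and>
      fst s3 ''st'' = (fst s ''st'')(u := 2) \<and>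
      fst s3 ''ord'' = (fst s ''ord'')(fst s ''cnt'' 0 := u) \<and> fst s3 ''cnt'' 0 = Suc (fst s ''cnt'' 0)"
        using min rm(1) p3 by blast
    qed
  qed
qed

section \<open>Best-first search\<close>

text \<open>Edge \<open>j\<close> joins the vertices \<open>a j\<close> and \<open>b j\<close>, so \<open>other a b j x\<close> is the end opposite to \<open>x\<close>.\<close>

definition other :: "(nat \<Rightarrow> nat) \<Rightarrow> (nat \<Rightarrow> nat) \<Rightarrow> nat \<Rightarrow> nat \<Rightarrow> nat" where
  "other a b j x = a j + b j - x"

definition incident :: "(nat \<Rightarrow> nat) \<Rightarrow> (nat \<Rightarrow> nat) \<Rightarrow> nat \<Rightarrow> nat \<Rightarrow> bool" where
  "incident a b j x \<longleftrightarrow> x = a j \<or> x = b j"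

lemma other_other: "incident a b j x \<Longrightarrow> other a b j (other a b j x) = x"
  and incident_other: "incident a b j x \<Longrightarrow> incident a b j (other a b j x)"
  and other_less: "incident a b j x \<Longrightarrow> a j < n \<Longrightarrow> b j < n \<Longrightarrow> other a b j x < n"
  by (auto simp: other_def incident_def)

text \<open>The vertices with \<open>st v = 2\<close> have been extracted in the order \<open>ord 0\<close>, \<open>ord 1\<close>, \dots; those
  with \<open>st v = 1\<close> are in the heap.  A vertex reached from \<open>x\<close> through edge \<open>j\<close> gets the key
  \<open>mu * key x + c j\<close>: with \<open>mu = 1\<close> this is the algorithm of Dijkstra, with \<open>mu = 0\<close> that of Prim.
  The last two assumptions are what both correctness proofs rest on.  The relation \<open>sc\<close> holds for the
  pairs of a vertex and an edge that have been scanned.\<close>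

locale search_inv =
  fixes n m :: nat and a b :: "nat \<Rightarrow> nat" and c :: "nat \<Rightarrow> real" and mu :: real and sd st :: "nat \<Rightarrow> nat"
    and key :: "nat \<Rightarrow> real" and pe ord :: "nat \<Rightarrow> nat" and cnt :: nat and sc :: "nat \<Rightarrow> nat \<Rightarrow> bool"
  assumes ord_inj: "inj_on ord {..<cnt}"
    and ord_image: "ord ` {..<cnt} = {v. v < n \<and> st v = 2}"
    and st_le: "\<And>v. v < n \<Longrightarrow> st v \<le> 2"
    and key_nonneg: "\<And>v. v < n \<Longrightarrow> 0 \<le> key v"
    and seed: "\<And>v. v < n \<Longrightarrow> st v \<noteq> 0 \<Longrightarrow> pe v = 0 \<Longrightarrow> 0 < sd v \<and> key v = 0"
    and parent: "\<And>v. v < n \<Longrightarrow> st v \<noteq> 0 \<Longrightarrow> pe v \<noteq> 0 \<Longrightarrow> sd v = 0 \<and> pe v - 1 < m \<and>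
        incident a b (pe v - 1) v \<and> other a b (pe v - 1) v < n \<and> st (other a b (pe v - 1) v) = 2 \<and>
        key v = mu * key (other a b (pe v - 1) v) + c (pe v - 1)"
    and unreached: "\<And>v. v < n \<Longrightarrow> st v = 0 \<Longrightarrow> sd v = 0 \<and> pe v = 0"
    and parent_earlier: "\<And>i. i < cnt \<Longrightarrow> pe (ord i) \<noteq> 0 \<Longrightarrow>
        other a b (pe (ord i) - 1) (ord i) \<in> ord ` {..<i}"
    and scanned: "\<And>x j. sc x j \<Longrightarrow> x < n \<and> st x = 2 \<and> st (other a b j x) \<noteq> 0 \<and>
        (st (other a b j x) = 1 \<longrightarrow> key (other a b j x) \<le> mu * key x + c j)"
    and key_le_seed: "\<And>i y. i < cnt \<Longrightarrow> y < n \<Longrightarrow> 0 < sd y \<Longrightarrow> y \<notin> ord ` {..<i} \<Longrightarrow> key (ord i) \<le> 0"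
    and key_le_edge: "\<And>i x j. i < cnt \<Longrightarrow> x \<in> ord ` {..<i} \<Longrightarrow> j < m \<Longrightarrow> incident a b j x \<Longrightarrow>
        other a b j x \<notin> ord ` {..<i} \<Longrightarrow> key (ord i) \<le> mu * key x + c j"

lemmas search_invD = search_inv.ord_inj search_inv.ord_image search_inv.st_le search_inv.key_nonneg
  search_inv.seed search_inv.parent search_inv.unreached search_inv.parent_earlier search_inv.scanned
  search_inv.key_le_seed search_inv.key_le_edge

text \<open>Only the new last index needs the two key bounds. By \<open>full\<close> every edge that
  leaves the extracted set has been scanned, so its other end is in the heap with a key no larger
  than the edge offers, and the minimum is no larger than that.\<close>

lemma search_inv_extract:
  assumes g: "search_inv n m a b c mu sd st key pe ord cnt sc"
    and full: "\<And>x j. x < n \<Longrightarrow> st x = 2 \<Longrightarrow> j < m \<Longrightarrow> incident a b j x \<Longrightarrow> sc x j"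
    and u: "u < n" "st u = 1" and min: "\<And>x. x < n \<Longrightarrow> st x = 1 \<Longrightarrow> key u \<le> key x"
    and ab: "\<And>j. j < m \<Longrightarrow> a j < n \<and> b j < n"
  shows "search_inv n m a b c mu sd (st(u := 2)) key pe (ord(cnt := u)) (Suc cnt) sc"
proof -
  note g = search_invD[OF g]
  have img: "(ord(cnt := u)) ` {..<i} = ord ` {..<i}" if "i \<le> cnt" for i
    using that by (intro image_cong) auto
  have un: "u \<notin> ord ` {..<cnt}" using g(2) u by auto
  show ?thesis
  proof (rule search_inv.intro)
    show "inj_on (ord(cnt := u)) {..<Suc cnt}"
      using g(1) un by (auto simp: inj_on_def lessThan_Suc)
    show "(ord(cnt := u)) ` {..<Suc cnt} = {v. v < n \<and> (st(u := 2)) v = 2}"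
      using img[of cnt] g(2) u by (auto simp: lessThan_Suc)
    show "(st(u := 2)) v \<le> 2" if "v < n" for v using g(3) that by auto
    show "0 \<le> key v" if "v < n" for v using g(4)[OF that] .
    show "0 < sd v \<and> key v = 0" if "v < n" "(st(u := 2)) v \<noteq> 0" "pe v = 0" for v
      using g(5)[of v] that u by (cases "v = u") auto
    show "sd v = 0 \<and> pe v - 1 < m \<and> incident a b (pe v - 1) v \<and>
        other a b (pe v - 1) v < n \<and> (st(u := 2)) (other a b (pe v - 1) v) = 2 \<and>
        key v = mu * key (other a b (pe v - 1) v) + c (pe v - 1)"
      if "v < n" "(st(u := 2)) v \<noteq> 0" "pe v \<noteq> 0" for v
      using g(6)[of v] that u by (cases "v = u") auto
    show "sd v = 0 \<and> pe v = 0" if "v < n" "(st(u := 2)) v = 0" for v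
      using g(7)[of v] that by (auto split: if_splits)
    show "other a b (pe ((ord(cnt := u)) i) - 1) ((ord(cnt := u)) i) \<in> (ord(cnt := u)) ` {..<i}"
      if i: "i < Suc cnt" "pe ((ord(cnt := u)) i) \<noteq> 0" for i
    proof (cases "i = cnt")
      case True
      then have "other a b (pe u - 1) u \<in> ord ` {..<cnt}" using g(6)[OF u(1)] u i g(2) by auto
      then show ?thesis using True img[of cnt] by simp
    next
      case False
      then show ?thesis using g(8)[of i] i img[of i] by simp
    qed
    show "x < n \<and> (st(u := 2)) x = 2 \<and> (st(u := 2)) (other a b j x) \<noteq> 0 \<and>
        ((st(u := 2)) (other a b j x) = 1 \<longrightarrow> key (other a b j x) \<le> mu * key x + c j)" if "sc x j" for x j
      using g(9)[OF that] by auto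
    show "key ((ord(cnt := u)) i) \<le> 0"
      if i: "i < Suc cnt" and y: "y < n" "0 < sd y" "y \<notin> (ord(cnt := u)) ` {..<i}" for i y
    proof (cases "i = cnt")
      case True
      have "y \<notin> ord ` {..<cnt}" using y True img[of cnt] by simp
      then have "st y \<noteq> 2" using g(2) y by auto
      moreover have "st y \<noteq> 0" using g(7)[of y] y by auto
      ultimately have "st y = 1" using g(3)[of y] y by linarith
      moreover have "key y = 0" using g(5,6)[of y] y \<open>st y \<noteq> 0\<close> by fastforce
      ultimately show ?thesis using min[of y] y True by simp
    next
      case False
      then show ?thesis using g(10)[of i y] i y img[of i] by simp
    qed
    show "key ((ord(cnt := u)) i) \<le> mu * key x + c j"
      if i: "i < Suc cnt" and x: "x \<in> (ord(cnt := u)) ` {..<i}" "j < m" "incident a b j x"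
        "other a b j x \<notin> (ord(cnt := u)) ` {..<i}" for i x j
    proof (cases "i = cnt")
      case True
      have x': "x < n" "st x = 2" "other a b j x \<notin> ord ` {..<cnt}"
        using x True img[of cnt] g(2) by auto
      have o: "other a b j x < n" using ab[OF x(2)] x(3) by (intro other_less) auto
      have s: "st (other a b j x) \<noteq> 0" "st (other a b j x) = 1 \<longrightarrow> key (other a b j x) \<le> mu * key x + c j"
        using g(9)[OF full[OF x'(1,2) x(2,3)]] by auto
      have "st (other a b j x) \<noteq> 2" using x' g(2) o by auto
      then have "st (other a b j x) = 1" using s g(3)[OF o] by linarith
      then show ?thesis using min[OF o] s True by auto
    next
      case False
      then show ?thesis using g(11)[of i x j] i x img[of i] by simp
    qed
  qed
qed

lemma search_inv_scan:
  assumes g: "search_inv n m a b c mu sd st key pe ord cnt sc"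
    and u: "u < n" "st u = 2" and j: "j < m" "incident a b j u" and v: "v = other a b j u"
    and ok: "st v \<noteq> 0" "st v = 1 \<longrightarrow> key v \<le> mu * key u + c j"
  shows "search_inv n m a b c mu sd st key pe ord cnt (\<lambda>x i. sc x i \<or> x = u \<and> i = j)"
proof -
  note g = search_invD[OF g]
  show ?thesis
  proof (rule search_inv.intro)
    show "inj_on ord {..<cnt}" "ord ` {..<cnt} = {v. v < n \<and> st v = 2}" by (fact g(1), fact g(2))
    fix w assume w: "w < n"
    show "st w \<le> 2" using w by (rule g(3))
    show "sd w = 0 \<and> pe w = 0" if "st w = 0" using w that by (rule g(7))
    show "0 \<le> key w" using w by (rule g(4))
    assume s: "st w \<noteq> 0"
    show "0 < sd w \<and> key w = 0" if "pe w = 0" using w s that by (rule g(5))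
    show "sd w = 0 \<and> pe w - 1 < m \<and> incident a b (pe w - 1) w \<and> other a b (pe w - 1) w < n \<and>
        st (other a b (pe w - 1) w) = 2 \<and> key w = mu * key (other a b (pe w - 1) w) + c (pe w - 1)"
      if "pe w \<noteq> 0" using w s that by (rule g(6))
  next
    fix x i assume "sc x i \<or> x = u \<and> i = j"
    then show "x < n \<and> st x = 2 \<and> st (other a b i x) \<noteq> 0 \<and>
        (st (other a b i x) = 1 \<longrightarrow> key (other a b i x) \<le> mu * key x + c i)"
      using g(9)[of x i] u ok v by metis
  next
    fix i assume i: "i < cnt"
    show "other a b (pe (ord i) - 1) (ord i) \<in> ord ` {..<i}" if "pe (ord i) \<noteq> 0" using i that by (rule g(8))
    show "key (ord i) \<le> 0" if "y < n" "0 < sd y" "y \<notin> ord ` {..<i}" for y using i that by (rule g(10))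
    show "key (ord i) \<le> mu * key x + c k" if "x \<in> ord ` {..<i}" "k < m" "incident a b k x"
      "other a b k x \<notin> ord ` {..<i}" for x k using i that by (rule g(11))
  qed
qed

text \<open>\<open>v\<close> is not extracted, so no statement about \<open>ord\<close> sees its new
  key. A seed has key 0 and cannot be improved by \<open>k \<ge> 0\<close>; hence
  \<open>sd v = 0\<close>, as the new parent pointer requires.\<close>

lemma search_inv_improve:
  assumes g: "search_inv n m a b c mu sd st key pe ord cnt sc"
    and u: "u < n" "st u = 2" and j: "j < m" "incident a b j u" and v: "v = other a b j u" "v < n"
    and k: "k = mu * key u + c j" "0 \<le> k" and imp: "st v = 0 \<or> st v = 1 \<and> k < key v"
  shows "search_inv n m a b c mu sd (st(v := 1)) (key(v := k)) (pe(v := Suc j)) ord cnt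
    (\<lambda>x i. sc x i \<or> x = u \<and> i = j)"
proof -
  note g = search_invD[OF g]
  have st2: "st v \<noteq> 2" using imp by auto
  have vo: "v \<notin> ord ` {..<i}" if "i \<le> cnt" for i
  proof -
    have "ord ` {..<i} \<subseteq> ord ` {..<cnt}" using that by (intro image_mono) auto
    then show ?thesis using g(2) st2 by auto
  qed
  have oi: "ord i \<noteq> v" if "i < cnt" for i using vo[of cnt] that by auto
  have sdv: "sd v = 0"
  proof (cases "st v = 0")
    case True then show ?thesis using g(7)[OF v(2)] by simp
  next
    case False
    show ?thesis
    proof (rule ccontr)
      assume "sd v \<noteq> 0"
      then have "key v = 0" using g(5,6)[OF v(2) False] by (cases "pe v = 0") simp_all
      then show False using imp False k by auto
    qed
  qed
  have ov: "other a b j v = u" using other_other[OF j(2)] v by simp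
  have iv: "incident a b j v" using incident_other[OF j(2)] v by simp
  have uv: "u \<noteq> v" using u st2 by auto
  show ?thesis
  proof (rule search_inv.intro)
    show "inj_on ord {..<cnt}" using g(1) .
    show "ord ` {..<cnt} = {w. w < n \<and> (st(v := 1)) w = 2}" using g(2) st2 by auto
    show "(st(v := 1)) w \<le> 2" if "w < n" for w using g(3) that by auto
    show "0 \<le> (key(v := k)) w" if "w < n" for w
      using g(4)[of w] that k by (cases "w = v") auto
    show "0 < sd w \<and> (key(v := k)) w = 0" if "w < n" "(st(v := 1)) w \<noteq> 0" "(pe(v := Suc j)) w = 0" for w
      using g(5)[of w] that by (cases "w = v") auto
    show "sd w = 0 \<and> (pe(v := Suc j)) w - 1 < m \<and> incident a b ((pe(v := Suc j)) w - 1) w \<and>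
        other a b ((pe(v := Suc j)) w - 1) w < n \<and> (st(v := 1)) (other a b ((pe(v := Suc j)) w - 1) w) = 2 \<and>
        (key(v := k)) w = mu * (key(v := k)) (other a b ((pe(v := Suc j)) w - 1) w) + c ((pe(v := Suc j)) w - 1)"
      if "w < n" "(st(v := 1)) w \<noteq> 0" "(pe(v := Suc j)) w \<noteq> 0" for w
    proof (cases "w = v")
      case True
      then show ?thesis using sdv j iv ov u uv k by simp
    next
      case False
      then show ?thesis using g(6)[of w] that st2 by auto
    qed
    show "sd w = 0 \<and> (pe(v := Suc j)) w = 0" if "w < n" "(st(v := 1)) w = 0" for w
      using g(7)[of w] that by (auto split: if_splits)
    show "other a b ((pe(v := Suc j)) (ord i) - 1) (ord i) \<in> ord ` {..<i}"
      if "i < cnt" "(pe(v := Suc j)) (ord i) \<noteq> 0" for i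
      using g(8)[of i] that oi[of i] by simp
    show "x < n \<and> (st(v := 1)) x = 2 \<and> (st(v := 1)) (other a b i x) \<noteq> 0 \<and>
        ((st(v := 1)) (other a b i x) = 1 \<longrightarrow> (key(v := k)) (other a b i x) \<le> mu * (key(v := k)) x + c i)"
      if "sc x i \<or> x = u \<and> i = j" for x i
      using that
    proof
      assume "sc x i"
      then have *: "x < n" "st x = 2" "st (other a b i x) \<noteq> 0"
        "st (other a b i x) = 1 \<longrightarrow> key (other a b i x) \<le> mu * key x + c i" using g(9) by auto
      then have "x \<noteq> v" using st2 by auto
      then show ?thesis using * imp by (cases "other a b i x = v") auto
    next
      assume "x = u \<and> i = j"
      then show ?thesis using u uv v k by auto
    qed
    show "(key(v := k)) (ord i) \<le> 0" if "i < cnt" "y < n" "0 < sd y" "y \<notin> ord ` {..<i}" for i y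
      using g(10)[OF that] oi[OF that(1)] by simp
    show "(key(v := k)) (ord i) \<le> mu * (key(v := k)) x + c ja"
      if "i < cnt" "x \<in> ord ` {..<i}" "ja < m" "incident a b ja x" "other a b ja x \<notin> ord ` {..<i}" for i x ja
      using g(11)[OF that] oi[OF that(1)] vo[of i] that by (cases "x = v") auto
  qed
qed

definition scan_edge :: com where
  "scan_edge = upd ''j'' (NRead ''adj'' (NAdd (NRead ''base'' (rd ''u'')) (rd ''i''))) ;;
     upd ''v'' (NSub (NAdd (NRead ''a'' (rd ''j'')) (NRead ''b'' (rd ''j''))) (rd ''u'')) ;;
     RWrite ''k'' (NConst 0) (RAdd (RMul (RRead ''mult'' (NConst 0)) (RRead ''key'' (rd ''u'')))
       (RRead ''cost'' (rd ''j''))) ;;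
     Cond (NLess (NRead ''st'' (rd ''v'')) (NConst 1))
      (NWrite ''st'' (rd ''v'') (NConst 1) ;;
       RWrite ''key'' (rd ''v'') (RRead ''k'' (NConst 0)) ;;
       NWrite ''pe'' (rd ''v'') (NAdd (rd ''j'') (NConst 1)) ;;
       NWrite ''par'' (rd ''v'') (NConst 0) ;;
       NWrite ''deg'' (rd ''v'') (NConst 0) ;;
       NWrite ''mark'' (rd ''v'') (NConst 0) ;;
       NWrite ''rt'' (rd ''rn'') (rd ''v'') ;;
       upd ''rn'' (NAdd (rd ''rn'') (NConst 1)))
      (Cond (BAnd (NLess (NRead ''st'' (rd ''v'')) (NConst 2))
               (RLess (RRead ''k'' (NConst 0)) (RRead ''key'' (rd ''v''))))
        (RWrite ''key'' (rd ''v'') (RRead ''k'' (NConst 0)) ;;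
         NWrite ''pe'' (rd ''v'') (NAdd (rd ''j'') (NConst 1)) ;;
         upd ''y'' (rd ''v'') ;;
         cut)
        Skip)"

definition scan :: com where
  "scan = For ''i'' (NRead ''dg'' (rd ''u'')) scan_edge"

definition search_loop :: com where
  "search_loop = While (NLess (NConst 0) (rd ''rn'')) (extract_min ;; scan)"

definition all_scanned :: "nat \<Rightarrow> nat \<Rightarrow> (nat \<Rightarrow> nat) \<Rightarrow> (nat \<Rightarrow> nat) \<Rightarrow> (nat \<Rightarrow> nat) \<Rightarrow> nat \<Rightarrow> nat \<Rightarrow> bool" where
  "all_scanned n m a b st x j \<longleftrightarrow> x < n \<and> st x = 2 \<and> j < m \<and> incident a b j x"

definition live :: "nat \<Rightarrow> state \<Rightarrow> nat set" where
  "live n s = {v. v < n \<and> fst s ''st'' v = 1}"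

text \<open>Consolidation roughly halves the number of roots at a cost of fewer than 20 credits per root,
  hence 40 credits per root; a cascading cut consumes a mark, which pays for the loop body and the new root.\<close>

definition potential :: "nat \<Rightarrow> state \<Rightarrow> nat" where
  "potential n s = 40 * fst s ''rn'' 0 + 60 * sum (fst s ''mark'') (live n s)"

text \<open>Only the set of entries in a row is prescribed: contraction turns edges inside a region
  into loops, and a loop is entered twice in the list of its vertex.\<close>

locale search_graph =
  fixes n m K L :: nat and a b :: "nat \<Rightarrow> nat" and c :: "nat \<Rightarrow> real" and mu :: real
    and sd adj dg :: "nat \<Rightarrow> nat"
  assumes ab: "\<And>j. j < m \<Longrightarrow> a j < n \<and> b j < n"
    and c_nonneg: "\<And>j. j < m \<Longrightarrow> 0 \<le> c j" and mu_nonneg: "0 \<le> mu"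
    and n_le: "n \<le> K" and n_less: "n < 2 ^ L"
    and adj: "\<And>v. v < n \<Longrightarrow> (\<lambda>i. adj (v * K + i)) ` {..<dg v} = {j. j < m \<and> incident a b j v}"
begin

definition static :: "state \<Rightarrow> bool" where
  "static s \<longleftrightarrow> fst s ''a'' = a \<and> fst s ''b'' = b \<and> snd s ''cost'' = c \<and> snd s ''mult'' 0 = mu \<and>
     fst s ''adj'' = adj \<and> fst s ''dg'' = dg \<and> strided n K s"

definition sinv :: "(nat \<Rightarrow> nat \<Rightarrow> bool) \<Rightarrow> state \<Rightarrow> bool" where
  "sinv sc s \<longleftrightarrow> static s \<and> heap_of K (live n s) {} s \<and> roots_of (live n s) s \<and>
     search_inv n m a b c mu sd (fst s ''st'') (snd s ''key'') (fst s ''pe'') (fst s ''ord'')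
       (fst s ''cnt'' 0) sc"

lemma live_sub: "live n s \<subseteq> {..<n}" "finite (live n s)" "card (live n s) < 2 ^ L"
proof -
  show "live n s \<subseteq> {..<n}" by (auto simp: live_def)
  then have "card (live n s) \<le> card {..<n}" "finite (live n s)"
    using card_mono finite_subset by blast+
  then show "finite (live n s)" "card (live n s) < 2 ^ L" using n_less by auto
qed

text \<open>The dearest case is a key decrease, with 8 steps before the cut and the 114 credits that
  the cut takes beyond the potential. A newly reached vertex needs 40 credits for its root and a few
  steps.\<close>

lemma wp_scan_edge:
  assumes I: "sinv sc s" and u: "fst s ''u'' 0 = u" "u < n" "fst s ''st'' u = 2"
    and i: "i < dg u" "fst s ''i'' 0 = i" and cr: "potential n s + 126 + C \<le> N"
  shows "wp scan_edge (\<lambda>s' n'. sinv (\<lambda>x j. sc x j \<or> x = u \<and> j = adj (u * K + i)) s' \<and>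
    (\<forall>x. fst s' ''st'' x = 2 \<longleftrightarrow> fst s ''st'' x = 2) \<and> potential n s' + C \<le> n') s N"
proof -
  let ?j = "adj (u * K + i)"
  let ?v = "other a b ?j u"
  let ?k = "mu * snd s ''key'' u + c ?j"
  let ?sc = "\<lambda>x j. sc x j \<or> x = u \<and> j = ?j"
  have st: "static s" and h: "heap_of K (live n s) {} s" and r: "roots_of (live n s) s"
    and g: "search_inv n m a b c mu sd (fst s ''st'') (snd s ''key'') (fst s ''pe'') (fst s ''ord'')
       (fst s ''cnt'' 0) sc" using I by (auto simp: sinv_def)
  have "?j \<in> (\<lambda>i. adj (u * K + i)) ` {..<dg u}" using i by blast
  then have j: "?j < m" "incident a b ?j u" using adj[OF u(2)] by auto
  have v: "?v < n" using other_less[OF j(2)] ab[OF j(1)] by blast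
  have k: "0 \<le> ?k" using c_nonneg[OF j(1)] mu_nonneg search_inv.key_nonneg[OF g u(2)] u(3) by simp
  have s: "fst s ''a'' = a" "fst s ''b'' = b" "snd s ''cost'' = c" "snd s ''mult'' 0 = mu"
    "fst s ''adj'' = adj" "fst s ''dg'' = dg" "fst s ''base'' u = u * K"
    using st u by (auto simp: static_def strided_def)
  note sv = other_def[symmetric]
  have nv: "a ?j + b ?j - u = ?v" by (simp add: other_def)
  consider (new) "fst s ''st'' ?v = 0" | (dec) "fst s ''st'' ?v = 1" "?k < snd s ''key'' ?v"
    | (skip) "fst s ''st'' ?v \<noteq> 0" "fst s ''st'' ?v = 1 \<longrightarrow> snd s ''key'' ?v \<le> ?k"
    by force
  then show ?thesis
  proof cases
    case new
    have g': "search_inv n m a b c mu sd ((fst s ''st'')(?v := 1)) ((snd s ''key'')(?v := ?k))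
        ((fst s ''pe'')(?v := Suc ?j)) (fst s ''ord'') (fst s ''cnt'' 0) ?sc"
      using search_inv_improve[OF g u(2,3) j refl v refl k] new by simp
    let ?A = "insert ?v (live n s)"
    have vA: "?v \<notin> live n s" using new by (simp add: live_def)
    have h': "heap K ?A {} ((snd s ''key'')(?v := ?k)) ((fst s ''par'')(?v := 0)) ((fst s ''deg'')(?v := 0))
        (fst s ''ch'') (fst s ''idx'') ((fst s ''mark'')(?v := 0))"
      using heap_insert[OF h vA] v n_le by simp
    have r': "roots ?A ((fst s ''par'')(?v := 0)) ((fst s ''rt'')(fst s ''rn'' 0 := ?v)) {..<Suc (fst s ''rn'' 0)}"
      using roots_add[OF r] vA by blast
    have lv: "{w. w < n \<and> (w \<noteq> ?v \<longrightarrow> fst s ''st'' w = 1)} = ?A" using v by (auto simp: live_def)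
    have lv': "{w. (w = ?v \<longrightarrow> ?v < n) \<and> (w \<noteq> ?v \<longrightarrow> w < n \<and> fst s ''st'' w = Suc 0)} = ?A"
      using v by (auto simp: live_def)
    have "sum ((fst s ''mark'')(?v := 0)) ?A = sum (fst s ''mark'') (live n s)"
      using vA live_sub(2) by (simp add: sum.insert) (intro sum.cong, auto)
    then show ?thesis
      using new g' h' r' cr st i u s(7)
      by (auto simp: scan_edge_def wp_simps s nv sinv_def static_def strided_def live_def[of n "nwrite _ _ _ _"]
          potential_def lv lv')
  next
    case dec
    have stv: "(fst s ''st'')(?v := 1) = fst s ''st''" using dec by auto
    have g': "search_inv n m a b c mu sd (fst s ''st'') ((snd s ''key'')(?v := ?k))
        ((fst s ''pe'')(?v := Suc ?j)) (fst s ''ord'') (fst s ''cnt'' 0) ?sc"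
      using search_inv_improve[OF g u(2,3) j refl v refl k] dec stv by simp
    have h': "heap K (live n s) {?v} ((snd s ''key'')(?v := ?k)) (fst s ''par'') (fst s ''deg'')
        (fst s ''ch'') (fst s ''idx'') (fst s ''mark'')"
      using heap_decrease[OF h, of ?k ?v] dec by simp
    let ?s = "nwrite ''y'' 0 ?v (nwrite ''pe'' ?v (Suc ?j) (rwrite ''key'' ?v ?k
       (rwrite ''k'' 0 ?k (nwrite ''v'' 0 ?v (nwrite ''j'' 0 ?j s)))))"
    have vA: "?v \<in> live n s" using dec v by (simp add: live_def)
    have "wp cut (\<lambda>s' n'. heap_of K (live n s) {} s' \<and> roots_of (live n s) s' \<and>
      40 * fst s' ''rn'' 0 + 60 * sum (fst s' ''mark'') (live n s) + C \<le> n') ?s (N - 8)"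
    proof (rule wp_cut)
      show "heap_of K (live n s) {?v} ?s" using h' by simp
      show "roots_of (live n s) ?s" using r by simp
      show "live n s \<subseteq> {..<n}" by (rule live_sub)
      show "strided n K ?s" using st by (simp add: static_def strided_def)
      show "fst ?s ''y'' 0 = ?v" by simp
      show "?v \<in> live n s" by (rule vA)
      show "40 * fst ?s ''rn'' 0 + 60 * sum (fst ?s ''mark'') (live n s) + 114 + C \<le> N - 8"
        using cr by (simp add: potential_def)
    qed
    then have "wp cut (\<lambda>s' n'. sinv ?sc s' \<and>
        (\<forall>x. fst s' ''st'' x = 2 \<longleftrightarrow> fst s ''st'' x = 2) \<and> potential n s' + C \<le> n') ?s (N - 8)"
    proof (rule wp_mono)
      fix s' n' assume p: "heap_of K (live n s) {} s' \<and> roots_of (live n s) s' \<and>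
        40 * fst s' ''rn'' 0 + 60 * sum (fst s' ''mark'') (live n s) + C \<le> n'" and fr: "frame cut ?s s'"
      note f = frameD1[OF fr, unfolded cut_def, simplified] frameD2[OF fr, unfolded cut_def, simplified]
      have lv: "live n s' = live n s" by (simp add: live_def f)
      show "sinv ?sc s' \<and> (\<forall>x. fst s' ''st'' x = 2 \<longleftrightarrow> fst s ''st'' x = 2) \<and> potential n s' + C \<le> n'"
        using p g' st unfolding sinv_def lv potential_def
        by (simp add: f static_def strided_def)
    qed
    moreover have "8 \<le> N" using cr by simp
    ultimately show ?thesis
      using dec s(7) i u by (auto simp add: scan_edge_def wp_simps s nv eval_nat_numeral)
  next
    case skip
    have g': "search_inv n m a b c mu sd (fst s ''st'') (snd s ''key'') (fst s ''pe'') (fst s ''ord'')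
       (fst s ''cnt'' 0) ?sc"
      using search_inv_scan[OF g u(2,3) j refl] skip by blast
    have "\<not> (fst s ''st'' ?v < 2 \<and> ?k < snd s ''key'' ?v)" using skip by auto
    then show ?thesis
      using skip g' h r cr st i u s(7)
      by (auto simp: scan_edge_def wp_simps s nv sinv_def static_def strided_def live_def potential_def)
  qed
qed

text \<open>\<open>all_scanned\<close> counts \<open>u\<close> as soon as it is extracted, before
  its edges have been looked at. Hence the exclusion \<open>x \<noteq> u\<close> in the hypothesis,
  and the explicit list of scanned edges of \<open>u\<close> in the loop invariant.\<close>

lemma wp_scan:
  assumes I: "sinv (\<lambda>x j. all_scanned n m a b (fst s ''st'') x j \<and> x \<noteq> u) s"
    and u: "fst s ''u'' 0 = u" "u < n" "fst s ''st'' u = 2"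
    and cr: "potential n s + 130 * dg u + 2 + C \<le> N"
  shows "wp scan (\<lambda>s' n'. sinv (all_scanned n m a b (fst s' ''st'')) s' \<and>
    (\<forall>x. fst s' ''st'' x = 2 \<longleftrightarrow> fst s ''st'' x = 2) \<and> potential n s' + C \<le> n') s N"
proof -
  let ?sc = "\<lambda>k x j. all_scanned n m a b (fst s ''st'') x j \<and> x \<noteq> u \<or> x = u \<and> j \<in> (\<lambda>i. adj (u * K + i)) ` {..<k}"
  let ?I = "\<lambda>k s' n'. sinv (?sc k) s' \<and> (\<forall>x. fst s' ''st'' x = 2 \<longleftrightarrow> fst s ''st'' x = 2) \<and>
      fst s' ''u'' 0 = u \<and> k \<le> dg u \<and> potential n s' + 130 * (dg u - k) + C + 1 \<le> n'"
  have sinv_i: "sinv sc (nwrite ''i'' 0 k s) = sinv sc s" for sc k s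
    by (simp add: sinv_def static_def strided_def live_def)
  have pot_i: "potential n (nwrite ''i'' 0 k s) = potential n s" for k s
    by (simp add: potential_def live_def)
  have dgs: "fst s ''dg'' = dg" using I by (simp add: sinv_def static_def)
  show ?thesis
    unfolding scan_def
  proof (rule wp_For_amortised[where I = ?I and N = "dg u"])
    show "1 \<le> N" using cr by simp
    show "?I 0 (nwrite ''i'' 0 0 s) (N - 1)" using I u cr by (simp add: sinv_i pot_i)
  next
    fix k s' n' assume k: "k < dg u" and J: "?I k s' n'" and i: "fst s' ''i'' 0 = k"
      and fr: "frame (For ''i'' (NRead ''dg'' (rd ''u'')) scan_edge) s s'"
    have "130 * (dg u - k) = 130 * (dg u - Suc k) + 130" using k by simp
    then have n': "potential n s' + 126 + (130 * (dg u - Suc k) + C + 2) \<le> n' - 1" "1 \<le> n'"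
      using J by linarith+
    have "wp scan_edge (\<lambda>s'' n''. sinv (\<lambda>x j. ?sc k x j \<or> x = u \<and> j = adj (u * K + k)) s'' \<and>
      (\<forall>x. fst s'' ''st'' x = 2 \<longleftrightarrow> fst s' ''st'' x = 2) \<and>
      potential n s'' + (130 * (dg u - Suc k) + C + 2) \<le> n'') s' (n' - 1)"
      by (rule wp_scan_edge) (use J k i u n' in auto)
    then have "wp scan_edge (\<lambda>s'' n''. fst s'' ''i'' 0 = k \<and> 1 \<le> n'' \<and> ?I (Suc k) (nwrite ''i'' 0 (Suc k) s'') (n'' - 1))
       s' (n' - 1)"
    proof (rule wp_mono)
      fix s'' n''
      assume p: "sinv (\<lambda>x j. ?sc k x j \<or> x = u \<and> j = adj (u * K + k)) s'' \<and>
      (\<forall>x. fst s'' ''st'' x = 2 \<longleftrightarrow> fst s' ''st'' x = 2) \<and>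
      potential n s'' + (130 * (dg u - Suc k) + C + 2) \<le> n''" and fr: "frame scan_edge s' s''"
      have sc: "(\<lambda>x j. ?sc k x j \<or> x = u \<and> j = adj (u * K + k)) = ?sc (Suc k)"
        by (auto simp: fun_eq_iff lessThan_Suc)
      have "fst s'' ''i'' 0 = k" "fst s'' ''u'' 0 = u"
        using i J by (simp_all add: frameD1[OF fr] scan_edge_def cut_def)
      then show "fst s'' ''i'' 0 = k \<and> 1 \<le> n'' \<and> ?I (Suc k) (nwrite ''i'' 0 (Suc k) s'') (n'' - 1)"
        using p J k unfolding sc by (auto simp: sinv_i pot_i)
    qed
    then show "1 \<le> n' \<and> wp scan_edge (\<lambda>s'' n''. fst s'' ''i'' 0 = k \<and> 1 \<le> n'' \<and>
       ?I (Suc k) (nwrite ''i'' 0 (Suc k) s'') (n'' - 1)) s' (n' - 1)" using n' by blast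
  next
    fix k s' n' assume J: "?I k s' n'" and fr: "frame (For ''i'' (NRead ''dg'' (rd ''u'')) scan_edge) s s'"
    show "nval (NRead ''dg'' (rd ''u'')) s' = dg u" using J by (simp add: sinv_def static_def)
  next
    fix s' n' assume J: "?I (dg u) s' n'"
    have "?sc (dg u) = all_scanned n m a b (fst s' ''st'')"
      using J u unfolding adj[OF u(2)] by (auto simp: fun_eq_iff all_scanned_def)
    then show "1 \<le> n' \<and> sinv (all_scanned n m a b (fst s' ''st'')) s' \<and>
      (\<forall>x. fst s' ''st'' x = 2 \<longleftrightarrow> fst s ''st'' x = 2) \<and> potential n s' + C \<le> n' - 1"
      using J by auto
  qed
qed

text \<open>Every vertex is extracted at most once and prepays its own extraction. Of
  \<open>183 * L\<close>, the part \<open>63 * L\<close> goes to \<open>extract_min\<close> and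
  \<open>120 * L\<close> refills the potential: the share of the roots falls from
  \<open>40 * R\<close> to at most \<open>20 * R + 120 * L\<close>, and the difference
  \<open>20 * R\<close> covers the cost \<open>19 * R\<close>.\<close>

lemma wp_search_loop:
  assumes I: "sinv (all_scanned n m a b (fst s ''st'')) s"
    and cr: "potential n s + (\<Sum>v\<in>{v. v < n \<and> fst s ''st'' v \<noteq> 2}. 183 * L + 20 + 130 * dg v) + 1 \<le> N"
  shows "wp search_loop (\<lambda>s' _. sinv (all_scanned n m a b (fst s' ''st'')) s' \<and> (\<forall>v<n. fst s' ''st'' v \<noteq> 1)) s N"
proof -
  let ?f = "\<lambda>v. 183 * L + 20 + 130 * dg v"
  let ?I = "\<lambda>s' n'. sinv (all_scanned n m a b (fst s' ''st'')) s' \<and>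
      potential n s' + sum ?f {v. v < n \<and> fst s' ''st'' v \<noteq> 2} + 1 \<le> n'"
  show ?thesis
    unfolding search_loop_def
  proof (rule wp_While[where I = ?I])
    show "?I s N" using I cr by simp
  next
    fix s n' assume J: "?I s n'" and bv: "bval (NLess (NConst 0) (rd ''rn'')) s"
    let ?A = "live n s"
    let ?R = "fst s ''rn'' 0"
    have st: "static s" and h: "heap_of K ?A {} s" and r: "roots_of ?A s"
      and g: "search_inv n m a b c mu sd (fst s ''st'') (snd s ''key'') (fst s ''pe'') (fst s ''ord'')
       (fst s ''cnt'' 0) (all_scanned n m a b (fst s ''st''))" using J by (auto simp: sinv_def)
    have fin: "finite {v. v < n \<and> fst s ''st'' v \<noteq> 2}" by simp
    have A_sub: "?A \<subseteq> {v. v < n \<and> fst s ''st'' v \<noteq> 2}" by (auto simp: live_def)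
    have ex: "wp extract_min (\<lambda>s' _. \<exists>u\<in>?A. fst s' ''u'' 0 = u \<and> (\<forall>x\<in>?A. snd s ''key'' u \<le> snd s ''key'' x) \<and>
      heap_of K (?A - {u}) {} s' \<and> roots_of (?A - {u}) s' \<and> 2 * fst s' ''rn'' 0 \<le> ?R + 6 * L \<and>
      fst s' ''st'' = (fst s ''st'')(u := 2) \<and>
      fst s' ''ord'' = (fst s ''ord'')(fst s ''cnt'' 0 := u) \<and> fst s' ''cnt'' 0 = Suc (fst s ''cnt'' 0))
    s (19 * ?R + 63 * L + 15)"
      by (rule wp_extract_min[OF h r refl]) (use bv live_sub[of s] st in \<open>auto simp: static_def\<close>)
    have ne: "?A \<noteq> {}" using r bv by (auto simp: roots_def)
    then obtain u0 where u0: "u0 \<in> ?A" by blast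
    have "?f u0 \<le> sum ?f {v. v < n \<and> fst s ''st'' v \<noteq> 2}"
      by (rule member_le_sum) (use u0 A_sub fin in auto)
    then have n1: "19 * ?R + 63 * L + 15 \<le> n' - 1" "1 \<le> n'" using J unfolding potential_def by linarith+
    have "wp (extract_min ;; scan) ?I s (n' - 1)"
      unfolding wp_Seq
    proof (rule wp_use[OF ex n1(1)], elim bexE conjE)
      fix s1 n2 u
      assume fr: "frame extract_min s s1" and n2: "n' - 1 \<le> n2 + (19 * ?R + 63 * L + 15)" and uA: "u \<in> ?A"
        and u: "fst s1 ''u'' 0 = u" and min: "\<forall>x\<in>?A. snd s ''key'' u \<le> snd s ''key'' x"
        and h1: "heap_of K (?A - {u}) {} s1" and r1: "roots_of (?A - {u}) s1"
        and R1: "2 * fst s1 ''rn'' 0 \<le> ?R + 6 * L" and st1: "fst s1 ''st'' = (fst s ''st'')(u := 2)"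
        and ord1: "fst s1 ''ord'' = (fst s ''ord'')(fst s ''cnt'' 0 := u)"
        and cnt1: "fst s1 ''cnt'' 0 = Suc (fst s ''cnt'' 0)"
      note f = frameD1[OF fr, unfolded extract_min_def find_min_def remove_min_def consolidate_def
          pair_root_def, simplified] frameD2[OF fr, unfolded extract_min_def find_min_def remove_min_def
          consolidate_def pair_root_def, simplified]
      have un: "u < n" "fst s ''st'' u = 1" using uA by (auto simp: live_def)
      have lv: "live n s1 = ?A - {u}" using un by (auto simp: live_def st1)
      have g1: "search_inv n m a b c mu sd (fst s1 ''st'') (snd s1 ''key'') (fst s1 ''pe'') (fst s1 ''ord'')
          (fst s1 ''cnt'' 0) (all_scanned n m a b (fst s ''st''))"
        unfolding st1 ord1 cnt1
        using search_inv_extract[OF g _ un _ ab] min by (simp add: f all_scanned_def live_def)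
      have sc: "all_scanned n m a b (fst s ''st'') = (\<lambda>x j. all_scanned n m a b (fst s1 ''st'') x j \<and> x \<noteq> u)"
        using un by (auto simp: fun_eq_iff all_scanned_def st1)
      have I1: "sinv (\<lambda>x j. all_scanned n m a b (fst s1 ''st'') x j \<and> x \<noteq> u) s1"
        using h1 r1 g1 st unfolding sinv_def lv sc by (simp add: static_def strided_def f)
      have dn: "{v. v < n \<and> fst s1 ''st'' v \<noteq> 2} = {v. v < n \<and> fst s ''st'' v \<noteq> 2} - {u}"
        by (auto simp: st1)
      have sm: "sum ?f {v. v < n \<and> fst s ''st'' v \<noteq> 2} = ?f u + sum ?f {v. v < n \<and> fst s1 ''st'' v \<noteq> 2}"
        unfolding dn using un by (intro sum.remove) auto
      have mark1: "fst s1 ''mark'' = fst s ''mark''" by (simp add: f)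
      have mk: "sum (fst s1 ''mark'') (live n s1) \<le> sum (fst s ''mark'') ?A"
        unfolding lv mark1 by (rule sum_mono2) (use live_sub[of s] in auto)
      have "potential n s1 + 130 * dg u + 2 + (sum ?f {v. v < n \<and> fst s1 ''st'' v \<noteq> 2} + 1) \<le> n2"
        using n2 J sm mk R1 unfolding potential_def by linarith
      moreover have "fst s1 ''st'' u = 2" by (simp add: st1)
      ultimately have "wp scan (\<lambda>s' n'. sinv (all_scanned n m a b (fst s' ''st'')) s' \<and>
        (\<forall>x. fst s' ''st'' x = 2 \<longleftrightarrow> fst s1 ''st'' x = 2) \<and>
        potential n s' + (sum ?f {v. v < n \<and> fst s1 ''st'' v \<noteq> 2} + 1) \<le> n') s1 n2"
        by (intro wp_scan[OF I1 u un(1)])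
      then show "wp scan ?I s1 n2"
        by (rule wp_mono) (simp add: add.assoc)
    qed
    then show "1 \<le> n' \<and> wp (extract_min ;; scan) ?I s (n' - 1)" using n1 by blast
  next
    fix s n' assume J: "?I s n'" and bv: "\<not> bval (NLess (NConst 0) (rd ''rn'')) s"
    have "live n s = {}"
    proof (rule ccontr)
      assume "live n s \<noteq> {}"
      then obtain x where "x \<in> live n s" by blast
      moreover have "heap_of K (live n s) {} s" using J by (simp add: sinv_def)
      ultimately obtain y where "y \<in> live n s" "fst s ''par'' y = 0" using heap_root_above by blast
      moreover have "roots_of (live n s) s" using J by (simp add: sinv_def)
      ultimately show False using bv by (auto simp: roots_def)
    qed
    then show "1 \<le> n' \<and> sinv (all_scanned n m a b (fst s ''st'')) s \<and> (\<forall>v<n. fst s ''st'' v \<noteq> 1)"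
      using J by (auto simp: live_def)
  qed
qed

end

text \<open>\<open>acc\<close> runs through the multiples of \<open>n + 2 * m\<close> by addition. A
  row of this length holds the children of a heap element, at most \<open>n\<close>, and likewise an
  adjacency list, at most \<open>2 * m\<close> entries.\<close>

definition init_vertex :: com where
  "init_vertex = NWrite ''base'' (rd ''i'') (rd ''acc'') ;;
     upd ''acc'' (NAdd (rd ''acc'') (NAdd (rd ''n'') (NAdd (rd ''m'') (rd ''m'')))) ;;
     NWrite ''dg'' (rd ''i'') (NConst 0) ;;
     NWrite ''st'' (rd ''i'') (NConst 0) ;;
     NWrite ''pe'' (rd ''i'') (NConst 0) ;;
     RWrite ''key'' (rd ''i'') (RConst 0) ;;
     Cond (NLess (NConst 0) (NRead ''seed'' (rd ''i'')))
      (NWrite ''st'' (rd ''i'') (NConst 1) ;;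
       NWrite ''par'' (rd ''i'') (NConst 0) ;;
       NWrite ''deg'' (rd ''i'') (NConst 0) ;;
       NWrite ''mark'' (rd ''i'') (NConst 0) ;;
       NWrite ''rt'' (rd ''rn'') (rd ''i'') ;;
       upd ''rn'' (NAdd (rd ''rn'') (NConst 1)))
      Skip"

definition search_init :: com where
  "search_init = upd ''acc'' (NConst 0) ;; upd ''rn'' (NConst 0) ;; upd ''cnt'' (NConst 0) ;;
     For ''i'' (rd ''n'') init_vertex"

definition push_adj :: "nexp \<Rightarrow> com" where
  "push_adj x = NWrite ''adj'' (NAdd (NRead ''base'' x) (NRead ''dg'' x)) (rd ''j'') ;;
     NWrite ''dg'' x (NAdd (NRead ''dg'' x) (NConst 1))"

definition build_adj :: com where
  "build_adj = For ''j'' (rd ''m'')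
     (push_adj (NRead ''a'' (rd ''j'')) ;; push_adj (NRead ''b'' (rd ''j'')))"

definition search :: com where
  "search = search_init ;; build_adj ;; search_loop"

definition adj_set :: "nat \<Rightarrow> (nat \<Rightarrow> nat) \<Rightarrow> (nat \<Rightarrow> nat) \<Rightarrow> nat \<Rightarrow> nat set" where
  "adj_set K adj dg v = (\<lambda>i. adj (v * K + i)) ` {..<dg v}"

lemma adj_set_push:
  assumes "dg v \<le> K" "dg x < K"
  shows "adj_set K (adj(x * K + dg x := j)) (dg(x := Suc (dg x))) v =
    (if v = x then insert j (adj_set K adj dg v) else adj_set K adj dg v)"
proof -
  have *: "(adj(x * K + dg x := j)) (v * K + i) = adj (v * K + i)" if "i < dg v" for i
    using stride_eq_iff[of i K "dg x" v x] assms that by auto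
  then have e: "(\<lambda>i. (adj(x * K + dg x := j)) (v * K + i)) ` {..<dg v} = adj_set K adj dg v"
    unfolding adj_set_def by (intro image_cong) auto
  show ?thesis
  proof (cases "v = x")
    case True
    then have "adj_set K (adj(x * K + dg x := j)) (dg(x := Suc (dg x))) v =
        insert j ((\<lambda>i. (adj(x * K + dg x := j)) (v * K + i)) ` {..<dg v})"
      by (simp only: adj_set_def fun_upd_same lessThan_Suc image_insert)
    then show ?thesis using True e by simp
  next
    case False
    then have "adj_set K (adj(x * K + dg x := j)) (dg(x := Suc (dg x))) v =
        (\<lambda>i. (adj(x * K + dg x := j)) (v * K + i)) ` {..<dg v}" by (simp add: adj_set_def)
    then show ?thesis using False e by simp
  qed
qed

lemma sum_increment:
  fixes f :: "nat \<Rightarrow> nat"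
  assumes "x < n"
  shows "sum (f(x := Suc (f x))) {..<n} = Suc (sum f {..<n})"
  using assms by (simp add: sum.remove[of "{..<n}" x])

text \<open>The total length of all lists, two entries per edge, also bounds every single list and
  so keeps the addresses within their rows.\<close>

lemma wp_build_adj:
  assumes m: "fst s ''m'' 0 = m" and ab: "\<And>j. j < m \<Longrightarrow> fst s ''a'' j < n \<and> fst s ''b'' j < n"
    and K: "2 * m \<le> K" and st: "strided n K s" and dg: "\<And>v. v < n \<Longrightarrow> fst s ''dg'' v = 0"
  shows "wp build_adj (\<lambda>s' _. sum (fst s' ''dg'') {..<n} = 2 * m \<and>
      (\<forall>v<n. adj_set K (fst s' ''adj'') (fst s' ''dg'') v =
        {j. j < m \<and> incident (fst s ''a'') (fst s ''b'') j v})) s (6 * m + 2)"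
  unfolding build_adj_def
proof -
  let ?c = "push_adj (NRead ''a'' (rd ''j'')) ;; push_adj (NRead ''b'' (rd ''j''))"
  let ?F = "For ''j'' (rd ''m'') ?c"
  let ?I = "\<lambda>k s'. sum (fst s' ''dg'') {..<n} = 2 * k \<and>
      (\<forall>v<n. adj_set K (fst s' ''adj'') (fst s' ''dg'') v =
        {j. j < k \<and> incident (fst s ''a'') (fst s ''b'') j v})"
  show "wp ?F (\<lambda>s' _. ?I m s') s (6 * m + 2)"
  proof (rule wp_For[where I = ?I and N = m and K = 4])
    show "?I 0 (nwrite ''j'' 0 0 s)" using dg by (simp add: adj_set_def)
  next
    fix k s' assume k: "k < m" and I: "?I k s'" and i: "fst s' ''j'' 0 = k" and fr: "frame ?F s s'"
    note f = frameD1[OF fr, unfolded push_adj_def, simplified]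
    define x y where "x = fst s ''a'' k" and "y = fst s ''b'' k"
    define dg0 adj0 where "dg0 = fst s' ''dg''" and "adj0 = fst s' ''adj''"
    define dg1 adj1 where "dg1 = dg0(x := Suc (dg0 x))" and "adj1 = adj0(x * K + dg0 x := k)"
    define dg2 adj2 where "dg2 = dg1(y := Suc (dg1 y))" and "adj2 = adj1(y * K + dg1 y := k)"
    have xy: "x < n" "y < n" using ab[OF k] by (auto simp: x_def y_def)
    have s0: "sum dg0 {..<n} = 2 * k" using I by (simp add: dg0_def)
    have s1: "sum dg1 {..<n} = Suc (2 * k)" using sum_increment[OF xy(1)] s0 by (simp add: dg1_def)
    have s2: "sum dg2 {..<n} = 2 * Suc k" using sum_increment[OF xy(2)] s1 by (simp add: dg2_def)
    have le: "f v \<le> sum f {..<n}" if "v < n" for f :: "nat \<Rightarrow> nat" and v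
      by (rule member_le_sum) (use that in auto)
    have d0: "dg0 v < K" if "v < n" for v using le[OF that, of dg0] s0 k K by linarith
    have d1: "dg1 v < K" if "v < n" for v using le[OF that, of dg1] s1 k K by linarith
    have "adj_set K adj2 dg2 v = {j. j < Suc k \<and> incident (fst s ''a'') (fst s ''b'') j v}" if v: "v < n" for v
    proof -
      have "adj_set K adj0 dg0 v = {j. j < k \<and> incident (fst s ''a'') (fst s ''b'') j v}"
        using I v by (simp add: dg0_def adj0_def)
      moreover have "adj_set K adj1 dg1 v = (if v = x then insert k (adj_set K adj0 dg0 v) else adj_set K adj0 dg0 v)"
        unfolding adj1_def dg1_def by (rule adj_set_push) (use d0 v xy less_imp_le in auto)
      moreover have "adj_set K adj2 dg2 v = (if v = y then insert k (adj_set K adj1 dg1 v) else adj_set K adj1 dg1 v)"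
        unfolding adj2_def dg2_def by (rule adj_set_push) (use d1 v xy less_imp_le in auto)
      ultimately show ?thesis by (auto simp: incident_def x_def y_def less_Suc_eq)
    qed
    moreover have "fst s' ''base'' x = x * K" "fst s' ''base'' y = y * K"
      using st xy by (auto simp: strided_def f)
    ultimately show "wp ?c (\<lambda>s'' _. fst s'' ''j'' 0 = k \<and> ?I (Suc k) (nwrite ''j'' 0 (Suc k) s'')) s' 4"
      using s2 i unfolding dg2_def adj2_def dg1_def adj1_def
      by (simp add: push_adj_def wp_simps f x_def[symmetric] y_def[symmetric] dg0_def[symmetric] adj0_def[symmetric]
          del: sum.lessThan_Suc fun_upd_apply)
  next
    fix k s' assume fr: "frame ?F s s'"
    show "nval (rd ''m'') s' = m" using m by (simp add: frameD1[OF fr] push_adj_def)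
  qed simp_all
qed

lemma wp_search_init:
  assumes n: "fst s ''n'' 0 = n" and m: "fst s ''m'' 0 = m" and K: "K = n + 2 * m"
  shows "wp search_init (\<lambda>s' _. strided n K s' \<and> fst s' ''cnt'' 0 = 0 \<and> fst s' ''rn'' 0 \<le> n \<and>
      roots {v. v < n \<and> 0 < fst s ''seed'' v} (fst s' ''par'') (fst s' ''rt'') {..<fst s' ''rn'' 0} \<and>
      (\<forall>v<n. fst s' ''dg'' v = 0 \<and> fst s' ''pe'' v = 0 \<and> snd s' ''key'' v = 0 \<and>
        fst s' ''st'' v = (if 0 < fst s ''seed'' v then 1 else 0) \<and>
        (0 < fst s ''seed'' v \<longrightarrow> fst s' ''par'' v = 0 \<and> fst s' ''deg'' v = 0 \<and> fst s' ''mark'' v = 0)))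
    s (15 * n + 5)"
proof -
  let ?F = "For ''i'' (rd ''n'') init_vertex"
  let ?s = "nwrite ''cnt'' 0 0 (nwrite ''rn'' 0 0 (nwrite ''acc'' 0 0 s))"
  let ?I = "\<lambda>k (s'::state). fst s' ''acc'' 0 = k * K \<and> fst s' ''cnt'' 0 = 0 \<and> fst s' ''rn'' 0 \<le> k \<and>
      inj_on (fst s' ''rt'') {..<fst s' ''rn'' 0} \<and>
      fst s' ''rt'' ` {..<fst s' ''rn'' 0} = {v. v < k \<and> 0 < fst s ''seed'' v} \<and>
      (\<forall>v<k. fst s' ''base'' v = v * K \<and> fst s' ''dg'' v = 0 \<and> fst s' ''pe'' v = 0 \<and> snd s' ''key'' v = 0 \<and>
        fst s' ''st'' v = (if 0 < fst s ''seed'' v then 1 else 0) \<and>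
        (0 < fst s ''seed'' v \<longrightarrow> fst s' ''par'' v = 0 \<and> fst s' ''deg'' v = 0 \<and> fst s' ''mark'' v = 0))"
  let ?Q = "\<lambda>s'::state. strided n K s' \<and> fst s' ''cnt'' 0 = 0 \<and> fst s' ''rn'' 0 \<le> n \<and>
      roots {v. v < n \<and> 0 < fst s ''seed'' v} (fst s' ''par'') (fst s' ''rt'') {..<fst s' ''rn'' 0} \<and>
      (\<forall>v<n. fst s' ''dg'' v = 0 \<and> fst s' ''pe'' v = 0 \<and> snd s' ''key'' v = 0 \<and>
        fst s' ''st'' v = (if 0 < fst s ''seed'' v then 1 else 0) \<and>
        (0 < fst s ''seed'' v \<longrightarrow> fst s' ''par'' v = 0 \<and> fst s' ''deg'' v = 0 \<and> fst s' ''mark'' v = 0))"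
  have "wp ?F (\<lambda>s' _. ?Q s') ?s (15 * n + 2)"
  proof (rule wp_For[where I = ?I and N = n and K = 13])
    show "?I 0 (nwrite ''i'' 0 0 ?s)" by simp
  next
    fix k s' assume k: "k < n" and I: "?I k s'" and i: "fst s' ''i'' 0 = k" and fr: "frame ?F ?s s'"
    note f = frameD1[OF fr, unfolded init_vertex_def, simplified]
    have acc: "fst s' ''acc'' 0 + (n + (m + m)) = Suc k * K" using I K by simp
    let ?rt = "(fst s' ''rt'')(fst s' ''rn'' 0 := k)"
    have inj: "inj_on ?rt {..<Suc (fst s' ''rn'' 0)}" if "0 < fst s ''seed'' k"
    proof -
      have "k \<notin> fst s' ''rt'' ` {..<fst s' ''rn'' 0}" using I by auto
      then show ?thesis using I by (auto simp: inj_on_def lessThan_Suc)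
    qed
    have img: "?rt ` {..<Suc (fst s' ''rn'' 0)} = {v. v < Suc k \<and> 0 < fst s ''seed'' v}" if "0 < fst s ''seed'' k"
    proof -
      have "?rt ` {..<Suc (fst s' ''rn'' 0)} = insert k (fst s' ''rt'' ` {..<fst s' ''rn'' 0})"
        by (auto simp: lessThan_Suc)
      then show ?thesis using I that by (auto simp: less_Suc_eq)
    qed
    have img': "{v. v < k \<and> 0 < fst s ''seed'' v} = {v. v < Suc k \<and> 0 < fst s ''seed'' v}"
      if "fst s ''seed'' k = 0" using that by (auto simp: less_Suc_eq)
    show "wp init_vertex (\<lambda>s'' _. fst s'' ''i'' 0 = k \<and> ?I (Suc k) (nwrite ''i'' 0 (Suc k) s'')) s' 13"
    proof (cases "0 < fst s ''seed'' k")
      case True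
      have old: "\<forall>v<k. v \<noteq> k" by simp
      have "?I (Suc k) (nwrite ''i'' 0 (Suc k) (nwrite ''rn'' 0 (Suc (fst s' ''rn'' 0))
        (nwrite ''rt'' (fst s' ''rn'' 0) k (nwrite ''mark'' k 0 (nwrite ''deg'' k 0 (nwrite ''par'' k 0
        (nwrite ''st'' k 1 (rwrite ''key'' k 0 (nwrite ''pe'' k 0 (nwrite ''st'' k 0 (nwrite ''dg'' k 0
        (nwrite ''acc'' 0 (fst s' ''acc'' 0 + (n + (m + m))) (nwrite ''base'' k (fst s' ''acc'' 0) s')))))))))))))"
        using I True acc inj[OF True] img[OF True]
        by (simp add: less_Suc_eq del: fun_upd_apply) (auto simp: less_Suc_eq)
      then show ?thesis using True i n m by (simp add: init_vertex_def wp_simps f del: fun_upd_apply)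
    next
      case False
      have "?I (Suc k) (nwrite ''i'' 0 (Suc k) (rwrite ''key'' k 0 (nwrite ''pe'' k 0 (nwrite ''st'' k 0 (nwrite ''dg'' k 0
        (nwrite ''acc'' 0 (fst s' ''acc'' 0 + (n + (m + m))) (nwrite ''base'' k (fst s' ''acc'' 0) s')))))))"
        using I False acc img' by (auto simp: less_Suc_eq)
      then show ?thesis using False i n m by (simp add: init_vertex_def wp_simps f del: fun_upd_apply)
    qed
  next
    fix k s' assume fr: "frame ?F ?s s'"
    show "nval (rd ''n'') s' = n" using n by (simp add: frameD1[OF fr] init_vertex_def)
  next
    fix s' assume I: "?I n s'"
    have "{v. v < n \<and> 0 < fst s ''seed'' v} = {x \<in> {v. v < n \<and> 0 < fst s ''seed'' v}. fst s' ''par'' x = 0}"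
      using I by auto
    then show "?Q s'" using I by (auto simp: strided_def roots_def)
  qed simp
  then show ?thesis by (simp add: search_init_def wp_simps)
qed

definition search_result :: "nat \<Rightarrow> nat \<Rightarrow> (nat \<Rightarrow> nat) \<Rightarrow> (nat \<Rightarrow> nat) \<Rightarrow> (nat \<Rightarrow> real) \<Rightarrow> real \<Rightarrow> (nat \<Rightarrow> nat) \<Rightarrow>
    state \<Rightarrow> bool" where
  "search_result n m a b c mu sd s \<longleftrightarrow>
     search_inv n m a b c mu sd (fst s ''st'') (snd s ''key'') (fst s ''pe'') (fst s ''ord'') (fst s ''cnt'' 0)
       (all_scanned n m a b (fst s ''st'')) \<and> (\<forall>v<n. fst s ''st'' v \<noteq> 1)"

text \<open>Initially the seeds are unmarked roots, a potential of at most \<open>40 * n\<close>.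
  Initialisation adds \<open>15 * n\<close>, the extractions \<open>183 * (n * L) + 20 * n\<close>,
  and building and scanning the lists \<open>6 * m\<close> and \<open>260 * m\<close>, as their
  lengths sum to \<open>2 * m\<close>. The stated coefficients round these up.\<close>

lemma wp_search:
  assumes n: "fst s ''n'' 0 = n" and m: "fst s ''m'' 0 = m" and L: "n < 2 ^ L"
    and ab: "\<And>j. j < m \<Longrightarrow> fst s ''a'' j < n \<and> fst s ''b'' j < n"
    and c: "\<And>j. j < m \<Longrightarrow> 0 \<le> snd s ''cost'' j" and mu: "0 \<le> snd s ''mult'' 0"
  shows "wp search (\<lambda>s' _. search_result n m (fst s ''a'') (fst s ''b'') (snd s ''cost'') (snd s ''mult'' 0)
      (fst s ''seed'') s') s (80 * n + 190 * (n * L) + 270 * m + 10)"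
proof -
  define K where "K = n + 2 * m"
  define N where "N = 80 * n + 190 * (n * L) + 270 * m + 10"
  have "wp search (\<lambda>s' _. search_result n m (fst s ''a'') (fst s ''b'') (snd s ''cost'') (snd s ''mult'' 0)
      (fst s ''seed'') s') s N"
    unfolding search_def wp_Seq
  proof (rule wp_use[OF wp_search_init[OF n m K_def]])
    show "15 * n + 5 \<le> N" by (simp add: N_def)
    fix s1 n1
    assume p1: "strided n K s1 \<and> fst s1 ''cnt'' 0 = 0 \<and> fst s1 ''rn'' 0 \<le> n \<and>
      roots {v. v < n \<and> 0 < fst s ''seed'' v} (fst s1 ''par'') (fst s1 ''rt'') {..<fst s1 ''rn'' 0} \<and>
      (\<forall>v<n. fst s1 ''dg'' v = 0 \<and> fst s1 ''pe'' v = 0 \<and> snd s1 ''key'' v = 0 \<and>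
        fst s1 ''st'' v = (if 0 < fst s ''seed'' v then 1 else 0) \<and>
        (0 < fst s ''seed'' v \<longrightarrow> fst s1 ''par'' v = 0 \<and> fst s1 ''deg'' v = 0 \<and> fst s1 ''mark'' v = 0))"
      and fr1: "frame search_init s s1" and n1: "N \<le> n1 + (15 * n + 5)"
    note f1 = frameD1[OF fr1, unfolded search_init_def init_vertex_def, simplified]
      frameD2[OF fr1, unfolded search_init_def init_vertex_def, simplified]
    have b1: "wp build_adj (\<lambda>s' _. sum (fst s' ''dg'') {..<n} = 2 * m \<and>
      (\<forall>v<n. adj_set K (fst s' ''adj'') (fst s' ''dg'') v =
        {j. j < m \<and> incident (fst s1 ''a'') (fst s1 ''b'') j v})) s1 (6 * m + 2)"
      by (rule wp_build_adj) (use p1 m ab K_def in \<open>auto simp: f1\<close>)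
    show "wp build_adj (wp search_loop (\<lambda>s' _. search_result n m (fst s ''a'') (fst s ''b'') (snd s ''cost'')
      (snd s ''mult'' 0) (fst s ''seed'') s')) s1 n1"
    proof (rule wp_use[OF b1])
      show "6 * m + 2 \<le> n1" using n1 by (simp add: N_def)
      fix s2 n2
      assume p2: "sum (fst s2 ''dg'') {..<n} = 2 * m \<and> (\<forall>v<n. adj_set K (fst s2 ''adj'') (fst s2 ''dg'') v =
        {j. j < m \<and> incident (fst s1 ''a'') (fst s1 ''b'') j v})"
        and fr2: "frame build_adj s1 s2" and n2: "n1 \<le> n2 + (6 * m + 2)"
      note f2 = frameD1[OF fr2, unfolded build_adj_def push_adj_def, simplified]
        frameD2[OF fr2, unfolded build_adj_def push_adj_def, simplified]
      interpret search_graph n m K L "fst s ''a''" "fst s ''b''" "snd s ''cost''" "snd s ''mult'' 0"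
        "fst s ''seed''" "fst s2 ''adj''" "fst s2 ''dg''"
      proof
        show "n \<le> K" by (simp add: K_def)
        show "(\<lambda>i. fst s2 ''adj'' (v * K + i)) ` {..<fst s2 ''dg'' v} =
          {j. j < m \<and> incident (fst s ''a'') (fst s ''b'') j v}" if "v < n" for v
          using p2 that by (simp add: adj_set_def f1)
      qed (use ab c mu L in auto)
      have lv: "live n s2 = {v. v < n \<and> 0 < fst s ''seed'' v}"
        using p1 by (auto simp: live_def f2 split: if_splits)
      have s2: "sinv (all_scanned n m (fst s ''a'') (fst s ''b'') (fst s2 ''st'')) s2"
        unfolding sinv_def lv
      proof (intro conjI)
        show "static s2" using p1 by (simp add: static_def f1 f2 strided_def)
        show "heap_of K {v. v < n \<and> 0 < fst s ''seed'' v} {} s2"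
          unfolding heap_def using p1 K_def by (auto simp: f2)
        show "roots {v. v < n \<and> 0 < fst s ''seed'' v} (fst s2 ''par'') (fst s2 ''rt'') {..<fst s2 ''rn'' 0}"
          using p1 by (simp add: f2)
        have st: "fst s2 ''st'' v = (if 0 < fst s ''seed'' v then 1 else 0)" if "v < n" for v
          using p1 that by (simp add: f2)
        have sm: "fst s2 ''pe'' v = 0" "snd s2 ''key'' v = 0" if "v < n" for v
          using p1 that by (simp_all add: f2)
        have cnt: "fst s2 ''cnt'' 0 = 0" using p1 by (simp add: f2)
        show "search_inv n m (fst s ''a'') (fst s ''b'') (snd s ''cost'') (snd s ''mult'' 0) (fst s ''seed'')
          (fst s2 ''st'') (snd s2 ''key'') (fst s2 ''pe'') (fst s2 ''ord'') (fst s2 ''cnt'' 0)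
          (all_scanned n m (fst s ''a'') (fst s ''b'') (fst s2 ''st''))"
          by unfold_locales (use st sm cnt in \<open>auto simp: all_scanned_def split: if_splits\<close>)
      qed
      have "sum (fst s2 ''mark'') (live n s2) = 0" unfolding lv using p1 by (auto simp: f2)
      then have pot: "potential n s2 \<le> 40 * n" using p1 by (simp add: potential_def f2)
      let ?f = "\<lambda>v. 183 * L + 20 + 130 * fst s2 ''dg'' v"
      have "sum ?f {v. v < n \<and> fst s2 ''st'' v \<noteq> 2} \<le> sum ?f {..<n}"
        by (rule sum_mono2) auto
      also have "\<dots> = n * (183 * L + 20) + 130 * sum (fst s2 ''dg'') {..<n}"
        by (simp add: sum.distrib sum_distrib_left)
      also have "\<dots> = 183 * (n * L) + 20 * n + 260 * m" using p2 by (simp add: algebra_simps)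
      finally have "potential n s2 + sum ?f {v. v < n \<and> fst s2 ''st'' v \<noteq> 2} + 1 \<le> n2"
        using pot n1 n2 unfolding N_def by linarith
      then show "wp search_loop (\<lambda>s' _. search_result n m (fst s ''a'') (fst s ''b'') (snd s ''cost'')
        (snd s ''mult'' 0) (fst s ''seed'') s') s2 n2"
        using wp_mono[OF wp_search_loop[OF s2]] by (simp add: search_result_def sinv_def)
    qed
  qed
  then show ?thesis unfolding N_def .
qed

section \<open>The program\<close>

definition load_edges :: com where
  "load_edges = For ''j'' (rd ''m'')
     (NWrite ''a'' (rd ''j'') (NRead ''src'' (rd ''j'')) ;;
      NWrite ''b'' (rd ''j'') (NRead ''dst'' (rd ''j'')) ;;
      Cond (NLess (NConst 0) (NRead ''predicted'' (rd ''j'')))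
        (RWrite ''cost'' (rd ''j'') (RDiv (RRead ''weight'' (rd ''j'')) (RRead ''alpha'' (NConst 0))))
        (RWrite ''cost'' (rd ''j'') (RRead ''weight'' (rd ''j''))))"

definition load_terminals :: com where
  "load_terminals = For ''i'' (rd ''n'') (NWrite ''seed'' (rd ''i'') (NRead ''terminal'' (rd ''i'')))"

text \<open>The second search overwrites \<open>pe\<close>, so the forest of the regions is copied
  to \<open>pe1\<close>. \<open>tv\<close> becomes some terminal, the root of the tree to be grown;
  it stays 0 if there is none.\<close>

definition save_search :: com where
  "save_search = upd ''tv'' (NConst 0) ;; For ''i'' (rd ''n'')
     (NWrite ''near'' (rd ''i'') (rd ''i'') ;;
      NWrite ''pe1'' (rd ''i'') (NRead ''pe'' (rd ''i'')) ;;
      NWrite ''need'' (rd ''i'') (NConst 0) ;;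
      NWrite ''seed'' (rd ''i'') (NConst 0) ;;
      Cond (NLess (NConst 0) (NRead ''terminal'' (rd ''i''))) (upd ''tv'' (rd ''i'')) Skip)"

text \<open>Parents precede their children in the order of extraction, so one pass suffices to hand
  the terminal at the root down through its region.\<close>

definition label_regions :: com where
  "label_regions = For ''i'' (rd ''cnt'')
     (upd ''v'' (NRead ''ord'' (rd ''i'')) ;;
      NWrite ''ord1'' (rd ''i'') (rd ''v'') ;;
      Cond (NLess (NConst 0) (NRead ''pe'' (rd ''v'')))
        (upd ''j'' (NSub (NRead ''pe'' (rd ''v'')) (NConst 1)) ;;
         NWrite ''near'' (rd ''v'') (NRead ''near''
           (NSub (NAdd (NRead ''a'' (rd ''j'')) (NRead ''b'' (rd ''j''))) (rd ''v''))))
        Skip)"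

text \<open>The new cost reads the keys at the original ends and is therefore computed before the
  ends are replaced. Vertex numbers are kept: a region is represented by its terminal, and edges
  inside a region become loops.\<close>

definition contract_regions :: com where
  "contract_regions = For ''j'' (rd ''m'')
     (RWrite ''cost'' (rd ''j'') (RAdd (RAdd (RRead ''key'' (NRead ''a'' (rd ''j''))) (RRead ''cost'' (rd ''j'')))
        (RRead ''key'' (NRead ''b'' (rd ''j'')))) ;;
      NWrite ''a'' (rd ''j'') (NRead ''near'' (NRead ''a'' (rd ''j''))) ;;
      NWrite ''b'' (rd ''j'') (NRead ''near'' (NRead ''b'' (rd ''j''))) ;;
      NWrite ''sol'' (rd ''j'') (NConst 0))"

definition collect_edges :: com where
  "collect_edges = For ''i'' (rd ''n'')
     (Cond (NLess (NConst 0) (NRead ''pe'' (rd ''i'')))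
       (upd ''j'' (NSub (NRead ''pe'' (rd ''i'')) (NConst 1)) ;;
        NWrite ''sol'' (rd ''j'') (NConst 1) ;;
        NWrite ''need'' (NRead ''src'' (rd ''j'')) (NConst 1) ;;
        NWrite ''need'' (NRead ''dst'' (rd ''j'')) (NConst 1))
       Skip)"

text \<open>Running backwards through the order of extraction, a vertex is reached after all its
  children and so has received its flag before it passes it on. Shared parts of paths are walked
  once, which makes the total time linear.\<close>

definition trace_paths :: com where
  "trace_paths = For ''i'' (rd ''cnt1'')
     (upd ''v'' (NRead ''ord1'' (NSub (rd ''cnt1'') (NAdd (rd ''i'') (NConst 1)))) ;;
      Cond (BAnd (NLess (NConst 0) (NRead ''need'' (rd ''v''))) (NLess (NConst 0) (NRead ''pe1'' (rd ''v''))))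
       (upd ''j'' (NSub (NRead ''pe1'' (rd ''v'')) (NConst 1)) ;;
        NWrite ''sol'' (rd ''j'') (NConst 1) ;;
        NWrite ''need'' (NSub (NAdd (NRead ''src'' (rd ''j'')) (NRead ''dst'' (rd ''j''))) (rd ''v'')) (NConst 1))
       Skip)"

definition weigh :: com where
  "weigh = RWrite ''wt'' (NConst 0) (RConst 0) ;; For ''j'' (rd ''m'')
     (Cond (NLess (NConst 0) (NRead ''sol'' (rd ''j'')))
       (RWrite ''wt'' (NConst 0) (RAdd (RRead ''wt'' (NConst 0)) (RRead ''weight'' (rd ''j'')))) Skip)"

lemma wp_load_edges:
  assumes m: "fst s ''m'' 0 = m"
  shows "wp load_edges (\<lambda>s' _. \<forall>j<m. fst s' ''a'' j = fst s ''src'' j \<and> fst s' ''b'' j = fst s ''dst'' j \<and>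
      snd s' ''cost'' j = (if 0 < fst s ''predicted'' j then snd s ''weight'' j / snd s ''alpha'' 0
        else snd s ''weight'' j)) s (6 * m + 2)"
  unfolding load_edges_def
  by (rule wp_For[where N = m and K = 4 and I = "\<lambda>k s'. \<forall>j<k. fst s' ''a'' j = fst s ''src'' j \<and>
      fst s' ''b'' j = fst s ''dst'' j \<and> snd s' ''cost'' j = (if 0 < fst s ''predicted'' j
        then snd s ''weight'' j / snd s ''alpha'' 0 else snd s ''weight'' j)"])
    (use m in \<open>auto simp: wp_simps frame_def less_Suc_eq\<close>)

lemma wp_load_terminals:
  assumes n: "fst s ''n'' 0 = n"
  shows "wp load_terminals (\<lambda>s' _. \<forall>i<n. fst s' ''seed'' i = fst s ''terminal'' i) s (3 * n + 2)"
  unfolding load_terminals_def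
  by (rule wp_For[where N = n and K = 1 and I = "\<lambda>k s'. \<forall>i<k. fst s' ''seed'' i = fst s ''terminal'' i"])
    (use n in \<open>auto simp: wp_simps frame_def less_Suc_eq\<close>)

lemma wp_save_search:
  assumes n: "fst s ''n'' 0 = n"
  shows "wp save_search (\<lambda>s' _. (\<forall>i<n. fst s' ''near'' i = i \<and> fst s' ''pe1'' i = fst s ''pe'' i \<and>
      fst s' ''need'' i = 0 \<and> fst s' ''seed'' i = 0) \<and>
      (\<forall>v<n. 0 < fst s ''terminal'' v \<longrightarrow> fst s' ''tv'' 0 < n \<and> 0 < fst s ''terminal'' (fst s' ''tv'' 0))) s (8 * n + 3)"
proof -
  let ?s = "nwrite ''tv'' 0 0 s"
  have "wp (For ''i'' (rd ''n'')
     (NWrite ''near'' (rd ''i'') (rd ''i'') ;;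
      NWrite ''pe1'' (rd ''i'') (NRead ''pe'' (rd ''i'')) ;;
      NWrite ''need'' (rd ''i'') (NConst 0) ;;
      NWrite ''seed'' (rd ''i'') (NConst 0) ;;
      Cond (NLess (NConst 0) (NRead ''terminal'' (rd ''i''))) (upd ''tv'' (rd ''i'')) Skip))
    (\<lambda>s' _. (\<forall>i<n. fst s' ''near'' i = i \<and> fst s' ''pe1'' i = fst s ''pe'' i \<and>
      fst s' ''need'' i = 0 \<and> fst s' ''seed'' i = 0) \<and>
      (\<forall>v<n. 0 < fst s ''terminal'' v \<longrightarrow> fst s' ''tv'' 0 < n \<and> 0 < fst s ''terminal'' (fst s' ''tv'' 0))) ?s (8 * n + 2)"
    by (rule wp_For[where N = n and K = 6 and I = "\<lambda>k s'. (\<forall>i<k. fst s' ''near'' i = i \<and>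
      fst s' ''pe1'' i = fst s ''pe'' i \<and> fst s' ''need'' i = 0 \<and> fst s' ''seed'' i = 0) \<and>
      (\<forall>v<k. 0 < fst s ''terminal'' v \<longrightarrow> fst s' ''tv'' 0 < n \<and> 0 < fst s ''terminal'' (fst s' ''tv'' 0))"])
     (use n in \<open>auto simp: wp_simps frame_def less_Suc_eq\<close>)
  then show ?thesis by (simp add: save_search_def wp_simps)
qed

lemma wp_label_regions:
  assumes g: "search_inv n m (fst s ''a'') (fst s ''b'') c mu sd st key (fst s ''pe'') (fst s ''ord'')
      (fst s ''cnt'' 0) sc"
    and near: "\<forall>i<n. fst s ''near'' i = i"
  shows "wp label_regions (\<lambda>s' _. (\<forall>i<fst s ''cnt'' 0. fst s' ''ord1'' i = fst s ''ord'' i) \<and>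
      (\<forall>v<n. fst s' ''near'' v < n \<and> (st v \<noteq> 1 \<longrightarrow> fst s' ''near'' v = (if fst s ''pe'' v = 0 then v
        else fst s' ''near'' (other (fst s ''a'') (fst s ''b'') (fst s ''pe'' v - 1) v))))) s (7 * n + 2)"
proof -
  let ?c = "upd ''v'' (NRead ''ord'' (rd ''i'')) ;;
      NWrite ''ord1'' (rd ''i'') (rd ''v'') ;;
      Cond (NLess (NConst 0) (NRead ''pe'' (rd ''v'')))
        (upd ''j'' (NSub (NRead ''pe'' (rd ''v'')) (NConst 1)) ;;
         NWrite ''near'' (rd ''v'') (NRead ''near''
           (NSub (NAdd (NRead ''a'' (rd ''j'')) (NRead ''b'' (rd ''j''))) (rd ''v''))))
        Skip"
  let ?F = "For ''i'' (rd ''cnt'') ?c"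
  let ?ord = "fst s ''ord''" and ?pe = "fst s ''pe''" and ?cnt = "fst s ''cnt'' 0"
  let ?par = "\<lambda>v. other (fst s ''a'') (fst s ''b'') (?pe v - 1) v"
  let ?I = "\<lambda>k (s'::state). (\<forall>i<k. fst s' ''ord1'' i = ?ord i) \<and> (\<forall>v<n. fst s' ''near'' v < n) \<and>
      (\<forall>v<n. ?pe v = 0 \<longrightarrow> fst s' ''near'' v = v) \<and>
      (\<forall>i<k. ?pe (?ord i) \<noteq> 0 \<longrightarrow> fst s' ''near'' (?ord i) = fst s' ''near'' (?par (?ord i)))"
  note g = search_invD[OF g]
  have ord_n: "?ord i < n" if "i < ?cnt" for i using g(2) that by blast
  have cn: "?cnt \<le> n"
  proof -
    have "card (?ord ` {..<?cnt}) \<le> card {..<n}" using ord_n by (intro card_mono) auto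
    then show ?thesis using card_image[OF g(1)] by simp
  qed
  have "wp ?F (\<lambda>s' _. ?I ?cnt s') s (7 * ?cnt + 2)"
  proof (rule wp_For[where I = ?I and N = ?cnt and K = 5])
    show "?I 0 (nwrite ''i'' 0 0 s)" using near by simp
  next
    fix k s' assume k: "k < ?cnt" and I: "?I k s'" and i: "fst s' ''i'' 0 = k" and fr: "frame ?F s s'"
    let ?v = "?ord k"
    note f = frameD1[OF fr, simplified]
    have v: "?v < n" using ord_n[OF k] .
    show "wp ?c (\<lambda>s'' _. fst s'' ''i'' 0 = k \<and> ?I (Suc k) (nwrite ''i'' 0 (Suc k) s'')) s' 5"
    proof (cases "?pe ?v = 0")
      case True
      then show ?thesis using I i by (simp add: wp_simps f less_Suc_eq)
    next
      case False
      have p: "?par ?v \<in> ?ord ` {..<k}" using g(8)[OF k False] .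
      have old: "?ord i \<noteq> ?v" if "i < k" for i using inj_onD[OF g(1), of i k] that k by auto
      obtain i' where i': "i' < k" "?par ?v = ?ord i'" using p by blast
      have pn: "?par ?v < n" "?par ?v \<noteq> ?v" unfolding i'(2) using ord_n[of i'] old[of i'] i'(1) k by auto
      \<comment> \<open>\<open>ord k\<close> is neither an earlier vertex nor the parent of one, so
        writing its label leaves the equations already established intact.\<close>
      have oldp: "?par (?ord i) \<noteq> ?v" if "i < k" "?pe (?ord i) \<noteq> 0" for i
      proof -
        have "?par (?ord i) \<in> ?ord ` {..<i}" using g(8) that k by simp
        then obtain l where "l < i" "?par (?ord i) = ?ord l" by blast
        then show ?thesis using old[of l] that by simp
      qed
      define near' where "near' = (fst s' ''near'')(?v := fst s' ''near'' (?par ?v))"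
      have n1: "\<forall>v<n. near' v < n" using I pn by (simp add: near'_def)
      have n2: "\<forall>v<n. ?pe v = 0 \<longrightarrow> near' v = v" using I False by (auto simp: near'_def)
      have n3: "\<forall>i<Suc k. ?pe (?ord i) \<noteq> 0 \<longrightarrow> near' (?ord i) = near' (?par (?ord i))"
      proof (intro allI impI)
        fix i assume i: "i < Suc k" "?pe (?ord i) \<noteq> 0"
        show "near' (?ord i) = near' (?par (?ord i))"
        proof (cases "i = k")
          case True
          then show ?thesis using pn by (simp add: near'_def)
        next
          case False
          then have "i < k" using i by simp
          then show ?thesis using I i old[of i] oldp[of i] by (simp add: near'_def)
        qed
      qed
      have "fst s' ''near'' (fst s ''a'' (?pe ?v - Suc 0) + fst s ''b'' (?pe ?v - Suc 0) - ?v) = fst s' ''near'' (?par ?v)"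
        by (simp add: other_def)
      then show ?thesis using I i False n1 n2 n3 unfolding near'_def
        by (simp add: wp_simps f less_Suc_eq)
    qed
  next
    fix k s' assume fr: "frame ?F s s'"
    show "nval (rd ''cnt'') s' = ?cnt" by (simp add: frameD1[OF fr])
  qed simp_all
  then show ?thesis
    unfolding label_regions_def
  proof (rule wp_use)
    show "7 * ?cnt + 2 \<le> 7 * n + 2" using cn by simp
    fix s' n' assume I: "?I ?cnt s'"
    have "fst s' ''near'' v = (if ?pe v = 0 then v else fst s' ''near'' (?par v))"
      if v: "v < n" "st v \<noteq> 1" for v
    proof (cases "?pe v = 0")
      case True
      then show ?thesis using I v by simp
    next
      case False
      then have "st v \<noteq> 0" using g(7)[OF v(1)] by auto
      then have "st v = 2" using g(3)[OF v(1)] v(2) by linarith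
      then have "v \<in> ?ord ` {..<?cnt}" using g(2) v by auto
      then show ?thesis using I False by auto
    qed
    then show "(\<forall>i<?cnt. fst s' ''ord1'' i = fst s ''ord'' i) \<and>
      (\<forall>v<n. fst s' ''near'' v < n \<and> (st v \<noteq> 1 \<longrightarrow> fst s' ''near'' v = (if fst s ''pe'' v = 0 then v
        else fst s' ''near'' (?par v))))"
      using I by blast
  qed
qed

lemma wp_contract_regions:
  assumes m: "fst s ''m'' 0 = m"
  shows "wp contract_regions (\<lambda>s' _. \<forall>j<m. fst s' ''a'' j = fst s ''near'' (fst s ''a'' j) \<and>
      fst s' ''b'' j = fst s ''near'' (fst s ''b'' j) \<and> fst s' ''sol'' j = 0 \<and>
      snd s' ''cost'' j = snd s ''key'' (fst s ''a'' j) + snd s ''cost'' j + snd s ''key'' (fst s ''b'' j))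
    s (6 * m + 2)"
  unfolding contract_regions_def
  by (rule wp_For[where N = m and K = 4 and I = "\<lambda>k s'. (\<forall>j<k. fst s' ''a'' j = fst s ''near'' (fst s ''a'' j) \<and>
      fst s' ''b'' j = fst s ''near'' (fst s ''b'' j) \<and> fst s' ''sol'' j = 0 \<and>
      snd s' ''cost'' j = snd s ''key'' (fst s ''a'' j) + snd s ''cost'' j + snd s ''key'' (fst s ''b'' j)) \<and>
      (\<forall>j\<ge>k. fst s' ''a'' j = fst s ''a'' j \<and> fst s' ''b'' j = fst s ''b'' j \<and> snd s' ''cost'' j = snd s ''cost'' j)"])
    (use m in \<open>auto simp: wp_simps frame_def less_Suc_eq\<close>)

lemma wp_collect_edges:
  assumes n: "fst s ''n'' 0 = n" and sol: "\<forall>j<m. fst s ''sol'' j = 0" and need: "\<forall>v<n. fst s ''need'' v = 0"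
  shows "wp collect_edges (\<lambda>s' _. (\<forall>j<m. fst s' ''sol'' j = (if \<exists>i<n. fst s ''pe'' i = Suc j then 1 else 0)) \<and>
      (\<forall>v<n. 0 < fst s' ''need'' v \<longleftrightarrow> (\<exists>i<n. fst s ''pe'' i \<noteq> 0 \<and>
        (v = fst s ''src'' (fst s ''pe'' i - 1) \<or> v = fst s ''dst'' (fst s ''pe'' i - 1))))) s (7 * n + 2)"
proof -
  let ?c = "Cond (NLess (NConst 0) (NRead ''pe'' (rd ''i'')))
       (upd ''j'' (NSub (NRead ''pe'' (rd ''i'')) (NConst 1)) ;;
        NWrite ''sol'' (rd ''j'') (NConst 1) ;;
        NWrite ''need'' (NRead ''src'' (rd ''j'')) (NConst 1) ;;
        NWrite ''need'' (NRead ''dst'' (rd ''j'')) (NConst 1))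
       Skip"
  let ?F = "For ''i'' (rd ''n'') ?c"
  define A where "A k j \<longleftrightarrow> (\<exists>i<k. fst s ''pe'' i = Suc j)" for k j
  define B where "B k v \<longleftrightarrow> (\<exists>i<k. fst s ''pe'' i \<noteq> 0 \<and>
    (v = fst s ''src'' (fst s ''pe'' i - 1) \<or> v = fst s ''dst'' (fst s ''pe'' i - 1)))" for k v
  have A: "\<not> A 0 j" "A (Suc k) j \<longleftrightarrow> A k j \<or> fst s ''pe'' k = Suc j" for k j
    by (auto simp: A_def less_Suc_eq)
  have B: "\<not> B 0 v" "B (Suc k) v \<longleftrightarrow> B k v \<or> fst s ''pe'' k \<noteq> 0 \<and>
    (v = fst s ''src'' (fst s ''pe'' k - 1) \<or> v = fst s ''dst'' (fst s ''pe'' k - 1))" for k v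
    by (auto simp: B_def less_Suc_eq)
  let ?I = "\<lambda>k (s'::state). (\<forall>j<m. fst s' ''sol'' j = (if A k j then 1 else 0)) \<and>
      (\<forall>v<n. 0 < fst s' ''need'' v \<longleftrightarrow> B k v)"
  have "wp ?F (\<lambda>s' _. ?I n s') s (7 * n + 2)"
  proof (rule wp_For[where I = ?I and N = n and K = 5])
    show "?I 0 (nwrite ''i'' 0 0 s)" using sol need A B by simp
  next
    fix k s' assume k: "k < n" and I: "?I k s'" and i: "fst s' ''i'' 0 = k" and fr: "frame ?F s s'"
    note f = frameD1[OF fr, simplified]
    show "wp ?c (\<lambda>s'' _. fst s'' ''i'' 0 = k \<and> ?I (Suc k) (nwrite ''i'' 0 (Suc k) s'')) s' 5"
    proof (cases "fst s ''pe'' k")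
      case 0
      then show ?thesis using I i by (simp add: wp_simps f A B)
    next
      case (Suc j)
      then show ?thesis using I i by (simp add: wp_simps f A B)
    qed
  next
    fix k s' assume fr: "frame ?F s s'"
    show "nval (rd ''n'') s' = n" using n by (simp add: frameD1[OF fr])
  qed simp_all
  then show ?thesis unfolding collect_edges_def A_def B_def .
qed

lemma wp_weigh:
  assumes m: "fst s ''m'' 0 = m"
  shows "wp weigh (\<lambda>s' _. snd s' ''wt'' 0 = sum (snd s ''weight'') {j. j < m \<and> 0 < fst s ''sol'' j}) s (4 * m + 3)"
proof -
  let ?s = "rwrite ''wt'' 0 0 s"
  have e: "{j. j < Suc k \<and> 0 < fst s ''sol'' j} = (if 0 < fst s ''sol'' k then insert k {j. j < k \<and> 0 < fst s ''sol'' j}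
     else {j. j < k \<and> 0 < fst s ''sol'' j})" for k by (auto simp: less_Suc_eq)
  have "wp (For ''j'' (rd ''m'')
     (Cond (NLess (NConst 0) (NRead ''sol'' (rd ''j'')))
       (RWrite ''wt'' (NConst 0) (RAdd (RRead ''wt'' (NConst 0)) (RRead ''weight'' (rd ''j'')))) Skip))
     (\<lambda>s' _. snd s' ''wt'' 0 = sum (snd s ''weight'') {j. j < m \<and> 0 < fst s ''sol'' j}) ?s (4 * m + 2)"
    by (rule wp_For[where N = m and K = 2 and I = "\<lambda>k s'. snd s' ''wt'' 0 = sum (snd s ''weight'') {j. j < k \<and> 0 < fst s ''sol'' j}"])
     (use m in \<open>auto simp: wp_simps frame_def e\<close>)
  then show ?thesis by (simp add: weigh_def wp_simps)
qed

text \<open>Relates \<open>v\<close> to the vertices on its way to the root of its region,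
  \<open>v\<close> included. Parent edges are stored shifted by one, with 0 for a root.\<close>

definition ancestor :: "nat \<Rightarrow> (nat \<Rightarrow> nat) \<Rightarrow> (nat \<Rightarrow> nat) \<Rightarrow> (nat \<Rightarrow> nat) \<Rightarrow> nat \<Rightarrow> nat \<Rightarrow> bool" where
  "ancestor n a b pe = (\<lambda>v x. v < n \<and> pe v \<noteq> 0 \<and> x = other a b (pe v - 1) v)\<^sup>*\<^sup>*"

lemma ancestor_refl: "ancestor n a b pe v v"
  by (simp add: ancestor_def)

lemma ancestor_step:
  "ancestor n a b pe x v \<Longrightarrow> v < n \<Longrightarrow> pe v \<noteq> 0 \<Longrightarrow> ancestor n a b pe x (other a b (pe v - 1) v)"
  unfolding ancestor_def by (rule rtranclp.rtrancl_into_rtrancl) blast+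

text \<open>\<open>N\<close> is pinned down from both sides: it is closed under parents and contains
  only ancestors of \<open>N0\<close>. The flags of processed vertices are final, because a parent
  stands before its child in \<open>ord1\<close> and is processed later.\<close>

lemma wp_trace_paths:
  assumes ord: "inj_on (fst s ''ord1'') {..<fst s ''cnt1'' 0}"
      "fst s ''ord1'' ` {..<fst s ''cnt1'' 0} = {v. v < n \<and> st v = (2::nat)}"
    and reached: "\<And>v. v < n \<Longrightarrow> fst s ''pe1'' v \<noteq> 0 \<Longrightarrow> st v = 2 \<and> fst s ''pe1'' v - 1 < m \<and>
        other (fst s ''src'') (fst s ''dst'') (fst s ''pe1'' v - 1) v < n"
    and earlier: "\<And>i. i < fst s ''cnt1'' 0 \<Longrightarrow> fst s ''pe1'' (fst s ''ord1'' i) \<noteq> 0 \<Longrightarrow>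
        other (fst s ''src'') (fst s ''dst'') (fst s ''pe1'' (fst s ''ord1'' i) - 1) (fst s ''ord1'' i)
          \<in> fst s ''ord1'' ` {..<i}"
    and sol: "\<forall>j<m. fst s ''sol'' j \<le> 1"
    and N0: "N0 = {v. v < n \<and> 0 < fst s ''need'' v}"
  shows "wp trace_paths (\<lambda>s' _. (\<forall>j<m. fst s' ''sol'' j \<le> 1) \<and> (\<exists>N. N0 \<subseteq> N \<and> N \<subseteq> {..<n} \<and>
      (\<forall>v\<in>N. \<exists>x\<in>N0. ancestor n (fst s ''src'') (fst s ''dst'') (fst s ''pe1'') x v) \<and>
      (\<forall>v\<in>N. fst s ''pe1'' v \<noteq> 0 \<longrightarrow> other (fst s ''src'') (fst s ''dst'') (fst s ''pe1'' v - 1) v \<in> N) \<and>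
      (\<forall>j<m. 0 < fst s' ''sol'' j \<longleftrightarrow> 0 < fst s ''sol'' j \<or> (\<exists>v\<in>N. fst s ''pe1'' v = Suc j)))) s (7 * n + 2)"
proof -
  let ?c = "upd ''v'' (NRead ''ord1'' (NSub (rd ''cnt1'') (NAdd (rd ''i'') (NConst 1)))) ;;
      Cond (BAnd (NLess (NConst 0) (NRead ''need'' (rd ''v''))) (NLess (NConst 0) (NRead ''pe1'' (rd ''v''))))
       (upd ''j'' (NSub (NRead ''pe1'' (rd ''v'')) (NConst 1)) ;;
        NWrite ''sol'' (rd ''j'') (NConst 1) ;;
        NWrite ''need'' (NSub (NAdd (NRead ''src'' (rd ''j'')) (NRead ''dst'' (rd ''j''))) (rd ''v'')) (NConst 1))
       Skip"
  let ?F = "For ''i'' (rd ''cnt1'') ?c"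
  let ?ord = "fst s ''ord1''" and ?pe = "fst s ''pe1''" and ?cnt = "fst s ''cnt1'' 0"
  let ?par = "\<lambda>v. other (fst s ''src'') (fst s ''dst'') (?pe v - 1) v"
  let ?N = "\<lambda>s'::state. {v. v < n \<and> 0 < fst s' ''need'' v}"
  let ?anc = "ancestor n (fst s ''src'') (fst s ''dst'') ?pe"
  let ?I = "\<lambda>k s'. (\<forall>j<m. fst s' ''sol'' j \<le> 1) \<and> N0 \<subseteq> ?N s' \<and>
      (\<forall>v\<in>?N s'. \<exists>x\<in>N0. ?anc x v) \<and>
      (\<forall>i. ?cnt - k \<le> i \<and> i < ?cnt \<and> ?ord i \<in> ?N s' \<and> ?pe (?ord i) \<noteq> 0 \<longrightarrow> ?par (?ord i) \<in> ?N s') \<and>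
      (\<forall>j<m. 0 < fst s' ''sol'' j \<longleftrightarrow> 0 < fst s ''sol'' j \<or>
        (\<exists>i. ?cnt - k \<le> i \<and> i < ?cnt \<and> ?ord i \<in> ?N s' \<and> ?pe (?ord i) = Suc j))"
  have ord_n: "?ord i < n" if "i < ?cnt" for i using ord(2) that by blast
  have cn: "?cnt \<le> n"
  proof -
    have "card (?ord ` {..<?cnt}) \<le> card {..<n}" using ord_n by (intro card_mono) auto
    then show ?thesis using card_image[OF ord(1)] by simp
  qed
  have "wp ?F (\<lambda>s' _. ?I ?cnt s') s (7 * ?cnt + 2)"
  proof (rule wp_For[where I = ?I and N = ?cnt and K = 5])
    show "?I 0 (nwrite ''i'' 0 0 s)" using sol unfolding N0 by (auto intro: ancestor_refl)
  next
    fix k s' assume k: "k < ?cnt" and I: "?I k s'" and i: "fst s' ''i'' 0 = k" and fr: "frame ?F s s'"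
    define i0 where "i0 = ?cnt - Suc k"
    define v where "v = ?ord i0"
    note f = frameD1[OF fr, simplified]
    have i0: "i0 < ?cnt" "?cnt - k = Suc i0" "?cnt - Suc k = i0" using k by (auto simp: i0_def)
    have v: "v < n" using ord_n[OF i0(1)] by (simp add: v_def)
    have split: "?cnt - Suc k \<le> i \<longleftrightarrow> i = i0 \<or> ?cnt - k \<le> i" for i unfolding i0(2,3) by auto
    have I': "\<forall>j<m. fst s' ''sol'' j \<le> 1" "N0 \<subseteq> ?N s'" "\<forall>v\<in>?N s'. \<exists>x\<in>N0. ?anc x v"
      "\<And>i. ?cnt - k \<le> i \<Longrightarrow> i < ?cnt \<Longrightarrow> ?ord i \<in> ?N s' \<Longrightarrow> ?pe (?ord i) \<noteq> 0 \<Longrightarrow> ?par (?ord i) \<in> ?N s'"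
      "\<And>j. j < m \<Longrightarrow> 0 < fst s' ''sol'' j \<longleftrightarrow> 0 < fst s ''sol'' j \<or>
        (\<exists>i. ?cnt - k \<le> i \<and> i < ?cnt \<and> ?ord i \<in> ?N s' \<and> ?pe (?ord i) = Suc j)"
      using I by blast+
    show "wp ?c (\<lambda>s'' _. fst s'' ''i'' 0 = k \<and> ?I (Suc k) (nwrite ''i'' 0 (Suc k) s'')) s' 5"
    proof (cases "0 < fst s' ''need'' v \<and> 0 < ?pe v")
      case True
      let ?p = "?par v"
      let ?j = "?pe v - 1"
      have j: "?pe v = Suc ?j" "?j < m" and p: "?p < n" using reached[OF v] True by auto
      have pe: "?p \<in> ?ord ` {..<i0}" using earlier[OF i0(1)] True by (auto simp: v_def)
      \<comment> \<open>The freshly flagged parent has a position below \<open>i0\<close>, so it is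
        none of the vertices processed so far, the current one included.\<close>
      have np: "?ord i \<noteq> ?p" if "i0 \<le> i" "i < ?cnt" for i
      proof -
        obtain i' where "i' < i0" "?p = ?ord i'" using pe by blast
        then show ?thesis using inj_onD[OF ord(1), of i i'] that by auto
      qed
      define s'' where "s'' = nwrite ''i'' 0 (Suc k) (nwrite ''need'' ?p 1 (nwrite ''sol'' ?j 1 (nwrite ''j'' 0 ?j (nwrite ''v'' 0 v s'))))"
      have N'': "?N s'' = insert ?p (?N s')" using p by (auto simp: s''_def)
      have so: "fst s'' ''sol'' = (fst s' ''sol'')(?j := 1)" by (simp add: s''_def)
      have vN: "v \<in> ?N s'" using v True by simp
      have mem: "?ord i \<in> ?N s'' \<longleftrightarrow> ?ord i \<in> ?N s'" if "i0 \<le> i" "i < ?cnt" for i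
        unfolding N'' using np[OF that] by simp
      have "?I (Suc k) s''"
      proof (intro conjI)
        show "\<forall>j<m. fst s'' ''sol'' j \<le> 1" using I'(1) by (simp add: so)
        show "N0 \<subseteq> ?N s''" unfolding N'' using I'(2) by blast
        show "\<forall>v\<in>?N s''. \<exists>x\<in>N0. ?anc x v"
        proof
          fix w assume "w \<in> ?N s''"
          then consider "w \<in> ?N s'" | "w = ?p" unfolding N'' by blast
          then show "\<exists>x\<in>N0. ?anc x w"
          proof cases
            case 1
            then show ?thesis using I'(3) by blast
          next
            case 2
            obtain x where x: "x \<in> N0" "?anc x v" using I'(3) vN by blast
            have "?pe v \<noteq> 0" using True by simp
            then have "?anc x w" unfolding 2 by (rule ancestor_step[OF x(2) v])
            then show ?thesis using x(1) by blast
          qed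
        qed
        show "\<forall>i. ?cnt - Suc k \<le> i \<and> i < ?cnt \<and> ?ord i \<in> ?N s'' \<and> ?pe (?ord i) \<noteq> 0 \<longrightarrow> ?par (?ord i) \<in> ?N s''"
        proof (intro allI impI, elim conjE)
          fix i assume i: "?cnt - Suc k \<le> i" "i < ?cnt" "?ord i \<in> ?N s''" "?pe (?ord i) \<noteq> 0"
          show "?par (?ord i) \<in> ?N s''"
          proof (cases "i = i0")
            case True
            then show ?thesis unfolding N'' v_def by simp
          next
            case False
            then have "?cnt - k \<le> i" using i(1) split by blast
            moreover have "?ord i \<in> ?N s'" using mem[of i] i i0 by simp
            ultimately show ?thesis unfolding N'' using I'(4)[of i] i by blast
          qed
        qed
        show "\<forall>j<m. 0 < fst s'' ''sol'' j \<longleftrightarrow> 0 < fst s ''sol'' j \<or>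
          (\<exists>i. ?cnt - Suc k \<le> i \<and> i < ?cnt \<and> ?ord i \<in> ?N s'' \<and> ?pe (?ord i) = Suc j)"
        proof (intro allI impI)
          fix j' assume j': "j' < m"
          have "(\<exists>i. ?cnt - Suc k \<le> i \<and> i < ?cnt \<and> ?ord i \<in> ?N s'' \<and> ?pe (?ord i) = Suc j') \<longleftrightarrow>
            j' = ?j \<or> (\<exists>i. ?cnt - k \<le> i \<and> i < ?cnt \<and> ?ord i \<in> ?N s' \<and> ?pe (?ord i) = Suc j')" (is "?L \<longleftrightarrow> ?R")
          proof
            assume ?L
            then obtain i where i: "?cnt - Suc k \<le> i" "i < ?cnt" "?ord i \<in> ?N s''" "?pe (?ord i) = Suc j'" by blast
            show ?R
            proof (cases "i = i0")
              case True
              then show ?thesis using i(4) j(1) by (simp add: v_def)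
            next
              case False
              then have "?cnt - k \<le> i" using i(1) split by blast
              then show ?thesis using i mem[of i] i0 by auto
            qed
          next
            assume ?R
            then show ?L
            proof
              assume "j' = ?j"
              then show ?L using i0 vN mem[of i0] j(1) by (intro exI[of _ i0]) (simp add: v_def)
            next
              assume "\<exists>i. ?cnt - k \<le> i \<and> i < ?cnt \<and> ?ord i \<in> ?N s' \<and> ?pe (?ord i) = Suc j'"
              then obtain i where i: "?cnt - k \<le> i" "i < ?cnt" "?ord i \<in> ?N s'" "?pe (?ord i) = Suc j'" by blast
              then show ?L using mem[of i] i0 by (intro exI[of _ i]) auto
            qed
          qed
          then show "0 < fst s'' ''sol'' j' \<longleftrightarrow> 0 < fst s ''sol'' j' \<or>
            (\<exists>i. ?cnt - Suc k \<le> i \<and> i < ?cnt \<and> ?ord i \<in> ?N s'' \<and> ?pe (?ord i) = Suc j')"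
            using I'(5)[OF j'] unfolding so by (cases "j' = ?j") auto
        qed
      qed
      then have J: "?I (Suc k) s''" .
      have sp: "fst s ''src'' ?j + fst s ''dst'' ?j - v = ?p" by (simp add: other_def)
      show ?thesis
        using J True i k i0(1) unfolding s''_def
        by (simp only: wp_simps nval.simps bval.simps f fst_nwrite list.inject char.inject simp_thms if_True if_False)
          (simp add: i0_def[symmetric] v_def[symmetric] f sp[simplified])
    next
      case False
      have "?I (Suc k) s'"
      proof (intro conjI)
        have no: "\<not> (?ord i0 \<in> ?N s' \<and> ?pe (?ord i0) \<noteq> 0)" using False by (auto simp: v_def)
        have later: "?cnt - k \<le> i" if "?cnt - Suc k \<le> i" "?ord i \<in> ?N s'" "?pe (?ord i) \<noteq> 0" for i
        proof (cases "i = i0")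
          case True
          then show ?thesis using no that(2,3) by (simp only: simp_thms)
        next
          case False
          then show ?thesis using split[of i] that(1) by (simp only: simp_thms)
        qed
        show "\<forall>i. ?cnt - Suc k \<le> i \<and> i < ?cnt \<and> ?ord i \<in> ?N s' \<and> ?pe (?ord i) \<noteq> 0 \<longrightarrow> ?par (?ord i) \<in> ?N s'"
        proof (intro allI impI, elim conjE)
          fix i assume i: "?cnt - Suc k \<le> i" "i < ?cnt" "?ord i \<in> ?N s'" "?pe (?ord i) \<noteq> 0"
          show "?par (?ord i) \<in> ?N s'" by (rule I'(4)[OF later[OF i(1,3,4)] i(2-4)])
        qed
        show "\<forall>j<m. 0 < fst s' ''sol'' j \<longleftrightarrow> 0 < fst s ''sol'' j \<or>
          (\<exists>i. ?cnt - Suc k \<le> i \<and> i < ?cnt \<and> ?ord i \<in> ?N s' \<and> ?pe (?ord i) = Suc j)"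
        proof (intro allI impI)
          fix j assume j: "j < m"
          have "(\<exists>i. ?cnt - Suc k \<le> i \<and> i < ?cnt \<and> ?ord i \<in> ?N s' \<and> ?pe (?ord i) = Suc j) \<longleftrightarrow>
            (\<exists>i. ?cnt - k \<le> i \<and> i < ?cnt \<and> ?ord i \<in> ?N s' \<and> ?pe (?ord i) = Suc j)"
          proof (intro ex_cong1 iffI, goal_cases)
            case (1 i)
            then have "?pe (?ord i) \<noteq> 0" by simp
            then show ?case using later[of i] 1 by blast
          next
            case (2 i)
            then show ?case by (simp add: le_diff_conv)
          qed
          then show "0 < fst s' ''sol'' j \<longleftrightarrow> 0 < fst s ''sol'' j \<or>
            (\<exists>i. ?cnt - Suc k \<le> i \<and> i < ?cnt \<and> ?ord i \<in> ?N s' \<and> ?pe (?ord i) = Suc j)"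
            using I'(5)[OF j] by (simp only:)
        qed
        show "\<forall>j<m. fst s' ''sol'' j \<le> 1" by (fact I'(1))
        show "N0 \<subseteq> ?N s'" by (fact I'(2))
        show "\<forall>v\<in>?N s'. \<exists>x\<in>N0. ?anc x v" by (fact I'(3))
      qed
      then show ?thesis using False i k
        by (auto simp add: wp_simps f i0_def[symmetric] v_def[symmetric])
    qed
  next
    fix k s' assume fr: "frame ?F s s'"
    show "nval (rd ''cnt1'') s' = ?cnt" by (simp add: frameD1[OF fr])
  qed simp_all
  then show ?thesis
    unfolding trace_paths_def
  proof (rule wp_use)
    show "7 * ?cnt + 2 \<le> 7 * n + 2" using cn by simp
    fix s' n' assume I: "?I ?cnt s'"
    let ?M = "?N s'"
    have pos: "\<exists>i<?cnt. v = ?ord i" if "v \<in> ?M" "?pe v \<noteq> 0" for v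
    proof -
      have "v \<in> ?ord ` {..<?cnt}" using reached[of v] that ord(2) by auto
      then show ?thesis by auto
    qed
    have I4: "\<And>i. i < ?cnt \<Longrightarrow> ?ord i \<in> ?M \<Longrightarrow> ?pe (?ord i) \<noteq> 0 \<Longrightarrow> ?par (?ord i) \<in> ?M"
      and I5: "\<And>j. j < m \<Longrightarrow> 0 < fst s' ''sol'' j \<longleftrightarrow> 0 < fst s ''sol'' j \<or>
        (\<exists>i. i < ?cnt \<and> ?ord i \<in> ?M \<and> ?pe (?ord i) = Suc j)"
      using I unfolding diff_self_eq_0 by simp_all
    have "\<forall>v\<in>?M. ?pe v \<noteq> 0 \<longrightarrow> ?par v \<in> ?M"
    proof (intro ballI impI)
      fix v assume v: "v \<in> ?M" "?pe v \<noteq> 0"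
      obtain i where "i < ?cnt" "v = ?ord i" using pos[OF v] by blast
      then show "?par v \<in> ?M" using I4[of i] v by simp
    qed
    moreover have "\<forall>j<m. 0 < fst s' ''sol'' j \<longleftrightarrow> 0 < fst s ''sol'' j \<or> (\<exists>v\<in>?M. ?pe v = Suc j)"
    proof (intro allI impI)
      fix j assume j: "j < m"
      have "(\<exists>i. i < ?cnt \<and> ?ord i \<in> ?M \<and> ?pe (?ord i) = Suc j) \<longleftrightarrow> (\<exists>v\<in>?M. ?pe v = Suc j)"
      proof
        assume "\<exists>v\<in>?M. ?pe v = Suc j"
        then obtain v where v: "v \<in> ?M" "?pe v = Suc j" by (elim bexE)
        then have "?pe v \<noteq> 0" by simp
        then obtain i where "i < ?cnt" "v = ?ord i" using pos[OF v(1)] by blast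
        then show "\<exists>i. i < ?cnt \<and> ?ord i \<in> ?M \<and> ?pe (?ord i) = Suc j" using v by (intro exI[of _ i]) simp
      qed (elim exE conjE, rule bexI)
      then show "0 < fst s' ''sol'' j \<longleftrightarrow> 0 < fst s ''sol'' j \<or> (\<exists>v\<in>?M. ?pe v = Suc j)"
        using I5[OF j] by (simp only:)
    qed
    moreover have "?M \<subseteq> {..<n}" by auto
    ultimately show "(\<forall>j<m. fst s' ''sol'' j \<le> 1) \<and> (\<exists>N. N0 \<subseteq> N \<and> N \<subseteq> {..<n} \<and>
      (\<forall>v\<in>N. \<exists>x\<in>N0. ?anc x v) \<and> (\<forall>v\<in>N. ?pe v \<noteq> 0 \<longrightarrow> ?par v \<in> N) \<and>
      (\<forall>j<m. 0 < fst s' ''sol'' j \<longleftrightarrow> 0 < fst s ''sol'' j \<or> (\<exists>v\<in>N. ?pe v = Suc j)))"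
      using I by (intro conjI exI[of _ ?M]) (assumption | (elim conjE, assumption))+
  qed
qed

section \<open>Composition of the two phases of a run\<close>

lemma wp_seq:
  assumes "wp c (\<lambda>s _. Q s) s k"
    and "\<And>s'. Q s' \<Longrightarrow> frame c s s' \<Longrightarrow> wp d (\<lambda>s _. R s) s' l" and "k + l \<le> n"
  shows "wp (c ;; d) (\<lambda>s _. R s) s n"
  unfolding wp_Seq
proof (rule wp_use[OF assms(1)])
  fix s' n' assume "Q s'" "frame c s s'" "n \<le> n' + k"
  then show "wp d (\<lambda>s _. R s) s' n'" using wp_credits_mono[OF assms(2)] assms(3) by simp
qed (use assms(3) in simp)

lemma wp_NWrite_seq:
  assumes "wp c (\<lambda>s _. R s) s' k" "s' = nwrite x (nval a s) (nval b s) s" "Suc k \<le> n"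
  shows "wp (NWrite x a b ;; c) (\<lambda>s _. R s) s n"
  using wp_credits_mono[OF assms(1), of "n - 1"] assms(2,3) by (auto simp: wp_Seq wp_NWrite)

lemma wp_RWrite_seq:
  assumes "wp c (\<lambda>s _. R s) s' k" "s' = rwrite x (nval a s) (rval b s) s" "Suc k \<le> n"
  shows "wp (RWrite x a b ;; c) (\<lambda>s _. R s) s n"
  using wp_credits_mono[OF assms(1), of "n - 1"] assms(2,3) by (auto simp: wp_Seq wp_RWrite)

text \<open>The result of the first search: \<open>near v\<close> is the terminal closest to \<open>v\<close>.  Arrays written by
  the program are constrained only at the indices below \<open>n\<close> or \<open>m\<close>.\<close>

locale voronoi_data =
  fixes n m :: nat and src dst tm pred :: "nat \<Rightarrow> nat" and weight :: "nat \<Rightarrow> real" and \<alpha> :: real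
    and a1 b1 :: "nat \<Rightarrow> nat" and c1 :: "nat \<Rightarrow> real" and sd1 st1 :: "nat \<Rightarrow> nat" and key1 :: "nat \<Rightarrow> real"
    and pe1 ord1 :: "nat \<Rightarrow> nat" and cnt1 :: nat and near :: "nat \<Rightarrow> nat"
  assumes search1: "search_inv n m a1 b1 c1 1 sd1 st1 key1 pe1 ord1 cnt1 (all_scanned n m a1 b1 st1)"
    and done1: "\<And>v. v < n \<Longrightarrow> st1 v \<noteq> 1"
    and edges1: "\<And>j. j < m \<Longrightarrow> a1 j = src j \<and> b1 j = dst j \<and> c1 j = (if 0 < pred j then weight j / \<alpha> else weight j)"
    and seeds1: "\<And>v. v < n \<Longrightarrow> sd1 v = tm v"
    and near_less: "\<And>v. v < n \<Longrightarrow> near v < n"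
    and near_eq: "\<And>v. v < n \<Longrightarrow> near v = (if pe1 v = 0 then v else near (other a1 b1 (pe1 v - 1) v))"

text \<open>With \<open>mu = 0\<close> the key of a vertex other than the seed is the cost of the
  edge that attaches it. The end of a run is recorded by plain functions, so that the graph argument
  can proceed without program states.\<close>

locale run_data = voronoi_data +
  fixes a2 b2 :: "nat \<Rightarrow> nat" and c2 :: "nat \<Rightarrow> real" and sd2 st2 :: "nat \<Rightarrow> nat" and key2 :: "nat \<Rightarrow> real"
    and pe2 ord2 :: "nat \<Rightarrow> nat" and cnt2 tv :: nat and N :: "nat set" and sol :: "nat \<Rightarrow> nat"
  assumes search2: "search_inv n m a2 b2 c2 0 sd2 st2 key2 pe2 ord2 cnt2 (all_scanned n m a2 b2 st2)"
    and done2: "\<And>v. v < n \<Longrightarrow> st2 v \<noteq> 1"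
    and edges2: "\<And>j. j < m \<Longrightarrow> a2 j = near (src j) \<and> b2 j = near (dst j) \<and>
      c2 j = key1 (src j) + c1 j + key1 (dst j)"
    and seeds2: "\<And>v. v < n \<Longrightarrow> 0 < sd2 v \<longleftrightarrow> v = tv \<and> 0 < tm tv"
    and first_terminal: "\<And>v. v < n \<Longrightarrow> 0 < tm v \<Longrightarrow> tv < n \<and> 0 < tm tv"
    and N_ends: "\<And>i. i < n \<Longrightarrow> pe2 i \<noteq> 0 \<Longrightarrow> src (pe2 i - 1) \<in> N \<and> dst (pe2 i - 1) \<in> N"
    and N_less: "\<And>v. v \<in> N \<Longrightarrow> v < n"
    and N_closed: "\<And>v. v \<in> N \<Longrightarrow> pe1 v \<noteq> 0 \<Longrightarrow> other a1 b1 (pe1 v - 1) v \<in> N"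
    and N_ancestor: "\<And>v. v \<in> N \<Longrightarrow> \<exists>i<n. pe2 i \<noteq> 0 \<and>
      (ancestor n a1 b1 pe1 (src (pe2 i - 1)) v \<or> ancestor n a1 b1 pe1 (dst (pe2 i - 1)) v)"
    and sol: "\<And>j. j < m \<Longrightarrow> 0 < sol j \<longleftrightarrow> (\<exists>i<n. pe2 i = Suc j) \<or> (\<exists>v\<in>N. pe1 v = Suc j)"

definition run_result :: "nat \<Rightarrow> nat \<Rightarrow> (nat \<Rightarrow> nat) \<Rightarrow> (nat \<Rightarrow> nat) \<Rightarrow> (nat \<Rightarrow> nat) \<Rightarrow> (nat \<Rightarrow> nat) \<Rightarrow>
    (nat \<Rightarrow> real) \<Rightarrow> real \<Rightarrow> (nat \<Rightarrow> nat) \<Rightarrow> bool" where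
  "run_result n m src dst tm pred weight \<alpha> sol \<longleftrightarrow>
     (\<exists>a1 b1 c1 sd1 st1 key1 pe1 ord1 cnt1 near a2 b2 c2 sd2 st2 key2 pe2 ord2 cnt2 tv N.
        run_data n m src dst tm pred weight \<alpha> a1 b1 c1 sd1 st1 key1 pe1 ord1 cnt1 near
          a2 b2 c2 sd2 st2 key2 pe2 ord2 cnt2 tv N sol)"

definition first_phase :: com where
  "first_phase = load_edges ;; load_terminals ;; RWrite ''mult'' (NConst 0) (RConst 1) ;; search ;;
     save_search ;; label_regions ;; upd ''cnt1'' (rd ''cnt'') ;; contract_regions"

text \<open>The seed receives the terminal flag of \<open>tv\<close> instead of the constant 1:
  without terminals \<open>tv\<close> is merely its default 0, and the search then starts from
  nothing.\<close>

definition second_phase :: com where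
  "second_phase = NWrite ''seed'' (rd ''tv'') (NRead ''terminal'' (rd ''tv'')) ;;
     RWrite ''mult'' (NConst 0) (RConst 0) ;; search ;; collect_edges ;; trace_paths ;; weigh"

definition run :: com where
  "run = first_phase ;; second_phase"

lemma search_writes [simp]:
  "nwrites search = {''acc'', ''rn'', ''cnt'', ''i'', ''base'', ''dg'', ''st'', ''pe'', ''par'', ''deg'', ''mark'',
     ''rt'', ''j'', ''adj'', ''bi'', ''u'', ''ord'', ''y'', ''nl'', ''r'', ''q'', ''p'', ''ch'', ''idx'', ''bp'', ''v'', ''z''}"
  "rwrites search = {''key'', ''k''}"
  by (auto simp: search_def search_init_def init_vertex_def build_adj_def push_adj_def search_loop_def
      extract_min_def find_min_def remove_min_def consolidate_def pair_root_def scan_def scan_edge_def cut_def)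

lemma simple_writes [simp]:
  "nwrites load_edges = {''j'', ''a'', ''b''}" "rwrites load_edges = {''cost''}"
  "nwrites load_terminals = {''i'', ''seed''}" "rwrites load_terminals = {}"
  "nwrites save_search = {''tv'', ''i'', ''near'', ''pe1'', ''need'', ''seed''}" "rwrites save_search = {}"
  "nwrites label_regions = {''i'', ''v'', ''ord1'', ''j'', ''near''}" "rwrites label_regions = {}"
  "nwrites contract_regions = {''j'', ''a'', ''b'', ''sol''}" "rwrites contract_regions = {''cost''}"
  "nwrites collect_edges = {''i'', ''j'', ''sol'', ''need''}" "rwrites collect_edges = {}"
  "nwrites trace_paths = {''i'', ''v'', ''j'', ''sol'', ''need''}" "rwrites trace_paths = {}"
  "nwrites weigh = {''j''}" "rwrites weigh = {''wt''}"
  by (auto simp: load_edges_def load_terminals_def save_search_def label_regions_def contract_regions_def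
      collect_edges_def trace_paths_def weigh_def)

lemma search_inv_cong:
  assumes g: "search_inv n m a b c mu sd st key pe ord cnt sc"
    and "\<And>j. j < m \<Longrightarrow> a j = a' j \<and> b j = b' j"
  shows "v < n \<Longrightarrow> pe v \<noteq> 0 \<Longrightarrow> other a b (pe v - 1) v = other a' b' (pe v - 1) v"
proof -
  assume v: "v < n" "pe v \<noteq> 0"
  then have "st v \<noteq> 0" using search_inv.unreached[OF g v(1)] by auto
  then have "pe v - 1 < m" using search_inv.parent[OF g v(1) _ v(2)] by blast
  then show ?thesis using assms(2) by (simp add: other_def)
qed

text \<open>The edge arrays of the first search are overwritten by the contraction, and
  \<open>pe\<close> and \<open>ord\<close> will be by the second search. The existential witnesses
  remember their values; the copies \<open>pe1\<close> and \<open>ord1\<close> agree with them on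
  the relevant indices.\<close>

lemma wp_first_phase:
  assumes n: "fst s ''n'' 0 = n" and m: "fst s ''m'' 0 = m" and L: "n < 2 ^ L"
    and ends: "\<And>j. j < m \<Longrightarrow> fst s ''src'' j < n \<and> fst s ''dst'' j < n"
    and w: "\<And>j. j < m \<Longrightarrow> 0 \<le> snd s ''weight'' j" and al: "0 < snd s ''alpha'' 0"
  shows "wp first_phase (\<lambda>s' _. \<exists>a1 b1 c1 sd1 st1 pe1 ord1.
      voronoi_data n m (fst s ''src'') (fst s ''dst'') (fst s ''terminal'') (fst s ''predicted'') (snd s ''weight'')
        (snd s ''alpha'' 0) a1 b1 c1 sd1 st1 (snd s' ''key'') pe1 ord1 (fst s' ''cnt1'' 0) (fst s' ''near'') \<and>
      (\<forall>i<n. fst s' ''pe1'' i = pe1 i \<and> fst s' ''need'' i = 0 \<and> fst s' ''seed'' i = 0) \<and>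
      (\<forall>v<n. 0 < fst s ''terminal'' v \<longrightarrow> fst s' ''tv'' 0 < n \<and> 0 < fst s ''terminal'' (fst s' ''tv'' 0)) \<and>
      (\<forall>i<fst s' ''cnt1'' 0. fst s' ''ord1'' i = ord1 i) \<and>
      (\<forall>j<m. fst s' ''a'' j = fst s' ''near'' (fst s ''src'' j) \<and> fst s' ''b'' j = fst s' ''near'' (fst s ''dst'' j) \<and>
        fst s' ''sol'' j = 0 \<and>
        snd s' ''cost'' j = snd s' ''key'' (fst s ''src'' j) + c1 j + snd s' ''key'' (fst s ''dst'' j)))
    s (98 * n + 190 * (n * L) + 282 * m + 24)"
  unfolding first_phase_def
proof (rule wp_seq[OF wp_load_edges[OF m], where l = "98 * n + 190 * (n * L) + 276 * m + 22"])
  fix s1 assume p1: "\<forall>j<m. fst s1 ''a'' j = fst s ''src'' j \<and> fst s1 ''b'' j = fst s ''dst'' j \<and>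
      snd s1 ''cost'' j = (if 0 < fst s ''predicted'' j then snd s ''weight'' j / snd s ''alpha'' 0
        else snd s ''weight'' j)" and fr1: "frame load_edges s s1"
  note f1 = frameD1[OF fr1, simplified] frameD2[OF fr1, simplified]
  have n1: "fst s1 ''n'' 0 = n" using n by (simp add: f1)
  show "wp (load_terminals ;; RWrite ''mult'' (NConst 0) (RConst 1) ;; search ;;
     save_search ;; label_regions ;; upd ''cnt1'' (rd ''cnt'') ;; contract_regions) (\<lambda>s' _. \<exists>a1 b1 c1 sd1 st1 pe1 ord1.
      voronoi_data n m (fst s ''src'') (fst s ''dst'') (fst s ''terminal'') (fst s ''predicted'') (snd s ''weight'')
        (snd s ''alpha'' 0) a1 b1 c1 sd1 st1 (snd s' ''key'') pe1 ord1 (fst s' ''cnt1'' 0) (fst s' ''near'') \<and>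
      (\<forall>i<n. fst s' ''pe1'' i = pe1 i \<and> fst s' ''need'' i = 0 \<and> fst s' ''seed'' i = 0) \<and>
      (\<forall>v<n. 0 < fst s ''terminal'' v \<longrightarrow> fst s' ''tv'' 0 < n \<and> 0 < fst s ''terminal'' (fst s' ''tv'' 0)) \<and>
      (\<forall>i<fst s' ''cnt1'' 0. fst s' ''ord1'' i = ord1 i) \<and>
      (\<forall>j<m. fst s' ''a'' j = fst s' ''near'' (fst s ''src'' j) \<and> fst s' ''b'' j = fst s' ''near'' (fst s ''dst'' j) \<and>
        fst s' ''sol'' j = 0 \<and>
        snd s' ''cost'' j = snd s' ''key'' (fst s ''src'' j) + c1 j + snd s' ''key'' (fst s ''dst'' j)))
     s1 (98 * n + 190 * (n * L) + 276 * m + 22)" (is "wp _ (\<lambda>s' _. ?R s') _ _")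
  proof (rule wp_seq[OF wp_load_terminals[OF n1], where l = "Suc (95 * n + 190 * (n * L) + 276 * m + 19)"])
    fix s2 assume p2: "\<forall>i<n. fst s2 ''seed'' i = fst s1 ''terminal'' i" and fr2: "frame load_terminals s1 s2"
    note f2 = frameD1[OF fr2, simplified] frameD2[OF fr2, simplified]
    let ?s2 = "rwrite ''mult'' 0 1 s2"
    have "wp search (\<lambda>s' _. search_result n m (fst ?s2 ''a'') (fst ?s2 ''b'') (snd ?s2 ''cost'')
        (snd ?s2 ''mult'' 0) (fst ?s2 ''seed'') s') ?s2 (80 * n + 190 * (n * L) + 270 * m + 10)"
      by (rule wp_search) (use n m L ends w al p1 in \<open>simp_all add: f1 f2\<close>)
    then have "wp (search ;; save_search ;; label_regions ;; upd ''cnt1'' (rd ''cnt'') ;; contract_regions)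
      (\<lambda>s' _. ?R s') ?s2 (95 * n + 190 * (n * L) + 276 * m + 19)"
    proof (rule wp_seq[where l = "15 * n + 6 * m + 9"])
      fix s3 assume p3: "search_result n m (fst ?s2 ''a'') (fst ?s2 ''b'') (snd ?s2 ''cost'')
        (snd ?s2 ''mult'' 0) (fst ?s2 ''seed'') s3" and fr3: "frame search ?s2 s3"
      note f3 = frameD1[OF fr3, simplified] frameD2[OF fr3, simplified]
      have g3: "search_inv n m (fst s2 ''a'') (fst s2 ''b'') (snd s2 ''cost'') 1 (fst s2 ''seed'') (fst s3 ''st'')
          (snd s3 ''key'') (fst s3 ''pe'') (fst s3 ''ord'') (fst s3 ''cnt'' 0)
          (all_scanned n m (fst s2 ''a'') (fst s2 ''b'') (fst s3 ''st''))"
        and d3: "\<forall>v<n. fst s3 ''st'' v \<noteq> 1" using p3 by (auto simp: search_result_def)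
      have n3: "fst s3 ''n'' 0 = n" using n by (simp add: f1 f2 f3)
      show "wp (save_search ;; label_regions ;; upd ''cnt1'' (rd ''cnt'') ;; contract_regions) (\<lambda>s' _. ?R s') s3
          (15 * n + 6 * m + 9)"
      proof (rule wp_seq[OF wp_save_search[OF n3], where l = "7 * n + 6 * m + 6"])
        fix s4 assume p4: "(\<forall>i<n. fst s4 ''near'' i = i \<and> fst s4 ''pe1'' i = fst s3 ''pe'' i \<and>
            fst s4 ''need'' i = 0 \<and> fst s4 ''seed'' i = 0) \<and>
          (\<forall>v<n. 0 < fst s3 ''terminal'' v \<longrightarrow> fst s4 ''tv'' 0 < n \<and> 0 < fst s3 ''terminal'' (fst s4 ''tv'' 0))"
          and fr4: "frame save_search s3 s4"
        note f4 = frameD1[OF fr4, simplified] frameD2[OF fr4, simplified]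
        have g4: "search_inv n m (fst s4 ''a'') (fst s4 ''b'') (snd s2 ''cost'') 1 (fst s2 ''seed'') (fst s3 ''st'')
          (snd s3 ''key'') (fst s4 ''pe'') (fst s4 ''ord'') (fst s4 ''cnt'' 0)
          (all_scanned n m (fst s2 ''a'') (fst s2 ''b'') (fst s3 ''st''))"
          using g3 by (simp add: f4 f3)
        have near4: "\<forall>i<n. fst s4 ''near'' i = i" using p4 by blast
        show "wp (label_regions ;; upd ''cnt1'' (rd ''cnt'') ;; contract_regions) (\<lambda>s' _. ?R s') s4 (7 * n + 6 * m + 6)"
        proof (rule wp_seq[OF wp_label_regions[OF g4 near4], where l = "6 * m + 3"])
          fix s5 assume p5: "(\<forall>i<fst s4 ''cnt'' 0. fst s5 ''ord1'' i = fst s4 ''ord'' i) \<and>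
            (\<forall>v<n. fst s5 ''near'' v < n \<and> (fst s3 ''st'' v \<noteq> 1 \<longrightarrow> fst s5 ''near'' v = (if fst s4 ''pe'' v = 0 then v
              else fst s5 ''near'' (other (fst s4 ''a'') (fst s4 ''b'') (fst s4 ''pe'' v - 1) v))))"
            and fr5: "frame label_regions s4 s5"
          note f5 = frameD1[OF fr5, simplified] frameD2[OF fr5, simplified]
          let ?s5 = "nwrite ''cnt1'' 0 (fst s5 ''cnt'' 0) s5"
          have m5: "fst ?s5 ''m'' 0 = m" using m by (simp add: f1 f2 f3 f4 f5)
          have "wp contract_regions (\<lambda>s' _. ?R s') ?s5 (6 * m + 2)"
          proof (rule wp_use[OF wp_contract_regions[OF m5]])
            fix s6 n6 assume p6: "\<forall>j<m. fst s6 ''a'' j = fst ?s5 ''near'' (fst ?s5 ''a'' j) \<and>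
              fst s6 ''b'' j = fst ?s5 ''near'' (fst ?s5 ''b'' j) \<and> fst s6 ''sol'' j = 0 \<and>
              snd s6 ''cost'' j = snd ?s5 ''key'' (fst ?s5 ''a'' j) + snd ?s5 ''cost'' j + snd ?s5 ''key'' (fst ?s5 ''b'' j)"
              and fr6: "frame contract_regions ?s5 s6"
            note f6 = frameD1[OF fr6, simplified] frameD2[OF fr6, simplified]
            have "voronoi_data n m (fst s ''src'') (fst s ''dst'') (fst s ''terminal'') (fst s ''predicted'') (snd s ''weight'')
               (snd s ''alpha'' 0) (fst s2 ''a'') (fst s2 ''b'') (snd s2 ''cost'') (fst s2 ''seed'') (fst s3 ''st'')
               (snd s6 ''key'') (fst s3 ''pe'') (fst s3 ''ord'') (fst s6 ''cnt1'' 0) (fst s6 ''near'')"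
            proof (rule voronoi_data.intro)
              show "search_inv n m (fst s2 ''a'') (fst s2 ''b'') (snd s2 ''cost'') 1 (fst s2 ''seed'') (fst s3 ''st'')
                (snd s6 ''key'') (fst s3 ''pe'') (fst s3 ''ord'') (fst s6 ''cnt1'' 0)
                (all_scanned n m (fst s2 ''a'') (fst s2 ''b'') (fst s3 ''st''))"
                using g3 by (simp add: f4 f5 f6)
            next
              fix v assume v: "v < n"
              show "fst s3 ''st'' v \<noteq> 1" using d3 v by blast
              show "fst s2 ''seed'' v = fst s ''terminal'' v" using p2 v by (simp add: f1)
              show "fst s6 ''near'' v < n" using p5 v by (simp add: f6)
              show "fst s6 ''near'' v = (if fst s3 ''pe'' v = 0 then v
                else fst s6 ''near'' (other (fst s2 ''a'') (fst s2 ''b'') (fst s3 ''pe'' v - 1) v))"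
                using p5 v d3 by (simp add: f3 f4 f6)
            next
              fix j assume j: "j < m"
              show "fst s2 ''a'' j = fst s ''src'' j \<and> fst s2 ''b'' j = fst s ''dst'' j \<and>
                snd s2 ''cost'' j = (if 0 < fst s ''predicted'' j then snd s ''weight'' j / snd s ''alpha'' 0
                else snd s ''weight'' j)" using p1 j by (simp add: f2)
            qed
            moreover have "\<forall>i<n. fst s6 ''pe1'' i = fst s3 ''pe'' i \<and> fst s6 ''need'' i = 0 \<and> fst s6 ''seed'' i = 0"
              using p4 by (simp add: f5 f6)
            moreover have "\<forall>v<n. 0 < fst s ''terminal'' v \<longrightarrow> fst s6 ''tv'' 0 < n \<and> 0 < fst s ''terminal'' (fst s6 ''tv'' 0)"
              using p4 by (simp add: f1 f2 f3 f5 f6)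
            moreover have "\<forall>i<fst s6 ''cnt1'' 0. fst s6 ''ord1'' i = fst s3 ''ord'' i"
              using p5 by (simp add: f4 f5 f6)
            moreover have "\<forall>j<m. fst s6 ''a'' j = fst s6 ''near'' (fst s ''src'' j) \<and>
              fst s6 ''b'' j = fst s6 ''near'' (fst s ''dst'' j) \<and> fst s6 ''sol'' j = 0 \<and>
              snd s6 ''cost'' j = snd s6 ''key'' (fst s ''src'' j) + snd s2 ''cost'' j + snd s6 ''key'' (fst s ''dst'' j)"
              using p6 p1 by (simp add: f2 f3 f4 f5 f6)
            ultimately show "?R s6" by (intro exI) (intro conjI)
          qed simp
          then show "wp (upd ''cnt1'' (rd ''cnt'') ;; contract_regions) (\<lambda>s' _. ?R s') s5 (6 * m + 3)"
            by (rule wp_NWrite_seq) simp_all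
        qed simp
      qed simp
    qed simp
    then show "wp (RWrite ''mult'' (NConst 0) (RConst 1) ;; search ;; save_search ;; label_regions ;;
        upd ''cnt1'' (rd ''cnt'') ;; contract_regions) (\<lambda>s' _. ?R s') s2 (Suc (95 * n + 190 * (n * L) + 276 * m + 19))"
      by (rule wp_RWrite_seq) simp_all
  qed simp
qed simp

lemma wp_second_phase:
  assumes n: "fst s ''n'' 0 = n" and m: "fst s ''m'' 0 = m" and L: "n < 2 ^ L"
    and ends: "\<And>j. j < m \<Longrightarrow> fst s ''src'' j < n \<and> fst s ''dst'' j < n"
    and w: "\<And>j. j < m \<Longrightarrow> 0 \<le> c1 j"
    and vd: "voronoi_data n m (fst s ''src'') (fst s ''dst'') (fst s ''terminal'') pred weight
        \<alpha> a1 b1 c1 sd1 st1 (snd s ''key'') pe1 ord1 (fst s ''cnt1'' 0) (fst s ''near'')"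
    and init: "\<forall>i<n. fst s ''pe1'' i = pe1 i \<and> fst s ''need'' i = 0 \<and> fst s ''seed'' i = 0"
    and tv: "\<forall>v<n. 0 < fst s ''terminal'' v \<longrightarrow> fst s ''tv'' 0 < n \<and> 0 < fst s ''terminal'' (fst s ''tv'' 0)"
    and ord: "\<forall>i<fst s ''cnt1'' 0. fst s ''ord1'' i = ord1 i"
    and edges: "\<forall>j<m. fst s ''a'' j = fst s ''near'' (fst s ''src'' j) \<and> fst s ''b'' j = fst s ''near'' (fst s ''dst'' j) \<and>
        fst s ''sol'' j = 0 \<and>
        snd s ''cost'' j = snd s ''key'' (fst s ''src'' j) + c1 j + snd s ''key'' (fst s ''dst'' j)"
    and wt: "weight = snd s ''weight''"
  shows "wp second_phase (\<lambda>s' _. run_result n m (fst s ''src'') (fst s ''dst'') (fst s ''terminal'') pred weight \<alpha>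
      (fst s' ''sol'') \<and> (\<forall>j<m. fst s' ''sol'' j \<le> 1) \<and>
      snd s' ''wt'' 0 = sum weight {j. j < m \<and> 0 < fst s' ''sol'' j}) s (94 * n + 190 * (n * L) + 274 * m + 19)"
proof -
  interpret voronoi_data n m "fst s ''src''" "fst s ''dst''" "fst s ''terminal''" pred weight
        \<alpha> a1 b1 c1 sd1 st1 "snd s ''key''" pe1 ord1 "fst s ''cnt1'' 0" "fst s ''near''" by (fact vd)
  interpret S1: search_inv n m a1 b1 c1 1 sd1 st1 "snd s ''key''" pe1 ord1 "fst s ''cnt1'' 0"
    "all_scanned n m a1 b1 st1" by (fact search1)
  let ?tv = "fst s ''tv'' 0"
  let ?s1 = "rwrite ''mult'' 0 0 (nwrite ''seed'' ?tv (fst s ''terminal'' ?tv) s)"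
  let ?src = "fst s ''src''" and ?dst = "fst s ''dst''" and ?tm = "fst s ''terminal''"
  let ?R = "\<lambda>s'. run_result n m ?src ?dst ?tm pred weight \<alpha> (fst s' ''sol'') \<and> (\<forall>j<m. fst s' ''sol'' j \<le> 1) \<and>
      snd s' ''wt'' 0 = sum weight {j. j < m \<and> 0 < fst s' ''sol'' j}"
  have key0: "0 \<le> snd s ''key'' v" if "v < n" for v using S1.key_nonneg that .
  have par_eq: "other a1 b1 (pe1 v - 1) v = other ?src ?dst (pe1 v - 1) v" if "v < n" "pe1 v \<noteq> 0" for v
    using search_inv_cong[OF search1 _ that] edges1 by blast
  have anc_eq: "ancestor n ?src ?dst (fst s ''pe1'') = ancestor n a1 b1 pe1"
    unfolding ancestor_def
  proof (rule arg_cong[of _ _ rtranclp], intro ext)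
    fix v x show "(v < n \<and> fst s ''pe1'' v \<noteq> 0 \<and> x = other ?src ?dst (fst s ''pe1'' v - 1) v) \<longleftrightarrow>
      (v < n \<and> pe1 v \<noteq> 0 \<and> x = other a1 b1 (pe1 v - 1) v)"
      using init par_eq[of v] by (cases "v < n") auto
  qed
  have cost: "0 \<le> snd s ''cost'' j" if j: "j < m" for j
    using edges ends[OF j] w[OF j] key0 j by simp
  have "wp search (\<lambda>s' _. search_result n m (fst ?s1 ''a'') (fst ?s1 ''b'') (snd ?s1 ''cost'')
        (snd ?s1 ''mult'' 0) (fst ?s1 ''seed'') s') ?s1 (80 * n + 190 * (n * L) + 270 * m + 10)"
    by (rule wp_search) (use n m L ends near_less edges cost in simp_all)
  then have "wp (search ;; collect_edges ;; trace_paths ;; weigh) (\<lambda>s' _. ?R s') ?s1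
    (94 * n + 190 * (n * L) + 274 * m + 17)"
  proof (rule wp_seq[where l = "14 * n + 4 * m + 7"])
    fix s2 assume p2: "search_result n m (fst ?s1 ''a'') (fst ?s1 ''b'') (snd ?s1 ''cost'')
        (snd ?s1 ''mult'' 0) (fst ?s1 ''seed'') s2" and fr2: "frame search ?s1 s2"
    note f2 = frameD1[OF fr2, simplified] frameD2[OF fr2, simplified]
    let ?sd2 = "(fst s ''seed'')(?tv := ?tm ?tv)"
    have g2: "search_inv n m (fst s ''a'') (fst s ''b'') (snd s ''cost'') 0 ?sd2 (fst s2 ''st'')
          (snd s2 ''key'') (fst s2 ''pe'') (fst s2 ''ord'') (fst s2 ''cnt'' 0)
          (all_scanned n m (fst s ''a'') (fst s ''b'') (fst s2 ''st''))"
        and d2: "\<forall>v<n. fst s2 ''st'' v \<noteq> 1" using p2 by (auto simp: search_result_def)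
    have n2: "fst s2 ''n'' 0 = n" using n by (simp add: f2)
    have sol2: "\<forall>j<m. fst s2 ''sol'' j = 0" using edges by (simp add: f2)
    have need2: "\<forall>v<n. fst s2 ''need'' v = 0" using init by (simp add: f2)
    show "wp (collect_edges ;; trace_paths ;; weigh) (\<lambda>s' _. ?R s') s2 (14 * n + 4 * m + 7)"
    proof (rule wp_seq[OF wp_collect_edges[OF n2 sol2 need2], where l = "7 * n + 4 * m + 5"])
      fix s3 assume p3: "(\<forall>j<m. fst s3 ''sol'' j = (if \<exists>i<n. fst s2 ''pe'' i = Suc j then 1 else 0)) \<and>
        (\<forall>v<n. 0 < fst s3 ''need'' v \<longleftrightarrow> (\<exists>i<n. fst s2 ''pe'' i \<noteq> 0 \<and>
          (v = fst s2 ''src'' (fst s2 ''pe'' i - 1) \<or> v = fst s2 ''dst'' (fst s2 ''pe'' i - 1))))"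
        and fr3: "frame collect_edges s2 s3"
      note f3 = frameD1[OF fr3, simplified] frameD2[OF fr3, simplified]
      let ?N0 = "{v. v < n \<and> 0 < fst s3 ''need'' v}"
      have ord3: "fst s3 ''ord1'' i = ord1 i" if "i < fst s ''cnt1'' 0" for i using ord that by (simp add: f2 f3)
      have cnt3: "fst s3 ''cnt1'' 0 = fst s ''cnt1'' 0" "fst s3 ''src'' = ?src" "fst s3 ''dst'' = ?dst"
        "fst s3 ''pe1'' = fst s ''pe1''" by (simp_all add: f2 f3)
      have ordn: "ord1 i < n" if "i < fst s ''cnt1'' 0" for i using S1.ord_image that by blast
      have img: "fst s3 ''ord1'' ` {..<i} = ord1 ` {..<i}" if "i \<le> fst s ''cnt1'' 0" for i
        using ord3 that by (intro image_cong) auto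
      have "wp trace_paths (\<lambda>s' _. (\<forall>j<m. fst s' ''sol'' j \<le> 1) \<and> (\<exists>N. ?N0 \<subseteq> N \<and> N \<subseteq> {..<n} \<and>
        (\<forall>v\<in>N. \<exists>x\<in>?N0. ancestor n (fst s3 ''src'') (fst s3 ''dst'') (fst s3 ''pe1'') x v) \<and>
        (\<forall>v\<in>N. fst s3 ''pe1'' v \<noteq> 0 \<longrightarrow> other (fst s3 ''src'') (fst s3 ''dst'') (fst s3 ''pe1'' v - 1) v \<in> N) \<and>
        (\<forall>j<m. 0 < fst s' ''sol'' j \<longleftrightarrow> 0 < fst s3 ''sol'' j \<or> (\<exists>v\<in>N. fst s3 ''pe1'' v = Suc j)))) s3 (7 * n + 2)"
      proof (rule wp_trace_paths[where st = st1])
        show "inj_on (fst s3 ''ord1'') {..<fst s3 ''cnt1'' 0}"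
          unfolding cnt3 using S1.ord_inj ord3 by (subst inj_on_cong[of _ _ ord1]) auto
        show "fst s3 ''ord1'' ` {..<fst s3 ''cnt1'' 0} = {v. v < n \<and> st1 v = 2}"
          unfolding cnt3 using S1.ord_image img by simp
        fix v assume v: "v < n" "fst s3 ''pe1'' v \<noteq> 0"
        then have pv: "pe1 v \<noteq> 0" "fst s3 ''pe1'' v = pe1 v" using init by (auto simp: cnt3)
        have s0: "st1 v \<noteq> 0" using S1.unreached[OF v(1)] pv by auto
        then have "st1 v = 2" using done1[OF v(1)] S1.st_le[OF v(1)] by linarith
        then show "st1 v = 2 \<and> fst s3 ''pe1'' v - 1 < m \<and>
          other (fst s3 ''src'') (fst s3 ''dst'') (fst s3 ''pe1'' v - 1) v < n"
          using S1.parent[OF v(1) s0 pv(1)] par_eq[OF v(1) pv(1)] pv by (simp add: cnt3)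
      next
        fix i assume i: "i < fst s3 ''cnt1'' 0" "fst s3 ''pe1'' (fst s3 ''ord1'' i) \<noteq> 0"
        then have i': "i < fst s ''cnt1'' 0" by (simp add: cnt3)
        have pi: "fst s3 ''pe1'' (fst s3 ''ord1'' i) = pe1 (ord1 i)" using init ordn[OF i'] ord3[OF i'] by (simp add: cnt3)
        then show "other (fst s3 ''src'') (fst s3 ''dst'') (fst s3 ''pe1'' (fst s3 ''ord1'' i) - 1) (fst s3 ''ord1'' i)
          \<in> fst s3 ''ord1'' ` {..<i}"
          using S1.parent_earlier[OF i'] par_eq[OF ordn[OF i']] i img[of i] i' by (simp add: cnt3 ord3)
      next
        show "\<forall>j<m. fst s3 ''sol'' j \<le> 1" using p3 by simp
      qed simp
      then show "wp (trace_paths ;; weigh) (\<lambda>s' _. ?R s') s3 (7 * n + 4 * m + 5)"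
      proof (rule wp_seq[where l = "4 * m + 3"])
        fix s4 assume p4: "(\<forall>j<m. fst s4 ''sol'' j \<le> 1) \<and> (\<exists>N. ?N0 \<subseteq> N \<and> N \<subseteq> {..<n} \<and>
          (\<forall>v\<in>N. \<exists>x\<in>?N0. ancestor n (fst s3 ''src'') (fst s3 ''dst'') (fst s3 ''pe1'') x v) \<and>
          (\<forall>v\<in>N. fst s3 ''pe1'' v \<noteq> 0 \<longrightarrow> other (fst s3 ''src'') (fst s3 ''dst'') (fst s3 ''pe1'' v - 1) v \<in> N) \<and>
          (\<forall>j<m. 0 < fst s4 ''sol'' j \<longleftrightarrow> 0 < fst s3 ''sol'' j \<or> (\<exists>v\<in>N. fst s3 ''pe1'' v = Suc j)))"
          and fr4: "frame trace_paths s3 s4"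
        note f4 = frameD1[OF fr4, simplified] frameD2[OF fr4, simplified]
        obtain N where N: "?N0 \<subseteq> N" "N \<subseteq> {..<n}" "\<forall>v\<in>N. \<exists>x\<in>?N0. ancestor n a1 b1 pe1 x v"
          "\<forall>v\<in>N. fst s ''pe1'' v \<noteq> 0 \<longrightarrow> other ?src ?dst (fst s ''pe1'' v - 1) v \<in> N"
          "\<forall>j<m. 0 < fst s4 ''sol'' j \<longleftrightarrow> 0 < fst s3 ''sol'' j \<or> (\<exists>v\<in>N. fst s ''pe1'' v = Suc j)"
          using p4[unfolded cnt3 anc_eq] by (elim conjE exE)
        have need3: "0 < fst s3 ''need'' v \<longleftrightarrow> (\<exists>i<n. fst s2 ''pe'' i \<noteq> 0 \<and>
          (v = ?src (fst s2 ''pe'' i - 1) \<or> v = ?dst (fst s2 ''pe'' i - 1)))" if "v < n" for v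
          using p3 that by (simp add: f2)
        have peN: "fst s ''pe1'' v = pe1 v" if "v \<in> N" for v using N(2) that init by auto
        have rd: "run_data n m ?src ?dst ?tm pred weight \<alpha> a1 b1 c1 sd1 st1 (snd s ''key'') pe1 ord1
          (fst s ''cnt1'' 0) (fst s ''near'') (fst s ''a'') (fst s ''b'') (snd s ''cost'') ?sd2 (fst s2 ''st'')
          (snd s2 ''key'') (fst s2 ''pe'') (fst s2 ''ord'') (fst s2 ''cnt'' 0) ?tv N (fst s4 ''sol'')"
        proof (rule run_data.intro[OF vd], rule run_data_axioms.intro)
          show "search_inv n m (fst s ''a'') (fst s ''b'') (snd s ''cost'') 0 ?sd2 (fst s2 ''st'')
          (snd s2 ''key'') (fst s2 ''pe'') (fst s2 ''ord'') (fst s2 ''cnt'' 0)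
          (all_scanned n m (fst s ''a'') (fst s ''b'') (fst s2 ''st''))" by (fact g2)
        next
          fix v assume v: "v < n"
          show "fst s2 ''st'' v \<noteq> 1" using d2 v by blast
          show "0 < ?sd2 v \<longleftrightarrow> v = ?tv \<and> 0 < ?tm ?tv" using init v by auto
          show "?tv < n \<and> 0 < ?tm ?tv" if "0 < ?tm v" using tv v that by blast
        next
          fix j assume j: "j < m"
          show "fst s ''a'' j = fst s ''near'' (?src j) \<and> fst s ''b'' j = fst s ''near'' (?dst j) \<and>
            snd s ''cost'' j = snd s ''key'' (?src j) + c1 j + snd s ''key'' (?dst j)" using edges j by blast
          have "0 < fst s3 ''sol'' j \<longleftrightarrow> (\<exists>i<n. fst s2 ''pe'' i = Suc j)" using p3 j by simp
          moreover have "(\<exists>v\<in>N. fst s ''pe1'' v = Suc j) \<longleftrightarrow> (\<exists>v\<in>N. pe1 v = Suc j)" using peN by auto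
          ultimately show "0 < fst s4 ''sol'' j \<longleftrightarrow> (\<exists>i<n. fst s2 ''pe'' i = Suc j) \<or> (\<exists>v\<in>N. pe1 v = Suc j)"
            using N(5)[rule_format, OF j] by (simp only:)
        next
          fix i assume i: "i < n" "fst s2 ''pe'' i \<noteq> 0"
          have "fst s2 ''pe'' i - 1 < m"
          proof -
            have "fst s2 ''st'' i \<noteq> 0" using search_inv.unreached[OF g2 i(1)] i(2) by auto
            then show ?thesis using search_inv.parent[OF g2 i(1) _ i(2)] by blast
          qed
          then have e: "?src (fst s2 ''pe'' i - 1) < n" "?dst (fst s2 ''pe'' i - 1) < n" using ends by auto
          then have "?src (fst s2 ''pe'' i - 1) \<in> ?N0" "?dst (fst s2 ''pe'' i - 1) \<in> ?N0"
            using need3 i by blast+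
          then show "?src (fst s2 ''pe'' i - 1) \<in> N \<and> ?dst (fst s2 ''pe'' i - 1) \<in> N" using N(1) by blast
        next
          fix v assume v: "v \<in> N"
          show vn: "v < n" using N(2) v by blast
          show "other a1 b1 (pe1 v - 1) v \<in> N" if "pe1 v \<noteq> 0"
            using N(4) v peN[OF v] par_eq[OF vn that] that by (metis)
          obtain x where x: "x < n" "0 < fst s3 ''need'' x" "ancestor n a1 b1 pe1 x v" using N(3) v by blast
          then show "\<exists>i<n. fst s2 ''pe'' i \<noteq> 0 \<and> (ancestor n a1 b1 pe1 (?src (fst s2 ''pe'' i - 1)) v \<or>
            ancestor n a1 b1 pe1 (?dst (fst s2 ''pe'' i - 1)) v)"
            using need3[OF x(1)] by blast
        qed
        have rr: "run_result n m ?src ?dst ?tm pred weight \<alpha> (fst s4 ''sol'')"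
          unfolding run_result_def by (intro exI) (rule rd)
        have m4: "fst s4 ''m'' 0 = m" using m by (simp add: f2 f3 f4)
        show "wp weigh (\<lambda>s' _. ?R s') s4 (4 * m + 3)"
        proof (rule wp_use[OF wp_weigh[OF m4]])
          fix s5 n5 assume p5: "snd s5 ''wt'' 0 = sum (snd s4 ''weight'') {j. j < m \<and> 0 < fst s4 ''sol'' j}"
            and fr5: "frame weigh s4 s5"
          have "fst s5 ''sol'' = fst s4 ''sol''" by (simp add: frameD1[OF fr5])
          then show "?R s5" using p5 rr p4 wt by (simp add: f2 f3 f4)
        qed simp
      qed simp
    qed simp
  qed simp
  then have "wp (RWrite ''mult'' (NConst 0) (RConst 0) ;; search ;; collect_edges ;; trace_paths ;; weigh)
      (\<lambda>s' _. ?R s') (nwrite ''seed'' ?tv (fst s ''terminal'' ?tv) s) (94 * n + 190 * (n * L) + 274 * m + 18)"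
    by (rule wp_RWrite_seq) (simp, linarith)
  then show ?thesis unfolding second_phase_def
    by (rule wp_NWrite_seq) (simp, linarith)
qed

lemma wp_run:
  assumes n: "fst s ''n'' 0 = n" and m: "fst s ''m'' 0 = m" and L: "n < 2 ^ L"
    and ends: "\<And>j. j < m \<Longrightarrow> fst s ''src'' j < n \<and> fst s ''dst'' j < n"
    and w: "\<And>j. j < m \<Longrightarrow> 0 \<le> snd s ''weight'' j" and al: "0 < snd s ''alpha'' 0"
  shows "wp run (\<lambda>s' _. run_result n m (fst s ''src'') (fst s ''dst'') (fst s ''terminal'') (fst s ''predicted'')
      (snd s ''weight'') (snd s ''alpha'' 0) (fst s' ''sol'') \<and> (\<forall>j<m. fst s' ''sol'' j \<le> 1) \<and>
      snd s' ''wt'' 0 = sum (snd s ''weight'') {j. j < m \<and> 0 < fst s' ''sol'' j})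
    s (192 * n + 380 * (n * L) + 556 * m + 43)"
  unfolding run_def
proof (rule wp_seq[OF wp_first_phase[OF n m L ends w al], where l = "94 * n + 190 * (n * L) + 274 * m + 19"])
  fix s1
  assume p: "\<exists>a1 b1 c1 sd1 st1 pe1 ord1.
      voronoi_data n m (fst s ''src'') (fst s ''dst'') (fst s ''terminal'') (fst s ''predicted'') (snd s ''weight'')
        (snd s ''alpha'' 0) a1 b1 c1 sd1 st1 (snd s1 ''key'') pe1 ord1 (fst s1 ''cnt1'' 0) (fst s1 ''near'') \<and>
      (\<forall>i<n. fst s1 ''pe1'' i = pe1 i \<and> fst s1 ''need'' i = 0 \<and> fst s1 ''seed'' i = 0) \<and>
      (\<forall>v<n. 0 < fst s ''terminal'' v \<longrightarrow> fst s1 ''tv'' 0 < n \<and> 0 < fst s ''terminal'' (fst s1 ''tv'' 0)) \<and>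
      (\<forall>i<fst s1 ''cnt1'' 0. fst s1 ''ord1'' i = ord1 i) \<and>
      (\<forall>j<m. fst s1 ''a'' j = fst s1 ''near'' (fst s ''src'' j) \<and> fst s1 ''b'' j = fst s1 ''near'' (fst s ''dst'' j) \<and>
        fst s1 ''sol'' j = 0 \<and>
        snd s1 ''cost'' j = snd s1 ''key'' (fst s ''src'' j) + c1 j + snd s1 ''key'' (fst s ''dst'' j))"
    and fr: "frame first_phase s s1"
  note f = frameD1[OF fr, unfolded first_phase_def, simplified] frameD2[OF fr, unfolded first_phase_def, simplified]
  have e: "fst s ''src'' = fst s1 ''src''" "fst s ''dst'' = fst s1 ''dst''" "fst s ''terminal'' = fst s1 ''terminal''"
    "snd s ''weight'' = snd s1 ''weight''" by (simp_all add: f)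
  obtain a1 b1 c1 sd1 st1 pe1 ord1 where q:
    "voronoi_data n m (fst s ''src'') (fst s ''dst'') (fst s ''terminal'') (fst s ''predicted'') (snd s ''weight'')
        (snd s ''alpha'' 0) a1 b1 c1 sd1 st1 (snd s1 ''key'') pe1 ord1 (fst s1 ''cnt1'' 0) (fst s1 ''near'')"
    "\<forall>i<n. fst s1 ''pe1'' i = pe1 i \<and> fst s1 ''need'' i = 0 \<and> fst s1 ''seed'' i = 0"
    "\<forall>v<n. 0 < fst s ''terminal'' v \<longrightarrow> fst s1 ''tv'' 0 < n \<and> 0 < fst s ''terminal'' (fst s1 ''tv'' 0)"
    "\<forall>i<fst s1 ''cnt1'' 0. fst s1 ''ord1'' i = ord1 i"
    "\<forall>j<m. fst s1 ''a'' j = fst s1 ''near'' (fst s ''src'' j) \<and> fst s1 ''b'' j = fst s1 ''near'' (fst s ''dst'' j) \<and>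
        fst s1 ''sol'' j = 0 \<and>
        snd s1 ''cost'' j = snd s1 ''key'' (fst s ''src'' j) + c1 j + snd s1 ''key'' (fst s ''dst'' j)"
    using p by (elim exE conjE)
  have c1: "0 \<le> c1 j" if "j < m" for j
    using voronoi_data.edges1[OF q(1) that] w[OF that] al by simp
  show "wp second_phase (\<lambda>s' _. run_result n m (fst s ''src'') (fst s ''dst'') (fst s ''terminal'') (fst s ''predicted'')
      (snd s ''weight'') (snd s ''alpha'' 0) (fst s' ''sol'') \<and> (\<forall>j<m. fst s' ''sol'' j \<le> 1) \<and>
      snd s' ''wt'' 0 = sum (snd s ''weight'') {j. j < m \<and> 0 < fst s' ''sol'' j}) s1
      (94 * n + 190 * (n * L) + 274 * m + 19)"
    unfolding e(1-3)
    by (rule wp_second_phase[OF _ _ L _ c1 q(1)[unfolded e(1-3)] q(2) q(3)[unfolded e(1-3)] q(4) q(5)[unfolded e(1-3)] e(4)])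
      (use n m ends in \<open>simp_all add: f\<close>)
qed (linarith | assumption)+

section \<open>The loop over the grid\<close>

definition keep_best :: com where
  "keep_best = Cond (BAnd (NLess (NConst 0) (rd ''have'')) (BNot (RLess (RRead ''wt'' (NConst 0)) (RRead ''best'' (NConst 0)))))
     Skip
     (RWrite ''best'' (NConst 0) (RRead ''wt'' (NConst 0)) ;; upd ''have'' (NConst 1) ;;
      For ''j'' (rd ''m'') (NWrite ''output'' (rd ''j'') (NRead ''sol'' (rd ''j''))))"

text \<open>\<open>\<alpha> * \<epsilon> < 1\<close> says that the exponent is still below
  \<open>max_exponent \<epsilon>\<close>, so no logarithm has to be computed.\<close>

definition next_alpha :: com where
  "next_alpha = Cond (RLess (RMul (RRead ''alpha'' (NConst 0)) (RRead ''epsilon'' (NConst 0))) (RConst 1))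
     (RWrite ''alpha'' (NConst 0) (RMul (RRead ''alpha'' (NConst 0)) (RAdd (RConst 1) (RRead ''epsilon'' (NConst 0)))))
     (upd ''go'' (NConst 0))"

definition program :: com where
  "program = RWrite ''alpha'' (NConst 0) (RConst 1) ;; upd ''go'' (NConst 1) ;;
     While (NLess (NConst 0) (rd ''go'')) (run ;; keep_best ;; next_alpha)"

lemma wp_keep_best:
  assumes m: "fst s ''m'' 0 = m"
  shows "wp keep_best (\<lambda>s' _. if 0 < fst s ''have'' 0 \<and> \<not> snd s ''wt'' 0 < snd s ''best'' 0 then s' = s
      else 0 < fst s' ''have'' 0 \<and> snd s' ''best'' 0 = snd s ''wt'' 0 \<and> (\<forall>j<m. fst s' ''output'' j = fst s ''sol'' j))
    s (3 * m + 5)"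
proof (cases "0 < fst s ''have'' 0 \<and> \<not> snd s ''wt'' 0 < snd s ''best'' 0")
  case True
  then show ?thesis by (simp add: keep_best_def wp_simps)
next
  case False
  let ?s = "nwrite ''have'' 0 1 (rwrite ''best'' 0 (snd s ''wt'' 0) s)"
  let ?Q = "\<lambda>s'::state. 0 < fst s' ''have'' 0 \<and> snd s' ''best'' 0 = snd s ''wt'' 0 \<and> (\<forall>j<m. fst s' ''output'' j = fst s ''sol'' j)"
  have "wp (For ''j'' (rd ''m'') (NWrite ''output'' (rd ''j'') (NRead ''sol'' (rd ''j'')))) (\<lambda>s' _. ?Q s') ?s (3 * m + 2)"
    by (rule wp_For[where N = m and K = 1 and I = "\<lambda>k s'. \<forall>j<k. fst s' ''output'' j = fst s ''sol'' j"])
      (use m in \<open>auto simp: wp_simps frame_def less_Suc_eq\<close>)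
  then have "wp (upd ''have'' (NConst 1) ;;
      For ''j'' (rd ''m'') (NWrite ''output'' (rd ''j'') (NRead ''sol'' (rd ''j'')))) (\<lambda>s' _. ?Q s')
      (rwrite ''best'' 0 (snd s ''wt'' 0) s) (3 * m + 3)"
    by (rule wp_NWrite_seq) (simp, linarith)
  then have "wp (RWrite ''best'' (NConst 0) (RRead ''wt'' (NConst 0)) ;; upd ''have'' (NConst 1) ;;
      For ''j'' (rd ''m'') (NWrite ''output'' (rd ''j'') (NRead ''sol'' (rd ''j'')))) (\<lambda>s' _. ?Q s') s (3 * m + 4)"
    by (rule wp_RWrite_seq) (simp, linarith)
  moreover have "\<not> bval (BAnd (NLess (NConst 0) (rd ''have''))
      (BNot (RLess (RRead ''wt'' (NConst 0)) (RRead ''best'' (NConst 0))))) s" using False by simp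
  moreover have "3 * m + 5 - 1 = 3 * m + 4" "1 \<le> 3 * m + 5" by simp_all
  ultimately have "wp keep_best (\<lambda>s' _. ?Q s') s (3 * m + 5)"
    unfolding keep_best_def wp_Cond by (simp only: if_False simp_thms)
  then show ?thesis unfolding if_not_P[OF False] .
qed

definition grid_result :: "nat \<Rightarrow> nat \<Rightarrow> (nat \<Rightarrow> nat) \<Rightarrow> (nat \<Rightarrow> nat) \<Rightarrow> (nat \<Rightarrow> nat) \<Rightarrow> (nat \<Rightarrow> nat) \<Rightarrow>
    (nat \<Rightarrow> real) \<Rightarrow> real \<Rightarrow> nat \<Rightarrow> (nat \<Rightarrow> nat) \<Rightarrow> real \<Rightarrow> bool" where
  "grid_result n m src dst tm pred weight \<epsilon> k out best \<longleftrightarrow>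
     (\<exists>sols b. (\<forall>i<k. run_result n m src dst tm pred weight ((1 + \<epsilon>) ^ i) (sols i) \<and> (\<forall>j<m. sols i j \<le> 1)) \<and>
        b < k \<and> (\<forall>j<m. out j = sols b j) \<and> best = sum weight {j. j < m \<and> 0 < sols b j} \<and>
        (\<forall>i<k. best \<le> sum weight {j. j < m \<and> 0 < sols i j}))"

lemma grid_result_step:
  assumes new: "run_result n m src dst tm pred weight ((1 + \<epsilon>) ^ k) sol" "\<forall>j<m. sol j \<le> 1"
    and wt: "wt = sum weight {j. j < m \<and> 0 < sol j}"
    and old: "k = 0 \<or> grid_result n m src dst tm pred weight \<epsilon> k out best"
    and choice: "k \<noteq> 0 \<and> \<not> wt < best \<and> (\<forall>j<m. out' j = out j) \<and> best' = best \<or>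
      (k = 0 \<or> wt < best) \<and> (\<forall>j<m. out' j = sol j) \<and> best' = wt"
  shows "grid_result n m src dst tm pred weight \<epsilon> (Suc k) out' best'"
proof (cases "k = 0")
  case True
  then show ?thesis unfolding grid_result_def
    using new wt choice by (intro exI[of _ "\<lambda>_. sol"] exI[of _ 0]) auto
next
  case False
  then obtain sols b where o: "\<forall>i<k. run_result n m src dst tm pred weight ((1 + \<epsilon>) ^ i) (sols i) \<and> (\<forall>j<m. sols i j \<le> 1)"
    "b < k" "\<forall>j<m. out j = sols b j" "best = sum weight {j. j < m \<and> 0 < sols b j}"
    "\<forall>i<k. best \<le> sum weight {j. j < m \<and> 0 < sols i j}"
    using old unfolding grid_result_def by blast
  let ?sols = "sols(k := sol)"
  have all: "\<forall>i<Suc k. run_result n m src dst tm pred weight ((1 + \<epsilon>) ^ i) (?sols i) \<and> (\<forall>j<m. ?sols i j \<le> 1)"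
    using o(1) new by (auto simp: less_Suc_eq)
  show ?thesis
  proof (cases "wt < best")
    case True
    then have c: "\<forall>j<m. out' j = sol j" "best' = wt" using choice by auto
    have "\<forall>i<Suc k. best' \<le> sum weight {j. j < m \<and> 0 < ?sols i j}"
      using o(5) True c wt by (fastforce simp: less_Suc_eq)
    then show ?thesis unfolding grid_result_def
      using all c wt by (intro exI[of _ ?sols] exI[of _ k]) auto
  next
    case f: False
    then have c: "\<forall>j<m. out' j = out j" "best' = best" using choice False by auto
    have "\<forall>i<Suc k. best' \<le> sum weight {j. j < m \<and> 0 < ?sols i j}"
      using o(5) f c wt by (auto simp: less_Suc_eq)
    then show ?thesis unfolding grid_result_def
      using all c o by (intro exI[of _ ?sols] exI[of _ b]) auto
  qed
qed

lemma wp_program: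
  assumes n: "fst s ''n'' 0 = n" and m: "fst s ''m'' 0 = m" and L: "n < 2 ^ L"
    and ends: "\<And>j. j < m \<Longrightarrow> fst s ''src'' j < n \<and> fst s ''dst'' j < n"
    and w: "\<And>j. j < m \<Longrightarrow> 0 \<le> snd s ''weight'' j" and have0: "fst s ''have'' 0 = 0"
    and eps: "snd s ''epsilon'' 0 = \<epsilon>" "0 < \<epsilon>" and M: "\<And>i. M \<le> i \<longleftrightarrow> 1 \<le> (1 + \<epsilon>) ^ i * \<epsilon>"
  shows "wp program (\<lambda>s' _. \<exists>best. grid_result n m (fst s ''src'') (fst s ''dst'') (fst s ''terminal'')
      (fst s ''predicted'') (snd s ''weight'') \<epsilon> (Suc M) (fst s' ''output'') best)
    s ((192 * n + 380 * (n * L) + 560 * m + 60) * Suc M + 3)"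
proof -
  let ?D = "192 * n + 380 * (n * L) + 560 * m + 60"
  let ?G = "grid_result n m (fst s ''src'') (fst s ''dst'') (fst s ''terminal'') (fst s ''predicted'') (snd s ''weight'') \<epsilon>"
  let ?in = "\<lambda>s'::state. fst s' ''n'' 0 = n \<and> fst s' ''m'' 0 = m \<and> fst s' ''src'' = fst s ''src'' \<and> fst s' ''dst'' = fst s ''dst'' \<and>
    fst s' ''terminal'' = fst s ''terminal'' \<and> fst s' ''predicted'' = fst s ''predicted'' \<and>
    snd s' ''weight'' = snd s ''weight'' \<and> snd s' ''epsilon'' 0 = \<epsilon>"
  \<comment> \<open>\<open>k\<close> runs are complete. While \<open>go\<close> is set, the run with
    exponent \<open>k\<close> is still to come; the last call of \<open>next_alpha\<close> leaves
    \<alpha> as it is and clears \<open>go\<close>, so that \<open>k = Suc M\<close> at the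
    end.\<close>
  let ?I = "\<lambda>s' n'. ?in s' \<and> (\<exists>k. (0 < fst s' ''go'' 0 \<and> snd s' ''alpha'' 0 = (1 + \<epsilon>) ^ k \<and> k \<le> M \<or>
      fst s' ''go'' 0 = 0 \<and> k = Suc M) \<and> (0 < fst s' ''have'' 0 \<longleftrightarrow> k \<noteq> 0) \<and>
      (k = 0 \<or> ?G k (fst s' ''output'') (snd s' ''best'' 0)) \<and> ?D * (Suc M - k) + 1 \<le> n')"
  let ?s = "nwrite ''go'' 0 1 (rwrite ''alpha'' 0 1 s)"
  have "wp (While (NLess (NConst 0) (rd ''go'')) (run ;; keep_best ;; next_alpha))
    (\<lambda>s' _. \<exists>best. ?G (Suc M) (fst s' ''output'') best) ?s (?D * Suc M + 1)"
  proof (rule wp_While[where I = ?I])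
    show "?I ?s (?D * Suc M + 1)" using n m eps have0 by (intro conjI exI[of _ 0]) auto
  next
    fix s1 n1 assume I: "?I s1 n1" and bv: "bval (NLess (NConst 0) (rd ''go'')) s1"
    then obtain k where k: "snd s1 ''alpha'' 0 = (1 + \<epsilon>) ^ k" "k \<le> M" "0 < fst s1 ''have'' 0 \<longleftrightarrow> k \<noteq> 0"
      "k = 0 \<or> ?G k (fst s1 ''output'') (snd s1 ''best'' 0)" "?D * (Suc M - k) + 1 \<le> n1" by auto
    have in1: "?in s1" using I by blast
    have "Suc M - k = Suc (M - k)" using k(2) by simp
    then have n1: "?D + ?D * (M - k) + 1 \<le> n1" using k(5) by simp
    have r1: "wp run (\<lambda>s' _. run_result n m (fst s1 ''src'') (fst s1 ''dst'') (fst s1 ''terminal'') (fst s1 ''predicted'')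
      (snd s1 ''weight'') (snd s1 ''alpha'' 0) (fst s' ''sol'') \<and> (\<forall>j<m. fst s' ''sol'' j \<le> 1) \<and>
      snd s' ''wt'' 0 = sum (snd s1 ''weight'') {j. j < m \<and> 0 < fst s' ''sol'' j})
      s1 (192 * n + 380 * (n * L) + 556 * m + 43)"
      by (rule wp_run) (use in1 L ends w k eps in auto)
    have "wp (run ;; keep_best ;; next_alpha) ?I s1 (n1 - 1)"
      unfolding wp_Seq
    proof (rule wp_use[OF r1])
      show "192 * n + 380 * (n * L) + 556 * m + 43 \<le> n1 - 1" using n1 by linarith
      fix s2 n2 assume p2: "run_result n m (fst s1 ''src'') (fst s1 ''dst'') (fst s1 ''terminal'') (fst s1 ''predicted'')
        (snd s1 ''weight'') (snd s1 ''alpha'' 0) (fst s2 ''sol'') \<and> (\<forall>j<m. fst s2 ''sol'' j \<le> 1) \<and>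
        snd s2 ''wt'' 0 = sum (snd s1 ''weight'') {j. j < m \<and> 0 < fst s2 ''sol'' j}"
        and fr2: "frame run s1 s2" and n2: "n1 - 1 \<le> n2 + (192 * n + 380 * (n * L) + 556 * m + 43)"
      note f2 = frameD1[OF fr2, unfolded run_def first_phase_def second_phase_def, simplified]
        frameD2[OF fr2, unfolded run_def first_phase_def second_phase_def, simplified]
      have in2: "?in s2" using in1 by (simp add: f2)
      have m2: "fst s2 ''m'' 0 = m" using in2 by blast
      show "wp keep_best (wp next_alpha ?I) s2 n2"
      proof (rule wp_use[OF wp_keep_best[OF m2]])
        show "3 * m + 5 \<le> n2" using n1 n2 by linarith
        fix s3 n3 assume p3: "if 0 < fst s2 ''have'' 0 \<and> \<not> snd s2 ''wt'' 0 < snd s2 ''best'' 0 then s3 = s2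
          else 0 < fst s3 ''have'' 0 \<and> snd s3 ''best'' 0 = snd s2 ''wt'' 0 \<and> (\<forall>j<m. fst s3 ''output'' j = fst s2 ''sol'' j)"
          and fr3: "frame keep_best s2 s3" and n3: "n2 \<le> n3 + (3 * m + 5)"
        note f3 = frameD1[OF fr3, unfolded keep_best_def, simplified] frameD2[OF fr3, unfolded keep_best_def, simplified]
        have in3: "?in s3" using in2 by (simp add: f3)
        have h2: "0 < fst s2 ''have'' 0 \<longleftrightarrow> k \<noteq> 0" using k(3) by (simp add: f2)
        have h3: "0 < fst s3 ''have'' 0" using p3 by (auto split: if_splits)
        have G: "?G (Suc k) (fst s3 ''output'') (snd s3 ''best'' 0)"
        proof (rule grid_result_step)
          show "run_result n m (fst s ''src'') (fst s ''dst'') (fst s ''terminal'') (fst s ''predicted'')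
            (snd s ''weight'') ((1 + \<epsilon>) ^ k) (fst s2 ''sol'')" using p2 in1 k(1) by simp
          show "\<forall>j<m. fst s2 ''sol'' j \<le> 1" using p2 by blast
          show "snd s2 ''wt'' 0 = sum (snd s ''weight'') {j. j < m \<and> 0 < fst s2 ''sol'' j}" using p2 in1 by simp
          show "k = 0 \<or> ?G k (fst s2 ''output'') (snd s2 ''best'' 0)" using k(4) by (simp add: f2)
          show "k \<noteq> 0 \<and> \<not> snd s2 ''wt'' 0 < snd s2 ''best'' 0 \<and> (\<forall>j<m. fst s3 ''output'' j = fst s2 ''output'' j) \<and>
              snd s3 ''best'' 0 = snd s2 ''best'' 0 \<or>
            (k = 0 \<or> snd s2 ''wt'' 0 < snd s2 ''best'' 0) \<and> (\<forall>j<m. fst s3 ''output'' j = fst s2 ''sol'' j) \<and>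
              snd s3 ''best'' 0 = snd s2 ''wt'' 0"
            using p3 h2 by (auto split: if_splits)
        qed
        have al3: "snd s3 ''alpha'' 0 = (1 + \<epsilon>) ^ k" "0 < fst s3 ''go'' 0" using k(1) bv by (simp_all add: f2 f3)
        have n3': "2 + ?D * (M - k) + 1 \<le> n3" using n1 n2 n3 by linarith
        have n33: "3 \<le> n3" and n3'': "?D * (Suc M - Suc k) + 1 \<le> n3 - 2"
          unfolding diff_Suc_Suc using n3' by linarith+
        have ep: "snd s3 ''epsilon'' 0 = \<epsilon>" using in3 by blast
        show "wp next_alpha ?I s3 n3"
        proof (cases "(1 + \<epsilon>) ^ k * \<epsilon> < 1")
          case True
          then have kM: "Suc k \<le> M" using M[of k] by linarith
          have "wp next_alpha (\<lambda>s' n'. s' = rwrite ''alpha'' 0 ((1 + \<epsilon>) ^ Suc k) s3 \<and> n' = n3 - 2) s3 n3"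
            using True n33 by (auto simp add: next_alpha_def wp_simps al3 ep mult.commute)
          then show ?thesis
          proof (rule wp_mono)
            fix s4 n4 assume p4: "s4 = rwrite ''alpha'' 0 ((1 + \<epsilon>) ^ Suc k) s3 \<and> n4 = n3 - 2"
            have "?in s4" "0 < fst s4 ''have'' 0" "?G (Suc k) (fst s4 ''output'') (snd s4 ''best'' 0)"
              using in3 h3 G p4 by simp_all
            moreover have "0 < fst s4 ''go'' 0 \<and> snd s4 ''alpha'' 0 = (1 + \<epsilon>) ^ Suc k \<and> Suc k \<le> M \<or>
              fst s4 ''go'' 0 = 0 \<and> Suc k = Suc M" using p4 kM al3 by simp
            ultimately show "?I s4 n4" using n3'' p4 by (intro conjI exI[of _ "Suc k"]) simp_all
          qed
        next
          case False
          then have kM: "k = M" using M[of k] k(2) by linarith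
          have "wp next_alpha (\<lambda>s' n'. s' = nwrite ''go'' 0 0 s3 \<and> n' = n3 - 2) s3 n3"
            using False n33 by (auto simp add: next_alpha_def wp_simps al3 ep)
          then show ?thesis
          proof (rule wp_mono)
            fix s4 n4 assume p4: "s4 = nwrite ''go'' 0 0 s3 \<and> n4 = n3 - 2"
            have "?in s4" "0 < fst s4 ''have'' 0" "?G (Suc k) (fst s4 ''output'') (snd s4 ''best'' 0)"
              using in3 h3 G p4 by simp_all
            moreover have "0 < fst s4 ''go'' 0 \<and> snd s4 ''alpha'' 0 = (1 + \<epsilon>) ^ Suc k \<and> Suc k \<le> M \<or>
              fst s4 ''go'' 0 = 0 \<and> Suc k = Suc M" using p4 kM al3 by simp
            ultimately show "?I s4 n4" using n3'' p4 by (intro conjI exI[of _ "Suc k"]) simp_all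
          qed
        qed
      qed
    qed
    then show "1 \<le> n1 \<and> wp (run ;; keep_best ;; next_alpha) ?I s1 (n1 - 1)" using n1 by simp
  next
    fix s1 n1 assume I: "?I s1 n1" and bv: "\<not> bval (NLess (NConst 0) (rd ''go'')) s1"
    then show "1 \<le> n1 \<and> (\<exists>best. ?G (Suc M) (fst s1 ''output'') best)" by auto
  qed
  then have "wp (upd ''go'' (NConst 1) ;; While (NLess (NConst 0) (rd ''go'')) (run ;; keep_best ;; next_alpha))
    (\<lambda>s' _. \<exists>best. ?G (Suc M) (fst s' ''output'') best) (rwrite ''alpha'' 0 1 s) (?D * Suc M + 2)"
    by (rule wp_NWrite_seq) (simp, linarith)
  then show ?thesis unfolding program_def
    by (rule wp_RWrite_seq) (simp, linarith)
qed

section \<open>Correctness of the program\<close>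

lemma linked_in_Union: "linked F u v \<Longrightarrow> u = v \<or> v \<in> \<Union>F"
  unfolding linked_def by (induction rule: rtranclp_induct) auto

text \<open>Greedy exchange: for every spanning tree \<open>F'\<close> some connecting set contains
  the first chosen edges and costs no more than \<open>F'\<close>. The cut between the first
  \<open>i\<close> terminals and the rest supplies the edge to be given up. Only connectivity of
  this set is maintained; at the end, nonnegative costs allow its surplus edges to be
  dropped.\<close>

lemma prim_minimum_spanning_tree:
  fixes t :: "nat \<Rightarrow> 'v" and q :: "nat \<Rightarrow> nat"
  assumes t: "inj_on t {..<k}" "t ` {..<k} = T" and q: "\<And>i. 0 < i \<Longrightarrow> i < k \<Longrightarrow> q i < i"
    and cut: "\<And>i a b. 0 < i \<Longrightarrow> a < i \<Longrightarrow> i \<le> b \<Longrightarrow> b < k \<Longrightarrow> c {t (q i), t i} \<le> c {t a, t b}"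
    and c: "\<And>e. e \<in> complete_edges T \<Longrightarrow> (0::real) \<le> c e"
  shows "minimum_spanning_tree T (complete_edges T) c ((\<lambda>i. {t (q i), t i}) ` {0<..<k})"
proof -
  let ?f = "\<lambda>i. {t (q i), t i}"
  let ?F = "\<lambda>i. ?f ` {0<..<i}"
  have fin: "finite T" using t(2) by blast
  have e1: "{0<..<Suc 0} = {}" by auto
  have neq: "t a \<noteq> t b" if "a < k" "b < k" "a \<noteq> b" for a b using t(1) that by (auto simp: inj_on_def)
  have step: "?F (Suc i) = insert (?f i) (?F i)" if "0 < i" for i
  proof -
    have "{0<..<Suc i} = insert i {0<..<i}" using that by auto
    then show ?thesis by simp
  qed
  have Un: "\<Union>(?F i) \<subseteq> t ` {..<i}" if "i \<le> k" for i
  proof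
    fix x assume "x \<in> \<Union>(?F i)"
    then obtain j where j: "0 < j" "j < i" "x = t (q j) \<or> x = t j" by auto
    then show "x \<in> t ` {..<i}" using q[of j] that by auto
  qed
  have sub: "?F k \<subseteq> complete_edges T"
  proof
    fix e assume "e \<in> ?F k"
    then obtain j where j: "0 < j" "j < k" "e = ?f j" by auto
    then show "e \<in> complete_edges T" using q[of j] neq[of "q j" j] t(2) by (auto intro!: complete_edgesI)
  qed
  have tree: "forest (?F i) \<and> connects (t ` {..<i}) (?F i)" if "i \<le> k" for i
    using that
  proof (induction i)
    case 0
    then show ?case by (simp add: forest_empty connects_def)
  next
    case (Suc i)
    show ?case
    proof (cases "i = 0")
      case True
      then show ?thesis by (simp add: forest_empty connects_def lessThan_Suc e1)
    next
      case False
      then have i: "0 < i" "i < k" "i \<le> k" using Suc by auto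
      have IH: "forest (?F i)" "connects (t ` {..<i}) (?F i)" using Suc i by auto
      have ti: "t i \<notin> t ` {..<i}" using neq i by auto
      have qi: "t (q i) \<in> t ` {..<i}" using q i by auto
      have "\<not> linked (?F i) (t (q i)) (t i)"
      proof
        assume "linked (?F i) (t (q i)) (t i)"
        from linked_in_Union[OF this] have "t i \<in> t ` {..<i}"
        proof
          assume "t (q i) = t i"
          then show ?thesis using qi by (simp only:)
        next
          assume "t i \<in> \<Union>(?F i)"
          then show ?thesis by (rule subsetD[OF Un[OF i(3)]])
        qed
        then show False using ti by (simp only: simp_thms)
      qed
      then have f: "forest (?F (Suc i))" unfolding step[OF i(1)] by (rule forest_insert[OF IH(1)])
      have l: "linked (?F (Suc i)) (t (q i)) (t i)" unfolding step[OF i(1)] by (rule linked_edge) simp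
      have lq: "linked (?F (Suc i)) (t (q i)) u" if "u \<in> t ` {..<Suc i}" for u
      proof (cases "u = t i")
        case False
        then have "u \<in> t ` {..<i}" using that by (auto simp: lessThan_Suc)
        then have "linked (?F i) (t (q i)) u" using IH(2) qi by (auto simp: connects_def)
        then show ?thesis by (rule linked_mono) (auto simp: step[OF i(1)])
      qed (use l in simp)
      have "connects (t ` {..<Suc i}) (?F (Suc i))"
        unfolding connects_def by (intro ballI linked_trans[OF linked_sym[OF lq] lq])
      then show ?thesis using f by blast
    qed
  qed
  have span: "spanning_tree T (complete_edges T) (?F k)"
    using tree[of k] sub t(2) by (simp add: spanning_tree_iff)
  have "sum c (?F k) \<le> sum c F'" if F': "spanning_tree T (complete_edges T) F'" for F'
  proof -
    have "\<exists>G. connects T G \<and> G \<subseteq> complete_edges T \<and> ?F i \<subseteq> G \<and> sum c G \<le> sum c F'" if "i \<le> k" for i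
      using that
    proof (induction i)
      case 0
      then show ?case using F' by (intro exI[of _ F']) (simp add: spanning_tree_iff)
    next
      case (Suc i)
      then obtain G where G: "connects T G" "G \<subseteq> complete_edges T" "?F i \<subseteq> G" "sum c G \<le> sum c F'" by auto
      show ?case
      proof (cases "i = 0 \<or> ?f i \<in> G")
        case True
        then have "?F (Suc i) \<subseteq> G" using G(3) step[of i] by (cases "i = 0") (auto simp: e1)
        then show ?thesis using G(1,2,4) by (intro exI[of _ G] conjI)
      next
        case False
        then have i: "0 < i" "i < k" "i \<le> k" using Suc by auto
        have u: "t (q i) \<in> T" "t i \<in> T" using i q[of i] t(2) by auto
        have D: "t (q i) \<in> t ` {..<i}" "t i \<notin> t ` {..<i}" using q i neq by auto
        obtain x y where xy: "{x, y} \<in> G" "x \<in> t ` {..<i}" "y \<notin> t ` {..<i}"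
          "connects T (insert (?f i) (G - {{x, y}}))"
          using connects_exchange[OF G(1) u D] by (elim exE conjE)
        let ?G = "insert (?f i) (G - {{x, y}})"
        have fG: "finite G" by (rule finite_subset[OF G(2) finite_complete_edges[OF fin]])
        have "y \<in> T" using complete_edges_Union[OF G(2)] xy(1) by blast
        then obtain b where b: "b < k" "y = t b" using t(2) by auto
        then have "i \<le> b" using xy(3) by (meson imageI lessThan_iff not_le)
        moreover obtain a where a: "a < i" "x = t a" using xy(2) by auto
        ultimately have le: "c (?f i) \<le> c {x, y}" using cut[of i a b] i b by simp
        have "sum c ?G = c (?f i) + sum c (G - {{x, y}})" using fG False by simp
        also have "\<dots> \<le> c {x, y} + sum c (G - {{x, y}})" using le by simp
        also have "\<dots> = sum c G" using fG xy(1) by (simp add: sum.remove)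
        finally have "sum c ?G \<le> sum c F'" using G(4) by simp
        \<comment> \<open>The edges chosen so far stay among the first \<open>i\<close> terminals,
          so the crossing edge given up is none of them.\<close>
        moreover have "{x, y} \<notin> ?F i"
        proof
          assume "{x, y} \<in> ?F i"
          then have "y \<in> \<Union>(?F i)" by blast
          then show False using Un[OF i(3)] xy(3) by blast
        qed
        then have "?F (Suc i) \<subseteq> ?G" unfolding step[OF i(1)] using G(3) by blast
        moreover have "?f i \<in> complete_edges T" using sub i by auto
        ultimately show ?thesis using xy(4) G(2) by (intro exI[of _ ?G]) auto
      qed
    qed
    from this[of k] obtain G where G: "G \<subseteq> complete_edges T" "?F k \<subseteq> G" "sum c G \<le> sum c F'" by auto
    have "finite G" by (rule finite_subset[OF G(1) finite_complete_edges[OF fin]])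
    then have "sum c (?F k) \<le> sum c G" using G c by (intro sum_mono2) auto
    then show ?thesis using G by simp
  qed
  then show ?thesis using span by (simp add: minimum_spanning_tree_def)
qed

section \<open>Regions and distances to the nearest terminal\<close>

locale steiner_run = run_data +
  fixes V :: "'v set" and E :: "'v set set" and w :: "'v set \<Rightarrow> real" and T :: "'v set" and Xhat :: "'v set set"
    and vtx :: "nat \<Rightarrow> 'v"
  assumes inst: "steiner_instance V E w T Xhat" and rep: "edge_list_representation V E vtx src dst"
    and n: "n = card V" and m: "m = card E" and alpha: "1 \<le> \<alpha>"
    and terminals: "\<And>v. v < n \<Longrightarrow> 0 < tm v \<longleftrightarrow> vtx v \<in> T"
    and predicted: "\<And>j. j < m \<Longrightarrow> 0 < pred j \<longleftrightarrow> edge_of vtx src dst j \<in> Xhat"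
    and weight: "\<And>j. j < m \<Longrightarrow> weight j = w (edge_of vtx src dst j)"
    and connected: "\<exists>X'. steiner_tree V E T X'"
begin

abbreviation "wa \<equiv> scaled_weight w Xhat \<alpha>"
abbreviation "edge \<equiv> edge_of vtx src dst"

sublocale S1: search_inv n m a1 b1 c1 1 sd1 st1 key1 pe1 ord1 cnt1 "all_scanned n m a1 b1 st1"
  by (fact search1)

sublocale S2: search_inv n m a2 b2 c2 0 sd2 st2 key2 pe2 ord2 cnt2 "all_scanned n m a2 b2 st2"
  by (fact search2)

lemma graph: "simple_graph V E" "\<And>e. e \<in> E \<Longrightarrow> 0 \<le> w e" "T \<subseteq> V"
  using inst by (auto simp: steiner_instance_def)

lemma vtx_bij: "bij_betw vtx {..<n} V" and edge_bij: "bij_betw edge {..<m} E"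
  and ends: "j < m \<Longrightarrow> src j < n \<and> dst j < n"
  using rep by (auto simp: edge_list_representation_def n m)

lemma vtx_inj: "x < n \<Longrightarrow> y < n \<Longrightarrow> vtx x = vtx y \<longleftrightarrow> x = y"
  using vtx_bij by (auto simp: bij_betw_def inj_on_def)

lemma vtx_in: "x < n \<Longrightarrow> vtx x \<in> V"
  using vtx_bij by (auto simp: bij_betw_def)

lemma edge_in: "j < m \<Longrightarrow> edge j \<in> E"
  using edge_bij by (auto simp: bij_betw_def)

lemma wa_nonneg: "e \<in> E \<Longrightarrow> 0 \<le> wa e"
  using graph(2)[of e] alpha by (auto simp: scaled_weight_def)

lemma c1_eq: "j < m \<Longrightarrow> c1 j = wa (edge j)"
  using edges1[of j] predicted[of j] weight[of j] by (auto simp: scaled_weight_def)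

lemma c1_nonneg: "j < m \<Longrightarrow> 0 \<le> c1 j"
  using c1_eq wa_nonneg edge_in by simp

lemma edge_index:
  assumes "{vtx x, vtx y} \<in> E" "x < n" "y < n"
  shows "\<exists>j<m. edge j = {vtx x, vtx y} \<and> (src j = x \<and> dst j = y \<or> src j = y \<and> dst j = x)"
proof -
  have "{vtx x, vtx y} \<in> edge ` {..<m}" using assms(1) edge_bij by (simp add: bij_betw_def)
  then obtain j where j: "j < m" "edge j = {vtx x, vtx y}" by auto
  then have "vtx (src j) = vtx x \<and> vtx (dst j) = vtx y \<or> vtx (src j) = vtx y \<and> vtx (dst j) = vtx x"
    by (auto simp: edge_of_def doubleton_eq_iff)
  then show ?thesis using j ends[OF j(1)] vtx_inj assms(2,3) by blast
qed

lemma reached1: "v < n \<Longrightarrow> st1 v \<noteq> 0 \<longleftrightarrow> (\<exists>i<cnt1. v = ord1 i)"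
proof -
  assume v: "v < n"
  have "st1 v \<noteq> 0 \<longleftrightarrow> st1 v = 2" using S1.st_le[OF v] done1[OF v] by linarith
  also have "\<dots> \<longleftrightarrow> v \<in> ord1 ` {..<cnt1}" using S1.ord_image v by blast
  finally show ?thesis by auto
qed

lemma ord1_less: "i < cnt1 \<Longrightarrow> ord1 i < n \<and> st1 (ord1 i) \<noteq> 0"
proof -
  assume "i < cnt1"
  then have "ord1 i \<in> {v. v < n \<and> st1 v = 2}" using S1.ord_image by blast
  then show ?thesis by simp
qed

lemma ord1_notin: "l \<le> i \<Longrightarrow> i < cnt1 \<Longrightarrow> ord1 i \<notin> ord1 ` {..<l}"
  using inj_onD[OF S1.ord_inj, of i] by fastforce

lemma parent1:
  assumes "v < n" "pe1 v \<noteq> 0"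
  shows "pe1 v - 1 < m" "other a1 b1 (pe1 v - 1) v < n" "st1 (other a1 b1 (pe1 v - 1) v) \<noteq> 0"
    "key1 v = key1 (other a1 b1 (pe1 v - 1) v) + c1 (pe1 v - 1)" "st1 v \<noteq> 0"
    "edge (pe1 v - 1) = {vtx (other a1 b1 (pe1 v - 1) v), vtx v}"
    "incident a1 b1 (pe1 v - 1) v"
proof -
  show r: "st1 v \<noteq> 0" using S1.unreached[OF assms(1)] assms(2) by auto
  note p = S1.parent[OF assms(1) r assms(2)]
  show j: "pe1 v - 1 < m" and "other a1 b1 (pe1 v - 1) v < n" "st1 (other a1 b1 (pe1 v - 1) v) \<noteq> 0"
    "key1 v = key1 (other a1 b1 (pe1 v - 1) v) + c1 (pe1 v - 1)" "incident a1 b1 (pe1 v - 1) v" using p by auto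
  show "edge (pe1 v - 1) = {vtx (other a1 b1 (pe1 v - 1) v), vtx v}"
    using p edges1[OF j] by (auto simp: edge_of_def incident_def other_def)
qed

text \<open>Derived from the final state instead of along the run. If the parent of
  \<open>ord1 i\<close> was extracted at position \<open>l\<close> or later, induction applies to it
  and the edge to \<open>ord1 i\<close> adds a nonnegative cost. Otherwise this edge left the
  extracted set at time \<open>l\<close>, so the key extracted then was at most what the edge
  offered, which is the key of \<open>ord1 i\<close>.\<close>

lemma key1_mono: "l \<le> i \<Longrightarrow> i < cnt1 \<Longrightarrow> key1 (ord1 l) \<le> key1 (ord1 i)"
proof (induction i rule: less_induct)
  case (less i)
  let ?v = "ord1 i"
  have v: "?v < n" "st1 ?v \<noteq> 0" using ord1_less less.prems by auto
  have vl: "?v \<notin> ord1 ` {..<l}" by (rule ord1_notin[OF less.prems])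
  have l: "l < cnt1" using less.prems by simp
  show ?case
  proof (cases "pe1 ?v = 0")
    case True
    then have "0 < sd1 ?v" using S1.seed[OF v] by simp
    then have "key1 (ord1 l) \<le> 0" using S1.key_le_seed[OF l v(1)] vl by blast
    then show ?thesis using S1.key_nonneg[OF v(1)] by simp
  next
    case False
    let ?p = "other a1 b1 (pe1 ?v - 1) ?v"
    note p = parent1[OF v(1) False]
    obtain i' where i': "i' < i" "?p = ord1 i'" using S1.parent_earlier[OF less.prems(2) False] by blast
    show ?thesis
    proof (cases "l \<le> i'")
      case True
      then have "key1 (ord1 l) \<le> key1 ?p" using less.IH[of i'] i' less.prems by simp
      then show ?thesis using p(4) c1_nonneg[OF p(1)] by simp
    next
      case f: False
      have "?p \<in> ord1 ` {..<l}" using i' f by auto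
      moreover have "other a1 b1 (pe1 ?v - 1) ?p = ?v" using other_other[OF p(7)] .
      ultimately have "key1 (ord1 l) \<le> 1 * key1 ?p + c1 (pe1 ?v - 1)"
        using S1.key_le_edge[OF l _ p(1) incident_other[OF p(7)]] vl by simp
      then show ?thesis using p(4) by simp
    qed
  qed
qed

text \<open>If \<open>y\<close> was extracted no later than \<open>x\<close>, monotonicity of the
  keys suffices. Otherwise \<open>x\<close> had been extracted when \<open>y\<close> was chosen, and
  the edge bounded the key of \<open>y\<close>.\<close>

lemma feasible:
  assumes xy: "{vtx x, vtx y} \<in> E" "x < n" "y < n" and x: "st1 x \<noteq> 0"
  shows "st1 y \<noteq> 0 \<and> key1 y \<le> key1 x + wa {vtx x, vtx y}"
proof -
  obtain j where j: "j < m" "edge j = {vtx x, vtx y}" "src j = x \<and> dst j = y \<or> src j = y \<and> dst j = x"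
    using edge_index[OF xy] by blast
  then have inc: "incident a1 b1 j x" and o: "other a1 b1 j x = y"
    using edges1[OF j(1)] by (auto simp: incident_def other_def)
  obtain i where i: "i < cnt1" "x = ord1 i" using reached1[OF xy(2)] x by blast
  have "st1 x = 2" using S1.st_le[OF xy(2)] done1[OF xy(2)] x by linarith
  then have y: "st1 y \<noteq> 0" using S1.scanned[of x j] xy j inc o by (auto simp: all_scanned_def)
  then obtain l where l: "l < cnt1" "y = ord1 l" using reached1[OF xy(3)] by blast
  have "key1 y \<le> key1 x + c1 j"
  proof (cases "l \<le> i")
    case True
    then show ?thesis using key1_mono[OF True i(1)] i l c1_nonneg[OF j(1)] by simp
  next
    case False
    then have "x \<in> ord1 ` {..<l}" using i by auto
    moreover have "y \<notin> ord1 ` {..<l}" unfolding l(2) by (rule ord1_notin[OF order_refl l(1)])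
    ultimately show ?thesis using S1.key_le_edge[OF l(1) _ j(1) inc] o l by simp
  qed
  then show ?thesis using y c1_eq[OF j(1)] j(2) by simp
qed

text \<open>Both directions are needed because a path across a cut is estimated from both of its end
  points.\<close>

lemma walk_feasible:
  assumes "set p \<subseteq> {..<n}" "path_edges (map vtx p) \<subseteq> E" "p \<noteq> []"
  shows "st1 (hd p) \<noteq> 0 \<Longrightarrow> st1 (last p) \<noteq> 0 \<and> key1 (last p) \<le> key1 (hd p) + walk_weight wa (map vtx p)"
    "st1 (last p) \<noteq> 0 \<Longrightarrow> st1 (hd p) \<noteq> 0 \<and> key1 (hd p) \<le> key1 (last p) + walk_weight wa (map vtx p)"
  using assms
proof (induction p rule: path_edges.induct)
  case (1 u v p)
  {
    case 1
    have "st1 v \<noteq> 0 \<and> key1 v \<le> key1 u + wa {vtx u, vtx v}" using feasible[of u v] 1 by auto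
    then show ?case using "1.IH"(1) 1 by auto
  next
    case 2
    have v: "st1 v \<noteq> 0 \<and> key1 v \<le> key1 (last (v # p)) + walk_weight wa (map vtx (v # p))"
      using "1.IH"(2) 2 by auto
    have "st1 u \<noteq> 0 \<and> key1 u \<le> key1 v + wa {vtx v, vtx u}"
      using feasible[of v u] 2 v by (auto simp: insert_commute)
    then show ?case using v by (auto simp: insert_commute)
  }
qed auto

lemma terminal_facts:
  assumes "v < n" "vtx v \<in> T"
  shows "st1 v \<noteq> 0" "key1 v = 0" "near v = v" "pe1 v = 0"
proof -
  have "0 < sd1 v" using terminals[OF assms(1)] seeds1[OF assms(1)] assms(2) by simp
  then show s: "st1 v \<noteq> 0" using S1.unreached[OF assms(1)] by auto
  show p: "pe1 v = 0"
  proof (rule ccontr)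
    assume "pe1 v \<noteq> 0"
    then show False using S1.parent[OF assms(1) s] \<open>0 < sd1 v\<close> by auto
  qed
  show "key1 v = 0" using S1.seed[OF assms(1) s p] by simp
  show "near v = v" using near_eq[OF assms(1)] p by simp
qed

abbreviation "anc \<equiv> ancestor n a1 b1 pe1"

lemma anc_parent:
  assumes "v < n" "pe1 v \<noteq> 0"
  shows "anc v x \<longleftrightarrow> x = v \<or> anc (other a1 b1 (pe1 v - 1) v) x"
proof
  assume "anc v x"
  then show "x = v \<or> anc (other a1 b1 (pe1 v - 1) v) x"
    unfolding ancestor_def by (cases rule: converse_rtranclpE) auto
next
  assume "x = v \<or> anc (other a1 b1 (pe1 v - 1) v) x"
  then show "anc v x"
  proof
    assume "anc (other a1 b1 (pe1 v - 1) v) x"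
    then show ?thesis unfolding ancestor_def
      by (rule converse_rtranclp_into_rtranclp[rotated]) (use assms in simp)
  qed (simp add: ancestor_refl)
qed

lemma anc_root: "pe1 v = 0 \<Longrightarrow> anc v x \<longleftrightarrow> x = v"
  unfolding ancestor_def by (auto elim: converse_rtranclpE)

text \<open>The path has to be known exactly: its vertices are all ancestors of
  \<open>ord1 i\<close> and its edges are their parent edges. This is what identifies the flags of
  the backward pass with the edges of cheapest paths. The restriction to positions up to
  \<open>i\<close> shows that appending the next vertex keeps the path simple, and the constant
  label later separates paths of different regions.\<close>

lemma tree_path:
  assumes "i < cnt1"
  shows "\<exists>p. p \<noteq> [] \<and> hd p = near (ord1 i) \<and> last p = ord1 i \<and> distinct p \<and> set p = {x. anc (ord1 i) x} \<and>
    set p \<subseteq> ord1 ` {..i} \<and> (\<forall>x\<in>set p. near x = near (ord1 i)) \<and>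
    path_edges (map vtx p) = edge ` {j. \<exists>x\<in>set p. pe1 x = Suc j} \<and>
    walk_weight wa (map vtx p) = key1 (ord1 i) \<and> vtx (near (ord1 i)) \<in> T"
  using assms
proof (induction i rule: less_induct)
  case (less i)
  let ?v = "ord1 i"
  have v: "?v < n" "st1 ?v \<noteq> 0" using ord1_less less.prems by auto
  show ?case
  proof (cases "pe1 ?v = 0")
    case True
    have "0 < sd1 ?v" "key1 ?v = 0" using S1.seed[OF v True] by auto
    then have "vtx ?v \<in> T" using terminals[OF v(1)] seeds1[OF v(1)] by simp
    moreover have "near ?v = ?v" using near_eq[OF v(1)] True by simp
    ultimately show ?thesis using True \<open>key1 ?v = 0\<close> anc_root[OF True]
      by (intro exI[of _ "[?v]"]) auto
  next
    case False
    let ?p = "other a1 b1 (pe1 ?v - 1) ?v"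
    note pf = parent1[OF v(1) False]
    obtain i' where i': "i' < i" "?p = ord1 i'" using S1.parent_earlier[OF less.prems False] by blast
    obtain p where p: "p \<noteq> []" "hd p = near ?p" "last p = ?p" "distinct p" "set p = {x. anc ?p x}"
      "set p \<subseteq> ord1 ` {..i'}" "\<forall>x\<in>set p. near x = near ?p"
      "path_edges (map vtx p) = edge ` {j. \<exists>x\<in>set p. pe1 x = Suc j}"
      "walk_weight wa (map vtx p) = key1 ?p" "vtx (near ?p) \<in> T"
      using less.IH[OF i'(1)] less.prems i' by auto
    have nv: "near ?v = near ?p" using near_eq[OF v(1)] False by simp
    have vp: "?v \<notin> set p"
    proof
      assume "?v \<in> set p"
      then obtain l where "l \<le> i'" "?v = ord1 l" using p(6) by auto
      then show False using S1.ord_inj i'(1) less.prems inj_onD[OF S1.ord_inj, of i l] by auto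
    qed
    have pe: "path_edges (map vtx (p @ [?v])) = insert (edge (pe1 ?v - 1)) (path_edges (map vtx p))"
      using p(1,3) pf(6) by (simp add: path_edges_snoc last_map)
    have ww: "walk_weight wa (map vtx (p @ [?v])) = key1 ?v"
    proof -
      have "map vtx p = butlast (map vtx p) @ [vtx ?p]"
        using p(1,3) by (metis append_butlast_last_id last_map map_is_Nil_conv)
      then have "walk_weight wa (map vtx (p @ [?v])) = walk_weight wa (butlast (map vtx p) @ vtx ?p # [vtx ?v])"
        by (metis append.assoc append_Cons append_Nil list.simps(8,9) map_append)
      also have "\<dots> = walk_weight wa (map vtx p) + wa {vtx ?p, vtx ?v}"
        using walk_weight_append[of wa "butlast (map vtx p)" "vtx ?p" "[vtx ?v]"]
          \<open>map vtx p = butlast (map vtx p) @ [vtx ?p]\<close> by simp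
      finally show ?thesis using p(9) pf(1,4,6) c1_eq by simp
    qed
    have js: "{j. \<exists>x\<in>set (p @ [?v]). pe1 x = Suc j} = insert (pe1 ?v - 1) {j. \<exists>x\<in>set p. pe1 x = Suc j}"
      using False by auto
    show ?thesis
    proof (intro exI[of _ "p @ [?v]"] conjI)
      show "hd (p @ [?v]) = near ?v" using p nv by simp
      show "distinct (p @ [?v])" using p vp by simp
      show "set (p @ [?v]) = {x. anc ?v x}" using p(5) anc_parent[OF v(1) False] by auto
      show "set (p @ [?v]) \<subseteq> ord1 ` {..i}" using p(6) i' by auto
      show "\<forall>x\<in>set (p @ [?v]). near x = near ?v" using p(7) nv by auto
      show "path_edges (map vtx (p @ [?v])) = edge ` {j. \<exists>x\<in>set (p @ [?v]). pe1 x = Suc j}"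
        unfolding pe js using p(8) by simp
      show "vtx (near ?v) \<in> T" using p(10) nv by simp
    qed (use ww in simp_all)
  qed
qed

lemma near_terminal: "v < n \<Longrightarrow> st1 v \<noteq> 0 \<Longrightarrow> vtx (near v) \<in> T"
  using reached1 tree_path by metis

lemma near_unreached: "v < n \<Longrightarrow> st1 v = 0 \<Longrightarrow> near v = v"
  using near_eq[of v] S1.unreached[of v] by simp

text \<open>An unreached vertex is labelled by itself, while a terminal is reached; so a vertex
  labelled by a terminal is reached. Along an edge between two regions the other end is then reached
  too, and its label is a terminal.\<close>

lemma ord2_terminal: "i < cnt2 \<Longrightarrow> ord2 i < n \<and> vtx (ord2 i) \<in> T"
proof (induction i rule: less_induct)
  case (less i)
  let ?v = "ord2 i"
  have "?v \<in> {v. v < n \<and> st2 v = 2}" using S2.ord_image less.prems by blast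
  then have v: "?v < n" "st2 ?v \<noteq> 0" by auto
  show ?case
  proof (cases "pe2 ?v = 0")
    case True
    then have "0 < sd2 ?v" using S2.seed[OF v] by blast
    then show ?thesis using seeds2[OF v(1)] terminals v by auto
  next
    case False
    let ?j = "pe2 ?v - 1"
    let ?p = "other a2 b2 ?j ?v"
    have j: "?j < m" "incident a2 b2 ?j ?v" using S2.parent[OF v False] by auto
    obtain i' where i': "i' < i" "?p = ord2 i'" using S2.parent_earlier[OF less.prems False] by blast
    have pT: "vtx ?p \<in> T" "?p < n" using less.IH[OF i'(1)] i' less.prems by auto
    obtain x y where xy: "x < n" "y < n" "near x = ?p" "near y = ?v" "edge ?j = {vtx x, vtx y}"
      using j edges2[OF j(1)] ends[OF j(1)] by (auto simp: incident_def other_def edge_of_def insert_commute)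
    have "st1 x \<noteq> 0"
      using near_unreached[OF xy(1)] terminal_facts(1)[OF pT(2,1)] xy(3) by metis
    then have "st1 y \<noteq> 0" using feasible[of x y] xy edge_in[OF j(1)] by simp
    then show ?thesis using near_terminal[OF xy(2)] xy(4) v by simp
  qed
qed

text \<open>A path in \<open>E\<close> from the seed is followed vertex by vertex: the label of each
  of its vertices has been extracted by the second search, hence the contracted image of the next
  edge has been scanned.\<close>

lemma terminal_in_ord2:
  assumes t: "t < n" "vtx t \<in> T"
  shows "t \<in> ord2 ` {..<cnt2}"
proof -
  have tv: "tv < n" "vtx tv \<in> T" using first_terminal[OF t(1)] terminals[of tv] terminals[OF t(1)] t(2) by auto
  have two: "v \<in> ord2 ` {..<cnt2} \<longleftrightarrow> st2 v \<noteq> 0" if "v < n" for v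
  proof -
    have "st2 v \<noteq> 0 \<longleftrightarrow> st2 v = 2" using S2.st_le[OF that] done2[OF that] by linarith
    then show ?thesis using S2.ord_image that by auto
  qed
  have "0 < sd2 tv" using seeds2[OF tv(1)] terminals[OF tv(1)] tv(2) by blast
  then have base: "st2 tv \<noteq> 0" using S2.unreached[OF tv(1)] by auto
  obtain X' where X': "steiner_tree V E T X'" using connected by blast
  then obtain p where p: "is_path V X' p" "hd p = vtx tv" "last p = vtx t"
    using tv t unfolding steiner_tree_def same_component_def by blast
  have "path_edges p \<subseteq> E" "p \<noteq> []" using p X' by (auto simp: is_path_def steiner_tree_def)
  then have l: "linked E (vtx tv) (vtx t)" using linked_path[of p E] p by simp
  have "\<exists>x<n. v = vtx x \<and> st1 x \<noteq> 0 \<and> st2 (near x) \<noteq> 0" if "linked E (vtx tv) v" for v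
    using that unfolding linked_def
  proof (induction rule: rtranclp_induct)
    case base
    show ?case using tv terminal_facts[OF tv] \<open>st2 tv \<noteq> 0\<close> by (intro exI[of _ tv]) simp
  next
    case (step v u)
    then obtain x where x: "x < n" "v = vtx x" "st1 x \<noteq> 0" "st2 (near x) \<noteq> 0" by blast
    have "u \<in> V" using step.hyps(2) simple_graph_edges(2)[OF graph(1)] by blast
    then obtain y where y: "y < n" "u = vtx y" using vtx_bij by (auto simp: bij_betw_def)
    have e: "{vtx x, vtx y} \<in> E" using step.hyps(2) x y by simp
    have sy: "st1 y \<noteq> 0" using feasible[OF e x(1) y(1) x(3)] by blast
    obtain j where j: "j < m" "src j = x \<and> dst j = y \<or> src j = y \<and> dst j = x" using edge_index[OF e x(1) y(1)] by blast
    then have inc: "incident a2 b2 j (near x)" and o: "other a2 b2 j (near x) = near y"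
      using edges2[OF j(1)] by (auto simp: incident_def other_def)
    have "st2 (near x) = 2" using S2.st_le[OF near_less[OF x(1)]] done2[OF near_less[OF x(1)]] x(4) by linarith
    then have "st2 (near y) \<noteq> 0" using S2.scanned[of "near x" j] near_less[OF x(1)] j(1) inc o
      by (auto simp: all_scanned_def)
    then show ?case using y sy by blast
  qed
  from this[OF l] obtain x where x: "x < n" "vtx t = vtx x" "st2 (near x) \<noteq> 0" by blast
  then have "x = t" using vtx_inj t by blast
  then show ?thesis using x terminal_facts[OF t] two[OF t(1)] by simp
qed

end

section \<open>The tree of the second search and its paths\<close>

context steiner_run
begin

lemma ord2_inj: "a < cnt2 \<Longrightarrow> b < cnt2 \<Longrightarrow> vtx (ord2 a) = vtx (ord2 b) \<longleftrightarrow> a = b"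
  using vtx_inj[of "ord2 a" "ord2 b"] ord2_terminal[of a] ord2_terminal[of b] inj_onD[OF S2.ord_inj, of a b] by auto

lemma ord2_image: "(\<lambda>i. vtx (ord2 i)) ` {..<cnt2} = T"
proof
  show "(\<lambda>i. vtx (ord2 i)) ` {..<cnt2} \<subseteq> T" using ord2_terminal by auto
  show "T \<subseteq> (\<lambda>i. vtx (ord2 i)) ` {..<cnt2}"
  proof
    fix t assume t: "t \<in> T"
    then have "t \<in> vtx ` {..<n}" using graph(3) vtx_bij by (auto simp: bij_betw_def)
    then obtain x where x: "x < n" "t = vtx x" by auto
    then have "x \<in> ord2 ` {..<cnt2}" using terminal_in_ord2 t by blast
    then show "t \<in> (\<lambda>i. vtx (ord2 i)) ` {..<cnt2}" using x by auto
  qed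
qed

lemma pe2_first: "0 < cnt2 \<Longrightarrow> pe2 (ord2 0) = 0"
  using S2.parent_earlier[of 0] by auto

lemma ord2_st: "i < cnt2 \<Longrightarrow> st2 (ord2 i) \<noteq> 0"
proof -
  assume "i < cnt2"
  then have "ord2 i \<in> {v. v < n \<and> st2 v = 2}" using S2.ord_image by blast
  then show ?thesis by simp
qed

text \<open>\<open>tv\<close> is the only seed, and the vertex extracted first must be it because no
  earlier vertex could be its parent.\<close>

lemma pe2_pos:
  assumes "0 < i" "i < cnt2"
  shows "pe2 (ord2 i) \<noteq> 0"
proof
  have seed: "ord2 l = tv" if "l < cnt2" "pe2 (ord2 l) = 0" for l
    using S2.seed[OF _ ord2_st[OF that(1)] that(2)] seeds2[of "ord2 l"] ord2_terminal[OF that(1)] by auto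
  assume "pe2 (ord2 i) = 0"
  then have "ord2 i = ord2 0" using seed[of i] seed[of 0] pe2_first assms by simp
  then show False using inj_onD[OF S2.ord_inj, of i 0] assms by simp
qed

text \<open>The path crosses from the regions of the first \<open>i\<close> terminals to another
  region along some edge \<open>{x, y}\<close>. Its pieces before \<open>x\<close> and after
  \<open>y\<close> have terminals, of key 0, at their outer ends, so by feasibility they weigh at
  least \<open>key1 x\<close> and \<open>key1 y\<close>. The whole path thus weighs at least the
  contracted cost of the edge, which bounds the key extracted at time \<open>i\<close>.\<close>

lemma cut_bound:
  assumes i: "a < i" "i \<le> b" "b < cnt2" and p: "joins V E {vtx (ord2 a), vtx (ord2 b)} p"
  shows "key2 (ord2 i) \<le> sum wa (path_edges p)"
proof -
  \<comment> \<open>\<open>joins\<close> does not fix an orientation, so the path may have to be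
    reversed to start at \<open>ord2 a\<close>.\<close>
  obtain p' where p': "p' \<noteq> []" "set p' \<subseteq> V" "distinct p'" "path_edges p' \<subseteq> E" "path_edges p' = path_edges p"
    "hd p' = vtx (ord2 a)" "last p' = vtx (ord2 b)"
  proof (cases "hd p = vtx (ord2 a)")
    case True
    then have "last p = vtx (ord2 b)" using p by (auto simp: joins_def doubleton_eq_iff)
    then show ?thesis using that[of p] True p by (auto simp: joins_def is_path_def)
  next
    case False
    then have "hd p = vtx (ord2 b)" "last p = vtx (ord2 a)" using p by (auto simp: joins_def doubleton_eq_iff)
    then show ?thesis using that[of "rev p"] p
      by (auto simp: joins_def is_path_def path_edges_rev hd_rev last_rev)
  qed
  have tm: "ord2 a < n" "vtx (ord2 a) \<in> T" "ord2 b < n" "vtx (ord2 b) \<in> T" "ord2 i < n" "i < cnt2"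
    using ord2_terminal i by auto
  define \<iota> where "\<iota> = inv_into {..<n} vtx"
  have io: "\<iota> x < n \<and> vtx (\<iota> x) = x" if "x \<in> V" for x
  proof -
    have "x \<in> vtx ` {..<n}" using vtx_bij that by (simp add: bij_betw_def)
    then show ?thesis using inv_into_into[of x vtx "{..<n}"] f_inv_into_f[of x vtx "{..<n}"] by (simp add: \<iota>_def)
  qed
  define r where "r = map \<iota> p'"
  have r: "r \<noteq> []" "set r \<subseteq> {..<n}" "map vtx r = p'"
    using p'(1,2) io by (auto simp: r_def map_idI subset_iff)
  have hr: "hd r < n" "last r < n" using r by (auto dest: hd_in_set last_in_set)
  have "vtx (hd r) = vtx (ord2 a)" "vtx (last r) = vtx (ord2 b)"
    using p'(6,7) r(1) unfolding r(3)[symmetric] by (simp_all add: hd_map last_map)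
  then have hd: "hd r = ord2 a" and la: "last r = ord2 b" using vtx_inj hr tm by auto
  let ?D = "{x. near x \<in> ord2 ` {..<i}}"
  have "ord2 b \<notin> ord2 ` {..<i}" using inj_onD[OF S2.ord_inj, of b] i by fastforce
  then have hl: "hd r \<in> ?D" "last r \<notin> ?D" using hd la terminal_facts(3)[OF tm(1,2)] terminal_facts(3)[OF tm(3,4)] i by auto
  from list_crossing[OF r(1) hl] obtain q x y s where qs: "r = q @ x # y # s" "x \<in> ?D" "y \<notin> ?D"
    by (elim exE conjE)
  have xy: "x < n" "y < n" using r(2) qs by auto
  have pe: "path_edges p' = path_edges (map vtx (q @ [x])) \<union> path_edges (map vtx (x # y # s))"
    unfolding r(3)[symmetric] qs(1) using path_edges_append[of "map vtx q" "vtx x" "map vtx (y # s)"] by simp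
  then have sub: "path_edges (map vtx (q @ [x])) \<subseteq> E" "path_edges (map vtx (y # s)) \<subseteq> E" "{vtx x, vtx y} \<in> E"
    using p'(4) by auto
  have ww: "walk_weight wa p' = walk_weight wa (map vtx (q @ [x])) + (wa {vtx x, vtx y} + walk_weight wa (map vtx (y # s)))"
    unfolding r(3)[symmetric] qs(1) using walk_weight_append[of wa "map vtx q" "vtx x" "map vtx (y # s)"] by simp
  have "hd (q @ [x]) = ord2 a" using hd qs by (cases q) auto
  then have kx: "st1 x \<noteq> 0" "key1 x \<le> walk_weight wa (map vtx (q @ [x]))"
    using walk_feasible(1)[of "q @ [x]"] r(2) qs sub(1) terminal_facts(1,2)[OF tm(1,2)] by auto
  have "last (y # s) = ord2 b" using la qs by auto
  then have ky: "key1 y \<le> walk_weight wa (map vtx (y # s))"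
    using walk_feasible(2)[of "y # s"] r(2) qs sub(2) terminal_facts(1,2)[OF tm(3,4)] by auto
  obtain j where j: "j < m" "edge j = {vtx x, vtx y}" "src j = x \<and> dst j = y \<or> src j = y \<and> dst j = x"
    using edge_index[OF sub(3) xy] by blast
  then have inc: "incident a2 b2 j (near x)" and o: "other a2 b2 j (near x) = near y"
    using edges2[OF j(1)] by (auto simp: incident_def other_def)
  have "key2 (ord2 i) \<le> 0 * key2 (near x) + c2 j"
    using S2.key_le_edge[OF tm(6) _ j(1) inc] o qs(2,3) by simp
  also have "0 * key2 (near x) + c2 j = key1 x + wa {vtx x, vtx y} + key1 y"
    using edges2[OF j(1)] c1_eq[OF j(1)] j(2,3) by auto
  also have "\<dots> \<le> walk_weight wa p'" using kx ky ww by simp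
  also have "\<dots> = sum wa (path_edges p)" using walk_weight_distinct[OF p'(3)] p'(5) by simp
  finally show ?thesis .
qed

definition attach :: "nat \<Rightarrow> nat" where
  "attach i = (SOME l. l < i \<and> ord2 l = other a2 b2 (pe2 (ord2 i) - 1) (ord2 i))"

lemma attach:
  assumes "0 < i" "i < cnt2"
  shows "attach i < i" "ord2 (attach i) = other a2 b2 (pe2 (ord2 i) - 1) (ord2 i)"
proof -
  have "other a2 b2 (pe2 (ord2 i) - 1) (ord2 i) \<in> ord2 ` {..<i}" using S2.parent_earlier assms pe2_pos by blast
  then have "\<exists>l. l < i \<and> ord2 l = other a2 b2 (pe2 (ord2 i) - 1) (ord2 i)" by auto
  from someI_ex[OF this] show "attach i < i" "ord2 (attach i) = other a2 b2 (pe2 (ord2 i) - 1) (ord2 i)"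
    unfolding attach_def by auto
qed

abbreviation "link i \<equiv> {vtx (ord2 (attach i)), vtx (ord2 i)}"

text \<open>The edges marked on behalf of position \<open>i\<close>: the edge between two regions
  and the parent edges on the way from both of its ends to their terminals.\<close>

definition used :: "nat \<Rightarrow> nat set" where
  "used i = insert (pe2 (ord2 i) - 1) {j. \<exists>x. (anc (src (pe2 (ord2 i) - 1)) x \<or> anc (dst (pe2 (ord2 i) - 1)) x) \<and> pe1 x = Suc j}"

text \<open>The path runs from one terminal to the end of the connecting edge inside its region,
  crosses, and returns to the other terminal inside the other region. The labels differ, so the two
  region paths are disjoint and the whole is simple. An upper bound on its weight suffices, since
  \<open>cut_bound\<close> gives the matching lower bound for every path between the two
  terminals.\<close>

lemma cheapest_link:
  assumes i: "0 < i" "i < cnt2"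
  shows "\<exists>p. cheapest_path V E wa (link i) p \<and> path_edges p = edge ` used i \<and> sum wa (path_edges p) \<le> key2 (ord2 i)"
proof -
  let ?v = "ord2 i" and ?u = "ord2 (attach i)"
  let ?j = "pe2 ?v - 1"
  have v: "?v < n" "vtx ?v \<in> T" and u: "?u < n" "vtx ?u \<in> T" and uv: "vtx ?u \<noteq> vtx ?v"
    using ord2_terminal[of i] ord2_terminal[of "attach i"] attach[OF i] i ord2_inj[of "attach i" i] by auto
  have par: "?j < m" "incident a2 b2 ?j ?v" "key2 ?v = c2 ?j"
    using S2.parent[OF v(1) ord2_st[OF i(2)] pe2_pos[OF i]] by auto
  obtain x y where xy: "x < n" "y < n" "near x = ?u" "near y = ?v" "src ?j = x \<and> dst ?j = y \<or> src ?j = y \<and> dst ?j = x"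
    using par edges2[OF par(1)] ends[OF par(1)] attach(2)[OF i] by (auto simp: incident_def other_def)
  have e: "edge ?j = {vtx x, vtx y}" using xy(5) by (auto simp: edge_of_def)
  have sx: "st1 x \<noteq> 0" using near_unreached[OF xy(1)] terminal_facts(1)[OF u] xy(3) by metis
  have sy: "st1 y \<noteq> 0" using near_unreached[OF xy(2)] terminal_facts(1)[OF v] xy(4) by metis
  have path: "\<exists>p. p \<noteq> [] \<and> hd p = near z \<and> last p = z \<and> distinct p \<and> set p = {x. anc z x} \<and>
    set p \<subseteq> {..<n} \<and> (\<forall>x\<in>set p. near x = near z) \<and>
    path_edges (map vtx p) = edge ` {j. \<exists>x. anc z x \<and> pe1 x = Suc j} \<and>
    walk_weight wa (map vtx p) = key1 z" if z: "z < n" "st1 z \<noteq> 0" for z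
  proof -
    obtain l where l: "l < cnt1" "z = ord1 l" using reached1 z by blast
    have "ord1 ` {..l} \<subseteq> {..<n}" using ord1_less l by auto
    moreover obtain p where p: "p \<noteq> []" "hd p = near z" "last p = z" "distinct p" "set p = {x. anc z x}"
      "set p \<subseteq> ord1 ` {..l}" "\<forall>x\<in>set p. near x = near z"
      "path_edges (map vtx p) = edge ` {j. \<exists>x\<in>set p. pe1 x = Suc j}" "walk_weight wa (map vtx p) = key1 z"
      using tree_path[OF l(1)] unfolding l(2) by (elim exE conjE)
    moreover have "{j. \<exists>x\<in>set p. pe1 x = Suc j} = {j. \<exists>x. anc z x \<and> pe1 x = Suc j}" unfolding p(5) by blast
    ultimately show ?thesis by (intro exI[of _ p] conjI) (assumption | simp)+
  qed
  obtain p where p: "p \<noteq> []" "hd p = ?u" "last p = x" "distinct p" "set p = {z. anc x z}" "set p \<subseteq> {..<n}"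
    "\<forall>z\<in>set p. near z = ?u" "path_edges (map vtx p) = edge ` {j. \<exists>z. anc x z \<and> pe1 z = Suc j}"
    "walk_weight wa (map vtx p) = key1 x" using path[OF xy(1) sx] unfolding xy(3) by (elim exE conjE)
  obtain q where q: "q \<noteq> []" "hd q = ?v" "last q = y" "distinct q" "set q = {z. anc y z}" "set q \<subseteq> {..<n}"
    "\<forall>z\<in>set q. near z = ?v" "path_edges (map vtx q) = edge ` {j. \<exists>z. anc y z \<and> pe1 z = Suc j}"
    "walk_weight wa (map vtx q) = key1 y" using path[OF xy(2) sy] unfolding xy(4) by (elim exE conjE)
  have disj: "set p \<inter> set q = {}" using p(7) q(7) uv by fastforce
  have inj: "inj_on vtx {..<n}" using vtx_bij by (simp add: bij_betw_def)
  have dm: "distinct (map vtx z)" if "distinct z" "set z \<subseteq> {..<n}" for z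
    using that inj by (simp add: distinct_map inj_on_subset)
  let ?P = "map vtx (p @ rev q)"
  have dP: "distinct ?P" by (rule dm) (use p q disj in auto)
  obtain R where R: "rev (map vtx q) = vtx y # R"
  proof -
    have "hd (rev (map vtx q)) = vtx y" "rev (map vtx q) \<noteq> []" using q by (simp_all add: hd_rev last_map)
    then show ?thesis using that by (metis list.collapse)
  qed
  have pe: "path_edges ?P = insert (edge ?j) (path_edges (map vtx p) \<union> path_edges (map vtx q))"
  proof -
    have "path_edges ?P = path_edges (map vtx p @ vtx y # R)" using R by (simp add: rev_map)
    also have "\<dots> = path_edges (map vtx p @ [vtx y]) \<union> path_edges (vtx y # R)" by (rule path_edges_append)
    also have "path_edges (vtx y # R) = path_edges (map vtx q)" unfolding R[symmetric] by (rule path_edges_rev)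
    also have "path_edges (map vtx p @ [vtx y]) = insert {vtx x, vtx y} (path_edges (map vtx p))"
      using p(1,3) by (simp add: path_edges_snoc last_map)
    finally show ?thesis using e by simp
  qed
  have us: "path_edges ?P = edge ` used i"
    unfolding pe p(8) q(8) used_def using xy(5) by (auto simp: image_Un[symmetric])
  have inE: "j < m" if "anc z x'" "z < n" "pe1 x' = Suc j" "x' < n" for z x' j
    using parent1(1)[OF that(4)] that(3) by simp
  have PE: "path_edges (map vtx p) \<subseteq> E" "path_edges (map vtx q) \<subseteq> E"
    unfolding p(8) q(8) using inE[of x] inE[of y] p(5,6) q(5,6) xy edge_in by auto
  have joins: "joins V E (link i) ?P"
  proof -
    have "hd ?P = vtx ?u" "last ?P = vtx ?v" using p q by (simp_all add: hd_map last_rev hd_append last_map)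
    moreover have "set ?P \<subseteq> V" using p(6) q(6) vtx_in by auto
    moreover have "path_edges ?P \<subseteq> E" unfolding pe using PE edge_in[OF par(1)] by simp
    ultimately show ?thesis using dP p(1) by (simp add: joins_def is_path_def)
  qed
  have nonneg: "0 \<le> sum wa A" if "A \<subseteq> E" for A using that wa_nonneg by (intro sum_nonneg) auto
  have "sum wa (path_edges ?P) \<le> wa (edge ?j) + sum wa (path_edges (map vtx p) \<union> path_edges (map vtx q))"
    unfolding pe using wa_nonneg[OF edge_in[OF par(1)]]
    by (cases "edge ?j \<in> path_edges (map vtx p) \<union> path_edges (map vtx q)") (auto simp: insert_absorb)
  also have "sum wa (path_edges (map vtx p) \<union> path_edges (map vtx q)) \<le>
      sum wa (path_edges (map vtx p)) + sum wa (path_edges (map vtx q))"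
    using nonneg[of "path_edges (map vtx p) \<inter> path_edges (map vtx q)"] PE by (subst sum_Un) auto
  also have "sum wa (path_edges (map vtx p)) = key1 x" using walk_weight_distinct[OF dm[OF p(4,6)]] p(9) by simp
  also have "sum wa (path_edges (map vtx q)) = key1 y" using walk_weight_distinct[OF dm[OF q(4,6)]] q(9) by simp
  also have "wa (edge ?j) + (key1 x + key1 y) = key2 ?v"
    using par edges2[OF par(1)] c1_eq[OF par(1)] xy(5) by auto
  finally have le: "sum wa (path_edges ?P) \<le> key2 ?v" by simp
  have "sum wa (path_edges ?P) \<le> sum wa (path_edges z)" if "joins V E (link i) z" for z
    using le cut_bound[OF attach(1)[OF i] order_refl i(2) that] by simp
  then show ?thesis using joins us le unfolding cheapest_path_def by (intro exI[of _ ?P] conjI allI impI)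
qed

lemma N_ancestors: "v \<in> N \<Longrightarrow> anc v x \<Longrightarrow> x \<in> N"
proof -
  assume v: "v \<in> N" and a: "anc v x"
  from a show "x \<in> N" unfolding ancestor_def
    by (induction rule: rtranclp_induct) (use v N_closed in auto)
qed

text \<open>The positive positions of \<open>ord2\<close> are exactly the vertices with a parent
  edge, and \<open>N\<close> consists of the ancestors of the ends of these edges;
  \<open>N_closed\<close> and \<open>N_ancestor\<close> supply the two inclusions.\<close>

lemma used_Union: "(\<Union>i\<in>{0<..<cnt2}. used i) = {j. j < m \<and> 0 < sol j}"
proof (intro set_eqI iffI)
  fix j assume "j \<in> (\<Union>i\<in>{0<..<cnt2}. used i)"
  then obtain i where i: "0 < i" "i < cnt2" "j \<in> used i" by auto
  have pos: "ord2 i < n" "pe2 (ord2 i) \<noteq> 0" using ord2_terminal pe2_pos i by auto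
  show "j \<in> {j. j < m \<and> 0 < sol j}"
  proof (cases "j = pe2 (ord2 i) - 1")
    case True
    have "j < m" using S2.parent[OF pos(1) ord2_st[OF i(2)] pos(2)] True by blast
    moreover have "pe2 (ord2 i) = Suc j" using True pos by simp
    ultimately show ?thesis using sol pos by auto
  next
    case False
    then obtain x where x: "anc (src (pe2 (ord2 i) - 1)) x \<or> anc (dst (pe2 (ord2 i) - 1)) x" "pe1 x = Suc j"
      using i(3) by (auto simp: used_def)
    then have "x \<in> N" using N_ends[OF pos] N_ancestors by blast
    moreover have "j < m" using parent1(1)[of x] N_less[OF \<open>x \<in> N\<close>] x(2) by simp
    ultimately show ?thesis using sol x(2) by auto
  qed
next
  fix j assume "j \<in> {j. j < m \<and> 0 < sol j}"
  then have j: "j < m" "(\<exists>i<n. pe2 i = Suc j) \<or> (\<exists>v\<in>N. pe1 v = Suc j)" using sol by auto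
  have pos: "\<exists>i. 0 < i \<and> i < cnt2 \<and> v = ord2 i" if v: "v < n" "pe2 v \<noteq> 0" for v
  proof -
    have "st2 v \<noteq> 0" using S2.unreached[OF v(1)] v(2) by auto
    then have "st2 v = 2" using S2.st_le[OF v(1)] done2[OF v(1)] by linarith
    then have "v \<in> ord2 ` {..<cnt2}" using S2.ord_image v by blast
    then obtain i where i: "i < cnt2" "v = ord2 i" by auto
    moreover have "i \<noteq> 0" using i v(2) pe2_first by (intro notI) simp
    ultimately show ?thesis by auto
  qed
  from j(2) show "j \<in> (\<Union>i\<in>{0<..<cnt2}. used i)"
  proof
    assume "\<exists>i<n. pe2 i = Suc j"
    then obtain v where v: "v < n" "pe2 v = Suc j" by blast
    then obtain i where i: "0 < i" "i < cnt2" "v = ord2 i" using pos[of v] by auto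
    then have "j \<in> used i" using v by (simp add: used_def)
    then show ?thesis using i by (intro UN_I[of i]) simp_all
  next
    assume "\<exists>v\<in>N. pe1 v = Suc j"
    then obtain x where x: "x \<in> N" "pe1 x = Suc j" by blast
    then obtain v where v: "v < n" "pe2 v \<noteq> 0" "anc (src (pe2 v - 1)) x \<or> anc (dst (pe2 v - 1)) x"
      using N_ancestor by blast
    then obtain i where i: "0 < i" "i < cnt2" "v = ord2 i" using pos[of v] by auto
    then have "j \<in> used i" using v(3) x(2) unfolding used_def by auto
    then show ?thesis using i by (intro UN_I[of i]) simp_all
  qed
qed

theorem run_correct: "scaled_algorithm_output V E w T Xhat \<alpha> (edge ` {j. j < m \<and> 0 < sol j})"
proof -
  let ?I = "{0<..<cnt2}"
  let ?c = "path_dist V E wa"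
  obtain p where p: "\<And>i. i \<in> ?I \<Longrightarrow> cheapest_path V E wa (link i) (p i)"
    "\<And>i. i \<in> ?I \<Longrightarrow> path_edges (p i) = edge ` used i"
    "\<And>i. i \<in> ?I \<Longrightarrow> sum wa (path_edges (p i)) \<le> key2 (ord2 i)"
  proof -
    have "\<forall>i\<in>?I. \<exists>p. cheapest_path V E wa (link i) p \<and> path_edges p = edge ` used i \<and> sum wa (path_edges p) \<le> key2 (ord2 i)"
      using cheapest_link by auto
    from bchoice[OF this] show ?thesis using that by blast
  qed
  obtain X' where X': "steiner_tree V E T X'" using connected by blast
  \<comment> \<open>Paths are indexed by positions, the output by tree edges, so \<open>link\<close>
    must be injective. Two positions with the same edge would each attach to the other, yet a
    position attaches only to a smaller one.\<close>
  have inj: "inj_on (\<lambda>i. link i) ?I"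
  proof (rule inj_onI)
    fix a b assume ab: "a \<in> ?I" "b \<in> ?I" "link a = link b"
    have at: "attach a < a" "attach b < b" using attach(1) ab by auto
    have c: "a < cnt2" "b < cnt2" "attach a < cnt2" "attach b < cnt2" using ab at by auto
    have "vtx (ord2 a) = vtx (ord2 b) \<or> vtx (ord2 a) = vtx (ord2 (attach b)) \<and> vtx (ord2 (attach a)) = vtx (ord2 b)"
      using ab(3) by (auto simp: doubleton_eq_iff)
    then have "a = b \<or> a = attach b \<and> attach a = b" using c by (simp add: ord2_inj)
    then show "a = b" using at by linarith
  qed
  have "minimum_spanning_tree T (complete_edges T) ?c ((\<lambda>i. {(\<lambda>i. vtx (ord2 i)) (attach i), (\<lambda>i. vtx (ord2 i)) i}) ` ?I)"
  proof (rule prim_minimum_spanning_tree)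
    show "inj_on (\<lambda>i. vtx (ord2 i)) {..<cnt2}" using ord2_inj by (auto simp: inj_on_def)
    show "(\<lambda>i. vtx (ord2 i)) ` {..<cnt2} = T" by (rule ord2_image)
    show "attach i < i" if "0 < i" "i < cnt2" for i using attach(1)[OF that] .
  next
    fix i a b assume i: "0 < i" "a < i" "i \<le> b" "b < cnt2"
    then have iI: "i \<in> ?I" by simp
    \<comment> \<open>The key mediates: the chosen link costs at most the key, and every pair of
      terminals across the cut at least the key.\<close>
    have "?c (link i) \<le> sum wa (path_edges (p i))"
      by (rule path_dist_le) (use wa_nonneg p(1)[OF iI] in \<open>auto simp: cheapest_path_def\<close>)
    also have "\<dots> \<le> key2 (ord2 i)" using p(3)[OF iI] .
    also have "\<dots> \<le> ?c {vtx (ord2 a), vtx (ord2 b)}"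
    proof -
      have "{vtx (ord2 a), vtx (ord2 b)} \<in> complete_edges T"
        using ord2_terminal i ord2_inj[of a b] by (intro complete_edgesI) auto
      then obtain z where z: "joins V E {vtx (ord2 a), vtx (ord2 b)} z" using steiner_tree_joins[OF X'] by blast
      then show ?thesis by (rule path_dist_ge) (rule cut_bound[OF i(2-4)])
    qed
    finally show "?c {vtx (ord2 (attach i)), vtx (ord2 i)} \<le> ?c {vtx (ord2 a), vtx (ord2 b)}" .
  next
    fix e assume "e \<in> complete_edges T"
    then obtain z where "joins V E e z" using steiner_tree_joins[OF X'] by blast
    then show "0 \<le> ?c e" by (intro path_dist_nonneg[OF wa_nonneg])
  qed
  then have mst: "minimum_spanning_tree T (complete_edges T) ?c ((\<lambda>i. link i) ` ?I)" by simp
  let ?P = "\<lambda>e. p (inv_into ?I (\<lambda>i. link i) e)"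
  have P: "?P (link i) = p i" if "i \<in> ?I" for i using inv_into_f_f[OF inj that] by simp
  have "(\<Union>e\<in>(\<lambda>i. link i) ` ?I. path_edges (?P e)) = (\<Union>i\<in>?I. path_edges (p i))" using P by simp
  also have "\<dots> = (\<Union>i\<in>?I. edge ` used i)" using p(2) by simp
  also have "\<dots> = edge ` (\<Union>i\<in>?I. used i)" by blast
  also have "\<dots> = edge ` {j. j < m \<and> 0 < sol j}" unfolding used_Union ..
  finally have U: "edge ` {j. j < m \<and> 0 < sol j} = (\<Union>e\<in>(\<lambda>i. link i) ` ?I. path_edges (?P e))" by simp
  moreover have "\<forall>e\<in>(\<lambda>i. link i) ` ?I. cheapest_path V E wa e (?P e)" using P p(1) by auto
  ultimately show ?thesis unfolding scaled_algorithm_output_def using mst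
    by (intro exI[of _ "(\<lambda>i. link i) ` ?I"] exI[of _ ?P] conjI)
qed

end

section \<open>Running time and the theorem\<close>

text \<open>The summand 2 covers \<open>n \<le> 1\<close>, where \<open>n * log 2 n\<close>
  vanishes. From \<open>n = 2\<close> on the logarithm is at least 1, so \<open>n\<close> is at most
  one and \<open>n * L\<close> at most two copies of \<open>n * log 2 n\<close>.\<close>

lemma size_bound:
  fixes n :: nat
  shows "\<exists>L. n < 2 ^ L \<and> real n + real (n * L) \<le> 3 * (real n * log 2 (real n)) + 2"
proof (cases "n \<le> 1")
  case True
  then have "n = 0 \<or> n = 1" by auto
  then show ?thesis by (intro exI[of _ n]) auto
next
  case False
  define L where "L = Suc (nat \<lfloor>log 2 (real n)\<rfloor>)"
  have lg: "1 \<le> log 2 (real n)" using False by (subst le_log_iff) auto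
  then have L: "log 2 (real n) < real L" "real L \<le> log 2 (real n) + 1" unfolding L_def by linarith+
  have "real n < 2 powr real L" using L(1) False by (subst log_less_iff[symmetric]) auto
  then have "real n < real (2 ^ L)" by (simp add: powr_realpow)
  then have "n < 2 ^ L" by (simp only: of_nat_less_iff)
  moreover have "real n \<le> real n * log 2 (real n)" using mult_left_mono[OF lg, of "real n"] by simp
  moreover have "real n * real L \<le> real n * (2 * log 2 (real n))" using L lg by (intro mult_left_mono) auto
  ultimately show ?thesis by (intro exI[of _ L]) simp
qed

lemma program_correct:
  assumes inst: "steiner_instance V E w T Xhat" and rep: "edge_list_representation V E vtx src dst"
    and eps: "0 < \<epsilon>"
    and grid: "grid_result (card V) (card E) (fst s0 ''src'') (fst s0 ''dst'') (fst s0 ''terminal'')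
      (fst s0 ''predicted'') (snd s0 ''weight'') \<epsilon> (Suc (max_exponent \<epsilon>)) (fst s ''output'') best"
    and s0: "s0 = input_state \<epsilon> V E w T Xhat vtx src dst" and conn: "\<exists>X'. steiner_tree V E T X'"
  shows "algorithm_output \<epsilon> V E w T Xhat (output_edges E vtx src dst s)"
proof -
  let ?n = "card V" and ?m = "card E"
  let ?src = "\<lambda>j. if j < ?m then src j else 0" and ?dst = "\<lambda>j. if j < ?m then dst j else 0"
  let ?tm = "\<lambda>i. if i < ?n \<and> vtx i \<in> T then 1 else 0::nat"
  let ?pr = "\<lambda>j. if j < ?m \<and> edge_of vtx src dst j \<in> Xhat then 1 else 0::nat"
  let ?wt = "\<lambda>j. if j < ?m then w (edge_of vtx src dst j) else 0"
  have arrays: "fst s0 ''src'' = ?src" "fst s0 ''dst'' = ?dst" "fst s0 ''terminal'' = ?tm"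
    "fst s0 ''predicted'' = ?pr" "snd s0 ''weight'' = ?wt" unfolding s0 by (simp_all add: input_state_def)
  obtain sols b where g: "\<And>i. i < Suc (max_exponent \<epsilon>) \<Longrightarrow> run_result ?n ?m ?src ?dst ?tm ?pr ?wt ((1 + \<epsilon>) ^ i) (sols i) \<and> (\<forall>j<?m. sols i j \<le> 1)"
    "b < Suc (max_exponent \<epsilon>)" "\<forall>j<?m. fst s ''output'' j = sols b j" "best = sum ?wt {j. j < ?m \<and> 0 < sols b j}"
    "\<forall>i<Suc (max_exponent \<epsilon>). best \<le> sum ?wt {j. j < ?m \<and> 0 < sols i j}"
    using grid unfolding grid_result_def arrays by blast
  have same: "edge_of vtx ?src ?dst j = edge_of vtx src dst j" if "j < ?m" for j
    using that by (simp add: edge_of_def)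
  \<comment> \<open>The input arrays are 0 from \<open>card E\<close> on, so they agree with
    \<open>src\<close> and \<open>dst\<close> only below it, which is all the representation looks
    at.\<close>
  have rep': "edge_list_representation V E vtx ?src ?dst"
    using rep bij_betw_cong[of "{..<?m}" "edge_of vtx ?src ?dst" "edge_of vtx src dst" E] same
    by (auto simp: edge_list_representation_def)
  have inj: "inj_on (edge_of vtx src dst) {..<?m}" using rep by (auto simp: edge_list_representation_def bij_betw_def)
  define Y where "Y i = edge_of vtx src dst ` {j. j < ?m \<and> 0 < sols i j}" for i
  have Y: "scaled_algorithm_output V E w T Xhat ((1 + \<epsilon>) ^ i) (Y i)" if i: "i \<le> max_exponent \<epsilon>" for i
  proof -
    have "run_result ?n ?m ?src ?dst ?tm ?pr ?wt ((1 + \<epsilon>) ^ i) (sols i)" using g(1) i by simp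
    then obtain a1 b1 c1 sd1 st1 key1 pe1 ord1 cnt1 near a2 b2 c2 sd2 st2 key2 pe2 ord2 cnt2 tv N where
      rd: "run_data ?n ?m ?src ?dst ?tm ?pr ?wt ((1 + \<epsilon>) ^ i) a1 b1 c1 sd1 st1 key1 pe1 ord1 cnt1 near
          a2 b2 c2 sd2 st2 key2 pe2 ord2 cnt2 tv N (sols i)"
      unfolding run_result_def by (elim exE)
    have "steiner_run ?n ?m ?src ?dst ?tm ?pr ?wt ((1 + \<epsilon>) ^ i) a1 b1 c1 sd1 st1 key1 pe1 ord1 cnt1 near
          a2 b2 c2 sd2 st2 key2 pe2 ord2 cnt2 tv N (sols i) V E w T Xhat vtx"
    proof (rule steiner_run.intro[OF rd], rule steiner_run_axioms.intro)
      show "1 \<le> (1 + \<epsilon>) ^ i" using eps by simp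
    qed (use inst rep' same conn in auto)
    then have "scaled_algorithm_output V E w T Xhat ((1 + \<epsilon>) ^ i) (edge_of vtx ?src ?dst ` {j. j < ?m \<and> 0 < sols i j})"
      by (rule steiner_run.run_correct)
    moreover have "edge_of vtx ?src ?dst ` {j. j < ?m \<and> 0 < sols i j} = Y i"
      unfolding Y_def using same by (intro image_cong) auto
    ultimately show ?thesis by simp
  qed
  have sumY: "sum w (Y i) = sum ?wt {j. j < ?m \<and> 0 < sols i j}" for i
    unfolding Y_def by (subst sum.reindex) (auto intro: inj_on_subset[OF inj] intro!: sum.cong)
  \<comment> \<open>The output convention asks for the value 1, the run guarantees only a positive
    flag; flags are at most 1.\<close>
  have "{j. j < ?m \<and> fst s ''output'' j = 1} = {j. j < ?m \<and> 0 < sols b j}"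
    using g(1)[OF g(2)] g(3) by (auto simp: le_Suc_eq)
  then have out: "output_edges E vtx src dst s = Y b" by (simp add: output_edges_def Y_def)
  have "sum w (Y b) \<le> sum w (Y i)" if "i \<le> max_exponent \<epsilon>" for i
    using g(4,5) that by (simp add: sumY)
  then show ?thesis unfolding algorithm_output_def out using Y g(2)
    by (intro exI[of _ Y]) (auto simp: less_Suc_eq_le)
qed

lemma program_time:
  assumes inst: "steiner_instance V E w T Xhat" and rep: "edge_list_representation V E vtx src dst"
    and eps: "0 < \<epsilon>"
  shows "\<exists>t s. exec program (input_state \<epsilon> V E w T Xhat vtx src dst) t s \<and>
    real t \<le> 1203 * real (Suc (max_exponent \<epsilon>)) *
      (1 + real (card E) + real (card V) * log 2 (real (card V))) \<and>
    ((\<exists>X'. steiner_tree V E T X') \<longrightarrow> algorithm_output \<epsilon> V E w T Xhat (output_edges E vtx src dst s))"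
proof -
  let ?n = "card V" and ?m = "card E" and ?M = "max_exponent \<epsilon>"
  define s0 where "s0 = input_state \<epsilon> V E w T Xhat vtx src dst"
  obtain L where L: "?n < 2 ^ L" "real ?n + real (?n * L) \<le> 3 * (real ?n * log 2 (real ?n)) + 2"
    using size_bound by blast
  have edge: "edge_of vtx src dst j \<in> E" if "j < ?m" for j
    using rep that by (auto simp: edge_list_representation_def bij_betw_def)
  have "wp program (\<lambda>s' _. \<exists>best. grid_result ?n ?m (fst s0 ''src'') (fst s0 ''dst'') (fst s0 ''terminal'')
      (fst s0 ''predicted'') (snd s0 ''weight'') \<epsilon> (Suc ?M) (fst s' ''output'') best)
    s0 ((192 * ?n + 380 * (?n * L) + 560 * ?m + 60) * Suc ?M + 3)"
  proof (rule wp_program)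
    show "?n < 2 ^ L" by (fact L)
    show "fst s0 ''src'' j < ?n \<and> fst s0 ''dst'' j < ?n" if "j < ?m" for j
      using rep that by (simp add: s0_def input_state_def edge_list_representation_def)
    show "0 \<le> snd s0 ''weight'' j" if "j < ?m" for j
      using inst edge[OF that] that by (simp add: s0_def input_state_def steiner_instance_def)
    show "?M \<le> i \<longleftrightarrow> 1 \<le> (1 + \<epsilon>) ^ i * \<epsilon>" for i by (rule le_max_exponent_iff[OF eps])
  qed (use eps in \<open>simp_all add: s0_def input_state_def\<close>)
  then obtain t s best where e: "exec program s0 t s" "t \<le> (192 * ?n + 380 * (?n * L) + 560 * ?m + 60) * Suc ?M + 3"
    and g: "grid_result ?n ?m (fst s0 ''src'') (fst s0 ''dst'') (fst s0 ''terminal'')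
      (fst s0 ''predicted'') (snd s0 ''weight'') \<epsilon> (Suc ?M) (fst s ''output'') best"
    unfolding wp_def by blast
  let ?x = "real ?n * log 2 (real ?n)"
  have x: "0 \<le> ?x" by (cases "?n = 0") auto
  let ?Z = "1 + real ?m + ?x"
  have "real (192 * ?n + 380 * (?n * L) + 560 * ?m + 60) \<le> 380 * (real ?n + real (?n * L)) + 560 * real ?m + 60"
    by simp
  \<comment> \<open>By the size bound the coefficients are \<open>380 * 3\<close> for
    \<open>n * log 2 n\<close>, 560 for the edges and \<open>380 * 2 + 60\<close> for the constant,
    all below 1200. The remaining 3 of 1203 absorbs the additive 3 in the step count.\<close>
  also have "\<dots> \<le> 1200 * ?Z" using L(2) x by simp
  finally have D: "real (192 * ?n + 380 * (?n * L) + 560 * ?m + 60) \<le> 1200 * ?Z" .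
  have "real t \<le> real ((192 * ?n + 380 * (?n * L) + 560 * ?m + 60) * Suc ?M + 3)" using e(2) by (rule of_nat_mono)
  also have "\<dots> = real (192 * ?n + 380 * (?n * L) + 560 * ?m + 60) * real (Suc ?M) + 3"
    by (simp only: of_nat_add of_nat_mult of_nat_numeral)
  also have "\<dots> \<le> 1200 * ?Z * real (Suc ?M) + 3 * (?Z * real (Suc ?M))"
  proof (rule add_mono)
    show "real (192 * ?n + 380 * (?n * L) + 560 * ?m + 60) * real (Suc ?M) \<le> 1200 * ?Z * real (Suc ?M)"
      using D by (rule mult_right_mono) simp
    have "1 * 1 \<le> ?Z * real (Suc ?M)" using x by (intro mult_mono) auto
    then show "3 \<le> 3 * (?Z * real (Suc ?M))" by simp
  qed
  also have "\<dots> = 1203 * real (Suc ?M) * ?Z" by (simp add: algebra_simps)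
  finally have "real t \<le> 1203 * real (Suc ?M) * ?Z" .
  then show ?thesis using e(1) program_correct[OF inst rep eps g s0_def] unfolding s0_def by blast
qed

theorem theorem4:
  shows
    "(\<forall>\<epsilon>>0. \<forall>(V :: 'v set) E w T Xhat X.
        steiner_instance V E w T Xhat \<longrightarrow>
        algorithm_output \<epsilon> V E w T Xhat X \<longrightarrow>
          steiner_tree V E T X \<and>
          (\<forall>X' MST S.
             steiner_tree V E T X' \<longrightarrow>
             minimum_spanning_tree T (complete_edges T) (path_dist V E w) MST \<longrightarrow>
             highest_cost_edges (path_dist V E w) MST (min (card T - 1) (card (Xhat - X'))) S \<longrightarrow>
             sum w X \<le> (1 + \<epsilon>) *
               (INF \<alpha>\<in>{1..}.
                  (1 + 1 / \<alpha>) * sum w X' +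
                  (1 - 1 / \<alpha>) * sum w (X' - Xhat) +
                  min (sum w (Xhat - X')) ((\<alpha> - 1) * (\<Sum>e\<in>S. path_dist V E w e))))) \<and>
     (\<exists>prog. \<forall>\<epsilon>>0. \<exists>C. \<forall>(V :: 'v set) E w T Xhat vtx src dst.
        steiner_instance V E w T Xhat \<longrightarrow>
        edge_list_representation V E vtx src dst \<longrightarrow>
        (\<exists>t s. exec prog (input_state \<epsilon> V E w T Xhat vtx src dst) t s \<and>
           real t \<le> C * (1 + real (card E) + real (card V) * log 2 (real (card V))) \<and>
           ((\<exists>X'. steiner_tree V E T X') \<longrightarrow>
              algorithm_output \<epsilon> V E w T Xhat (output_edges E vtx src dst s))))"

proof (intro conjI allI impI)
  fix \<epsilon> :: real and V :: "'v set" and E w T Xhat X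
  assume 1: "0 < \<epsilon>" "steiner_instance V E w T Xhat" "algorithm_output \<epsilon> V E w T Xhat X"
  show "steiner_tree V E T X" by (rule algorithm_guarantee(1)[OF 1])
  fix X' MST S
  assume "steiner_tree V E T X'" "minimum_spanning_tree T (complete_edges T) (path_dist V E w) MST"
    "highest_cost_edges (path_dist V E w) MST (min (card T - 1) (card (Xhat - X'))) S"
  then show "sum w X \<le> (1 + \<epsilon>) * (INF \<alpha>\<in>{1..}. (1 + 1 / \<alpha>) * sum w X' +
      (1 - 1 / \<alpha>) * sum w (X' - Xhat) + min (sum w (Xhat - X')) ((\<alpha> - 1) * (\<Sum>e\<in>S. path_dist V E w e)))"
    by (rule algorithm_guarantee(2)[OF 1])
next
  \<comment> \<open>The witness for \<open>C\<close> comes from unification with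
    \<open>program_time\<close>. It is fixed before the graph, so it depends on \<epsilon> alone,
    through \<open>max_exponent \<epsilon>\<close>.\<close>
  show "\<exists>prog. \<forall>\<epsilon>>0. \<exists>C. \<forall>(V :: 'v set) E w T Xhat vtx src dst.
        steiner_instance V E w T Xhat \<longrightarrow>
        edge_list_representation V E vtx src dst \<longrightarrow>
        (\<exists>t s. exec prog (input_state \<epsilon> V E w T Xhat vtx src dst) t s \<and>
           real t \<le> C * (1 + real (card E) + real (card V) * log 2 (real (card V))) \<and>
           ((\<exists>X'. steiner_tree V E T X') \<longrightarrow>
              algorithm_output \<epsilon> V E w T Xhat (output_edges E vtx src dst s)))"
    by (rule exI[of _ program], intro allI impI, rule exI, intro allI impI) (rule program_time)
qed

end
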